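(* Assume that the objective function $F$ satisfies Assumption (F-strong) and that the diffusion coefficient $\sigma$ satisfies Assumption ($\sigma$-strong), as spelled out in the context. There exist positive real numbers $H\in(0,h_0)$ and $C\in(0,\infty)$ such that for any mapping $\varphi:\mathbb{R}^d\to\mathbb{R}$ of class $\mathcal{C}^3$ with bounded second and third order derivatives, any initial value $x_0\in\mathbb{R}^d$ and any $h\in(0,H)$, \[ \sup_{N\in\mathbb{N}^\star}\big|\mathbb{E}[\varphi(X_N)]-\mathbb{E}[\varphi(\mathcal{Y}^h(Nh))]\big|\le C_2(\varphi,x_0)h^2, \] where $C_2(\varphi,x_0)=C\bigl(\|\nabla\varphi(x^\star)\|+|||\varphi|||_2+|||\varphi|||_3\bigr)\bigl(1+\|x_0-x^\star\|^5\bigr)$, $(X_n)_{n\ge0}$ is the stochastic gradient scheme with step size $h$ and $X_0=x_0$, and $\mathcal{Y}^h$ is the solution of the It\^o stochastic differential equation \[ d\mathcal{Y}^h(t)=-\nabla F^h(\mathcal{Y}^h(t))\,dt+\sqrt h\,\sigma(t,\mathcal{Y}^h(t))\,dB(t),\ t\ge0,\qquad \mathcal{Y}^h(0)=x_0,\qquad F^h=F+\tfrac h4\|\nabla F\|^2 . \]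
   Context: Notation: $\mathbb{N}=\{0,1,\dots\}$, $\mathbb{N}^\star=\{1,2,\dots\}$, $d\in\mathbb{N}^\star$; $\|\cdot\|$ is the Euclidean norm on $\mathbb{R}^d$ and the Frobenius norm on the space $\mathcal{M}_d(\mathbb{R})$ of real $d\times d$ matrices. For $\varphi:\mathbb{R}^d\to\mathbb{R}$ of class $\mathcal{C}^m$, $|||\varphi|||_m=\sup_{x\in\mathbb{R}^d}\sup_{k_1,\dots,k_m\neq0}\frac{|D^m\varphi(x).(k_1,\dots,k_m)|}{\|k_1\|\cdots\|k_m\|}$. A positive real number $h_{\max}$ is fixed; step sizes satisfy $h\in(0,h_{\max})$, and $t_n=nh$. $(B(t))_{t\ge0}$ is a standard $\mathbb{R}^d$-valued Wiener process. Scheme: for deterministic $x_0\in\mathbb{R}^d$ and $h\in(0,h_{\max})$, $X_0=x_0$ and $X_{n+1}=X_n-h\nabla F(X_n)+h\sigma(t_n,X_n)\gamma_{n+1}$ for $n\in\mathbb{N}$, where $(\gamma_n)_{n\ge1}$ are independent standard centered Gaussian random variables in $\mathbb{R}^d$. Assumption (F-strong): $F:\mathbb{R}^d\to\mathbb{R}$ is of class $\mathcal{C}^5$; $\nabla F$ is globally Lipschitz continuous; there are $\mu\in(0,\infty)$ and $h_0\in(0,h_{\max})$ such that $\langle\nabla F(x_2)-\nabla F(x_1),x_2-x_1\rangle\ge\mu\|x_2-x_1\|^2$ for all $x_1,x_2\in\mathbb{R}^d$ and, for all $h\in(0,h_0)$, $\langle\nabla F^h(x_2)-\nabla F^h(x_1),x_2-x_1\rangle\ge\mu\|x_2-x_1\|^2$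 for all $x_1,x_2\in\mathbb{R}^d$; the third, fourth and fifth order derivatives of $F$ are bounded. Under this assumption $F$ has a unique minimizer, denoted $x^\star$, and the stochastic differential equation above is globally well-posed for $h\in(0,h_0)$. Assumption ($\sigma$-strong): $\sigma:[0,\infty)\times\mathbb{R}^d\to\mathcal{M}_d(\mathbb{R})$ is continuous, and there is a bounded mapping $\varsigma:[0,\infty)\to[0,\infty)$ such that for all $t\ge0$: $\|\sigma(t,x_2)-\sigma(t,x_1)\|\le\varsigma(t)\|x_2-x_1\|$ for all $x_1,x_2\in\mathbb{R}^d$, and $\sup_{x\in\mathbb{R}^d}\frac{\|\sigma(t,x)\|}{1+\|x-x^\star\|}\le\varsigma(t)$. Moreover, for all $t\ge0$, $\sigma(t,\cdot)$ is of class $\mathcal{C}^3$, with second and third order derivatives bounded uniformly in $(t,x)\in[0,\infty)\times\mathbb{R}^d$; and there is $L_\sigma\in(0,\infty)$ such that $\|\sigma(t_2,x)-\sigma(t_1,x)\|\le L_\sigma|t_2-t_1|$ for all $t_1,t_2\ge0$ and $x\in\mathbb{R}^d$. *)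

theory Defs
  imports "HOL-Probability.Probability"
begin

section \<open>Derivatives\<close>

definition grad :: "('a::real_inner \<Rightarrow> real) \<Rightarrow> 'a \<Rightarrow> 'a" where
  "grad f x = (THE D. GDERIV f x :> D)"

text \<open>\<open>iter_deriv f [k\<^sub>1, \<dots>, k\<^sub>m] x\<close> is \<open>D\<^sup>m f(x).(k\<^sub>1, \<dots>, k\<^sub>m)\<close>.\<close>

primrec iter_deriv ::
  "('a::real_normed_vector \<Rightarrow> 'b::real_normed_vector) \<Rightarrow> 'a list \<Rightarrow> 'a \<Rightarrow> 'b" where
  "iter_deriv f [] = f"
| "iter_deriv f (k # ks) = (\<lambda>x. frechet_derivative (iter_deriv f ks) (at x) k)"

text \<open>In finite dimension, \<open>f\<close> is of class \<open>C\<^sup>m\<close> if and only if, for fixed directions, the iterated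
  directional derivatives of order less than \<open>m\<close> are Frechet differentiable everywhere and those
  of order \<open>m\<close> are continuous.\<close>

definition class_C :: "nat \<Rightarrow> ('a::euclidean_space \<Rightarrow> 'b::euclidean_space) \<Rightarrow> bool" where
  "class_C m f \<longleftrightarrow>
     (\<forall>ks x. length ks < m \<longrightarrow> iter_deriv f ks differentiable (at x)) \<and>
     (\<forall>ks. length ks = m \<longrightarrow> continuous_on UNIV (iter_deriv f ks))"

definition deriv_ratios :: "nat \<Rightarrow> ('a::euclidean_space \<Rightarrow> 'b::euclidean_space) \<Rightarrow> real set" where
  "deriv_ratios m f =
     {norm (iter_deriv f ks x) / (\<Prod>k\<leftarrow>ks. norm k) | x ks. length ks = m \<and> 0 \<notin> set ks}"

definition bounded_deriv :: "nat \<Rightarrow> ('a::euclidean_space \<Rightarrow> 'b::euclidean_space) \<Rightarrow> bool" where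
  "bounded_deriv m f \<longleftrightarrow> bdd_above (deriv_ratios m f)"

text \<open>The seminorm \<open>|||f|||\<^sub>m\<close>. The supremum is taken in the reals, so it is meaningful
  only under \<open>bounded_deriv m f\<close>.\<close>

definition deriv_norm :: "nat \<Rightarrow> ('a::euclidean_space \<Rightarrow> 'b::euclidean_space) \<Rightarrow> real" where
  "deriv_norm m f = Sup (deriv_ratios m f)"


section \<open>Assumptions on the objective function and on the diffusion coefficient\<close>

definition modified_objective :: "('a::real_inner \<Rightarrow> real) \<Rightarrow> real \<Rightarrow> 'a \<Rightarrow> real" where
  "modified_objective F h x = F x + h / 4 * (norm (grad F x))\<^sup>2"

definition strongly_monotone :: "real \<Rightarrow> ('a::real_inner \<Rightarrow> 'a) \<Rightarrow> bool" where
  "strongly_monotone \<mu> g \<longleftrightarrow> (\<forall>x1 x2. (g x2 - g x1) \<bullet> (x2 - x1) \<ge> \<mu> * (norm (x2 - x1))\<^sup>2)"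

definition F_strong :: "real \<Rightarrow> real \<Rightarrow> real \<Rightarrow> ('a::euclidean_space \<Rightarrow> real) \<Rightarrow> bool" where
  "F_strong h_max h\<^sub>0 \<mu> F \<longleftrightarrow>
     class_C 5 F \<and>
     (\<exists>L. L-lipschitz_on UNIV (grad F)) \<and>
     0 < \<mu> \<and> 0 < h\<^sub>0 \<and> h\<^sub>0 < h_max \<and>
     strongly_monotone \<mu> (grad F) \<and>
     (\<forall>h. 0 < h \<and> h < h\<^sub>0 \<longrightarrow> strongly_monotone \<mu> (grad (modified_objective F h))) \<and>
     bounded_deriv 3 F \<and> bounded_deriv 4 F \<and> bounded_deriv 5 F"

text \<open>The point \<open>x\<^sup>\<star>\<close>, which is well defined under \<^const>\<open>F_strong\<close>.\<close>

definition minimizer :: "('a \<Rightarrow> real) \<Rightarrow> 'a" where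
  "minimizer F = (THE x. \<forall>y. F x \<le> F y)"

text \<open>The canonical norm of \<^typ>\<open>real^'n^'n\<close> is the Frobenius norm. Only the values
  \<open>\<sigma> t\<close> with \<open>t \<ge> 0\<close> are relevant.\<close>

definition sigma_strong ::
  "(real^'n \<Rightarrow> real) \<Rightarrow> (real \<Rightarrow> real^'n \<Rightarrow> real^'n^'n) \<Rightarrow> bool" where
  "sigma_strong F \<sigma> \<longleftrightarrow>
     continuous_on ({0..} \<times> UNIV) (\<lambda>(t, x). \<sigma> t x) \<and>
     (\<exists>\<sigma>b :: real \<Rightarrow> real. bounded (\<sigma>b ` {0..}) \<and>
        (\<forall>t\<ge>0. 0 \<le> \<sigma>b t \<and>
           (\<forall>x1 x2. norm (\<sigma> t x2 - \<sigma> t x1) \<le> \<sigma>b t * norm (x2 - x1)) \<and>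
           (\<forall>x. norm (\<sigma> t x) / (1 + norm (x - minimizer F)) \<le> \<sigma>b t))) \<and>
     (\<forall>t\<ge>0. class_C 3 (\<sigma> t)) \<and>
     bdd_above (\<Union>t\<in>{0..}. deriv_ratios 2 (\<sigma> t)) \<and>
     bdd_above (\<Union>t\<in>{0..}. deriv_ratios 3 (\<sigma> t)) \<and>
     (\<exists>L>0. \<forall>t1\<ge>0. \<forall>t2\<ge>0. \<forall>x. norm (\<sigma> t2 x - \<sigma> t1 x) \<le> L * \<bar>t2 - t1\<bar>)"


section \<open>Gaussian variables, the scheme, and Wiener processes\<close>

text \<open>Density of the centered Gaussian law on \<open>\<real>\<^sup>d\<close> with covariance \<open>v I\<close>; note that
  \<^const>\<open>normal_density\<close> takes the standard deviation.\<close>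

definition gauss_density :: "real \<Rightarrow> real^'n \<Rightarrow> ennreal" where
  "gauss_density v x = ennreal (\<Prod>i\<in>UNIV. normal_density 0 (sqrt v) (x $ i))"

definition std_gaussian_sequence :: "'w measure \<Rightarrow> (nat \<Rightarrow> 'w \<Rightarrow> real^'n) \<Rightarrow> bool" where
  "std_gaussian_sequence M \<gamma> \<longleftrightarrow>
     prob_space M \<and>
     prob_space.indep_vars M (\<lambda>_. borel) \<gamma> {1..} \<and>
     (\<forall>n\<ge>1. distributed M lborel (\<gamma> n) (gauss_density 1))"

primrec sg_scheme ::
  "(real^'n \<Rightarrow> real) \<Rightarrow> (real \<Rightarrow> real^'n \<Rightarrow> real^'n^'n) \<Rightarrow> (nat \<Rightarrow> 'w \<Rightarrow> real^'n) \<Rightarrow>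
     real \<Rightarrow> real^'n \<Rightarrow> nat \<Rightarrow> 'w \<Rightarrow> real^'n" where
  "sg_scheme F \<sigma> \<gamma> h x\<^sub>0 0 \<omega> = x\<^sub>0"
| "sg_scheme F \<sigma> \<gamma> h x\<^sub>0 (Suc n) \<omega> =
     (let X = sg_scheme F \<sigma> \<gamma> h x\<^sub>0 n \<omega>
      in X - h *\<^sub>R grad F X + h *\<^sub>R (\<sigma> (real n * h) X *v \<gamma> (Suc n) \<omega>))"

text \<open>Standard Wiener process with respect to a filtration. The time index is a real number,
  but \<open>B t\<close> is only constrained for \<open>t \<ge> 0\<close>.\<close>

definition wiener_process ::
  "'w measure \<Rightarrow> (real \<Rightarrow> 'w measure) \<Rightarrow> (real \<Rightarrow> 'w \<Rightarrow> real^'n) \<Rightarrow> bool" where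
  "wiener_process M \<F> B \<longleftrightarrow>
     prob_space M \<and>
     filtration (space M) \<F> \<and> (\<forall>t. subalgebra M (\<F> t)) \<and>
     (\<forall>t\<ge>0. B t \<in> borel_measurable (\<F> t)) \<and>
     (\<forall>\<omega>\<in>space M. continuous_on {0..} (\<lambda>t. B t \<omega>)) \<and>
     (AE \<omega> in M. B 0 \<omega> = 0) \<and>
     (\<forall>s\<ge>0. \<forall>t>s.
        distributed M lborel (\<lambda>\<omega>. B t \<omega> - B s \<omega>) (gauss_density (t - s)) \<and>
        prob_space.indep_set M (sets (\<F> s))
          {(\<lambda>\<omega>. B t \<omega> - B s \<omega>) -` A \<inter> space M | A. A \<in> sets borel})"


section \<open>Ito integral\<close>

text \<open>Simple integrands \<open>\<Sum>i<n. \<xi> i 1\<^bsub>(\<tau> i, \<tau> (i + 1)]\<^esub>\<close> with bounded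
  \<open>\<F> (\<tau> i)\<close>-measurable coefficients, and their integral over \<open>[0, t]\<close>.\<close>

definition simple_integrand ::
  "'w measure \<Rightarrow> (real \<Rightarrow> 'w measure) \<Rightarrow> nat \<Rightarrow> (nat \<Rightarrow> real) \<Rightarrow> (nat \<Rightarrow> 'w \<Rightarrow> real^'n^'m) \<Rightarrow> bool"
where
  "simple_integrand M \<F> n \<tau> \<xi> \<longleftrightarrow>
     0 \<le> \<tau> 0 \<and> (\<forall>i<n. \<tau> i \<le> \<tau> (Suc i)) \<and>
     (\<forall>i<n. \<xi> i \<in> borel_measurable (\<F> (\<tau> i)) \<and> bounded (\<xi> i ` space M))"

definition simple_process ::
  "nat \<Rightarrow> (nat \<Rightarrow> real) \<Rightarrow> (nat \<Rightarrow> 'w \<Rightarrow> real^'n^'m) \<Rightarrow> real \<Rightarrow> 'w \<Rightarrow> real^'n^'m" where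
  "simple_process n \<tau> \<xi> s \<omega> = (\<Sum>i<n. indicator {\<tau> i<..\<tau> (Suc i)} s *\<^sub>R \<xi> i \<omega>)"

definition simple_integral ::
  "(real \<Rightarrow> 'w \<Rightarrow> real^'n) \<Rightarrow> nat \<Rightarrow> (nat \<Rightarrow> real) \<Rightarrow> (nat \<Rightarrow> 'w \<Rightarrow> real^'n^'m) \<Rightarrow>
     real \<Rightarrow> 'w \<Rightarrow> real^'m" where
  "simple_integral B n \<tau> \<xi> t \<omega> =
     (\<Sum>i<n. \<xi> i \<omega> *v (B (min t (\<tau> (Suc i))) \<omega> - B (min t (\<tau> i)) \<omega>))"

text \<open>Convergence to \<open>0\<close> in probability. Measurability is part of the definition, because
  \<^const>\<open>measure\<close> is \<open>0\<close> on non-measurable sets.\<close>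

definition vanishes_in_prob :: "'w measure \<Rightarrow> (nat \<Rightarrow> 'w \<Rightarrow> ennreal) \<Rightarrow> bool" where
  "vanishes_in_prob M Z \<longleftrightarrow>
     (\<forall>k. Z k \<in> borel_measurable M) \<and>
     (\<forall>\<epsilon>::real. \<epsilon> > 0 \<longrightarrow> (\<lambda>k. measure M {\<omega> \<in> space M. Z k \<omega> > ennreal \<epsilon>}) \<longlonglongrightarrow> 0)"

text \<open>\<open>ito_integral M \<F> B \<Phi> t I\<close> means that the random variable \<open>I\<close> is a version of
  \<open>\<integral>\<^sub>0\<^sup>t \<Phi>(s) dB(s)\<close>: for a measurable adapted integrand \<open>\<Phi>\<close> there are
  simple integrands \<open>\<Phi>\<^sub>k\<close> such that \<open>\<integral>\<^sub>0\<^sup>t \<parallel>\<Phi>\<^sub>k(s) - \<Phi>(s)\<parallel>\<^sup>2 ds\<close> tends to \<open>0\<close> in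
  probability and the elementary integrals of \<open>\<Phi>\<^sub>k\<close> over \<open>[0, t]\<close> tend to \<open>I\<close> in probability. This
  determines \<open>I\<close> almost surely when \<open>B\<close> is a Wiener process.\<close>

definition ito_integral ::
  "'w measure \<Rightarrow> (real \<Rightarrow> 'w measure) \<Rightarrow> (real \<Rightarrow> 'w \<Rightarrow> real^'n) \<Rightarrow>
     (real \<Rightarrow> 'w \<Rightarrow> real^'n^'m) \<Rightarrow> real \<Rightarrow> ('w \<Rightarrow> real^'m) \<Rightarrow> bool" where
  "ito_integral M \<F> B \<Phi> t I \<longleftrightarrow>
     (\<lambda>(s, \<omega>). \<Phi> s \<omega>) \<in> borel_measurable (restrict_space borel {0..t} \<Otimes>\<^sub>M M) \<and>
     (\<forall>s\<in>{0..t}. \<Phi> s \<in> borel_measurable (\<F> s)) \<and>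
     I \<in> borel_measurable M \<and>
     (\<exists>n \<tau> \<xi>.
        (\<forall>k. simple_integrand M \<F> (n k) (\<tau> k) (\<xi> k)) \<and>
        vanishes_in_prob M (\<lambda>k \<omega>.
          \<integral>\<^sup>+ s\<in>{0..t}. ennreal ((norm (simple_process (n k) (\<tau> k) (\<xi> k) s \<omega> - \<Phi> s \<omega>))\<^sup>2) \<partial>lborel) \<and>
        vanishes_in_prob M (\<lambda>k \<omega>.
          ennreal (norm (simple_integral B (n k) (\<tau> k) (\<xi> k) t \<omega> - I \<omega>))))"


section \<open>Stochastic differential equations\<close>

text \<open>Global solutions of \<open>dY(t) = b(Y(t)) dt + s(t, Y(t)) dB(t)\<close>, \<open>Y(0) = x\<^sub>0\<close>.\<close>

definition sde_solution ::
  "'w measure \<Rightarrow> (real \<Rightarrow> 'w measure) \<Rightarrow> (real \<Rightarrow> 'w \<Rightarrow> real^'n) \<Rightarrow>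
     (real^'n \<Rightarrow> real^'n) \<Rightarrow> (real \<Rightarrow> real^'n \<Rightarrow> real^'n^'n) \<Rightarrow> real^'n \<Rightarrow>
     (real \<Rightarrow> 'w \<Rightarrow> real^'n) \<Rightarrow> bool" where
  "sde_solution M \<F> B b s x\<^sub>0 Y \<longleftrightarrow>
     (\<forall>t\<ge>0. Y t \<in> borel_measurable (\<F> t)) \<and>
     (\<forall>\<omega>\<in>space M. continuous_on {0..} (\<lambda>t. Y t \<omega>)) \<and>
     (AE \<omega> in M. Y 0 \<omega> = x\<^sub>0) \<and>
     (\<forall>t\<ge>0. \<exists>I. ito_integral M \<F> B (\<lambda>u \<omega>. s u (Y u \<omega>)) t I \<and>
        (AE \<omega> in M. (\<lambda>u. b (Y u \<omega>)) absolutely_integrable_on {0..t} \<and>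
           Y t \<omega> = x\<^sub>0 + integral {0..t} (\<lambda>u. b (Y u \<omega>)) + I \<omega>))"

text \<open>The equation \<open>dY = -\<nabla>F\<^sup>h(Y) dt + \<surd>h \<sigma>(t, Y) dB\<close>, with \<open>F\<^sup>h\<close> the modified objective.\<close>

definition modified_sde_solution ::
  "'w measure \<Rightarrow> (real \<Rightarrow> 'w measure) \<Rightarrow> (real \<Rightarrow> 'w \<Rightarrow> real^'n) \<Rightarrow>
     (real^'n \<Rightarrow> real) \<Rightarrow> (real \<Rightarrow> real^'n \<Rightarrow> real^'n^'n) \<Rightarrow> real \<Rightarrow> real^'n \<Rightarrow>
     (real \<Rightarrow> 'w \<Rightarrow> real^'n) \<Rightarrow> bool" where
  "modified_sde_solution M \<F> B F \<sigma> h x\<^sub>0 Y \<longleftrightarrow>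
     sde_solution M \<F> B
       (\<lambda>x. - grad (modified_objective F h) x) (\<lambda>t x. sqrt h *\<^sub>R \<sigma> t x) x\<^sub>0 Y"

end

theory Submission
  imports Defs
begin

text \<open>
  The scheme is a Markov chain; let \<open>P\<close> be its transition operators, and consider the backward
  iterates \<open>V\<^sub>j\<close> of \<open>\<phi>\<close> under \<open>P\<close>. They have Taylor expansions of order two whose coefficients and
  remainders grow linearly, with a constant that, by the strong monotonicity of \<open>\<nabla>F\<close>, contracts by a
  factor \<open>1 - \<lambda>h\<close> at every step. The drift of the modified equation is such that, for a function
  \<open>u\<close> with such an expansion, \<open>E u(Y(t + h))\<close> and \<open>E (P u)(Y(t))\<close> agree up to \<open>h\<^sup>3\<close> times the fourth
  moment of \<open>Y(t)\<close>, which stays bounded for all times. In the telescoping sum of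
  \<open>E V\<^sub>j(Y((N - j)h)) - E V\<^bsub>j+1\<^esub>(Y((N - j - 1)h))\<close> the local errors \<open>h\<^sup>3(1 - \<lambda>h)\<^sup>j\<close> add up to
  \<open>O(h\<^sup>2)\<close>. The Ito formula is avoided: the increment of \<open>Y\<close> over one step is an almost sure limit of
  Riemann sums with Brownian increments, whose expectations follow from independence, and a uniform
  bound on their fourth moments permits the passage to the limit.\<close>

section \<open>Gaussian moments\<close>

text \<open>Two scalings decide which orders matter. The scheme adds noise
  \<open>h \<sigma> \<gamma>\<close>, the equation adds noise \<open>sqrt h \<sigma>\<close> per
  unit of Brownian increment over a time \<open>h\<close>; both covariances are of order
  \<open>h^2\<close>, so one-step increments are of order \<open>h\<close>, and a cubic Taylor
  remainder already costs only \<open>h^3\<close>. Only means and covariances have to be matched. At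
  elapsed time \<open>s\<close> the drift of the equation has changed by \<open>s\<close> times the
  Hessian applied to the gradient; the correction in the modified objective contributes
  \<open>- h / 2\<close> times the same vector, and the two cancel on average over the step. Since
  the gradient of \<open>\<phi>\<close> may grow linearly, the expansions carry a linear weight,
  which is not itself asked to contract. Products of the weight with up to three factors of the
  linearised step are bounded through second moments of the weight and sixth moments of the step.
  The solution comes without any moment bound. Localising to events on which the path stays in a
  ball, absorbing the unknown moment for small \<open>h\<close> and applying Fatou's lemma supply
  one.\<close>

lemma lborel_vec_prod:
  fixes f :: "'n::finite \<Rightarrow> real \<Rightarrow> real"
  assumes f: "\<And>i. integrable lborel (f i)"
  shows "integrable lborel (\<lambda>x::real^'n. \<Prod>i\<in>UNIV. f i (x $ i))"
    and "(\<integral>x. (\<Prod>i\<in>UNIV. f i (x $ i)) \<partial>(lborel :: (real^'n) measure)) = (\<Prod>i\<in>UNIV. integral\<^sup>L lborel (f i))"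
proof -
  \<comment> \<open>\<open>ax\<close> identifies the coordinates with the basis vectors that index
    the product measure behind \<open>lborel\<close>; the claim is Fubini for that product,
    transported along \<open>distr\<close>.\<close>
  define ax :: "'n \<Rightarrow> real^'n" where "ax = (\<lambda>i. axis i 1)"
  have inj: "inj ax" by (auto simp: inj_on_def ax_def axis_eq_axis)
  have B: "(Basis :: (real^'n) set) = ax ` UNIV"
    by (auto simp: Basis_vec_def ax_def)
  define F where "F = (\<lambda>b::real^'n. f (inv ax b))"
  have Fax: "F (ax i) = f i" for i using inj by (simp add: F_def)
  interpret product_sigma_finite "\<lambda>b::real^'n. lborel :: real measure"
    by standard
  have Fi: "integrable lborel (F b)" for b by (simp add: F_def f)
  have [measurable]: "f i \<in> borel_measurable borel" for i using f[of i] by simp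
  have eq: "(\<Prod>b\<in>Basis. F b (x b)) = (\<Prod>i\<in>UNIV. f i (x (ax i)))" for x
    unfolding B by (subst prod.reindex) (auto intro: inj_on_subset[OF inj] simp: Fax)
  have comp: "(\<Sum>b\<in>Basis. x b *\<^sub>R b) $ i = x (ax i)" for x :: "real^'n \<Rightarrow> real" and i
  proof -
    have "(\<Sum>b\<in>Basis. x b *\<^sub>R b) $ i = (\<Sum>b\<in>Basis. x b *\<^sub>R b) \<bullet> ax i"
      by (simp add: ax_def inner_axis)
    also have "\<dots> = x (ax i)"
      by (subst inner_sum_left_Basis) (auto simp: B)
    finally show ?thesis .
  qed
  \<comment> \<open>The definition of \<open>lborel\<close> takes interval measures as factors;
    \<open>lborel_eq_real\<close> brings the one-dimensional \<open>lborel\<close> into that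
    form.\<close>
  have L: "(lborel :: (real^'n) measure) = distr (\<Pi>\<^sub>M b\<in>Basis. lborel) borel (\<lambda>x. \<Sum>b\<in>Basis. x b *\<^sub>R b)"
    unfolding lborel_eq_real by (rule lborel_def)
  have meas: "(\<lambda>x. \<Sum>b\<in>Basis. x b *\<^sub>R b) \<in> measurable (\<Pi>\<^sub>M b\<in>(Basis :: (real^'n) set). (lborel::real measure)) borel"
    by measurable
  have i1: "integrable (\<Pi>\<^sub>M b\<in>(Basis :: (real^'n) set). lborel) (\<lambda>x. \<Prod>b\<in>Basis. F b (x b))"
    by (rule product_integrable_prod) (auto simp: Fi)
  have i2: "(\<integral>x. (\<Prod>b\<in>Basis. F b (x b)) \<partial>(\<Pi>\<^sub>M b\<in>(Basis :: (real^'n) set). lborel)) = (\<Prod>b\<in>Basis. integral\<^sup>L lborel (F b))"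
    by (rule product_integral_prod) (auto simp: Fi)
  show "integrable lborel (\<lambda>x::real^'n. \<Prod>i\<in>UNIV. f i (x $ i))"
    apply (subst L)
    apply (subst integrable_distr_eq[OF meas])
     apply measurable
    using i1 unfolding comp eq .
  have "(\<Prod>b\<in>Basis. integral\<^sup>L lborel (F b)) = (\<Prod>i\<in>UNIV. integral\<^sup>L lborel (f i))"
    unfolding B by (subst prod.reindex) (auto intro: inj_on_subset[OF inj] simp: Fax)
  then show "(\<integral>x. (\<Prod>i\<in>UNIV. f i (x $ i)) \<partial>(lborel :: (real^'n) measure)) = (\<Prod>i\<in>UNIV. integral\<^sup>L lborel (f i))"
    apply (subst L)
    apply (subst integral_distr[OF meas])
     apply measurable
    using i2 unfolding comp eq by simp
qed

definition gauss :: "real \<Rightarrow> (real^'n) measure" where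
  "gauss v = density lborel (gauss_density v)"

lemma sets_gauss [measurable_cong, simp]: "sets (gauss v) = sets borel"
  and space_gauss [simp]: "space (gauss v) = UNIV"
  by (simp_all add: gauss_def)

lemma measurable_gauss_density [measurable]: "gauss_density v \<in> borel_measurable borel"
  unfolding gauss_density_def[abs_def] by measurable

context
  fixes v :: real
  assumes v: "0 < v"
begin

text \<open>The density is a product over the coordinates, so \<open>lborel_vec_prod\<close> splits
  the integral into one-dimensional normal moments. The exact Gaussian moments below are instances,
  with the exponents chosen accordingly.\<close>

lemma gauss_monomial:
  fixes e :: "'n::finite \<Rightarrow> nat"
  shows "integrable (gauss v) (\<lambda>x::real^'n. \<Prod>i\<in>UNIV. (x $ i) ^ e i)"
    and "(\<integral>x. (\<Prod>i\<in>UNIV. (x $ i) ^ e i) \<partial>(gauss v :: (real^'n) measure)) =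
      (\<Prod>i\<in>UNIV. (\<integral>t. normal_density 0 (sqrt v) t * t ^ e i \<partial>lborel))"
proof -
  have s: "0 < sqrt v" using v by simp
  have i: "integrable lborel (\<lambda>t. normal_density 0 (sqrt v) t * t ^ e i)" for i
    using integrable_normal_moment[OF s, of 0 "e i"] by simp
  note P = lborel_vec_prod[of "\<lambda>i t. normal_density 0 (sqrt v) t * t ^ e i", OF i]
  have nn: "0 \<le> (\<Prod>i\<in>UNIV. normal_density 0 (sqrt v) (x $ i))" for x :: "real^'n"
    by (intro prod_nonneg) auto
  show "integrable (gauss v) (\<lambda>x::real^'n. \<Prod>i\<in>UNIV. (x $ i) ^ e i)"
    unfolding gauss_def gauss_density_def
    apply (subst integrable_real_density)
    using P(1) nn by (auto simp: prod.distrib)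
  show "(\<integral>x. (\<Prod>i\<in>UNIV. (x $ i) ^ e i) \<partial>(gauss v :: (real^'n) measure)) =
      (\<Prod>i\<in>UNIV. (\<integral>t. normal_density 0 (sqrt v) t * t ^ e i \<partial>lborel))"
    unfolding gauss_def gauss_density_def
    apply (subst integral_real_density)
    using P(2) nn by (auto simp: prod.distrib)
qed

text \<open>The total mass is the moment of the empty monomial.\<close>

lemma prob_space_gauss: "prob_space (gauss v :: (real^'n) measure)"
proof
  have s: "0 < sqrt v" using v by simp
  have f: "integrable (gauss v :: (real^'n) measure) (\<lambda>x. 1::real)"
    and e: "(\<integral>x. (1::real) \<partial>(gauss v :: (real^'n) measure)) = 1"
    using gauss_monomial[of "\<lambda>i::'n. 0"] s by (simp_all del: integral_const integrable_const lebesgue_integral_const)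
  have "emeasure (gauss v :: (real^'n) measure) (space (gauss v)) < \<infinity>"
    using f by (simp add: integrable_iff_bounded)
  then have "emeasure (gauss v :: (real^'n) measure) (space (gauss v)) \<noteq> top" by simp
  moreover have "measure (gauss v :: (real^'n) measure) (space (gauss v)) = 1"
    using e by simp
  ultimately show "emeasure (gauss v :: (real^'n) measure) (space (gauss v)) = 1"
    by (metis emeasure_eq_ennreal_measure ennreal_1)
qed

lemma gauss_coord:
  fixes i :: "'n::finite"
  shows "integrable (gauss v) (\<lambda>x::real^'n. (x $ i) ^ k)"
    and "(\<integral>x. (x $ i) ^ k \<partial>(gauss v :: (real^'n) measure)) = (\<integral>t. normal_density 0 (sqrt v) t * t ^ k \<partial>lborel)"
proof -
  have s: "0 < sqrt v" using v by simp
  define e where "e = (\<lambda>j. if j = i then k else 0)"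
  have "(\<Prod>j\<in>UNIV. (x $ j) ^ e j) = (\<Prod>j\<in>UNIV. if j = i then (x $ j) ^ k else 1)" for x :: "real^'n"
    by (intro prod.cong) (auto simp: e_def)
  then have p: "(\<Prod>j\<in>UNIV. (x $ j) ^ e j) = (x $ i) ^ k" for x :: "real^'n"
    by simp
  have "(\<Prod>j\<in>UNIV. (\<integral>t. normal_density 0 (sqrt v) t * t ^ e j \<partial>lborel)) =
    (\<Prod>j\<in>UNIV. if j = i then (\<integral>t. normal_density 0 (sqrt v) t * t ^ k \<partial>lborel) else 1)"
    using s by (intro prod.cong) (auto simp: e_def)
  then have q: "(\<Prod>j\<in>UNIV. (\<integral>t. normal_density 0 (sqrt v) t * t ^ e j \<partial>lborel)) =
    (\<integral>t. normal_density 0 (sqrt v) t * t ^ k \<partial>lborel)"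
    by simp
  show "integrable (gauss v) (\<lambda>x::real^'n. (x $ i) ^ k)"
    using gauss_monomial(1)[of e] by (simp add: p)
  show "(\<integral>x. (x $ i) ^ k \<partial>(gauss v :: (real^'n) measure)) = (\<integral>t. normal_density 0 (sqrt v) t * t ^ k \<partial>lborel)"
    using gauss_monomial(2)[of e] by (simp add: p q)
qed

lemma gauss_mean: "(\<integral>x. x $ i \<partial>(gauss v :: (real^'n) measure)) = 0"
  using gauss_coord(2)[of i 1] integral_normal_moment_odd[of "sqrt v" 0 0] v by simp

lemma gauss_cov:
  shows "integrable (gauss v) (\<lambda>x::real^'n. x $ i * x $ j)"
    and "(\<integral>x. x $ i * x $ j \<partial>(gauss v :: (real^'n) measure)) = (if i = j then v else 0)"
proof -
  have s: "0 < sqrt v" using v by simp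
  \<comment> \<open>The exponent counts the occurrences of \<open>k\<close> in the pair
    \<open>i\<close>, \<open>j\<close>, which covers the diagonal and the off-diagonal case at
    once.\<close>
  define e where "e = (\<lambda>k. (if k = i then 1 else 0) + (if k = j then 1 else (0::nat)))"
  have "(\<Prod>k\<in>UNIV. (x $ k) ^ e k) =
     (\<Prod>k\<in>UNIV. if k = i then x $ k else 1) * (\<Prod>k\<in>UNIV. if k = j then x $ k else 1)" for x :: "real^'n"
    unfolding prod.distrib[symmetric] by (intro prod.cong) (auto simp: e_def)
  then have p: "(\<Prod>k\<in>UNIV. (x $ k) ^ e k) = x $ i * x $ j" for x :: "real^'n"
    by simp
  show "integrable (gauss v) (\<lambda>x::real^'n. x $ i * x $ j)"
    using gauss_monomial(1)[of e] by (simp add: p)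
  show "(\<integral>x. x $ i * x $ j \<partial>(gauss v :: (real^'n) measure)) = (if i = j then v else 0)"
  proof (cases "i = j")
    case True
    have "(\<integral>x. (x $ i) ^ 2 \<partial>(gauss v :: (real^'n) measure)) = v"
      using gauss_coord(2)[of i 2] integral_normal_moment_even[of "sqrt v" 0 1] v
      by (simp add: fact_numeral)
    then show ?thesis using True by (simp add: power2_eq_square)
  next
    case False
    have "(\<integral>t. normal_density 0 (sqrt v) t * t ^ e i \<partial>lborel) = 0"
      using integral_normal_moment_odd[of "sqrt v" 0 0] False v by (simp add: e_def)
    then have "(\<Prod>k\<in>UNIV. (\<integral>t. normal_density 0 (sqrt v) t * t ^ e k \<partial>lborel)) = 0"
      by (meson UNIV_I finite prod_zero)
    then show ?thesis
      using gauss_monomial(2)[of e] False by (simp add: p)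
  qed
qed

text \<open>The norm is at most the dimension times the largest coordinate in modulus. Passing to
  the even exponent \<open>2 * k\<close> removes the absolute value, and the largest coordinate is
  dominated by the sum over all of them.\<close>

lemma integrable_gauss_norm: "integrable (gauss v) (\<lambda>x::real^'n. norm x ^ k)"
proof -
  interpret prob_space "gauss v :: (real^'n) measure" by (rule prob_space_gauss)
  show ?thesis
  proof (rule Bochner_Integration.integrable_bound)
    show "integrable (gauss v) (\<lambda>x::real^'n. 1 + real CARD('n) ^ (2*k) * (\<Sum>i\<in>UNIV. (x $ i) ^ (2 * k)))"
      using gauss_coord(1) by (intro Bochner_Integration.integrable_add integrable_mult_right Bochner_Integration.integrable_sum) auto
    show "AE x in (gauss v :: (real^'n) measure). norm (norm x ^ k) \<le> norm (1 + real CARD('n) ^ (2*k) * (\<Sum>i\<in>UNIV. (x $ i) ^ (2 * k)))"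
    proof (rule AE_I2)
      fix x :: "real^'n"
      obtain j where j: "\<And>i. \<bar>x $ i\<bar> \<le> \<bar>x $ j\<bar>"
      proof -
        have "finite (range (\<lambda>i. \<bar>x $ i\<bar>))" "range (\<lambda>i. \<bar>x $ i\<bar>) \<noteq> {}" by auto
        from Max_in[OF this] obtain j where "Max (range (\<lambda>i. \<bar>x $ i\<bar>)) = \<bar>x $ j\<bar>" by (metis imageE)
        then have "\<bar>x $ i\<bar> \<le> \<bar>x $ j\<bar>" for i
          using Max_ge[of "range (\<lambda>i. \<bar>x $ i\<bar>)" "\<bar>x $ i\<bar>"] by auto
        then show ?thesis using that by blast
      qed
      have "norm x \<le> (\<Sum>i\<in>UNIV. \<bar>x $ i\<bar>)" by (rule norm_le_l1_cart)
      also have "\<dots> \<le> (\<Sum>i\<in>(UNIV::'n set). \<bar>x $ j\<bar>)" by (intro sum_mono j)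
      finally have n: "norm x \<le> real CARD('n) * \<bar>x $ j\<bar>" by simp
      have "norm x ^ k \<le> 1 + norm x ^ (2 * k)"
      proof (cases "norm x \<le> 1")
        case True then show ?thesis using power_le_one[of "norm x" k] by (simp add: add_increasing2)
      next
        case False then show ?thesis using power_increasing[of k "2*k" "norm x"] by linarith
      qed
      also have "norm x ^ (2 * k) \<le> (real CARD('n) * \<bar>x $ j\<bar>) ^ (2 * k)"
        by (intro power_mono n) auto
      also have "\<dots> = real CARD('n) ^ (2*k) * (x $ j) ^ (2 * k)"
        by (simp add: power_mult_distrib power_even_abs)
      also have "(x $ j) ^ (2 * k) \<le> (\<Sum>i\<in>UNIV. (x $ i) ^ (2 * k))"
        by (rule member_le_sum) auto
      finally show "norm (norm x ^ k) \<le> norm (1 + real CARD('n) ^ (2*k) * (\<Sum>i\<in>UNIV. (x $ i) ^ (2 * k)))"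
        by (simp add: mult_left_mono sum_nonneg)
    qed
  qed simp
qed

text \<open>Cauchy-Schwarz over the coordinates costs one factor \<open>CARD('n)\<close>, the sum of
  the fourth moments \<open>3 * v^2\<close> the other.\<close>

lemma gauss_norm4: "(\<integral>x. norm x ^ 4 \<partial>(gauss v :: (real^'n) measure)) \<le> 3 * real CARD('n) ^ 2 * v ^ 2"
proof -
  have m4: "(\<integral>x. (x $ i) ^ 4 \<partial>(gauss v :: (real^'n) measure)) = 3 * v ^ 2" for i :: 'n
    using gauss_coord(2)[of i 4] integral_normal_moment_even[of "sqrt v" 0 2] v
    by (simp add: fact_numeral power_divide power2_eq_square)
  have "norm x ^ 4 \<le> real CARD('n) * (\<Sum>i\<in>UNIV. (x $ i) ^ 4)" for x :: "real^'n"
  proof -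
    have "norm x ^ 4 = ((norm x)^2) ^ 2" by simp
    also have "\<dots> = (\<Sum>i\<in>UNIV. (x $ i)^2) ^ 2"
      by (simp add: norm_vec_def L2_set_def sum_nonneg)
    also have "\<dots> \<le> real CARD('n) * (\<Sum>i\<in>UNIV. ((x $ i)^2)^2)"
      using sum_squared_le_sum_of_squares[of "\<lambda>i. (x $ i)^2" UNIV] by (simp add: mult.commute)
    finally show ?thesis by simp
  qed
  then have "(\<integral>x. norm x ^ 4 \<partial>(gauss v :: (real^'n) measure)) \<le> (\<integral>x. real CARD('n) * (\<Sum>i\<in>UNIV. (x $ i) ^ 4) \<partial>(gauss v :: (real^'n) measure))"
    using gauss_coord(1) integrable_gauss_norm
    by (intro integral_mono integrable_mult_right Bochner_Integration.integrable_sum) auto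
  also have "\<dots> = 3 * real CARD('n) ^ 2 * v ^ 2"
    by (simp add: m4 power2_eq_square Bochner_Integration.integral_sum gauss_coord(1))
  finally show ?thesis .
qed

end

section \<open>Wiener increments\<close>

lemma norm_matrix_vector_mult: "norm (A *v x) \<le> norm A * norm x"
  for A :: "real^'n^'m" and x :: "real^'n"
proof -
  have "norm (A *v x) = L2_set (\<lambda>i. \<bar>A $ i \<bullet> x\<bar>) UNIV"
    by (simp add: norm_vec_def matrix_vector_mul_component)
  also have "\<dots> \<le> L2_set (\<lambda>i. norm (A $ i) * norm x) UNIV"
    by (intro L2_set_mono Cauchy_Schwarz_ineq2) auto
  also have "\<dots> = norm A * norm x"
    by (simp add: L2_set_left_distrib norm_vec_def[of A])
  finally show ?thesis .
qed

lemma norm_transpose: "norm (transpose A) = norm A" for A :: "real^'n^'m"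
proof -
  have "(norm (transpose A))^2 = (norm A)^2"
    by (simp add: norm_vec_def L2_set_def sum_nonneg transpose_def) (rule sum.swap)
  then show ?thesis by simp
qed

lemma norm_vector_matrix_mult: "norm (x v* A) \<le> norm A * norm x"
  for A :: "real^'n^'m"
  by (metis norm_matrix_vector_mult norm_transpose transpose_matrix_vector)

lemma inner_matrix_transpose: "(A *v x) \<bullet> y = x \<bullet> (transpose A *v y)"
  for A :: "real^'n^'m"
  by (metis dot_lmul_matrix inner_commute transpose_matrix_vector transpose_transpose)

lemma measurable_vec_nth [measurable (raw)]:
  "f \<in> borel_measurable N \<Longrightarrow> (\<lambda>x. f x $ i) \<in> borel_measurable N"
  for f :: "_ \<Rightarrow> ('a::euclidean_space)^'n"
  by (rule borel_measurable_continuous_on[of "\<lambda>y. y $ i"]) (intro continuous_intros)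

lemma measurable_vecI:
  fixes f :: "_ \<Rightarrow> ('a::euclidean_space)^'n"
  assumes "\<And>i. (\<lambda>x. f x $ i) \<in> borel_measurable N"
  shows "f \<in> borel_measurable N"
proof (subst borel_measurable_euclidean_space, rule ballI)
  fix b :: "'a^'n" assume "b \<in> Basis"
  then obtain i u where "b = axis i u" "u \<in> Basis" by (auto simp: Basis_vec_def)
  then show "(\<lambda>x. f x \<bullet> b) \<in> borel_measurable N"
    using assms[of i] by (simp add: inner_axis)
qed

lemma measurable_matrix_vector [measurable (raw)]:
  fixes A :: "_ \<Rightarrow> real^'n^'m"
  assumes [measurable]: "A \<in> borel_measurable N" "x \<in> borel_measurable N"
  shows "(\<lambda>w. A w *v x w) \<in> borel_measurable N"
  by (rule measurable_vecI) (simp add: matrix_vector_mul_component)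

lemma measurable_transpose [measurable (raw)]:
  fixes A :: "_ \<Rightarrow> real^'n^'m"
  assumes [measurable]: "A \<in> borel_measurable N"
  shows "(\<lambda>w. transpose (A w)) \<in> borel_measurable N"
  by (intro measurable_vecI) (simp add: transpose_def)

section \<open>Moments of Wiener increments against factors known before them\<close>

locale wiener =
  fixes M :: "'w measure" and F :: "real \<Rightarrow> 'w measure" and B :: "real \<Rightarrow> 'w \<Rightarrow> real^'n"
  assumes W: "wiener_process M F B"

sublocale wiener \<subseteq> prob_space M
  by (rule wiener_process_def[THEN iffD1, THEN conjunct1, OF W])

context wiener
begin

lemma sub: "space (F t) = space M" "sets (F t) \<subseteq> sets M"
  using W unfolding wiener_process_def subalgebra_def by blast+

lemma F_mono: "s \<le> t \<Longrightarrow> sets (F s) \<subseteq> sets (F t)"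
  using W unfolding wiener_process_def using filtration.sets_F_mono by blast

lemma F_meas_mono: "s \<le> t \<Longrightarrow> f \<in> measurable (F s) N \<Longrightarrow> f \<in> measurable (F t) N"
  using measurable_mono[of N N "F s" "F t"] F_mono[of s t] sub(1) by auto

lemma F_meas: "f \<in> measurable (F s) N \<Longrightarrow> f \<in> measurable M N"
  using measurable_mono[of N N "F s" M] sub by auto

lemma B_adapted: "0 \<le> t \<Longrightarrow> B t \<in> borel_measurable (F t)"
  using W unfolding wiener_process_def by blast

definition incr :: "real \<Rightarrow> real \<Rightarrow> 'w \<Rightarrow> real^'n" where
  "incr s t om = B t om - B s om"

lemma incr_adapted: "0 \<le> s \<Longrightarrow> s \<le> t \<Longrightarrow> incr s t \<in> borel_measurable (F t)"
  using B_adapted[of t] F_meas_mono[OF _ B_adapted[of s], of t] unfolding incr_def[abs_def]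
  by (intro borel_measurable_diff) auto

lemma incr_meas: "0 \<le> s \<Longrightarrow> s \<le> t \<Longrightarrow> incr s t \<in> borel_measurable M"
  using incr_adapted F_meas by blast

lemma incr_distr:
  assumes "0 \<le> s" "s < t" shows "distr M borel (incr s t) = gauss (t - s)"
proof -
  have "distributed M lborel (incr s t) (gauss_density (t - s))"
    using W assms unfolding wiener_process_def incr_def[abs_def] by blast
  then have "distr M lborel (incr s t) = gauss (t - s)"
    by (simp add: distributed_def gauss_def)
  then show ?thesis by (simp cong: distr_cong)
qed

text \<open>The Wiener property makes all of \<open>F s\<close> independent of the events of the
  increment; the sigma-algebras generated by \<open>Z\<close> and by \<open>f\<close> of the
  increment are contained in these two families.\<close>

lemma incr_indep:
  assumes st: "0 \<le> s" "s < t" and Z: "Z \<in> borel_measurable (F s)" and f: "f \<in> borel_measurable borel"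
  shows "indep_var borel Z borel (\<lambda>om. f (incr s t om) :: real)"
proof -
  have i: "indep_set (sets (F s)) {incr s t -` A \<inter> space M | A. A \<in> sets borel}"
    using W st unfolding wiener_process_def incr_def[abs_def] by blast
  have [measurable]: "incr s t \<in> borel_measurable M" using incr_meas st by auto
  have 1: "{Z -` A \<inter> space M |A. A \<in> sets borel} \<subseteq> sets (F s)"
    using measurable_sets[OF Z] sub(1)[of s] by auto
  then have 2: "sigma_sets (space M) {Z -` A \<inter> space M |A. A \<in> sets borel} \<subseteq> sets (F s)"
    using sets.sigma_sets_subset[OF 1] sub(1)[of s] by simp
  have "(\<lambda>om. f (incr s t om)) -` A \<inter> space M = incr s t -` (f -` A) \<inter> space M" for A by auto
  moreover have "f -` A \<in> sets borel" if "A \<in> sets borel" for A using measurable_sets[OF f that] by simp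
  ultimately have 3: "{(\<lambda>om. f (incr s t om)) -` A \<inter> space M |A. A \<in> sets borel} \<subseteq> {incr s t -` A \<inter> space M | A. A \<in> sets borel}"
    by auto blast
  \<comment> \<open>The preimages of Borel sets are already a sigma-algebra, the one pulled back by
    the increment, so generating adds nothing to them.\<close>
  have sa: "sigma_algebra (space M) {incr s t -` A \<inter> space M | A. A \<in> sets borel}"
    using sets.sigma_algebra_axioms[of "vimage_algebra (space M) (incr s t) borel"]
    by (simp add: sets_vimage_algebra2)
  have 4: "sigma_sets (space M) {(\<lambda>om. f (incr s t om)) -` A \<inter> space M |A. A \<in> sets borel} \<subseteq> {incr s t -` A \<inter> space M | A. A \<in> sets borel}"
    by (rule sigma_algebra.sigma_sets_subset[OF sa 3])
  have "indep_set (sigma_sets (space M) {Z -` A \<inter> space M |A. A \<in> sets borel})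
     (sigma_sets (space M) {(\<lambda>om. f (incr s t om)) -` A \<inter> space M |A. A \<in> sets borel})"
    unfolding indep_set_def
    by (rule indep_sets_mono_sets[OF i[unfolded indep_set_def]]) (use 2 4 in \<open>auto split: bool.split\<close>)
  then show ?thesis
    unfolding indep_var_eq using F_meas[OF Z] f by auto
qed

text \<open>Stands in for conditioning on \<open>F s\<close>: the moment identities for increments
  follow by applying it to the entries of vectors and matrices.\<close>

lemma incr_integral:
  fixes f :: "real^'n \<Rightarrow> real"
  assumes st: "0 \<le> s" "s < t" and Z: "Z \<in> borel_measurable (F s)" "integrable M Z"
    and f: "f \<in> borel_measurable borel" "integrable (gauss (t - s)) f"
  shows "integrable M (\<lambda>om. Z om * f (incr s t om))"
    and "(\<integral>om. Z om * f (incr s t om) \<partial>M) = (\<integral>om. Z om \<partial>M) * (\<integral>x. f x \<partial>gauss (t - s))"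
proof -
  have [measurable]: "incr s t \<in> borel_measurable M" using incr_meas st by auto
  note [measurable] = f(1)
  have i: "integrable M (\<lambda>om. f (incr s t om))"
    using f(2) unfolding incr_distr[OF st, symmetric] by (simp add: integrable_distr_eq)
  have e: "(\<integral>x. f x \<partial>gauss (t - s)) = (\<integral>om. f (incr s t om) \<partial>M)"
    unfolding incr_distr[OF st, symmetric] by (simp add: integral_distr)
  note iv = incr_indep[OF st Z(1) f(1)]
  show "integrable M (\<lambda>om. Z om * f (incr s t om))"
    by (rule indep_var_integrable[OF iv Z(2) i])
  show "(\<integral>om. Z om * f (incr s t om) \<partial>M) = (\<integral>om. Z om \<partial>M) * (\<integral>x. f x \<partial>gauss (t - s))"
    unfolding e by (rule indep_var_lebesgue_integral[OF iv Z(2) i])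
qed

lemma incr_refl [simp]: "incr s s om = 0" by (simp add: incr_def)

text \<open>Centring, coordinate by coordinate. Increments with \<open>s = t\<close> are treated
  apart, because the Gaussian density requires a positive variance; they occur for grids with
  repeated points.\<close>

lemma incr_mean:
  fixes G :: "'w \<Rightarrow> real^'n"
  assumes st: "0 \<le> s" "s \<le> t" and G: "G \<in> borel_measurable (F s)" "integrable M (\<lambda>om. norm (G om))"
  shows "integrable M (\<lambda>om. G om \<bullet> incr s t om)" "(\<integral>om. G om \<bullet> incr s t om \<partial>M) = 0"
proof -
  have *: "integrable M (\<lambda>om. G om \<bullet> incr s t om) \<and> (\<integral>om. G om \<bullet> incr s t om \<partial>M) = 0" if "s < t"
  proof -
    have v: "0 < t - s" using that by simp
    note [measurable] = G(1) F_meas[OF G(1)]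
    have Gi: "integrable M (\<lambda>om. G om $ i)" for i
      by (rule Bochner_Integration.integrable_bound[OF G(2)]) (auto simp: component_le_norm_cart)
    have a: "integrable M (\<lambda>om. G om $ i * incr s t om $ i)" for i
      by (rule incr_integral(1)[OF st(1) that, where f = "\<lambda>x. x $ i"])
         (use Gi gauss_coord(1)[OF v, of i 1] in auto)
    have b: "(\<integral>om. G om $ i * incr s t om $ i \<partial>M) = 0" for i
      by (subst incr_integral(2)[OF st(1) that, where f = "\<lambda>x. x $ i"])
         (use Gi gauss_coord(1)[OF v, of i 1] gauss_mean[OF v] in auto)
    show ?thesis unfolding inner_vec_def using a b by simp
  qed
  then show "integrable M (\<lambda>om. G om \<bullet> incr s t om)" "(\<integral>om. G om \<bullet> incr s t om \<partial>M) = 0"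
    using st by (cases "s = t"; simp)+
qed

text \<open>The coordinates of the increment are uncorrelated with variance \<open>t - s\<close>, so
  only the trace of \<open>Q\<close> survives.\<close>

lemma incr_cov:
  fixes Q :: "'w \<Rightarrow> real^'n^'n"
  assumes st: "0 \<le> s" "s \<le> t" and Q: "Q \<in> borel_measurable (F s)" "integrable M (\<lambda>om. norm (Q om))"
  shows "integrable M (\<lambda>om. incr s t om \<bullet> (Q om *v incr s t om))"
   "(\<integral>om. incr s t om \<bullet> (Q om *v incr s t om) \<partial>M) = (t - s) * (\<integral>om. (\<Sum>i\<in>UNIV. Q om $ i $ i) \<partial>M)"
proof -
  have *: "integrable M (\<lambda>om. incr s t om \<bullet> (Q om *v incr s t om)) \<and>
   (\<integral>om. incr s t om \<bullet> (Q om *v incr s t om) \<partial>M) = (t - s) * (\<integral>om. (\<Sum>i\<in>UNIV. Q om $ i $ i) \<partial>M)" if "s < t"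
  proof -
    have v: "0 < t - s" using that by simp
    note [measurable] = Q(1) F_meas[OF Q(1)]
    have qb: "\<bar>Q om $ i $ j\<bar> \<le> norm (Q om)" for i j om
      using component_le_norm_cart[of "Q om $ i" j] Finite_Cartesian_Product.norm_nth_le[of "Q om" i] by linarith
    have Qi: "integrable M (\<lambda>om. Q om $ i $ j)" for i j
      by (rule Bochner_Integration.integrable_bound[OF Q(2)]) (auto simp: qb)
    have a: "integrable M (\<lambda>om. Q om $ i $ j * (incr s t om $ i * incr s t om $ j))" for i j
      by (rule incr_integral(1)[OF st(1) that, where f = "\<lambda>x. x $ i * x $ j"])
         (use Qi gauss_cov(1)[OF v, of i j] in auto)
    have b: "(\<integral>om. Q om $ i $ j * (incr s t om $ i * incr s t om $ j) \<partial>M) =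
       (if i = j then (t - s) * (\<integral>om. Q om $ i $ j \<partial>M) else 0)" for i j
      by (subst incr_integral(2)[OF st(1) that, where f = "\<lambda>x. x $ i * x $ j"])
         (use Qi gauss_cov[OF v, of i j] in auto)
    have eq: "incr s t om \<bullet> (Q om *v incr s t om) = (\<Sum>i\<in>UNIV. \<Sum>j\<in>UNIV. Q om $ i $ j * (incr s t om $ i * incr s t om $ j))" for om
      by (simp add: inner_vec_def matrix_vector_mult_def sum_distrib_left ac_simps)
    have "integrable M (\<lambda>om. incr s t om \<bullet> (Q om *v incr s t om))" unfolding eq using a by auto
    moreover have "(\<integral>om. incr s t om \<bullet> (Q om *v incr s t om) \<partial>M) = (\<Sum>i\<in>UNIV. \<Sum>j\<in>UNIV. if i = j then (t - s) * (\<integral>om. Q om $ i $ j \<partial>M) else 0)"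
      unfolding eq using a b by simp
    ultimately show ?thesis using Qi by (simp add: sum_distrib_left)
  qed
  then show "integrable M (\<lambda>om. incr s t om \<bullet> (Q om *v incr s t om))"
   "(\<integral>om. incr s t om \<bullet> (Q om *v incr s t om) \<partial>M) = (t - s) * (\<integral>om. (\<Sum>i\<in>UNIV. Q om $ i $ i) \<partial>M)"
    using st by (cases "s = t"; simp)+
qed

lemma incr_norm:
  fixes Z :: "'w \<Rightarrow> real"
  assumes st: "0 \<le> s" "s \<le> t" and Z: "Z \<in> borel_measurable (F s)" "integrable M Z"
  shows "integrable M (\<lambda>om. Z om * norm (incr s t om) ^ k)"
proof -
  have "integrable M (\<lambda>om. Z om * norm (incr s t om) ^ k)" if "s < t"
    by (rule incr_integral(1)[OF st(1) that Z, where f = "\<lambda>x. norm x ^ k"])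
       (use that in \<open>auto intro: integrable_gauss_norm\<close>)
  \<comment> \<open>With \<open>s = t\<close> the integrand is \<open>Z\<close> for
    \<open>k = 0\<close> and vanishes otherwise.\<close>
  moreover have "integrable M (\<lambda>om. Z om * norm (incr t t om) ^ k)"
    using Z(2) by (cases k) auto
  ultimately show ?thesis using st by (cases "s = t") auto
qed

lemma incr_norm2:
  fixes Z :: "'w \<Rightarrow> real"
  assumes st: "0 \<le> s" "s \<le> t" and Z: "Z \<in> borel_measurable (F s)" "integrable M Z"
  shows "(\<integral>om. Z om * norm (incr s t om) ^ 2 \<partial>M) = real CARD('n) * (t - s) * (\<integral>om. Z om \<partial>M)"
proof -
  note [measurable] = Z(1)
  \<comment> \<open>A multiple of the identity matrix, whose trace produces the dimension.\<close>
  define Q where "Q = (\<lambda>om. Z om *\<^sub>R (mat 1 :: real^'n^'n))"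
  have m: "Q \<in> borel_measurable (F s)" unfolding Q_def by measurable
  have i: "integrable M (\<lambda>om. norm (Q om))" unfolding Q_def using Z(2) by auto
  have "incr s t om \<bullet> (Q om *v incr s t om) = Z om * norm (incr s t om) ^ 2" for om
    by (simp add: Q_def scaleR_matrix_vector_assoc[symmetric] power2_norm_eq_inner)
  moreover have "(\<Sum>i\<in>UNIV. Q om $ i $ i) = real CARD('n) * Z om" for om
    by (simp add: Q_def mat_def)
  ultimately show ?thesis using incr_cov(2)[OF st m i] by simp
qed

lemma incr_norm4:
  fixes Z :: "'w \<Rightarrow> real"
  assumes st: "0 \<le> s" "s \<le> t" and Z: "Z \<in> borel_measurable (F s)" "integrable M Z" "\<And>om. 0 \<le> Z om"
  shows "(\<integral>om. Z om * norm (incr s t om) ^ 4 \<partial>M) \<le> 3 * real CARD('n) ^ 2 * (t - s) ^ 2 * (\<integral>om. Z om \<partial>M)"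
proof (cases "s = t")
  case False
  then have "s < t" using st by simp
  then have "(\<integral>om. Z om * norm (incr s t om) ^ 4 \<partial>M) = (\<integral>om. Z om \<partial>M) * (\<integral>x. norm x ^ 4 \<partial>(gauss (t - s) :: (real^'n) measure))"
    by (intro incr_integral(2)[OF st(1) _ Z(1,2), where f = "\<lambda>x. norm x ^ 4"])
      (auto intro: integrable_gauss_norm)
  also have "\<dots> \<le> (\<integral>om. Z om \<partial>M) * (3 * real CARD('n) ^ 2 * (t - s) ^ 2)"
    using \<open>s < t\<close> Z(3) by (intro mult_left_mono gauss_norm4) auto
  finally show ?thesis by (simp add: ac_simps)
qed simp

end

section \<open>Discrete stochastic integrals\<close>

context wiener
begin

definition grid :: "nat \<Rightarrow> (nat \<Rightarrow> real) \<Rightarrow> bool" where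
  "grid k s \<longleftrightarrow> 0 \<le> s 0 \<and> (\<forall>j<k. s j \<le> s (Suc j))"

definition adapted :: "nat \<Rightarrow> (nat \<Rightarrow> real) \<Rightarrow> (nat \<Rightarrow> 'w \<Rightarrow> real^'n^'m) \<Rightarrow> bool" where
  "adapted k s G \<longleftrightarrow> (\<forall>j<k. G j \<in> borel_measurable (F (s j)))"

text \<open>Discrete Ito sum: the integrand sits at the left end of each cell, so for adapted
  \<open>G\<close> it is independent of the increment that it multiplies.\<close>

definition mart :: "(nat \<Rightarrow> real) \<Rightarrow> (nat \<Rightarrow> 'w \<Rightarrow> real^'n^'m) \<Rightarrow> nat \<Rightarrow> 'w \<Rightarrow> real^'m" where
  "mart s G k om = (\<Sum>j<k. G j om *v incr (s j) (s (Suc j)) om)"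

lemma grid_mono:
  assumes "grid k s" "i \<le> j" "j \<le> k" shows "s i \<le> s j"
  using assms(2,3)
proof (induction j)
  case (Suc j)
  show ?case
  proof (cases "i = Suc j")
    case False
    then have "s i \<le> s j" using Suc by simp
    also have "s j \<le> s (Suc j)" using assms(1) Suc.prems(2) by (simp add: grid_def)
    finally show ?thesis .
  qed simp
qed simp

lemma grid_nonneg: "grid k s \<Longrightarrow> j \<le> k \<Longrightarrow> 0 \<le> s j"
  using grid_mono[of k s 0 j] by (auto simp: grid_def)

lemma mart_0 [simp]: "mart s G 0 om = 0" by (simp add: mart_def)

lemma mart_Suc: "mart s G (Suc k) om = mart s G k om + G k om *v incr (s k) (s (Suc k)) om"
  by (simp add: mart_def)

lemma mart_meas_F:
  assumes "grid k s" "adapted k s G" shows "mart s G k \<in> borel_measurable (F (s k))"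
proof -
  have "(\<lambda>om. G j om *v incr (s j) (s (Suc j)) om) \<in> borel_measurable (F (s k))" if "j < k" for j
  proof -
    have "s j \<le> s k" "s (Suc j) \<le> s k" using grid_mono[OF assms(1)] that by auto
    moreover have "G j \<in> borel_measurable (F (s j))" using assms(2) that by (simp add: adapted_def)
    moreover have "incr (s j) (s (Suc j)) \<in> borel_measurable (F (s (Suc j)))"
      using assms(1) that by (intro incr_adapted) (auto simp: grid_nonneg grid_def)
    ultimately show ?thesis
      by (intro measurable_matrix_vector) (auto intro: F_meas_mono)
  qed
  then show ?thesis unfolding mart_def[abs_def] by (intro borel_measurable_sum) auto
qed

lemma mart_meas:
  assumes "grid k s" "adapted k s G" shows "mart s G k \<in> borel_measurable M"
  using mart_meas_F[OF assms] F_meas by blast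

lemma grid_Suc: "grid (Suc k) s \<Longrightarrow> grid k s" by (simp add: grid_def)
lemma adapted_Suc: "adapted (Suc k) s G \<Longrightarrow> adapted k s G" by (simp add: adapted_def)

text \<open>Transposing moves \<open>G j\<close> onto \<open>Z\<close>: each summand is a vector
  known at time \<open>s j\<close> paired with the increment that follows, hence centred.\<close>

lemma mart_mean:
  fixes G :: "nat \<Rightarrow> 'w \<Rightarrow> real^'n^'m"
  assumes g: "grid k s" and G: "adapted k s G" and Z: "Z \<in> borel_measurable (F (s 0))"
    and i: "\<And>j. j < k \<Longrightarrow> integrable M (\<lambda>om. norm (G j om) * norm (Z om))"
  shows "integrable M (\<lambda>om. Z om \<bullet> mart s G k om)" "(\<integral>om. Z om \<bullet> mart s G k om \<partial>M) = 0"
proof -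
  have *: "integrable M (\<lambda>om. Z om \<bullet> (G j om *v incr (s j) (s (Suc j)) om)) \<and>
     (\<integral>om. Z om \<bullet> (G j om *v incr (s j) (s (Suc j)) om) \<partial>M) = 0" if j: "j < k" for j
  proof -
    have [measurable]: "G j \<in> borel_measurable (F (s j))" using G j by (simp add: adapted_def)
    have [measurable]: "Z \<in> borel_measurable (F (s j))"
      by (rule F_meas_mono[OF _ Z]) (use grid_mono[OF g] j in auto)
    define R where "R = (\<lambda>om. transpose (G j om) *v Z om)"
    have R: "R \<in> borel_measurable (F (s j))" unfolding R_def by measurable
    have [measurable]: "R \<in> borel_measurable M" using F_meas[OF R] .
    have ij: "integrable M (\<lambda>om. norm (R om))"
    proof (rule Bochner_Integration.integrable_bound[OF i[OF j]])
      show "AE om in M. norm (norm (R om)) \<le> norm (norm (G j om) * norm (Z om))"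
        by (intro AE_I2) (auto simp: R_def norm_transpose intro: norm_vector_matrix_mult)
    qed simp
    have eq: "Z om \<bullet> (G j om *v incr (s j) (s (Suc j)) om) = R om \<bullet> incr (s j) (s (Suc j)) om" for om
      unfolding R_def by (metis inner_commute inner_matrix_transpose)
    have "0 \<le> s j" "s j \<le> s (Suc j)" using g j grid_nonneg[OF g, of j] by (auto simp: grid_def)
    from incr_mean[OF this R ij] show ?thesis unfolding eq by simp
  qed
  show "integrable M (\<lambda>om. Z om \<bullet> mart s G k om)" "(\<integral>om. Z om \<bullet> mart s G k om \<partial>M) = 0"
    unfolding mart_def inner_sum_right using * by auto
qed

text \<open>Provides the integrability for the induction in \<open>mart_quad\<close>. The weight
  \<open>q\<close> is known at the first grid point and may have either sign, whence the absolute
  values in the dominating function.\<close>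

lemma mart_int2:
  fixes G :: "nat \<Rightarrow> 'w \<Rightarrow> real^'n^'m" and q :: "'w \<Rightarrow> real"
  assumes "grid k s" "adapted k s G" and q: "q \<in> borel_measurable (F (s 0))"
    and "\<And>j. j < k \<Longrightarrow> integrable M (\<lambda>om. q om * norm (G j om) ^ 2)"
  shows "integrable M (\<lambda>om. q om * norm (mart s G k om) ^ 2)"
  using assms(1,2,4)
proof (induction k)
  case (Suc k)
  have g: "grid k s" "adapted k s G" using Suc.prems grid_Suc adapted_Suc by auto
  have IH: "integrable M (\<lambda>om. q om * norm (mart s G k om) ^ 2)"
    using Suc.IH[OF g] Suc.prems(3) by auto
  have q': "q \<in> borel_measurable (F (s k))"
    by (rule F_meas_mono[OF _ q]) (use grid_mono[OF g(1)] in auto)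
  have Gk: "G k \<in> borel_measurable (F (s k))" using Suc.prems(2) by (simp add: adapted_def)
  note [measurable] = mart_meas[OF Suc.prems(1,2)] mart_meas[OF g] F_meas[OF q] F_meas[OF q'] F_meas[OF Gk] q' Gk
  have sk: "0 \<le> s k" "s k \<le> s (Suc k)" using grid_nonneg[OF g(1), of k] Suc.prems(1) by (auto simp: grid_def)
  have I2: "integrable M (\<lambda>om. (q om * norm (G k om) ^ 2) * norm (incr (s k) (s (Suc k)) om) ^ 2)"
    using Suc.prems(3)[of k] by (intro incr_norm sk) auto
  show ?case
  proof (rule Bochner_Integration.integrable_bound)
    show "integrable M (\<lambda>om. 2 * \<bar>q om * norm (mart s G k om) ^ 2\<bar> + 2 * \<bar>(q om * norm (G k om) ^ 2) * norm (incr (s k) (s (Suc k)) om) ^ 2\<bar>)"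
      using IH I2 by auto
    show "AE om in M. norm (q om * norm (mart s G (Suc k) om) ^ 2) \<le> norm (2 * \<bar>q om * norm (mart s G k om) ^ 2\<bar> + 2 * \<bar>(q om * norm (G k om) ^ 2) * norm (incr (s k) (s (Suc k)) om) ^ 2\<bar>)"
    proof (rule AE_I2)
      fix om
      define a b where "a = norm (mart s G k om)" and "b = norm (G k om) * norm (incr (s k) (s (Suc k)) om)"
      have "norm (mart s G (Suc k) om) \<le> a + b"
        unfolding mart_Suc a_def b_def by (intro norm_triangle_le add_mono norm_matrix_vector_mult) simp
      then have "norm (mart s G (Suc k) om) ^ 2 \<le> (a + b)^2" by (intro power_mono) auto
      also have "\<dots> \<le> 2 * a^2 + 2 * b^2" using sum_squares_bound[of a b] by (simp add: power2_sum)
      finally have "\<bar>q om\<bar> * norm (mart s G (Suc k) om) ^ 2 \<le> \<bar>q om\<bar> * (2 * a^2 + 2 * b^2)"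
        by (intro mult_left_mono) auto
      then show "norm (q om * norm (mart s G (Suc k) om) ^ 2) \<le> norm (2 * \<bar>q om * norm (mart s G k om) ^ 2\<bar> + 2 * \<bar>(q om * norm (G k om) ^ 2) * norm (incr (s k) (s (Suc k)) om) ^ 2\<bar>)"
        by (simp add: abs_mult a_def b_def power_mult_distrib algebra_simps)
    qed
  qed simp
qed simp

text \<open>Ito isometry for a quadratic form known at the start of the grid. Adding one increment
  \<open>x\<close> with coefficient \<open>A\<close> produces cross terms linear in
  \<open>x\<close>, which are centred, and the form \<open>transpose A ** (Q ** A)\<close> in
  \<open>x\<close>, whose trace is the sum over the columns of \<open>A\<close>.\<close>

lemma mart_quad:
  fixes G :: "nat \<Rightarrow> 'w \<Rightarrow> real^'n^'m" and Q :: "'w \<Rightarrow> real^'m^'m"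
  assumes "grid k s" "adapted k s G" and Q: "Q \<in> borel_measurable (F (s 0))"
    and "\<And>j. j < k \<Longrightarrow> integrable M (\<lambda>om. norm (Q om) * norm (G j om) ^ 2)"
  shows "integrable M (\<lambda>om. mart s G k om \<bullet> (Q om *v mart s G k om)) \<and>
    (\<integral>om. mart s G k om \<bullet> (Q om *v mart s G k om) \<partial>M) =
    (\<Sum>j<k. (s (Suc j) - s j) * (\<integral>om. (\<Sum>i\<in>UNIV. column i (G j om) \<bullet> (Q om *v column i (G j om))) \<partial>M))"
  using assms(1,2,4)
proof (induction k)
  case (Suc k)
  have g: "grid k s" "adapted k s G" using Suc.prems grid_Suc adapted_Suc by auto
  note IH = Suc.IH[OF g Suc.prems(3)[OF less_SucI]]
  have Q': "Q \<in> borel_measurable (F (s k))"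
    by (rule F_meas_mono[OF _ Q]) (use grid_mono[OF g(1)] in auto)
  have Gk: "G k \<in> borel_measurable (F (s k))" using Suc.prems(2) by (simp add: adapted_def)
  have nQ: "(\<lambda>om. norm (Q om)) \<in> borel_measurable (F (s 0))" using Q by measurable
  note [measurable] = mart_meas[OF Suc.prems(1,2)] mart_meas[OF g] F_meas[OF Q] F_meas[OF Q'] F_meas[OF Gk] Q' Gk mart_meas_F[OF g]
  have sk: "0 \<le> s k" "s k \<le> s (Suc k)" using grid_nonneg[OF g(1), of k] Suc.prems(1) by (auto simp: grid_def)
  have iS: "integrable M (\<lambda>om. norm (Q om) * norm (mart s G k om) ^ 2)"
    by (rule mart_int2[OF g nQ]) (use Suc.prems(3) in auto)
  have iG: "integrable M (\<lambda>om. norm (Q om) * norm (G k om) ^ 2)" using Suc.prems(3) by auto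
  \<comment> \<open>\<open>R1\<close> collects the two cross terms, which differ because
    \<open>Q\<close> is an arbitrary matrix; \<open>R2\<close> below is the form induced on the
    increment.\<close>
  define R1 where "R1 = (\<lambda>om. transpose (G k om) *v (Q om *v mart s G k om) + transpose (G k om) *v (transpose (Q om) *v mart s G k om))"
  define R2 where "R2 = (\<lambda>om. transpose (G k om) ** (Q om ** G k om))"
  have R1: "R1 \<in> borel_measurable (F (s k))" unfolding R1_def by measurable
  have R2e: "R2 om $ i $ j = column i (G k om) \<bullet> (Q om *v column j (G k om))" for om i j
    by (simp add: R2_def matrix_matrix_mult_def transpose_def column_def inner_vec_def matrix_vector_mult_def)
  have "(\<lambda>om. column i (G k om)) \<in> borel_measurable (F (s k))" for i
  proof -
    have "column i (G k om) = G k om *v axis i 1" for om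
      by (simp add: matrix_vector_mult_basis)
    then show ?thesis by simp
  qed
  note [measurable] = this
  have R2: "R2 \<in> borel_measurable (F (s k))"
    by (intro measurable_vecI) (simp add: R2e)
  note [measurable] = F_meas[OF R1] F_meas[OF R2]
  have nR1: "norm (R1 om) \<le> norm (Q om) * norm (mart s G k om) ^ 2 + norm (Q om) * norm (G k om) ^ 2" for om
  proof -
    have "norm (R1 om) \<le> norm (G k om) * (norm (Q om) * norm (mart s G k om)) + norm (G k om) * (norm (Q om) * norm (mart s G k om))"
      unfolding R1_def
      by (intro norm_triangle_le add_mono order_trans[OF norm_matrix_vector_mult])
         (auto simp: norm_transpose intro!: mult_left_mono norm_matrix_vector_mult norm_vector_matrix_mult)
    also have "\<dots> = norm (Q om) * (2 * norm (mart s G k om) * norm (G k om))" by simp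
    also have "\<dots> \<le> norm (Q om) * (norm (mart s G k om) ^ 2 + norm (G k om) ^ 2)"
      by (intro mult_left_mono sum_squares_bound) auto
    finally show ?thesis by (simp add: algebra_simps)
  qed
  have iR1: "integrable M (\<lambda>om. norm (R1 om))"
    by (rule Bochner_Integration.integrable_bound[OF Bochner_Integration.integrable_add[OF iS iG]]) (use nR1 in \<open>auto intro!: AE_I2 order_trans[OF nR1]\<close>)
  have nc: "norm (column i A) \<le> norm A" for A :: "real^'n^'m" and i
    using norm_matrix_vector_mult[of A "axis i 1"] by (simp add: matrix_vector_mult_basis)
  have nR2c: "\<bar>R2 om $ i $ j\<bar> \<le> norm (Q om) * norm (G k om) ^ 2" for om i j
  proof -
    have "\<bar>R2 om $ i $ j\<bar> \<le> norm (column i (G k om)) * (norm (Q om) * norm (column j (G k om)))"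
      unfolding R2e by (intro order_trans[OF Cauchy_Schwarz_ineq2] mult_left_mono norm_matrix_vector_mult) auto
    also have "\<dots> \<le> norm (G k om) * (norm (Q om) * norm (G k om))"
      by (intro mult_mono nc) auto
    finally show ?thesis by (simp add: power2_eq_square ac_simps)
  qed
  have nR2: "norm (R2 om) \<le> real CARD('n) ^ 2 * (norm (Q om) * norm (G k om) ^ 2)" for om
  proof -
    have "norm (R2 om) \<le> (\<Sum>i\<in>UNIV. norm (R2 om $ i))" unfolding norm_vec_def by (rule L2_set_le_sum) auto
    also have "\<dots> \<le> (\<Sum>i\<in>UNIV. \<Sum>j\<in>UNIV. \<bar>R2 om $ i $ j\<bar>)" by (intro sum_mono norm_le_l1_cart)
    also have "\<dots> \<le> (\<Sum>i\<in>(UNIV::'n set). \<Sum>j\<in>(UNIV::'n set). norm (Q om) * norm (G k om) ^ 2)" by (intro sum_mono nR2c)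
    finally show ?thesis by (simp add: power2_eq_square ac_simps)
  qed
  have iR2: "integrable M (\<lambda>om. norm (R2 om))"
    by (rule Bochner_Integration.integrable_bound[OF integrable_mult_right[OF iG, of "real CARD('n) ^ 2"]]) (use nR2 in \<open>auto intro!: AE_I2\<close>)
  note A = incr_mean[OF sk R1 iR1] and C = incr_cov[OF sk R2 iR2]
  have eq: "mart s G (Suc k) om \<bullet> (Q om *v mart s G (Suc k) om) = mart s G k om \<bullet> (Q om *v mart s G k om)
     + R1 om \<bullet> incr (s k) (s (Suc k)) om + incr (s k) (s (Suc k)) om \<bullet> (R2 om *v incr (s k) (s (Suc k)) om)" for om
  proof -
    define x S A where "x = incr (s k) (s (Suc k)) om" and "S = mart s G k om" and "A = G k om"
    have "(A *v x) \<bullet> (Q om *v S) = (transpose A *v (Q om *v S)) \<bullet> x"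
      by (metis inner_commute inner_matrix_transpose)
    moreover have "S \<bullet> (Q om *v (A *v x)) = (transpose A *v (transpose (Q om) *v S)) \<bullet> x"
      by (metis inner_commute inner_matrix_transpose)
    moreover have "(A *v x) \<bullet> (Q om *v (A *v x)) = x \<bullet> ((transpose A ** (Q om ** A)) *v x)"
      by (simp add: inner_matrix_transpose matrix_vector_mul_assoc)
    ultimately show ?thesis unfolding mart_Suc x_def[symmetric] S_def[symmetric] A_def[symmetric] R1_def R2_def
      by (simp add: matrix_vector_right_distrib inner_add_left inner_add_right)
  qed
  show ?case unfolding eq using A C IH by (simp add: R2e)
qed simp

text \<open>The term linear in \<open>y\<close> keeps its exact coefficient, because its mean is
  evaluated separately in the applications; the other mixed terms go into even powers by Young's
  inequality. The count is \<open>8 = 4 + 2 + 2\<close> for the mixed squares and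
  \<open>3 = 1 + 2\<close> for the fourth power of \<open>y\<close>.\<close>

lemma norm_add_pow4:
  fixes x y :: "'a::real_inner"
  shows "norm (x + y) ^ 4 \<le> norm x ^ 4 + 4 * ((norm x)^2 * (x \<bullet> y)) + 8 * ((norm x)^2 * (norm y)^2) + 3 * norm y ^ 4"
proof -
  define a b c where "a = norm x" and "b = norm y" and "c = x \<bullet> y"
  have c: "\<bar>c\<bar> \<le> a * b" unfolding a_def b_def c_def by (rule Cauchy_Schwarz_ineq2)
  have "norm (x + y) ^ 4 = ((norm (x + y))^2)^2" by simp
  also have "(norm (x + y))^2 = a^2 + 2 * c + b^2"
    unfolding a_def b_def c_def by (simp add: power2_norm_eq_inner inner_add_left inner_add_right inner_commute)
  also have "(a^2 + 2 * c + b^2)^2 = a^4 + 4 * (a^2 * c) + 4 * c^2 + 2 * a^2 * b^2 + 4 * c * b^2 + b^4"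
    by (simp add: power2_eq_square power4_eq_xxxx algebra_simps)
  also have "\<dots> \<le> a^4 + 4 * (a^2 * c) + 8 * (a^2 * b^2) + 3 * b^4"
  proof -
    have 1: "c^2 \<le> (a * b)^2" using c by (metis abs_ge_zero power2_abs power_mono)
    have "c * b^2 \<le> a * b * b^2" using c by (intro mult_right_mono) auto
    also have "\<dots> = (a * b) * (b * b)" by (simp add: power2_eq_square)
    also have "2 * ((a * b) * (b * b)) \<le> (a * b)^2 + (b * b)^2" using sum_squares_bound[of "a * b" "b * b"] by simp
    finally have 2: "2 * (c * b^2) \<le> a^2 * b^2 + b^4" by (simp add: power_mult_distrib power2_eq_square power4_eq_xxxx ac_simps)
    show ?thesis using 1 2 by (simp add: power_mult_distrib)
  qed
  finally show ?thesis unfolding a_def b_def c_def .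
qed

text \<open>The cruder variant, for sums in which no cancellation is exploited.\<close>

lemma norm_add_pow4_le:
  fixes x y :: "'a::real_normed_vector"
  shows "norm (x + y) ^ 4 \<le> 8 * norm x ^ 4 + 8 * norm y ^ 4"
proof -
  have "norm (x + y) ^ 4 \<le> (norm x + norm y) ^ 4" by (intro power_mono norm_triangle_ineq) auto
  also have "\<dots> = ((norm x + norm y)^2)^2" by simp
  also have "\<dots> \<le> (2 * ((norm x)^2 + (norm y)^2))^2"
    using sum_squares_bound[of "norm x" "norm y"] by (intro power_mono) (auto simp: power2_sum)
  also have "\<dots> = 4 * ((norm x)^2 + (norm y)^2)^2" by (simp only: power_mult_distrib) simp
  also have "\<dots> \<le> 4 * (2 * ((norm x)^4 + (norm y)^4))"
    using sum_squares_bound[of "(norm x)^2" "(norm y)^2"] by (intro mult_left_mono) (auto simp: power2_sum)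
  finally show ?thesis by simp
qed

text \<open>Constant of a fourth moment bound of Burkholder-Davis-Gundy type. In
  \<open>mart_pow4\<close>, \<open>13 = 4 + 9\<close> adds the contributions of the mixed and of the
  pure increment terms, and the exponential bounds a discrete Gronwall factor.\<close>

definition (in -) bdg :: "nat \<Rightarrow> real" where "bdg d = 13 * real d ^ 2 * exp (4 * real d)"

text \<open>By \<open>norm_add_pow4\<close> the fourth moments \<open>a k\<close> of the partial
  sums satisfy \<open>a (k + 1) \<le> r * a k + c\<close> with \<open>r = 1 + 4 * d * D / T\<close>,
  where \<open>d\<close> is the dimension of the noise. As \<open>m * D = T\<close>, the accumulated
  factor \<open>r ^ m\<close> is bounded independently of the mesh, so the estimate survives
  refinement.\<close>

lemma mart_pow4:
  fixes G :: "nat \<Rightarrow> 'w \<Rightarrow> real^'n^'m"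
  assumes g: "grid m s" and D: "0 < D" "\<And>j. j < m \<Longrightarrow> s (Suc j) - s j = D" and T: "T = real m * D"
    and G: "adapted m s G" and K: "0 \<le> K" "\<And>j. j < m \<Longrightarrow> integrable M (\<lambda>om. norm (G j om) ^ 4)"
     "\<And>j. j < m \<Longrightarrow> (\<integral>om. norm (G j om) ^ 4 \<partial>M) \<le> K"
    and k: "k \<le> m"
  shows "integrable M (\<lambda>om. norm (mart s G k om) ^ 4) \<and>
    (\<integral>om. norm (mart s G k om) ^ 4 \<partial>M) \<le> bdg CARD('n) * T ^ 2 * K"
proof -
  let ?d = "real CARD('n)"
  have d1: "1 \<le> ?d" by (simp add: Suc_leI)
  have T0: "0 \<le> T" using T D by simp
  have main: "integrable M (\<lambda>om. norm (mart s G k om) ^ 4) \<and>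
    (\<integral>om. norm (mart s G k om) ^ 4 \<partial>M) \<le> real k * (13 * ?d ^ 2 * D * T * K) * (1 + 4 * ?d * D / T) ^ k"
    using k
  proof (induction k)
    case (Suc k)
    have km: "k < m" using Suc.prems by simp
    have gk: "grid k s" "adapted k s G" using g G km by (auto simp: grid_def adapted_def)
    define c where "c = 13 * ?d ^ 2 * D * T * K"
    define r where "r = 1 + 4 * ?d * D / T"
    have Tpos: "0 < T" using T D km by simp
    have r1: "1 \<le> r" unfolding r_def using Tpos D d1 by simp
    have c0: "0 \<le> c" unfolding c_def using K D T0 by simp
    have DT: "D \<le> T" using T D km by (simp add: mult_le_cancel_right1)
    have IHi: "integrable M (\<lambda>om. norm (mart s G k om) ^ 4)"
      and IHb: "(\<integral>om. norm (mart s G k om) ^ 4 \<partial>M) \<le> real k * c * r ^ k"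
      using Suc by (auto simp: c_def r_def)
    have Gk: "G k \<in> borel_measurable (F (s k))" using G km by (simp add: adapted_def)
    have Sk: "mart s G k \<in> borel_measurable (F (s k))" by (rule mart_meas_F[OF gk])
    have sk: "0 \<le> s k" "s k \<le> s (Suc k)" "s (Suc k) - s k = D"
      using grid_nonneg[OF g, of k] km D by (auto simp: D(2)) (smt (verit, best) D)
    note [measurable] = Gk Sk F_meas[OF Gk] F_meas[OF Sk]
    have Ig4: "integrable M (\<lambda>om. norm (G k om) ^ 4)" and Ib4: "(\<integral>om. norm (G k om) ^ 4 \<partial>M) \<le> K"
      using K km by auto
    define x where "x = incr (s k) (s (Suc k))"
    have [measurable]: "x \<in> borel_measurable M" unfolding x_def using sk by (intro incr_meas) auto
    \<comment> \<open>Young's inequality with weight \<open>T\<close>: what is charged to the fourth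
      moment of the sum has the coefficient \<open>1 / (2 * T)\<close>, which makes
      \<open>r - 1\<close> proportional to \<open>D / T\<close>.\<close>
    have SG: "(norm (mart s G k om))^2 * (norm (G k om))^2 \<le> norm (mart s G k om) ^ 4 / (2 * T) + T * norm (G k om) ^ 4 / 2" (is "?a * ?b \<le> _")
      for om
    proof -
      have "2 * (?a / sqrt T) * (?b * sqrt T) \<le> (?a / sqrt T)^2 + (?b * sqrt T)^2" by (rule sum_squares_bound)
      then show ?thesis using Tpos by (simp add: power_divide power_mult_distrib field_simps)
    qed
    have iSG: "integrable M (\<lambda>om. (norm (mart s G k om))^2 * (norm (G k om))^2)"
    proof (rule Bochner_Integration.integrable_bound)
      show "integrable M (\<lambda>om. norm (mart s G k om) ^ 4 / (2 * T) + T * norm (G k om) ^ 4 / 2)"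
        using IHi Ig4 by auto
      show "AE om in M. norm ((norm (mart s G k om))^2 * (norm (G k om))^2) \<le> norm (norm (mart s G k om) ^ 4 / (2 * T) + T * norm (G k om) ^ 4 / 2)"
        using SG Tpos by (intro AE_I2) (simp add: order_trans[OF SG] abs_of_nonneg)
    qed measurable
    \<comment> \<open>The cubic cross term is this vector, known at time \<open>s k\<close>, paired
      with the increment; it is centred once its integrability is derived from the fourth
      moments.\<close>
    define R where "R = (\<lambda>om. (norm (mart s G k om))^2 *\<^sub>R (transpose (G k om) *v mart s G k om))"
    have R: "R \<in> borel_measurable (F (s k))" unfolding R_def by measurable
    note [measurable] = F_meas[OF R]
    have iR: "integrable M (\<lambda>om. norm (R om))"
    proof (rule Bochner_Integration.integrable_bound)
      show "integrable M (\<lambda>om. norm (mart s G k om) ^ 4 + (norm (mart s G k om))^2 * (norm (G k om))^2)" using IHi iSG by auto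
      show "AE om in M. norm (norm (R om)) \<le> norm (norm (mart s G k om) ^ 4 + (norm (mart s G k om))^2 * (norm (G k om))^2)"
      proof (rule AE_I2)
        fix om
        define a b where "a = norm (mart s G k om)" and "b = norm (G k om)"
        have "norm (R om) \<le> a^2 * (b * a)"
          unfolding R_def a_def b_def by (auto intro!: mult_left_mono norm_vector_matrix_mult)
        also have "\<dots> \<le> a^2 * (a^2 + b^2)"
        proof (intro mult_left_mono)
          have "0 \<le> b * a" by (simp add: a_def b_def)
          then show "b * a \<le> a^2 + b^2" using sum_squares_bound[of b a] by linarith
        qed simp
        finally show "norm (norm (R om)) \<le> norm (norm (mart s G k om) ^ 4 + (norm (mart s G k om))^2 * (norm (G k om))^2)"
          by (simp add: a_def b_def algebra_simps power2_eq_square power4_eq_xxxx)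
      qed
    qed measurable
    have cross: "integrable M (\<lambda>om. (norm (mart s G k om))^2 * (mart s G k om \<bullet> (G k om *v x om)))"
       "(\<integral>om. (norm (mart s G k om))^2 * (mart s G k om \<bullet> (G k om *v x om)) \<partial>M) = 0"
    proof -
      have "(norm (mart s G k om))^2 * (mart s G k om \<bullet> (G k om *v x om)) = R om \<bullet> x om" for om
        unfolding R_def by (metis inner_commute inner_matrix_transpose inner_scaleR_right)
      then show "integrable M (\<lambda>om. (norm (mart s G k om))^2 * (mart s G k om \<bullet> (G k om *v x om)))"
       "(\<integral>om. (norm (mart s G k om))^2 * (mart s G k om \<bullet> (G k om *v x om)) \<partial>M) = 0"
        using incr_mean[OF sk(1,2) R iR] by (auto simp: x_def)
    qed
    have m2: "(\<lambda>om. (norm (mart s G k om))^2 * (norm (G k om))^2) \<in> borel_measurable (F (s k))"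
      and m4: "(\<lambda>om. norm (G k om) ^ 4) \<in> borel_measurable (F (s k))" by measurable
    note i2 = incr_norm[OF sk(1,2) m2 iSG, of 2, folded x_def] and e2 = incr_norm2[OF sk(1,2) m2 iSG, folded x_def]
    note i4 = incr_norm[OF sk(1,2) m4 Ig4, of 4, folded x_def] and e4 = incr_norm4[OF sk(1,2) m4 Ig4, folded x_def]
    define U where "U = (\<lambda>om. norm (mart s G k om) ^ 4 + 4 * ((norm (mart s G k om))^2 * (mart s G k om \<bullet> (G k om *v x om)))
        + 8 * ((norm (mart s G k om))^2 * (norm (G k om))^2 * (norm (x om))^2) + 3 * (norm (G k om) ^ 4 * norm (x om) ^ 4))"
    have ub: "norm (mart s G (Suc k) om) ^ 4 \<le> U om" for om
    proof -
      have n: "norm (G k om *v x om) \<le> norm (G k om) * norm (x om)" by (rule norm_matrix_vector_mult)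
      have "norm (mart s G (Suc k) om) ^ 4 \<le> norm (mart s G k om) ^ 4 + 4 * ((norm (mart s G k om))^2 * (mart s G k om \<bullet> (G k om *v x om)))
        + 8 * ((norm (mart s G k om))^2 * (norm (G k om *v x om))^2) + 3 * norm (G k om *v x om) ^ 4"
        unfolding mart_Suc x_def by (rule norm_add_pow4)
      also have "\<dots> \<le> norm (mart s G k om) ^ 4 + 4 * ((norm (mart s G k om))^2 * (mart s G k om \<bullet> (G k om *v x om)))
        + 8 * ((norm (mart s G k om))^2 * (norm (G k om) * norm (x om))^2) + 3 * (norm (G k om) * norm (x om)) ^ 4"
        by (intro add_mono mult_left_mono power_mono n) auto
      finally show ?thesis by (simp add: U_def power_mult_distrib ac_simps)
    qed
    have iU: "integrable M U" unfolding U_def using IHi cross(1) i2 i4 by auto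
    have gS: "grid (Suc k) s" "adapted (Suc k) s G" using g G km by (auto simp: grid_def adapted_def)
    note [measurable] = mart_meas[OF gS]
    have i: "integrable M (\<lambda>om. norm (mart s G (Suc k) om) ^ 4)"
      by (rule Bochner_Integration.integrable_bound[OF iU]) (auto intro!: AE_I2 order_trans[OF ub])
    have "(\<integral>om. norm (mart s G (Suc k) om) ^ 4 \<partial>M) \<le> (\<integral>om. U om \<partial>M)"
      by (rule integral_mono[OF i iU]) (rule ub)
    also have "\<dots> = (\<integral>om. norm (mart s G k om) ^ 4 \<partial>M) + 8 * (\<integral>om. (norm (mart s G k om))^2 * (norm (G k om))^2 * (norm (x om))^2 \<partial>M)
      + 3 * (\<integral>om. norm (G k om) ^ 4 * norm (x om) ^ 4 \<partial>M)"
      unfolding U_def using IHi cross i2 i4 by simp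
    also have "\<dots> \<le> (\<integral>om. norm (mart s G k om) ^ 4 \<partial>M) + 8 * (?d * D * ((\<integral>om. norm (mart s G k om) ^ 4 \<partial>M) / (2 * T) + T * K / 2))
      + 3 * (3 * ?d ^ 2 * D ^ 2 * K)"
    proof (intro add_mono mult_left_mono order_refl)
      have "(\<integral>om. (norm (mart s G k om))^2 * (norm (G k om))^2 \<partial>M) \<le> (\<integral>om. norm (mart s G k om) ^ 4 / (2 * T) + T * norm (G k om) ^ 4 / 2 \<partial>M)"
        using IHi Ig4 by (intro integral_mono iSG SG) auto
      also have "\<dots> = (\<integral>om. norm (mart s G k om) ^ 4 \<partial>M) / (2 * T) + T * (\<integral>om. norm (G k om) ^ 4 \<partial>M) / 2"
        using IHi Ig4 by simp
      also have "\<dots> \<le> (\<integral>om. norm (mart s G k om) ^ 4 \<partial>M) / (2 * T) + T * K / 2"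
        using Ib4 Tpos by (simp add: divide_right_mono)
      finally show "(\<integral>om. (norm (mart s G k om))^2 * (norm (G k om))^2 * (norm (x om))^2 \<partial>M)
         \<le> ?d * D * ((\<integral>om. norm (mart s G k om) ^ 4 \<partial>M) / (2 * T) + T * K / 2)"
        unfolding e2 sk(3) using D by (intro mult_left_mono) auto
      have "(\<integral>om. norm (G k om) ^ 4 * norm (x om) ^ 4 \<partial>M) \<le> 3 * ?d^2 * D^2 * (\<integral>om. norm (G k om) ^ 4 \<partial>M)"
        using e4 unfolding sk(3) by simp
      also have "\<dots> \<le> 3 * ?d^2 * D^2 * K" using Ib4 by (intro mult_left_mono) auto
      finally show "(\<integral>om. norm (G k om) ^ 4 * norm (x om) ^ 4 \<partial>M) \<le> 3 * ?d^2 * D^2 * K" .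
    qed auto
    also have "\<dots> = r * (\<integral>om. norm (mart s G k om) ^ 4 \<partial>M) + (4 * ?d * (D * T * K) + 9 * ?d ^ 2 * (D * D * K))"
      unfolding r_def using Tpos by (simp add: field_simps power2_eq_square)
    also have "\<dots> \<le> r * (\<integral>om. norm (mart s G k om) ^ 4 \<partial>M) + c"
    proof -
      have "?d * (D * T * K) \<le> ?d ^ 2 * (D * T * K)" using d1 D T0 K by (intro mult_right_mono) (auto simp: power2_eq_square)
      moreover have "?d ^ 2 * (D * D * K) \<le> ?d ^ 2 * (D * T * K)" using DT D K by (intro mult_left_mono mult_right_mono) auto
      ultimately show ?thesis unfolding c_def by (simp add: algebra_simps)
    qed
    also have "\<dots> \<le> r * (real k * c * r ^ k) + c * r ^ Suc k"
      using IHb r1 c0 mult_left_mono[of 1 "r ^ Suc k" c] by (intro add_mono mult_left_mono) (auto simp: one_le_power simp del: power_Suc)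
    also have "\<dots> = real (Suc k) * c * r ^ Suc k" by (simp add: algebra_simps)
    finally show ?case using i by (simp add: c_def r_def)
  qed (use K D T0 in simp)
  show ?thesis
  proof (intro conjI main[THEN conjunct1] order_trans[OF main[THEN conjunct2]])
    show "real k * (13 * ?d^2 * D * T * K) * (1 + 4 * ?d * D / T) ^ k \<le> bdg CARD('n) * T^2 * K"
    proof (cases "k = 0")
      case False
      then have m: "0 < m" using k by simp
      then have Tp: "0 < T" using T D by simp
      have e: "4 * ?d * D / T = 4 * ?d / real m" using T m D by (simp add: field_simps)
      have "(1 + 4 * ?d / real m) ^ k \<le> (1 + 4 * ?d / real m) ^ m" using k by (intro power_increasing) auto
      also have "\<dots> \<le> exp (4 * ?d / real m) ^ m" by (intro power_mono exp_ge_add_one_self) auto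
      also have "\<dots> = exp (4 * ?d)" using m by (simp add: exp_of_nat_mult[symmetric])
      finally have 1: "(1 + 4 * ?d * D / T) ^ k \<le> exp (4 * ?d)" unfolding e .
      have "real k * D \<le> T" using k D T by (simp add: mult_right_mono)
      then have "13 * ?d^2 * T * K * (real k * D) \<le> 13 * ?d^2 * T * K * T"
        using T0 K by (intro mult_left_mono) auto
      then have 2: "real k * (13 * ?d^2 * D * T * K) \<le> 13 * ?d^2 * T^2 * K" by (simp add: power2_eq_square ac_simps)
      have "real k * (13 * ?d^2 * D * T * K) * (1 + 4 * ?d * D / T) ^ k \<le> (13 * ?d^2 * T^2 * K) * exp (4 * ?d)"
        by (rule mult_mono[OF 2 1]) (use K(1) D(1) Tp in auto)
      then show ?thesis by (simp add: bdg_def ac_simps)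
    qed (use K T0 in \<open>simp add: bdg_def\<close>)
  qed
qed

text \<open>Lenglart's inequality. The integrand is switched off where the accumulated quadratic
  variation would exceed \<open>d\<close>. The switched sum has second moment at most
  \<open>d\<close>, which bounds its tail by Markov's inequality, and it agrees with the original
  sum wherever the total variation stays at most \<open>d\<close>. This admits integrands
  \<open>G\<close> without moments.\<close>

lemma mart_lenglart:
  fixes G :: "nat \<Rightarrow> 'w \<Rightarrow> real^'n^'m"
  assumes g: "grid k s" and G: "adapted k s G" and e: "0 < e" and d: "0 < d"
  shows "prob {om \<in> space M. norm (mart s G k om) > e} \<le>
    prob {om \<in> space M. (\<Sum>j<k. (s (Suc j) - s j) * (norm (G j om))^2) > d} + d / e^2"
proof -
  define q where "q = (\<lambda>j om. \<Sum>i<j. (s (Suc i) - s i) * (norm (G i om))^2)"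
  \<comment> \<open>\<open>q (Suc j)\<close> already includes the cell \<open>j\<close>. It is known
    at time \<open>s j\<close>, so the switched integrand stays adapted, and the level
    \<open>d\<close> is never overshot.\<close>
  define H where "H = (\<lambda>j om. if q (Suc j) om \<le> d then G j om else 0)"
  have Gj: "G i \<in> borel_measurable (F (s j))" if "i \<le> j" "j < k" for i j
    using G that grid_mono[OF g, of i j] F_meas_mono[of "s i" "s j" "G i"] by (auto simp: adapted_def)
  have qm: "q j \<in> borel_measurable (F (s i))" if "j \<le> Suc i" "i < k" for i j
  proof -
    have "(\<lambda>om. (s (Suc l) - s l) * (norm (G l om))^2) \<in> borel_measurable (F (s i))" if "l < j" for l
    proof -
      have [measurable]: "G l \<in> borel_measurable (F (s i))"
        using \<open>j \<le> Suc i\<close> \<open>i < k\<close> that by (intro Gj) auto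
      show ?thesis by measurable
    qed
    then show ?thesis unfolding q_def by (intro borel_measurable_sum) auto
  qed
  have H: "adapted k s H"
    unfolding adapted_def
  proof (intro allI impI)
    fix j assume j: "j < k"
    note [measurable] = qm[of "Suc j" j, OF order_refl j] Gj[of j j, OF order_refl j]
    show "H j \<in> borel_measurable (F (s j))" unfolding H_def by measurable
  qed
  have pos: "0 \<le> s (Suc i) - s i" if "i < k" for i using g that by (auto simp: grid_def)
  have qmono: "q i om \<le> q j om" if "i \<le> j" "j \<le> k" for i j om
    unfolding q_def using that pos by (intro sum_mono2) auto
  \<comment> \<open>A cell either keeps the accumulated variation below \<open>d\<close> or
    contributes nothing.\<close>
  have bound: "(\<Sum>i<j. (s (Suc i) - s i) * (norm (H i om))^2) \<le> d \<and> (\<Sum>i<j. (s (Suc i) - s i) * (norm (H i om))^2) \<le> q j om" if "j \<le> k" for j om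
    using that
  proof (induction j)
    case (Suc j)
    then have j: "j < k" by simp
    show ?case
    proof (cases "q (Suc j) om \<le> d")
      case True
      then have "(\<Sum>i<Suc j. (s (Suc i) - s i) * (norm (H i om))^2) \<le> q (Suc j) om"
        using Suc by (simp add: H_def q_def)
      then show ?thesis using True by simp
    next
      case False
      then show ?thesis using Suc qmono[of j "Suc j" om] by (simp add: H_def)
    qed
  qed (use d in \<open>simp add: q_def\<close>)
  have Hm: "H j \<in> borel_measurable M" if "j < k" for j using H that F_meas by (auto simp: adapted_def)
  have Dint: "integrable M (\<lambda>om. (s (Suc j) - s j) * (norm (H j om))^2)" if j: "j < k" for j
  proof (rule integrable_const_bound[where B = d])
    show "AE om in M. norm ((s (Suc j) - s j) * (norm (H j om))^2) \<le> d"
    proof (rule AE_I2)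
      fix om
      have "(s (Suc j) - s j) * (norm (H j om))^2 \<le> (\<Sum>i<k. (s (Suc i) - s i) * (norm (H i om))^2)"
        using pos j by (intro member_le_sum) auto
      also have "\<dots> \<le> d" using bound[of k] by simp
      finally show "norm ((s (Suc j) - s j) * (norm (H j om))^2) \<le> d" using pos[OF j] by simp
    qed
    show "(\<lambda>om. (s (Suc j) - s j) * (norm (H j om))^2) \<in> borel_measurable M"
      using Hm[OF j] by measurable
  qed
  \<comment> \<open>On a cell of length zero the bound on the quadratic variation says nothing about
    \<open>H j\<close>. Replacing it by zero there leaves the sum unchanged and makes every
    coefficient square integrable.\<close>
  define H' where "H' = (\<lambda>j. if s (Suc j) = s j then (\<lambda>om. 0) else H j)"
  have H': "adapted k s H'" using H by (auto simp: H'_def adapted_def)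
  have meq: "mart s H k om = mart s H' k om" for om
    unfolding mart_def H'_def by (intro sum.cong) auto
  have i2: "integrable M (\<lambda>om. (norm (H' j om))^2)" if j: "j < k" for j
  proof (cases "s (Suc j) = s j")
    case False
    then have "integrable M (\<lambda>om. inverse (s (Suc j) - s j) * ((s (Suc j) - s j) * (norm (H j om))^2))"
      using Dint[OF j] by (intro integrable_mult_right) auto
    then show ?thesis using False by (simp add: H'_def mult.assoc[symmetric])
  qed (simp add: H'_def)
  \<comment> \<open>With the identity matrix, \<open>mart_quad\<close> becomes the isometry for the
    norm.\<close>
  define Q where "Q = (\<lambda>om::'w. (mat 1 :: real^'m^'m))"
  have Q: "Q \<in> borel_measurable (F (s 0))" unfolding Q_def by simp
  have iQ: "integrable M (\<lambda>om. norm (Q om) * norm (H' j om) ^ 2)" if "j < k" for j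
    using i2[OF that] unfolding Q_def by (rule integrable_mult_right)
  note mq = mart_quad[OF g H' Q iQ]
  have col: "(\<Sum>i\<in>UNIV. column i A \<bullet> column i A) = (norm A)^2" for A :: "real^'n^'m"
  proof -
    have "(\<Sum>i\<in>UNIV. column i A \<bullet> column i A) = (\<Sum>i\<in>UNIV. \<Sum>j\<in>UNIV. (A $ j $ i)^2)"
      by (simp add: inner_vec_def column_def power2_eq_square)
    also have "\<dots> = (\<Sum>j\<in>UNIV. \<Sum>i\<in>UNIV. (A $ j $ i)^2)" by (rule sum.swap)
    also have "\<dots> = (norm A)^2" by (simp add: norm_vec_def L2_set_def sum_nonneg)
    finally show ?thesis .
  qed
  have mi: "integrable M (\<lambda>om. (norm (mart s H' k om))^2)"
    and me: "(\<integral>om. (norm (mart s H' k om))^2 \<partial>M) = (\<Sum>j<k. (s (Suc j) - s j) * (\<integral>om. (norm (H' j om))^2 \<partial>M))"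
    using mq by (auto simp: Q_def power2_norm_eq_inner col[unfolded power2_norm_eq_inner])
  have "(\<Sum>j<k. (s (Suc j) - s j) * (\<integral>om. (norm (H' j om))^2 \<partial>M)) = (\<integral>om. (\<Sum>j<k. (s (Suc j) - s j) * (norm (H' j om))^2) \<partial>M)"
    using i2 by (subst Bochner_Integration.integral_sum) auto
  also have "\<dots> \<le> (\<integral>om. d \<partial>M)"
  proof (rule integral_mono)
    fix om
    have "(\<Sum>j<k. (s (Suc j) - s j) * (norm (H' j om))^2) = (\<Sum>j<k. (s (Suc j) - s j) * (norm (H j om))^2)"
      unfolding H'_def by (intro sum.cong) auto
    then show "(\<Sum>j<k. (s (Suc j) - s j) * (norm (H' j om))^2) \<le> d" using bound[of k om] by simp
  qed (use i2 in auto)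
  finally have E: "(\<integral>om. (norm (mart s H' k om))^2 \<partial>M) \<le> d" using me by (simp add: prob_space)
  note [measurable] = mart_meas[OF g G] mart_meas[OF g H']
  have qk: "q k \<in> borel_measurable M"
    unfolding q_def
  proof (intro borel_measurable_sum)
    fix i assume "i \<in> {..<k}"
    then have [measurable]: "G i \<in> borel_measurable M" using G F_meas by (auto simp: adapted_def)
    show "(\<lambda>om. (s (Suc i) - s i) * (norm (G i om))^2) \<in> borel_measurable M" by measurable
  qed
  note [measurable] = qk
  have markov: "prob {om \<in> space M. norm (mart s H' k om) \<ge> e} \<le> d / e^2"
  proof -
    have "prob {om \<in> space M. norm (mart s H' k om) \<ge> e} \<le> prob {om \<in> space M. (norm (mart s H' k om))^2 \<ge> e^2}"
      using e by (intro finite_measure_mono) (auto intro: power_mono)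
    also have "\<dots> \<le> (\<integral>om. (norm (mart s H' k om))^2 \<partial>M) / e^2"
      using e by (intro integral_Markov_inequality_measure[where A = "{}", OF mi]) auto
    also have "\<dots> \<le> d / e^2" using E e by (intro divide_right_mono) auto
    finally show ?thesis .
  qed
  have "prob {om \<in> space M. norm (mart s G k om) > e} \<le> prob ({om \<in> space M. q k om > d} \<union> {om \<in> space M. norm (mart s H' k om) \<ge> e})"
  proof (rule finite_measure_mono)
    show "{om \<in> space M. norm (mart s G k om) > e} \<subseteq> {om \<in> space M. q k om > d} \<union> {om \<in> space M. norm (mart s H' k om) \<ge> e}"
    proof
      fix om assume w: "om \<in> {om \<in> space M. norm (mart s G k om) > e}"
      show "om \<in> {om \<in> space M. q k om > d} \<union> {om \<in> space M. norm (mart s H' k om) \<ge> e}"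
      proof (cases "q k om > d")
        case False
        have "H j om = G j om" if "j < k" for j using False qmono[of "Suc j" k om] that by (simp add: H_def)
        then have "mart s H k om = mart s G k om" unfolding mart_def by simp
        then show ?thesis using w meq by auto
      qed (use w in auto)
    qed
  qed measurable
  also have "\<dots> \<le> prob {om \<in> space M. q k om > d} + prob {om \<in> space M. norm (mart s H' k om) \<ge> e}"
    by (rule measure_Un_le) measurable
  finally show ?thesis using markov unfolding q_def by linarith
qed

end

section \<open>Ito integrals as limits of Riemann sums\<close>

text \<open>No breakpoint of \<open>\<tau>\<close>, cut off at \<open>t\<close>, lies inside a cell
  of \<open>\<pi>\<close>, so a step process on \<open>\<tau>\<close> is constant on each cell. The
  cut-off accounts for breakpoints beyond \<open>t\<close>.\<close>

definition refines :: "real \<Rightarrow> nat \<Rightarrow> (nat \<Rightarrow> real) \<Rightarrow> nat \<Rightarrow> (nat \<Rightarrow> real) \<Rightarrow> bool" where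
  "refines t K \<pi> n \<tau> \<longleftrightarrow> \<pi> 0 = 0 \<and> \<pi> K = t \<and> (\<forall>j<K. \<pi> j \<le> \<pi> (Suc j)) \<and>
     0 \<le> \<tau> 0 \<and> (\<forall>i<n. \<tau> i \<le> \<tau> (Suc i)) \<and>
     (\<forall>i\<le>n. \<forall>j<K. min t (\<tau> i) \<le> \<pi> j \<or> \<pi> (Suc j) \<le> min t (\<tau> i))"

text \<open>Sorting the finite set of all cut-off breakpoints of both sequences, together with
  \<open>0\<close> and \<open>t\<close>, yields the common refinement.\<close>

lemma ex_refines:
  assumes t: "0 \<le> t" and "0 \<le> \<tau> 0" "\<And>i. i < n \<Longrightarrow> \<tau> i \<le> \<tau> (Suc i)"
    and "0 \<le> \<tau>' 0" "\<And>i. i < n' \<Longrightarrow> \<tau>' i \<le> \<tau>' (Suc i)"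
  obtains K \<pi> where "refines t K \<pi> n \<tau>" "refines t K \<pi> n' \<tau>'"
proof -
  define P where "P = {0, t} \<union> (\<lambda>i. min t (\<tau> i)) ` {..n} \<union> (\<lambda>i. min t (\<tau>' i)) ` {..n'}"
  have nn: "0 \<le> \<tau> i" if "i \<le> n" for i
    using that assms(2,3) by (induction i) (auto intro: order_trans)
  have nn': "0 \<le> \<tau>' i" if "i \<le> n'" for i
    using that assms(4,5) by (induction i) (auto intro: order_trans)
  have fin: "finite P" by (simp add: P_def)
  define L where "L = sorted_list_of_set P"
  have L: "set L = P" "sorted L" using fin by (auto simp: L_def)
  have ne: "L \<noteq> []" using L(1) by (auto simp: P_def)
  define K where "K = length L - 1"
  have len: "length L = Suc K" using ne by (simp add: K_def)
  define \<pi> where "\<pi> = (\<lambda>j. L ! j)"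
  have mono: "\<pi> i \<le> \<pi> j" if "i \<le> j" "j \<le> K" for i j
    using L(2) that len by (simp add: \<pi>_def sorted_nth_mono)
  have idx: "\<exists>j\<le>K. \<pi> j = x" if "x \<in> P" for x
    using that unfolding L(1)[symmetric] by (metis \<pi>_def in_set_conv_nth len less_Suc_eq_le)
  have inP: "\<pi> j \<in> P" if "j \<le> K" for j
    using that len L(1) by (metis \<pi>_def less_Suc_eq_le nth_mem)
  have P0: "0 \<le> x" "x \<le> t" if "x \<in> P" for x using that t nn nn' by (auto simp: P_def)
  have "0 \<in> P" "t \<in> P" by (auto simp: P_def)
  have p0: "\<pi> 0 = 0"
    using idx[OF \<open>0 \<in> P\<close>] mono[of 0] P0(1)[OF inP[of 0]] by force
  have pK: "\<pi> K = t"
    using idx[OF \<open>t \<in> P\<close>] mono[of _ K] P0(2)[OF inP[of K]] by force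
  have gap: "x \<le> \<pi> j \<or> \<pi> (Suc j) \<le> x" if x: "x \<in> P" and j: "j < K" for x j
  proof -
    obtain i where "i \<le> K" "\<pi> i = x" using idx[OF x] by auto
    then show ?thesis using mono[of i j] mono[of "Suc j" i] j by (cases "i \<le> j") auto
  qed
  have g1: "min t (\<tau> i) \<le> \<pi> j \<or> \<pi> (Suc j) \<le> min t (\<tau> i)" if "i \<le> n" "j < K" for i j
    using gap[of "min t (\<tau> i)" j] that by (simp add: P_def)
  have g2: "min t (\<tau>' i) \<le> \<pi> j \<or> \<pi> (Suc j) \<le> min t (\<tau>' i)" if "i \<le> n'" "j < K" for i j
    using gap[of "min t (\<tau>' i)" j] that by (simp add: P_def)
  have "refines t K \<pi> n \<tau>" "refines t K \<pi> n' \<tau>'"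
    unfolding refines_def using p0 pK mono assms g1 g2 by auto
  then show ?thesis by (rule that)
qed

text \<open>Makes step processes constant on the half-open cells, and shows that a coefficient
  active on a cell is known at its left end.\<close>

lemma refines_cell:
  assumes "refines t K \<pi> n \<tau>" "j < K" "i < n" "\<pi> j < s" "s \<le> \<pi> (Suc j)"
  shows "(\<tau> i < s \<and> s \<le> \<tau> (Suc i)) \<longleftrightarrow> (\<tau> i < \<pi> (Suc j) \<and> \<pi> (Suc j) \<le> \<tau> (Suc i))"
    and "\<tau> i < \<pi> (Suc j) \<Longrightarrow> \<tau> i \<le> \<pi> j"
    and "\<tau> (Suc i) < \<pi> (Suc j) \<Longrightarrow> \<tau> (Suc i) \<le> \<pi> j"
    and "\<pi> (Suc j) \<le> t"
proof -
  have mono: "\<pi> (Suc j) \<le> \<pi> K"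
  proof -
    have "\<pi> (Suc j) \<le> \<pi> k" if "Suc j \<le> k" "k \<le> K" for k
      using that
    proof (induction k)
      case (Suc k)
      have "\<pi> k \<le> \<pi> (Suc k)" using assms(1) Suc.prems by (simp add: refines_def)
      then show ?case using Suc by (cases "j = k") auto
    qed simp
    then show ?thesis using assms(2) by auto
  qed
  then show t: "\<pi> (Suc j) \<le> t" using assms(1) by (simp add: refines_def)
  have a: "min t (\<tau> i) \<le> \<pi> j \<or> \<pi> (Suc j) \<le> min t (\<tau> i)"
    and b: "min t (\<tau> (Suc i)) \<le> \<pi> j \<or> \<pi> (Suc j) \<le> min t (\<tau> (Suc i))"
    using assms(1-3) by (auto simp: refines_def)
  show 1: "\<tau> i < \<pi> (Suc j) \<Longrightarrow> \<tau> i \<le> \<pi> j" using a t by auto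
  show 2: "\<tau> (Suc i) < \<pi> (Suc j) \<Longrightarrow> \<tau> (Suc i) \<le> \<pi> j" using b t by auto
  show "(\<tau> i < s \<and> s \<le> \<tau> (Suc i)) \<longleftrightarrow> (\<tau> i < \<pi> (Suc j) \<and> \<pi> (Suc j) \<le> \<tau> (Suc i))"
    using 1 2 assms(4,5) by (smt (verit))
qed

lemma telescope_cells:
  fixes f :: "real \<Rightarrow> 'a::real_vector"
  assumes r: "refines t K \<pi> n \<tau>" and i: "i < n"
  shows "(\<Sum>j<K. (indicator {\<tau> i<..\<tau> (Suc i)} (\<pi> (Suc j)) :: real) *\<^sub>R (f (\<pi> (Suc j)) - f (\<pi> j)))
    = f (min t (\<tau> (Suc i))) - f (min t (\<tau> i))"
proof -
  define a b where "a = min t (\<tau> i)" and "b = min t (\<tau> (Suc i))"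
  have ab: "a \<le> b" using r i by (auto simp: a_def b_def refines_def min_def)
  have a0: "0 \<le> \<tau> k" if "k \<le> n" for k
    using that
  proof (induction k)
    case (Suc k) then show ?case using r by (auto simp: refines_def intro: order_trans)
  qed (use r in \<open>simp add: refines_def\<close>)
  \<comment> \<open>Clamping the argument to \<open>[a, b]\<close> replaces the indicator by
    increments of \<open>g\<close>, which telescope over all cells.\<close>
  define g where "g = (\<lambda>x. f (max a (min x b)))"
  have "(indicator {\<tau> i<..\<tau> (Suc i)} (\<pi> (Suc j)) :: real) *\<^sub>R (f (\<pi> (Suc j)) - f (\<pi> j)) = g (\<pi> (Suc j)) - g (\<pi> j)"
    if j: "j < K" for j
  proof (cases "\<pi> j = \<pi> (Suc j)")
    case False
    have le: "\<pi> j \<le> \<pi> (Suc j)" using r j by (simp add: refines_def)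
    then have lt: "\<pi> j < \<pi> (Suc j)" using False by simp
    note c = refines_cell(2-4)[OF r j i lt order_refl]
    consider "\<tau> i < \<pi> (Suc j)" "\<pi> (Suc j) \<le> \<tau> (Suc i)" | "\<pi> (Suc j) \<le> \<tau> i" | "\<tau> (Suc i) < \<pi> (Suc j)" by linarith
    then show ?thesis
    proof cases
      case 1
      then have "a \<le> \<pi> j" "\<pi> (Suc j) \<le> b" using c by (auto simp: a_def b_def)
      then show ?thesis using 1 le by (simp add: g_def max_def min_def)
    next
      case 2
      then have "\<pi> (Suc j) \<le> a" using c by (auto simp: a_def)
      then have "max a (min (\<pi> (Suc j)) b) = a" "max a (min (\<pi> j) b) = a" using ab le by auto
      then show ?thesis using 2 by (simp add: g_def)
    next
      case 3
      then have "b \<le> \<pi> j" using c by (auto simp: b_def)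
      then have "min (\<pi> (Suc j)) b = b" "min (\<pi> j) b = b" using le by auto
      then show ?thesis using 3 by (simp add: g_def)
    qed
  qed simp
  then have "(\<Sum>j<K. (indicator {\<tau> i<..\<tau> (Suc i)} (\<pi> (Suc j)) :: real) *\<^sub>R (f (\<pi> (Suc j)) - f (\<pi> j)))
    = (\<Sum>j<K. g (\<pi> (Suc j)) - g (\<pi> j))" by (intro sum.cong) auto
  also have "\<dots> = g (\<pi> K) - g (\<pi> 0)" by (rule sum_lessThan_telescope)
  also have "\<dots> = f b - f a"
  proof -
    have "\<pi> K = t" "\<pi> 0 = 0" using r by (auto simp: refines_def)
    moreover have "0 \<le> t"
    proof -
      have "\<pi> 0 \<le> \<pi> k" if "k \<le> K" for k
        using that
      proof (induction k)
        case (Suc k) then show ?case using r by (auto simp: refines_def intro: order_trans)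
      qed simp
      then show ?thesis using r by (auto simp: refines_def)
    qed
    moreover have "0 \<le> a" using a0[of i] i \<open>0 \<le> t\<close> by (simp add: a_def)
    moreover have "b \<le> t" by (simp add: b_def)
    ultimately show ?thesis using ab by (simp add: g_def max_def min_def)
  qed
  finally show ?thesis by (simp add: a_def b_def)
qed

lemma sum_matrix_vector_mult: "(\<Sum>i\<in>I. A i) *v x = (\<Sum>i\<in>I. A i *v x)"
  for A :: "_ \<Rightarrow> real^'n^'m"
  by (induction I rule: infinite_finite_induct) (auto simp: matrix_vector_mult_add_rdistrib)

lemma matrix_vector_mult_sum_right: "A *v (\<Sum>i\<in>I. x i) = (\<Sum>i\<in>I. A *v x i)"
  for A :: "real^'n^'m"
  by (induction I rule: infinite_finite_induct) (auto simp: matrix_vector_right_distrib)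

context wiener
begin

text \<open>Simple integrands without the boundedness: Riemann sums freeze a continuous
  \<open>\<Phi>\<close> at grid points, where it may be an unbounded random variable.\<close>

definition step_integrand :: "nat \<Rightarrow> (nat \<Rightarrow> real) \<Rightarrow> (nat \<Rightarrow> 'w \<Rightarrow> real^'n^'m) \<Rightarrow> bool" where
  "step_integrand n \<tau> \<xi> \<longleftrightarrow> grid n \<tau> \<and> adapted n \<tau> \<xi>"

text \<open>The value at the right end of a cell is the value on the whole cell, because the
  intervals of a simple process are closed on the right.\<close>

lemma simple_integral_refine:
  assumes r: "refines t K \<pi> n \<tau>"
  shows "simple_integral B n \<tau> \<xi> t om = mart \<pi> (\<lambda>j om. simple_process n \<tau> \<xi> (\<pi> (Suc j)) om) K om"
proof -
  have "mart \<pi> (\<lambda>j om. simple_process n \<tau> \<xi> (\<pi> (Suc j)) om) K om =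
     (\<Sum>j<K. \<Sum>i<n. (indicator {\<tau> i<..\<tau> (Suc i)} (\<pi> (Suc j)) *\<^sub>R \<xi> i om) *v (B (\<pi> (Suc j)) om - B (\<pi> j) om))"
    unfolding mart_def simple_process_def incr_def sum_matrix_vector_mult ..
  also have "\<dots> = (\<Sum>i<n. \<Sum>j<K. (indicator {\<tau> i<..\<tau> (Suc i)} (\<pi> (Suc j)) *\<^sub>R \<xi> i om) *v (B (\<pi> (Suc j)) om - B (\<pi> j) om))"
    by (rule sum.swap)
  also have "\<dots> = (\<Sum>i<n. \<xi> i om *v (\<Sum>j<K. indicator {\<tau> i<..\<tau> (Suc i)} (\<pi> (Suc j)) *\<^sub>R (B (\<pi> (Suc j)) om - B (\<pi> j) om)))"
    by (simp add: matrix_vector_mult_sum_right scaleR_matrix_vector_assoc[symmetric] matrix_vector_mult_scaleR)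
  also have "\<dots> = simple_integral B n \<tau> \<xi> t om"
    unfolding simple_integral_def
    by (intro sum.cong refl) (subst telescope_cells[OF r, of _ "\<lambda>s. B s om"], auto)
  finally show ?thesis by simp
qed

text \<open>Although sampled at the right end, the process is known at the left end of the cell: an
  interval of \<open>\<tau>\<close> that meets the cell starts no later than it.\<close>

lemma refine_adapted:
  assumes r: "refines t K \<pi> n \<tau>" and \<xi>: "step_integrand n \<tau> \<xi>"
  shows "grid K \<pi>" "adapted K \<pi> (\<lambda>j om. simple_process n \<tau> \<xi> (\<pi> (Suc j)) om)"
proof -
  show g: "grid K \<pi>" using r by (simp add: refines_def grid_def)
  show "adapted K \<pi> (\<lambda>j om. simple_process n \<tau> \<xi> (\<pi> (Suc j)) om)"
    unfolding adapted_def
  proof (intro allI impI)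
    fix j assume j: "j < K"
    show "(\<lambda>om. simple_process n \<tau> \<xi> (\<pi> (Suc j)) om) \<in> borel_measurable (F (\<pi> j))"
      unfolding simple_process_def
    proof (intro borel_measurable_sum)
      fix i assume "i \<in> {..<n}"
      then have i: "i < n" by simp
      show "(\<lambda>om. indicator {\<tau> i<..\<tau> (Suc i)} (\<pi> (Suc j)) *\<^sub>R \<xi> i om) \<in> borel_measurable (F (\<pi> j))"
      proof (cases "\<tau> i < \<pi> (Suc j)")
        case True
        have "\<tau> i \<le> \<pi> j"
        proof (cases "\<pi> j < \<pi> (Suc j)")
          case lt: True
          show ?thesis by (rule refines_cell(2)[OF r j i lt order_refl True])
        next
          case False
          then show ?thesis using True by simp
        qed
        moreover have "\<xi> i \<in> borel_measurable (F (\<tau> i))" using \<xi> i by (simp add: step_integrand_def adapted_def)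
        ultimately have [measurable]: "\<xi> i \<in> borel_measurable (F (\<pi> j))" by (rule F_meas_mono)
        show ?thesis by measurable
      qed simp
    qed
  qed
qed

text \<open>The integrand is constant on the cells, which tile \<open>(0, t]\<close>. This links the
  quadratic variation in \<open>mart_lenglart\<close> to the time integral in the definition of the
  Ito integral.\<close>

lemma step_sum_le_integral:
  assumes r: "refines t K \<pi> n \<tau>" "refines t K \<pi> n' \<tau>'"
  shows "ennreal (\<Sum>j<K. (\<pi> (Suc j) - \<pi> j) * (norm (simple_process n \<tau> \<xi> (\<pi> (Suc j)) om - simple_process n' \<tau>' \<xi>' (\<pi> (Suc j)) om))^2)
    \<le> (\<integral>\<^sup>+ s\<in>{0..t}. ennreal ((norm (simple_process n \<tau> \<xi> s om - simple_process n' \<tau>' \<xi>' s om))^2) \<partial>lborel)"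
proof -
  define N where "N = (\<lambda>s. (norm (simple_process n \<tau> \<xi> s om - simple_process n' \<tau>' \<xi>' s om))^2)"
  have g: "\<pi> j \<le> \<pi> (Suc j)" if "j < K" for j using r that by (simp add: refines_def)
  have cell: "N s = N (\<pi> (Suc j))" if "j < K" "s \<in> {\<pi> j<..\<pi> (Suc j)}" for s j
  proof -
    have "simple_process n \<tau> \<xi> s om = simple_process n \<tau> \<xi> (\<pi> (Suc j)) om"
      unfolding simple_process_def
      using refines_cell(1)[OF r(1) that(1), of _ s] that(2) by (intro sum.cong) (auto simp: indicator_def)
    moreover have "simple_process n' \<tau>' \<xi>' s om = simple_process n' \<tau>' \<xi>' (\<pi> (Suc j)) om"
      unfolding simple_process_def
      using refines_cell(1)[OF r(2) that(1), of _ s] that(2) by (intro sum.cong) (auto simp: indicator_def)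
    ultimately show ?thesis by (simp add: N_def)
  qed
  have "ennreal (\<Sum>j<K. (\<pi> (Suc j) - \<pi> j) * N (\<pi> (Suc j))) = (\<Sum>j<K. ennreal (N (\<pi> (Suc j))) * emeasure lborel {\<pi> j<..\<pi> (Suc j)})"
    using g by (subst sum_ennreal[symmetric]) (auto simp: ennreal_mult[symmetric] N_def mult.commute)
  also have "\<dots> = (\<integral>\<^sup>+ s. (\<Sum>j<K. ennreal (N (\<pi> (Suc j))) * indicator {\<pi> j<..\<pi> (Suc j)} s) \<partial>lborel)"
    by (subst nn_integral_sum) (auto simp: nn_integral_cmult)
  also have "\<dots> \<le> (\<integral>\<^sup>+ s\<in>{0..t}. ennreal (N s) \<partial>lborel)"
  proof (rule nn_integral_mono)
    fix s
    have tel: "(\<Sum>j<k. indicator {\<pi> j<..\<pi> (Suc j)} s :: real) = indicator {0<..\<pi> k} s" if "k \<le> K" for k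
      using that
    proof (induction k)
      case 0 then show ?case using r by (simp add: refines_def)
    next
      case (Suc k)
      have "0 \<le> \<pi> k"
        using Suc.prems grid_nonneg[of K \<pi> k] r by (simp add: refines_def grid_def)
      then show ?case using Suc g[of k] by (auto simp: indicator_def)
    qed
    have "(\<Sum>j<K. ennreal (N (\<pi> (Suc j))) * indicator {\<pi> j<..\<pi> (Suc j)} s) = (\<Sum>j<K. ennreal (N s * indicator {\<pi> j<..\<pi> (Suc j)} s))"
      by (intro sum.cong) (auto simp: indicator_def dest: cell[symmetric])
    also have "\<dots> = ennreal (N s * (\<Sum>j<K. indicator {\<pi> j<..\<pi> (Suc j)} s))"
      by (subst sum_ennreal) (auto simp: N_def sum_distrib_left)
    also have "\<dots> \<le> ennreal (N s) * indicator {0..t} s"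
      unfolding tel[OF order_refl] using r by (auto simp: indicator_def refines_def)
    finally show "(\<Sum>j<K. ennreal (N (\<pi> (Suc j))) * indicator {\<pi> j<..\<pi> (Suc j)} s) \<le> ennreal (N s) * indicator {0..t} s" .
  qed
  finally show ?thesis unfolding N_def .
qed

lemma simple_integral_meas:
  assumes "0 \<le> t" "step_integrand n \<tau> \<xi>"
  shows "simple_integral B n \<tau> \<xi> t \<in> borel_measurable M"
proof -
  obtain K \<pi> where r: "refines t K \<pi> n \<tau>"
    using ex_refines[OF assms(1), of \<tau> n \<tau> n] assms(2) by (auto simp: step_integrand_def grid_def)
  have "simple_integral B n \<tau> \<xi> t = mart \<pi> (\<lambda>j om. simple_process n \<tau> \<xi> (\<pi> (Suc j)) om) K"
    by (rule ext) (rule simple_integral_refine[OF r])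
  then show ?thesis
    using mart_meas[OF refine_adapted[OF r assms(2)]] by simp
qed

lemma simple_process_jmeas:
  fixes \<xi> :: "nat \<Rightarrow> 'w \<Rightarrow> real^'n^'m"
  assumes "\<And>i. i < n \<Longrightarrow> \<xi> i \<in> borel_measurable M"
  shows "(\<lambda>(s, om). simple_process n \<tau> \<xi> s om) \<in> borel_measurable (borel \<Otimes>\<^sub>M M)"
proof -
  have "(\<lambda>x. indicator {\<tau> i<..\<tau> (Suc i)} (fst x) *\<^sub>R \<xi> i (snd x)) \<in> borel_measurable (borel \<Otimes>\<^sub>M M)" if "i < n" for i
  proof -
    note [measurable] = assms[OF that]
    show ?thesis by measurable
  qed
  then show ?thesis unfolding simple_process_def split_beta' by (intro borel_measurable_sum) auto
qed

section \<open>Time integrals of processes and convergence in probability\<close>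

lemma nn_integral_time_meas:
  fixes f :: "real \<Rightarrow> 'w \<Rightarrow> ennreal"
  assumes "(\<lambda>(s, om). f s om) \<in> borel_measurable (restrict_space borel {0..t} \<Otimes>\<^sub>M M)"
  shows "(\<lambda>om. \<integral>\<^sup>+ s\<in>{0..t}. f s om \<partial>lborel) \<in> borel_measurable M"
proof -
  \<comment> \<open>Joint measurability is available on \<open>[0, t]\<close> only, so Tonelli is
    applied to Lebesgue measure restricted to that interval.\<close>
  interpret S: sigma_finite_measure "restrict_space lborel {0..t::real}"
    by (rule sigma_finite_measure_restrict_space) (auto intro: sigma_finite_lborel)
  have eq: "(\<integral>\<^sup>+ s\<in>{0..t}. f s om \<partial>lborel) = (\<integral>\<^sup>+ s. f s om \<partial>restrict_space lborel {0..t})" for om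
    by (subst nn_integral_restrict_space) auto
  have s: "sets (restrict_space lborel {0..t::real} \<Otimes>\<^sub>M M) = sets (restrict_space borel {0..t} \<Otimes>\<^sub>M M)"
    by (intro sets_pair_measure_cong) (simp_all add: sets_restrict_space)
  have "(\<lambda>(s, om). f s om) \<in> borel_measurable (restrict_space lborel {0..t} \<Otimes>\<^sub>M M)"
    using assms measurable_cong_sets[OF s refl] by blast
  then have "(\<lambda>(om, s). f s om) \<in> borel_measurable (M \<Otimes>\<^sub>M restrict_space lborel {0..t})"
    using measurable_compose[OF measurable_pair_swap', of "\<lambda>(s, om). f s om"] by (simp add: split_beta')
  from S.borel_measurable_nn_integral[OF this] show ?thesis unfolding eq by simp
qed

lemma prob_tendsto_0:
  fixes X :: "nat \<Rightarrow> 'w \<Rightarrow> ennreal"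
  assumes [measurable]: "\<And>m. X m \<in> borel_measurable M"
    and lim: "\<And>om. om \<in> space M \<Longrightarrow> (\<lambda>m. X m om) \<longlonglongrightarrow> 0" and d: "0 < d"
  shows "(\<lambda>m. prob {om \<in> space M. X m om > ennreal d}) \<longlonglongrightarrow> 0"
proof -
  have "(\<lambda>m. \<integral>om. indicator {om \<in> space M. X m om > ennreal d} om \<partial>M) \<longlonglongrightarrow> (\<integral>om. (0::real) \<partial>M)"
  proof (rule integral_dominated_convergence[where w = "\<lambda>_. 1"])
    show "AE om in M. (\<lambda>m. indicator {om \<in> space M. X m om > ennreal d} om :: real) \<longlonglongrightarrow> 0"
    proof (rule AE_I2)
      fix om assume w: "om \<in> space M"
      have "eventually (\<lambda>m. X m om < ennreal d) sequentially"
        using order_tendstoD(2)[OF lim[OF w], of "ennreal d"] d by simp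
      then have "eventually (\<lambda>m. indicator {om \<in> space M. X m om > ennreal d} om = (0::real)) sequentially"
        by eventually_elim (auto simp: indicator_def)
      then show "(\<lambda>m. indicator {om \<in> space M. X m om > ennreal d} om :: real) \<longlonglongrightarrow> 0"
        by (rule tendsto_eventually)
    qed
  qed auto
  moreover have "(\<integral>om. indicator {om \<in> space M. X m om > ennreal d} om \<partial>M) = prob {om \<in> space M. X m om > ennreal d}" for m
    by (subst Bochner_Integration.integral_indicator) (auto simp: Int_absorb2 subset_eq)
  ultimately show ?thesis by simp
qed

definition conv_prob :: "(nat \<Rightarrow> 'w \<Rightarrow> 'b::real_normed_vector) \<Rightarrow> ('w \<Rightarrow> 'b) \<Rightarrow> bool" where
  "conv_prob X Y \<longleftrightarrow> (\<forall>e>0. (\<lambda>m. prob {om \<in> space M. norm (X m om - Y om) > e}) \<longlonglongrightarrow> 0)"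

definition path_cont :: "real \<Rightarrow> (real \<Rightarrow> 'w \<Rightarrow> 'b::topological_space) \<Rightarrow> bool" where
  "path_cont t \<Phi> \<longleftrightarrow> (\<forall>om\<in>space M. continuous_on {0..t} (\<lambda>s. \<Phi> s om))"

text \<open>Freezing at the left grid points keeps the process adapted.\<close>

abbreviation frozen :: "nat \<Rightarrow> (nat \<Rightarrow> real) \<Rightarrow> (real \<Rightarrow> 'w \<Rightarrow> real^'n^'m) \<Rightarrow> real \<Rightarrow> 'w \<Rightarrow> real^'n^'m" where
  "frozen k \<tau> \<Phi> \<equiv> simple_process k \<tau> (\<lambda>j. \<Phi> (\<tau> j))"

text \<open>The path is uniformly continuous on \<open>[0, t]\<close>: once the mesh is fine,
  freezing changes it by at most \<open>e\<close> everywhere on \<open>(0, t]\<close>.\<close>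

lemma riemann_defect_tendsto:
  fixes \<Phi> :: "real \<Rightarrow> 'w \<Rightarrow> real^'n^'m"
  assumes t: "0 \<le> t" and c: "continuous_on {0..t} (\<lambda>s. \<Phi> s om)"
    and g: "\<And>m. grid (k m) (\<tau> m)" "\<And>m. \<tau> m 0 = 0" "\<And>m. \<tau> m (k m) = t"
    and mesh: "\<And>e. e > 0 \<Longrightarrow> eventually (\<lambda>m. \<forall>j<k m. \<tau> m (Suc j) - \<tau> m j < e) sequentially"
  shows "(\<lambda>m. \<integral>\<^sup>+ s\<in>{0..t}. ennreal ((norm (frozen (k m) (\<tau> m) \<Phi> s om - \<Phi> s om))^2) \<partial>lborel) \<longlonglongrightarrow> 0"
proof -
  have uc: "uniformly_continuous_on {0..t} (\<lambda>s. \<Phi> s om)"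
    using c by (intro compact_uniformly_continuous) auto
  show ?thesis
  proof (rule order_tendstoI)
    fix a :: ennreal assume a: "0 < a"
    obtain e where e: "0 < e" "ennreal (e^2 * t) < a"
    proof -
      have "\<exists>x>0. ennreal x < a"
      proof (cases a)
        case (real r)
        then show ?thesis using a by (intro exI[of _ "r/2"]) (auto simp: ennreal_less_iff)
      next
        case top then show ?thesis by (intro exI[of _ 1]) auto
      qed
      then obtain x where x: "x > 0" "ennreal x < a" by auto
      have "ennreal ((sqrt (x / (t + 1)))^2 * t) \<le> ennreal x"
        using x t by (intro ennreal_leI) (simp add: field_simps)
      then have "ennreal ((sqrt (x / (t + 1)))^2 * t) < a" using x(2) by (rule le_less_trans)
      moreover have "0 < sqrt (x / (t + 1))" using x t by simp
      ultimately show ?thesis using that by blast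
    qed
    obtain d where d: "0 < d" "\<And>s s'. s \<in> {0..t} \<Longrightarrow> s' \<in> {0..t} \<Longrightarrow> dist s' s < d \<Longrightarrow> dist (\<Phi> s' om) (\<Phi> s om) < e"
      using uc e(1) unfolding uniformly_continuous_on_def by metis
    show "eventually (\<lambda>m. (\<integral>\<^sup>+ s\<in>{0..t}. ennreal ((norm (frozen (k m) (\<tau> m) \<Phi> s om - \<Phi> s om))^2) \<partial>lborel) < a) sequentially"
      using mesh[OF d(1)]
    proof eventually_elim
      case (elim m)
      have tel: "(\<Sum>j<i. indicator {\<tau> m j<..\<tau> m (Suc j)} s :: real) = indicator {0<..\<tau> m i} s" if "i \<le> k m" for i s
        using that
      proof (induction i)
        case 0 then show ?case using g by simp
      next
        case (Suc i)
        have "0 \<le> \<tau> m i" "\<tau> m i \<le> \<tau> m (Suc i)" using Suc.prems grid_nonneg[OF g(1)[of m], of i] g(1)[of m] by (auto simp: grid_def)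
        then show ?case using Suc by (auto simp: indicator_def)
      qed
      have diff: "norm (frozen (k m) (\<tau> m) \<Phi> s om - \<Phi> s om) \<le> e" if s: "0 < s" "s \<le> t" for s
      proof -
        have one: "(\<Sum>j<k m. indicator {\<tau> m j<..\<tau> m (Suc j)} s :: real) = 1"
          using tel[OF order_refl] s g by simp
        have "\<Phi> s om = (\<Sum>j<k m. indicator {\<tau> m j<..\<tau> m (Suc j)} s :: real) *\<^sub>R \<Phi> s om" unfolding one by simp
        also have "\<dots> = (\<Sum>j<k m. indicator {\<tau> m j<..\<tau> m (Suc j)} s *\<^sub>R \<Phi> s om)" by (rule scaleR_left.sum)
        finally have ps: "\<Phi> s om = (\<Sum>j<k m. indicator {\<tau> m j<..\<tau> m (Suc j)} s *\<^sub>R \<Phi> s om)" .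
        have "frozen (k m) (\<tau> m) \<Phi> s om - \<Phi> s om =
           (\<Sum>j<k m. indicator {\<tau> m j<..\<tau> m (Suc j)} s *\<^sub>R (\<Phi> (\<tau> m j) om - \<Phi> s om))"
          unfolding simple_process_def by (subst ps) (simp add: sum_subtractf scaleR_diff_right)
        also have "norm \<dots> \<le> (\<Sum>j<k m. indicator {\<tau> m j<..\<tau> m (Suc j)} s * e)"
        proof (rule sum_norm_le)
          fix j assume "j \<in> {..<k m}"
          then have j: "j < k m" by simp
          show "norm (indicator {\<tau> m j<..\<tau> m (Suc j)} s *\<^sub>R (\<Phi> (\<tau> m j) om - \<Phi> s om)) \<le> indicator {\<tau> m j<..\<tau> m (Suc j)} s * e"
          proof (cases "s \<in> {\<tau> m j<..\<tau> m (Suc j)}")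
            case True
            have "0 \<le> \<tau> m j" using j grid_nonneg[OF g(1)[of m], of j] by auto
            moreover have "\<tau> m j \<le> t" using True s by auto
            moreover have "dist (\<tau> m j) s < d" using True elim j by (force simp: dist_real_def)
            ultimately have "dist (\<Phi> (\<tau> m j) om) (\<Phi> s om) < e" using d(2)[of s "\<tau> m j"] s by auto
            then show ?thesis using True by (simp add: dist_norm)
          qed simp
        qed
        also have "\<dots> = e" using one by (simp flip: sum_distrib_right)
        finally show ?thesis .
      qed
      have "(\<integral>\<^sup>+ s\<in>{0..t}. ennreal ((norm (frozen (k m) (\<tau> m) \<Phi> s om - \<Phi> s om))^2) \<partial>lborel)
         \<le> (\<integral>\<^sup>+ s\<in>{0..t}. ennreal (e^2) \<partial>lborel)"
      proof (rule nn_integral_mono_AE)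
        \<comment> \<open>Time \<open>0\<close> lies in none of the half-open cells, but it is a
          null set.\<close>
        show "AE s in lborel. ennreal ((norm (frozen (k m) (\<tau> m) \<Phi> s om - \<Phi> s om))^2) * indicator {0..t} s \<le> ennreal (e^2) * indicator {0..t} s"
          using AE_lborel_singleton[of "0::real"]
        proof eventually_elim
          case (elim s)
          show ?case
          proof (cases "s \<in> {0..t}")
            case True
            then have "0 < s" "s \<le> t" using elim by auto
            then show ?thesis using diff[of s] by (auto intro!: ennreal_leI power_mono)
          qed simp
        qed
      qed
      also have "\<dots> = ennreal (e^2 * t)" using t by (simp add: nn_integral_cmult_indicator ennreal_mult)
      also have "\<dots> < a" by (rule e)
      finally show ?case .
    qed
  qed simp
qed

lemma prob_union_le:
  assumes [measurable]: "U \<in> sets M" "V1 \<in> sets M" "V2 \<in> sets M" and sub: "U \<subseteq> V1 \<union> V2"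
  shows "prob U \<le> prob V1 + prob V2"
proof -
  have "prob U \<le> prob (V1 \<union> V2)" by (rule finite_measure_mono[OF sub]) measurable
  also have "\<dots> \<le> prob V1 + prob V2" by (rule measure_Un_le) auto
  finally show ?thesis .
qed

text \<open>The Ito integral is given only through some approximating simple integrands. On a common
  refinement, their integrals differ from the Riemann sums by a discrete integral whose quadratic
  variation is controlled by the two \<open>L^2\<close> defects in time. Both defects vanish in
  probability, and \<open>mart_lenglart\<close> converts this into convergence in probability of the
  sums, without moments of \<open>\<Phi>\<close>.\<close>

theorem ito_integral_riemann:
  fixes \<Phi> :: "real \<Rightarrow> 'w \<Rightarrow> real^'n^'m"
  assumes t: "0 \<le> t" and I: "ito_integral M F B \<Phi> t I" and c: "path_cont t \<Phi>"
    and g: "\<And>m. grid (k m) (\<tau> m)" "\<And>m. \<tau> m 0 = 0" "\<And>m. \<tau> m (k m) = t"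
    and mesh: "\<And>e. e > 0 \<Longrightarrow> eventually (\<lambda>m. \<forall>j<k m. \<tau> m (Suc j) - \<tau> m j < e) sequentially"
  shows "conv_prob (\<lambda>m. mart (\<tau> m) (\<lambda>j. \<Phi> (\<tau> m j)) (k m)) I"
proof -
  have jm: "(\<lambda>(s, om). \<Phi> s om) \<in> borel_measurable (restrict_space borel {0..t} \<Otimes>\<^sub>M M)"
    and ad: "\<And>s. s \<in> {0..t} \<Longrightarrow> \<Phi> s \<in> borel_measurable (F s)"
    and Im: "I \<in> borel_measurable M" using I by (auto simp: ito_integral_def)
  obtain n \<tau>' \<xi> where si: "\<And>i. simple_integrand M F (n i) (\<tau>' i) (\<xi> i)"
    and v1: "vanishes_in_prob M (\<lambda>i om.
          \<integral>\<^sup>+ s\<in>{0..t}. ennreal ((norm (simple_process (n i) (\<tau>' i) (\<xi> i) s om - \<Phi> s om))^2) \<partial>lborel)"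
    and v2: "vanishes_in_prob M (\<lambda>i om. ennreal (norm (simple_integral B (n i) (\<tau>' i) (\<xi> i) t om - I om)))"
    using I unfolding ito_integral_def by blast
  have step1: "step_integrand (n i) (\<tau>' i) (\<xi> i)" for i
    using si[of i] by (auto simp: simple_integrand_def step_integrand_def grid_def adapted_def)
  have rng: "\<tau> m j \<in> {0..t}" if "j \<le> k m" for m j
    using grid_mono[OF g(1)[of m], of j "k m"] grid_nonneg[OF g(1)[of m] that] that g(3)[of m] by auto
  have step2: "step_integrand (k m) (\<tau> m) (\<lambda>j. \<Phi> (\<tau> m j))" for m
    using g(1)[of m] ad rng by (auto simp: step_integrand_def adapted_def)
  have simart: "simple_integral B (k m) (\<tau> m) (\<lambda>j. \<Phi> (\<tau> m j)) t om = mart (\<tau> m) (\<lambda>j. \<Phi> (\<tau> m j)) (k m) om" for m om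
    unfolding simple_integral_def mart_def incr_def
  proof (intro sum.cong refl)
    fix j assume "j \<in> {..<k m}"
    then have "\<tau> m j \<le> t" "\<tau> m (Suc j) \<le> t" using rng[of j m] rng[of "Suc j" m] by auto
    then show "\<Phi> (\<tau> m j) om *v (B (min t (\<tau> m (Suc j))) om - B (min t (\<tau> m j)) om) =
      \<Phi> (\<tau> m j) om *v (B (\<tau> m (Suc j)) om - B (\<tau> m j) om)" by (simp add: min_absorb2)
  qed
  define S where "S = (\<lambda>m. mart (\<tau> m) (\<lambda>j. \<Phi> (\<tau> m j)) (k m))"
  define S' where "S' = (\<lambda>i. simple_integral B (n i) (\<tau>' i) (\<xi> i) t)"
  define Z where "Z = (\<lambda>m om. \<integral>\<^sup>+ s\<in>{0..t}. ennreal ((norm (frozen (k m) (\<tau> m) \<Phi> s om - \<Phi> s om))^2) \<partial>lborel)"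
  define Z' where "Z' = (\<lambda>i om. \<integral>\<^sup>+ s\<in>{0..t}. ennreal ((norm (simple_process (n i) (\<tau>' i) (\<xi> i) s om - \<Phi> s om))^2) \<partial>lborel)"
  have Sm [measurable]: "S m \<in> borel_measurable M" for m
    using simple_integral_meas[OF t step2[of m]] by (simp add: S_def simart[abs_def])
  have S'm [measurable]: "S' i \<in> borel_measurable M" for i
    unfolding S'_def by (rule simple_integral_meas[OF t step1])
  have jmdiff: "(\<lambda>(s, om). ennreal ((norm (simple_process N \<theta> \<zeta> s om - \<Phi> s om))^2)) \<in> borel_measurable (restrict_space borel {0..t} \<Otimes>\<^sub>M M)"
    if "step_integrand N \<theta> \<zeta>" for N \<theta> and \<zeta> :: "nat \<Rightarrow> 'w \<Rightarrow> real^'n^'m"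
  proof -
    have "(\<lambda>(s, om). simple_process N \<theta> \<zeta> s om) \<in> borel_measurable (borel \<Otimes>\<^sub>M M)"
      using that F_meas by (intro simple_process_jmeas) (auto simp: step_integrand_def adapted_def)
    moreover have "(\<lambda>x. x) \<in> (restrict_space borel {0..t} \<Otimes>\<^sub>M M) \<rightarrow>\<^sub>M (borel \<Otimes>\<^sub>M M)"
    proof -
      have "(\<lambda>x. (fst x, snd x)) \<in> (restrict_space borel {0..t} \<Otimes>\<^sub>M M) \<rightarrow>\<^sub>M (borel \<Otimes>\<^sub>M M)"
      proof (rule measurable_Pair)
        have "(\<lambda>s. s) \<in> restrict_space borel {0..t} \<rightarrow>\<^sub>M borel" by (rule measurable_restrict_space1) auto
        show "fst \<in> (restrict_space borel {0..t} \<Otimes>\<^sub>M M) \<rightarrow>\<^sub>M borel"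
          by (rule measurable_compose[OF measurable_fst \<open>(\<lambda>s. s) \<in> _\<close>])
      qed simp
      then show ?thesis by simp
    qed
    ultimately have "(\<lambda>(s, om). simple_process N \<theta> \<zeta> s om) \<in> borel_measurable (restrict_space borel {0..t} \<Otimes>\<^sub>M M)"
      using measurable_compose by blast
    then show ?thesis using jm unfolding split_beta' by measurable
  qed
  have Zm [measurable]: "Z m \<in> borel_measurable M" for m
    unfolding Z_def by (intro nn_integral_time_meas jmdiff step2)
  have Z'm [measurable]: "Z' i \<in> borel_measurable M" for i
    unfolding Z'_def by (intro nn_integral_time_meas jmdiff step1)
  have Zlim: "(\<lambda>m. prob {om \<in> space M. Z m om > ennreal d}) \<longlonglongrightarrow> 0" if "0 < d" for d
  proof (rule prob_tendsto_0[OF Zm _ that])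
    fix om assume "om \<in> space M"
    then have "continuous_on {0..t} (\<lambda>s. \<Phi> s om)" using c by (simp add: path_cont_def)
    from riemann_defect_tendsto[where k=k and \<tau>=\<tau> and \<Phi>=\<Phi> and om=om, OF t this g mesh]
    show "(\<lambda>m. Z m om) \<longlonglongrightarrow> 0" unfolding Z_def by simp
  qed
  \<comment> \<open>\<open>Z\<close> and \<open>Z'\<close> are the \<open>L^2\<close> defects of the
    two approximations. If the quadratic variation exceeds \<open>d\<close>, then
    \<open>2 * Z + 2 * Z' > d\<close>, so one of the defects exceeds \<open>d / 4\<close>; the
    radius \<open>e\<close> is split evenly.\<close>
  have bound: "prob {om \<in> space M. norm (S m om - I om) > e} \<le>
     prob {om \<in> space M. Z m om > ennreal (d/4)} + prob {om \<in> space M. Z' i om > ennreal (d/4)} + d / (e/2)^2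
     + prob {om \<in> space M. ennreal (norm (S' i om - I om)) > ennreal (e / 2)}" if e: "0 < e" and d: "0 < d" for e d m i
  proof -
    note [measurable] = Im
    obtain K \<pi> where r: "refines t K \<pi> (k m) (\<tau> m)" and r': "refines t K \<pi> (n i) (\<tau>' i)"
      using ex_refines[OF t, of "\<tau> m" "k m" "\<tau>' i" "n i"] step1[of i] step2[of m]
      by (auto simp: step_integrand_def grid_def)
    define D where "D = (\<lambda>j om. frozen (k m) (\<tau> m) \<Phi> (\<pi> (Suc j)) om - simple_process (n i) (\<tau>' i) (\<xi> i) (\<pi> (Suc j)) om)"
    note A1 = refine_adapted[OF r step2] and A2 = refine_adapted[OF r' step1]
    have Da: "adapted K \<pi> D" using A1(2) A2(2) unfolding D_def adapted_def by (auto intro: borel_measurable_diff)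
    have SD: "S m om - S' i om = mart \<pi> D K om" for om
      unfolding S_def S'_def simart[symmetric] simple_integral_refine[OF r] simple_integral_refine[OF r']
      by (simp add: mart_def D_def sum_subtractf matrix_vector_mult_diff_rdistrib)
    have Dm: "D j \<in> borel_measurable M" if "j < K" for j using Da that F_meas by (auto simp: adapted_def)
    have Qm [measurable]: "(\<lambda>om. \<Sum>j<K. (\<pi> (Suc j) - \<pi> j) * (norm (D j om))^2) \<in> borel_measurable M"
    proof (intro borel_measurable_sum)
      fix j assume "j \<in> {..<K}"
      then have [measurable]: "D j \<in> borel_measurable M" using Dm by auto
      show "(\<lambda>om. (\<pi> (Suc j) - \<pi> j) * (norm (D j om))^2) \<in> borel_measurable M" by measurable
    qed
    have "e / 2 > 0" using e by simp
    from mart_lenglart[OF A1(1) Da this d]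
    have 1: "prob {om \<in> space M. norm (S m om - S' i om) > e / 2} \<le> prob {om \<in> space M. (\<Sum>j<K. (\<pi> (Suc j) - \<pi> j) * (norm (D j om))^2) > d} + d / (e/2)^2"
      unfolding SD .
    have 2: "prob {om \<in> space M. (\<Sum>j<K. (\<pi> (Suc j) - \<pi> j) * (norm (D j om))^2) > d}
       \<le> prob {om \<in> space M. Z m om > ennreal (d/4)} + prob {om \<in> space M. Z' i om > ennreal (d/4)}"
    proof (rule prob_union_le)
      show "{om \<in> space M. (\<Sum>j<K. (\<pi> (Suc j) - \<pi> j) * (norm (D j om))^2) > d} \<subseteq> {om \<in> space M. Z m om > ennreal (d/4)} \<union> {om \<in> space M. Z' i om > ennreal (d/4)}"
      proof
        fix om assume w: "om \<in> {om \<in> space M. (\<Sum>j<K. (\<pi> (Suc j) - \<pi> j) * (norm (D j om))^2) > d}"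
        then have ws: "om \<in> space M" by simp
        have cont: "continuous_on {0..t} (\<lambda>s. \<Phi> s om)" using c ws by (simp add: path_cont_def)
        \<comment> \<open>Additivity of the time integral needs measurable paths, which continuity
          on \<open>[0, t]\<close> provides.\<close>
        have mphi: "(\<lambda>s. indicator {0..t} s *\<^sub>R \<Phi> s om) \<in> borel_measurable borel"
          by (rule borel_measurable_continuous_on_indicator[OF _ cont]) auto
        have mdiff: "(\<lambda>s. ennreal ((norm (simple_process N \<theta> \<zeta> s om - \<Phi> s om))^2) * indicator {0..t} s) \<in> borel_measurable borel"
          for N \<theta> and \<zeta> :: "nat \<Rightarrow> 'w \<Rightarrow> real^'n^'m"
        proof -
          have "(\<lambda>s. ennreal ((norm (simple_process N \<theta> \<zeta> s om - \<Phi> s om))^2) * indicator {0..t} s) =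
            (\<lambda>s. ennreal ((norm (simple_process N \<theta> \<zeta> s om - indicator {0..t} s *\<^sub>R \<Phi> s om))^2) * indicator {0..t} s)"
            by (auto simp: fun_eq_iff indicator_def)
          also have "\<dots> \<in> borel_measurable borel"
            using mphi unfolding simple_process_def by measurable
          finally show ?thesis .
        qed
        have "ennreal d < ennreal (\<Sum>j<K. (\<pi> (Suc j) - \<pi> j) * (norm (D j om))^2)"
          using w d by (simp add: ennreal_less_iff)
        also have "\<dots> \<le> (\<integral>\<^sup>+ s\<in>{0..t}. ennreal ((norm (frozen (k m) (\<tau> m) \<Phi> s om - simple_process (n i) (\<tau>' i) (\<xi> i) s om))^2) \<partial>lborel)"
          unfolding D_def by (rule step_sum_le_integral[OF r r'])
        also have "\<dots> \<le> (\<integral>\<^sup>+ s. 2 * (ennreal ((norm (frozen (k m) (\<tau> m) \<Phi> s om - \<Phi> s om))^2) * indicator {0..t} s)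
            + 2 * (ennreal ((norm (simple_process (n i) (\<tau>' i) (\<xi> i) s om - \<Phi> s om))^2) * indicator {0..t} s) \<partial>lborel)"
        proof (rule nn_integral_mono)
          fix s
          have "(norm (x - y))^2 \<le> 2 * (norm (x - z))^2 + 2 * (norm (y - z))^2" for x y z :: "real^'n^'m"
          proof -
            have "norm (x - y) \<le> norm (x - z) + norm (y - z)" by (metis norm_triangle_sub norm_minus_commute norm_triangle_ineq4 diff_diff_eq2 add.commute diff_add_cancel)
            then have "(norm (x - y))^2 \<le> (norm (x - z) + norm (y - z))^2" by (intro power_mono) auto
            also have "\<dots> \<le> 2 * (norm (x - z))^2 + 2 * (norm (y - z))^2"
              using sum_squares_bound[of "norm (x - z)" "norm (y - z)"] by (simp add: power2_sum)
            finally show ?thesis .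
          qed
          then have "ennreal ((norm (x - y))^2) \<le> 2 * ennreal ((norm (x - z))^2) + 2 * ennreal ((norm (y - z))^2)" for x y z :: "real^'n^'m"
            by (metis (mono_tags, lifting) ennreal_leI ennreal_mult' ennreal_numeral ennreal_plus mult_nonneg_nonneg zero_le_numeral zero_le_power2)
          then show "ennreal ((norm (frozen (k m) (\<tau> m) \<Phi> s om - simple_process (n i) (\<tau>' i) (\<xi> i) s om))^2) * indicator {0..t} s \<le>
            2 * (ennreal ((norm (frozen (k m) (\<tau> m) \<Phi> s om - \<Phi> s om))^2) * indicator {0..t} s)
            + 2 * (ennreal ((norm (simple_process (n i) (\<tau>' i) (\<xi> i) s om - \<Phi> s om))^2) * indicator {0..t} s)"
            by (auto simp: indicator_def)
        qed
        also have "\<dots> = 2 * Z m om + 2 * Z' i om"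
          using mdiff unfolding Z_def Z'_def by (simp add: nn_integral_add nn_integral_cmult)
        finally have big: "ennreal d < 2 * Z m om + 2 * Z' i om" .
        show "om \<in> {om \<in> space M. Z m om > ennreal (d/4)} \<union> {om \<in> space M. Z' i om > ennreal (d/4)}"
        proof (rule ccontr)
          assume "\<not> ?thesis"
          then have "Z m om \<le> ennreal (d/4)" "Z' i om \<le> ennreal (d/4)" using ws by auto
          then have "2 * Z m om + 2 * Z' i om \<le> 2 * ennreal (d/4) + 2 * ennreal (d/4)"
            by (intro add_mono mult_left_mono) auto
          also have "\<dots> = ennreal d"
            using d by (simp add: ennreal_mult''[symmetric] flip: ennreal_numeral ennreal_mult ennreal_plus)
          finally show False using big by simp
        qed
      qed
    qed measurable
    have 3: "prob {om \<in> space M. norm (S m om - I om) > e} \<le> prob {om \<in> space M. norm (S m om - S' i om) > e / 2} + prob {om \<in> space M. ennreal (norm (S' i om - I om)) > ennreal (e / 2)}"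
    proof (rule prob_union_le)
      show "{om \<in> space M. norm (S m om - I om) > e} \<subseteq> {om \<in> space M. norm (S m om - S' i om) > e / 2} \<union> {om \<in> space M. ennreal (norm (S' i om - I om)) > ennreal (e / 2)}"
      proof
        fix om assume w: "om \<in> {om \<in> space M. norm (S m om - I om) > e}"
        have "norm (S m om - I om) \<le> norm (S m om - S' i om) + norm (S' i om - I om)"
          using norm_triangle_ineq[of "S m om - S' i om" "S' i om - I om"] by simp
        then have "norm (S m om - S' i om) > e / 2 \<or> norm (S' i om - I om) > e / 2" using w by auto
        then show "om \<in> {om \<in> space M. norm (S m om - S' i om) > e / 2} \<union> {om \<in> space M. ennreal (norm (S' i om - I om)) > ennreal (e / 2)}"
          using w e by (auto simp: ennreal_less_iff)
      qed
    qed measurable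
    show ?thesis using 1 2 3 by linarith
  qed
  show ?thesis
    unfolding conv_prob_def S_def[symmetric]
  proof (intro allI impI)
    fix e :: real assume e: "0 < e"
    show "(\<lambda>m. prob {om \<in> space M. norm (S m om - I om) > e}) \<longlonglongrightarrow> 0"
    proof (rule LIMSEQ_I)
      fix r :: real assume r: "0 < r"
      \<comment> \<open>Makes the Lenglart term equal to \<open>r / 4\<close>. The index
        \<open>i\<close> of the simple integrand is fixed before \<open>m\<close> is sent to
        infinity, and the four terms of \<open>bound\<close> receive a quarter of \<open>r\<close>
        each.\<close>
      define d where "d = r / 4 * (e/2)^2"
      have d: "0 < d" "d / (e/2)^2 = r / 4" using r e by (auto simp: d_def)
      have "(\<lambda>i. prob {om \<in> space M. Z' i om > ennreal (d/4)}) \<longlonglongrightarrow> 0"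
        using v1 d unfolding vanishes_in_prob_def Z'_def by auto
      then have e1: "eventually (\<lambda>i. prob {om \<in> space M. Z' i om > ennreal (d/4)} < r / 4) sequentially"
        using r by (intro order_tendstoD) auto
      have "(\<lambda>i. prob {om \<in> space M. ennreal (norm (S' i om - I om)) > ennreal (e / 2)}) \<longlonglongrightarrow> 0"
        using v2 e unfolding vanishes_in_prob_def S'_def by auto
      then have e2: "eventually (\<lambda>i. prob {om \<in> space M. ennreal (norm (S' i om - I om)) > ennreal (e / 2)} < r / 4) sequentially"
        using r by (intro order_tendstoD) auto
      obtain i where i: "prob {om \<in> space M. Z' i om > ennreal (d/4)} < r / 4"
        "prob {om \<in> space M. ennreal (norm (S' i om - I om)) > ennreal (e / 2)} < r / 4"
        using eventually_happens[OF eventually_conj[OF e1 e2]] by auto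
      have "eventually (\<lambda>m. prob {om \<in> space M. Z m om > ennreal (d/4)} < r / 4) sequentially"
        using Zlim[of "d/4"] d r by (intro order_tendstoD) auto
      then obtain N where N: "\<And>m. m \<ge> N \<Longrightarrow> prob {om \<in> space M. Z m om > ennreal (d/4)} < r / 4"
        unfolding eventually_sequentially by auto
      show "\<exists>no. \<forall>m\<ge>no. norm (prob {om \<in> space M. norm (S m om - I om) > e} - 0) < r"
      proof (intro exI allI impI)
        fix m assume "N \<le> m"
        from N[OF this] i bound[OF e d(1), of m i] d(2)
        show "norm (prob {om \<in> space M. norm (S m om - I om) > e} - 0) < r" by simp
      qed
    qed
  qed
qed

text \<open>Convergence in probability gives \<open>L^1\<close> convergence of the truncated
  distance \<open>min 1 (norm (X m - Y))\<close>, hence almost sure convergence along a subsequence;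
  there the truncation is eventually inactive.\<close>

lemma conv_prob_subseq:
  fixes X :: "nat \<Rightarrow> 'w \<Rightarrow> 'b::{banach, second_countable_topology}"
  assumes c: "conv_prob X Y" and [measurable]: "\<And>m. X m \<in> borel_measurable M" "Y \<in> borel_measurable M"
  obtains r :: "nat \<Rightarrow> nat" where "strict_mono r" "AE om in M. (\<lambda>m. X (r m) om) \<longlonglongrightarrow> Y om"
proof -
  define u where "u = (\<lambda>m om. min 1 (norm (X m om - Y om)))"
  have [measurable]: "u m \<in> borel_measurable M" for m unfolding u_def by measurable
  have i: "integrable M (u m)" for m
    by (rule integrable_const_bound[where B = 1]) (auto simp: u_def)
  have "(\<lambda>m. \<integral>om. norm (u m om) \<partial>M) \<longlonglongrightarrow> 0"
  proof (rule LIMSEQ_I)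
    fix e :: real assume e: "0 < e"
    have "(\<lambda>m. prob {om \<in> space M. norm (X m om - Y om) > e / 2}) \<longlonglongrightarrow> 0"
      using c e unfolding conv_prob_def by (meson half_gt_zero)
    then have "eventually (\<lambda>m. prob {om \<in> space M. norm (X m om - Y om) > e / 2} < e / 2) sequentially"
      using e by (intro order_tendstoD(2)) auto
    then obtain N where N: "\<And>m. m \<ge> N \<Longrightarrow> prob {om \<in> space M. norm (X m om - Y om) > e / 2} < e / 2"
      unfolding eventually_sequentially by auto
    show "\<exists>no. \<forall>m\<ge>no. norm ((\<integral>om. norm (u m om) \<partial>M) - 0) < e"
    proof (intro exI allI impI)
      fix m assume m: "N \<le> m"
      have "(\<integral>om. norm (u m om) \<partial>M) \<le> (\<integral>om. e / 2 + indicator {om \<in> space M. norm (X m om - Y om) > e / 2} om \<partial>M)"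
      proof (rule integral_mono)
        show "integrable M (\<lambda>om. e / 2 + indicat_real {om \<in> space M. norm (X m om - Y om) > e / 2} om)"
          by (intro Bochner_Integration.integrable_add) (auto simp: integrable_indicator_iff less_top[symmetric])
        show "norm (u m om) \<le> e / 2 + indicat_real {om \<in> space M. norm (X m om - Y om) > e / 2} om" if "om \<in> space M" for om
          using that e by (auto simp: u_def indicator_def)
      qed (use i in auto)
      also have "\<dots> = e / 2 + prob {om \<in> space M. norm (X m om - Y om) > e / 2}"
        by (subst Bochner_Integration.integral_add) (auto simp: integrable_indicator_iff less_top[symmetric] prob_space Int_absorb2 subset_eq)
      also have "\<dots> < e" using N[OF m] by simp
      finally show "norm ((\<integral>om. norm (u m om) \<partial>M) - 0) < e"
        by (simp add: u_def)
    qed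
  qed
  from tendsto_L1_AE_subseq[OF i this] obtain r where r: "strict_mono r" "AE om in M. (\<lambda>m. u (r m) om) \<longlonglongrightarrow> 0"
    by auto
  from r(2) have "AE om in M. (\<lambda>m. X (r m) om) \<longlonglongrightarrow> Y om"
  proof eventually_elim
    case (elim om)
    have "eventually (\<lambda>m. u (r m) om < 1) sequentially" using elim by (rule order_tendstoD) simp
    then have "eventually (\<lambda>m. u (r m) om = norm (X (r m) om - Y om)) sequentially"
      by eventually_elim (auto simp: u_def)
    with elim have "(\<lambda>m. norm (X (r m) om - Y om)) \<longlonglongrightarrow> 0" by (rule Lim_transform_eventually)
    then show ?case by (simp add: LIM_zero_cancel tendsto_norm_zero_iff)
  qed
  with r(1) show ?thesis by (rule that)
qed

end

section \<open>Taylor expansions for functions of class \<open>C\<^sup>m\<close>\<close>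

text \<open>Multilinear form of a bound on \<open>deriv_ratios\<close>, free of division, so that it
  composes with Taylor's formula.\<close>

definition dbound :: "nat \<Rightarrow> real \<Rightarrow> ('a::euclidean_space \<Rightarrow> 'b::euclidean_space) \<Rightarrow> bool" where
  "dbound m K f \<longleftrightarrow> (\<forall>ks x. length ks = m \<longrightarrow> norm (iter_deriv f ks x) \<le> K * (\<Prod>k\<leftarrow>ks. norm k))"

lemma class_C_deriv:
  assumes "class_C m f" "length ks < m"
  shows "(iter_deriv f ks has_derivative (\<lambda>k. iter_deriv f (k # ks) x)) (at x)"
  using assms by (simp add: class_C_def frechet_derivative_works[symmetric])

lemma class_C_linear:
  assumes "class_C m f" "length ks < m"
  shows "linear (\<lambda>k. iter_deriv f (k # ks) x)"
  using class_C_deriv[OF assms, of x] has_derivative_linear by blast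

lemma class_C_cont:
  assumes "class_C m f" "length ks \<le> m"
  shows "continuous_on UNIV (iter_deriv f ks)"
proof (cases "length ks = m")
  case False
  then have "length ks < m" using assms(2) by simp
  then show ?thesis using class_C_deriv[OF assms(1)] by (metis continuous_at_imp_continuous_on has_derivative_continuous)
qed (use assms in \<open>auto simp: class_C_def\<close>)

text \<open>Linearity in the outer direction is that of the Frechet derivative. In the inner
  direction it results from differentiating the identities that express linearity of the first
  derivative, by uniqueness of derivatives.\<close>

lemma class_C_bilinear:
  assumes f: "class_C m f" and m: "2 \<le> m"
  shows "bilinear (\<lambda>k l. iter_deriv f [k, l] x)"
  unfolding bilinear_def
proof (intro conjI allI)
  show "linear (\<lambda>l. iter_deriv f [k, l] x)" for k
  proof
    have d: "(iter_deriv f [l] has_derivative (\<lambda>k. iter_deriv f [k, l] x)) (at x)" for l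
      using class_C_deriv[OF f, of "[l]"] m by auto
    have lin: "linear (\<lambda>l. iter_deriv f [l] y)" for y using class_C_linear[OF f, of "[]" y] m by auto
    fix l l'
    have "((\<lambda>y. iter_deriv f [l] y + iter_deriv f [l'] y) has_derivative (\<lambda>k. iter_deriv f [k, l] x + iter_deriv f [k, l'] x)) (at x)"
      by (intro derivative_intros d)
    moreover have "(\<lambda>y. iter_deriv f [l] y + iter_deriv f [l'] y) = iter_deriv f [l + l']"
      using linear_add[OF lin] by auto
    ultimately have "(\<lambda>k. iter_deriv f [k, l + l'] x) = (\<lambda>k. iter_deriv f [k, l] x + iter_deriv f [k, l'] x)"
      using d[of "l + l'"] has_derivative_unique by metis
    then show "iter_deriv f [k, l + l'] x = iter_deriv f [k, l] x + iter_deriv f [k, l'] x" by meson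
    fix c
    have "((\<lambda>y. c *\<^sub>R iter_deriv f [l] y) has_derivative (\<lambda>k. c *\<^sub>R iter_deriv f [k, l] x)) (at x)"
      by (intro derivative_intros d)
    moreover have "(\<lambda>y. c *\<^sub>R iter_deriv f [l] y) = iter_deriv f [c *\<^sub>R l]"
      using linear_scale[OF lin] by auto
    ultimately have "(\<lambda>k. iter_deriv f [k, c *\<^sub>R l] x) = (\<lambda>k. c *\<^sub>R iter_deriv f [k, l] x)"
      using d[of "c *\<^sub>R l"] has_derivative_unique by metis
    then show "iter_deriv f [k, c *\<^sub>R l] x = c *\<^sub>R iter_deriv f [k, l] x" by meson
  qed
  show "linear (\<lambda>k. iter_deriv f [k, l] x)" for l
    using class_C_linear[OF f, of "[l]" x] m by auto
qed

text \<open>Lets \<open>dbound\<close> range over all directions, although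
  \<open>deriv_ratios\<close> excludes zero ones.\<close>

lemma class_C_zero:
  assumes "class_C m f" "0 \<in> set ks" "length ks \<le> m"
  shows "iter_deriv f ks x = 0"
  using assms(2,3)
proof (induction ks arbitrary: x)
  case (Cons k ks)
  show ?case
  proof (cases "k = 0")
    case True
    have "length ks < m" using Cons.prems by simp
    from linear_0[OF class_C_linear[OF assms(1) this, of x]] show ?thesis using True by simp
  next
    case False
    then have "iter_deriv f ks = (\<lambda>x. 0)" using Cons by auto
    then show ?thesis by simp
  qed
qed simp

lemma dboundI:
  fixes f :: "'a::euclidean_space \<Rightarrow> 'b::euclidean_space"
  assumes f: "class_C n f" "m \<le> n" and K: "\<And>r. r \<in> deriv_ratios m f \<Longrightarrow> r \<le> K"
  shows "dbound m K f"
  unfolding dbound_def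
proof (intro allI impI)
  fix ks :: "'a list" and x assume len: "length ks = m"
  show "norm (iter_deriv f ks x) \<le> K * (\<Prod>k\<leftarrow>ks. norm k)"
  proof (cases "0 \<in> set ks")
    case True
    then have "(\<Prod>k\<leftarrow>ks. norm k) = 0" by (simp add: prod_list_zero_iff)
    then show ?thesis using class_C_zero[OF f(1) True] f(2) len by simp
  next
    case False
    have p: "0 < (\<Prod>k\<leftarrow>ks. norm k)" using False by (induction ks) auto
    have "norm (iter_deriv f ks x) / (\<Prod>k\<leftarrow>ks. norm k) \<le> K"
      by (rule K) (use len False in \<open>auto simp: deriv_ratios_def\<close>)
    then show ?thesis using p by (simp add: field_simps)
  qed
qed

lemma dbound_deriv_norm:
  assumes "class_C n f" "m \<le> n" "bounded_deriv m f"
  shows "dbound m (deriv_norm m f) f"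
  using assms by (intro dboundI[OF assms(1,2)]) (auto simp: deriv_norm_def bounded_deriv_def intro: cSup_upper)

text \<open>A real supremum is informative only for a nonempty set: a nonzero vector repeated
  \<open>m\<close> times supplies an element.\<close>

lemma deriv_norm_nonneg:
  fixes f :: "'a::euclidean_space \<Rightarrow> 'b::euclidean_space"
  assumes "bounded_deriv m f" shows "0 \<le> deriv_norm m f"
proof -
  obtain b :: 'a where "b \<noteq> 0" using nonzero_Basis SOME_Basis by blast
  then have "norm (iter_deriv f (replicate m b) 0) / (\<Prod>k\<leftarrow>replicate m b. norm k) \<in> deriv_ratios m f"
    unfolding deriv_ratios_def by (cases m) fastforce+
  moreover have "0 \<le> norm (iter_deriv f (replicate m b) 0) / (\<Prod>k\<leftarrow>replicate m b. norm k)"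
    by (intro divide_nonneg_nonneg prod_list_nonneg) auto
  ultimately show ?thesis unfolding deriv_norm_def
    using assms cSup_upper unfolding bounded_deriv_def by (meson order_trans)
qed

text \<open>Vector values are reduced to the scalar Maclaurin formula by pairing with the error
  \<open>e\<close> itself; the resulting bound on the square of \<open>norm e\<close> is then
  divided by \<open>norm e\<close>.\<close>

lemma taylor_bound:
  fixes f :: "'a::euclidean_space \<Rightarrow> 'b::euclidean_space"
  assumes f: "class_C N f" and len: "length ks + n \<le> N" and n: "0 < n" and K: "dbound (n + length ks) K f"
  shows "norm (iter_deriv f ks (x + d) - (\<Sum>m<n. (1 / fact m) *\<^sub>R iter_deriv f (replicate m d @ ks) x))
    \<le> K * (\<Prod>k\<leftarrow>ks. norm k) * norm d ^ n / fact n"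
proof -
  define e where "e = iter_deriv f ks (x + d) - (\<Sum>m<n. (1 / fact m) *\<^sub>R iter_deriv f (replicate m d @ ks) x)"
  define diff where "diff = (\<lambda>m s. iter_deriv f (replicate m d @ ks) (x + s *\<^sub>R d) \<bullet> e)"
  have D: "DERIV (diff m) s :> diff (Suc m) s" if "m < n" for m s
  proof -
    have l: "length (replicate m d @ ks) < N" using that len by simp
    have "((\<lambda>s. x + s *\<^sub>R d) has_derivative (\<lambda>r. r *\<^sub>R d)) (at s)"
      by (auto intro!: derivative_eq_intros)
    from has_derivative_compose[OF this class_C_deriv[OF f l]]
    have "((\<lambda>s. iter_deriv f (replicate m d @ ks) (x + s *\<^sub>R d)) has_derivative (\<lambda>r. iter_deriv f (r *\<^sub>R d # replicate m d @ ks) (x + s *\<^sub>R d))) (at s)" .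
    then have "(diff m has_derivative (\<lambda>r. iter_deriv f (r *\<^sub>R d # replicate m d @ ks) (x + s *\<^sub>R d) \<bullet> e)) (at s)"
      unfolding diff_def by (rule has_derivative_inner_left)
    moreover have "iter_deriv f (r *\<^sub>R d # replicate m d @ ks) (x + s *\<^sub>R d) = r *\<^sub>R iter_deriv f (replicate (Suc m) d @ ks) (x + s *\<^sub>R d)" for r
      using linear_scale[OF class_C_linear[OF f l]] by simp
    ultimately show ?thesis
      unfolding has_field_derivative_def diff_def by (simp add: mult_commute_abs)
  qed
  obtain t where t: "diff 0 1 = (\<Sum>m<n. diff m 0 / fact m * 1 ^ m) + diff n t / fact n * 1 ^ n"
    using Maclaurin[of 1 n diff "diff 0"] n D by auto
  have "e \<bullet> e = diff 0 1 - (\<Sum>m<n. diff m 0 / fact m)"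
    unfolding diff_def by (subst (2) e_def) (simp add: inner_diff_right inner_sum_right inner_commute)
  also have "\<dots> = diff n t / fact n" using t by simp
  also have "\<dots> \<le> norm (iter_deriv f (replicate n d @ ks) (x + t *\<^sub>R d)) * norm e / fact n"
    unfolding diff_def by (intro divide_right_mono norm_cauchy_schwarz) auto
  also have "\<dots> \<le> K * (\<Prod>k\<leftarrow>replicate n d @ ks. norm k) * norm e / fact n"
    using K[unfolded dbound_def, rule_format, of "replicate n d @ ks" "x + t *\<^sub>R d"]
    by (intro divide_right_mono mult_right_mono) auto
  finally have *: "norm e * norm e \<le> (K * (\<Prod>k\<leftarrow>ks. norm k) * norm d ^ n / fact n) * norm e"
    by (simp add: power2_norm_eq_inner[symmetric] power2_eq_square map_replicate_const prod_list_replicate ac_simps)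
  show ?thesis
  proof (cases "norm e = 0")
    case False
    then show ?thesis unfolding e_def[symmetric] by (intro mult_right_le_imp_le[OF *]) simp
  next
    case True
    have "0 \<le> norm (iter_deriv f (replicate n d @ ks) x)" by simp
    also have "\<dots> \<le> K * (\<Prod>k\<leftarrow>replicate n d @ ks. norm k)"
      using K[unfolded dbound_def, rule_format, of "replicate n d @ ks" x] by simp
    finally show ?thesis using True unfolding e_def[symmetric]
      by (simp add: map_replicate_const prod_list_replicate ac_simps)
  qed
qed

text \<open>Common interface for the gradient and for \<open>\<sigma> t\<close>. Derivatives enter
  as families of linear and bilinear maps with the estimates used below, all with one constant, in
  the format in which the expansions of test functions are propagated later.\<close>

definition smooth3 :: "real \<Rightarrow> ('a::euclidean_space \<Rightarrow> 'b::euclidean_space) \<Rightarrow> ('a \<Rightarrow> 'a \<Rightarrow> 'b) \<Rightarrow> ('a \<Rightarrow> 'a \<Rightarrow> 'a \<Rightarrow> 'b) \<Rightarrow> bool" where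
  "smooth3 K f f1 f2 \<longleftrightarrow> f \<in> borel_measurable borel \<and>
    (\<forall>k. (\<lambda>x. f1 x k) \<in> borel_measurable borel) \<and> (\<forall>k l. (\<lambda>x. f2 x k l) \<in> borel_measurable borel) \<and>
    (\<forall>x. linear (f1 x)) \<and> (\<forall>x. bilinear (f2 x)) \<and>
    (\<forall>x k. norm (f1 x k) \<le> K * norm k) \<and> (\<forall>x k l. norm (f2 x k l) \<le> K * norm k * norm l) \<and>
    (\<forall>x d. norm (f (x + d) - f x) \<le> K * norm d) \<and>
    (\<forall>x d k. norm (f1 (x + d) k - f1 x k) \<le> K * norm d * norm k) \<and>
    (\<forall>x d. norm (f (x + d) - f x - f1 x d - (1/2) *\<^sub>R f2 x d d) \<le> K * norm d ^ 3)"

lemma smooth3I: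
  fixes f :: "'a::euclidean_space \<Rightarrow> 'b::euclidean_space"
  assumes f: "class_C m f" and m: "3 \<le> m" and K: "0 \<le> K" and lip: "\<And>x y. norm (f y - f x) \<le> K * norm (y - x)"
    and d: "dbound 2 K f" "dbound 3 K f"
  shows "smooth3 K f (\<lambda>x k. iter_deriv f [k] x) (\<lambda>x k l. iter_deriv f [k, l] x)"
  unfolding smooth3_def
proof (intro conjI allI)
  have meas: "iter_deriv f ks \<in> borel_measurable borel" if "length ks \<le> 3" for ks
    using class_C_cont[OF f, of ks] that m by (intro borel_measurable_continuous_onI) auto
  show "f \<in> borel_measurable borel" using meas[of "[]"] by simp
  show "(\<lambda>x. iter_deriv f [k] x) \<in> borel_measurable borel" for k using meas[of "[k]"] by simp
  show "(\<lambda>x. iter_deriv f [k, l] x) \<in> borel_measurable borel" for k l using meas[of "[k, l]"] by simp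
  show l1: "linear (\<lambda>k. iter_deriv f [k] x)" for x using class_C_linear[OF f, of "[]" x] m by auto
  show "bilinear (\<lambda>k l. iter_deriv f [k, l] x)" for x using class_C_bilinear[OF f, of x] m by auto
  show "norm (iter_deriv f [k, l] x) \<le> K * norm k * norm l" for x k l
    using d(1)[unfolded dbound_def, rule_format, of "[k, l]" x] by (simp add: ac_simps)
  show "norm (f (x + d) - f x) \<le> K * norm d" for x d using lip[of "x + d" x] by simp
  show "norm (iter_deriv f [k] (x + d) - iter_deriv f [k] x) \<le> K * norm d * norm k" for x d k
    using taylor_bound[OF f, of "[k]" 1 K x d] d(1) m by (simp add: numeral_2_eq_2 ac_simps)
  show "norm (f (x + d) - f x - iter_deriv f [d] x - (1/2) *\<^sub>R iter_deriv f [d, d] x) \<le> K * norm d ^ 3" for x d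
  proof -
    have "norm (f (x + d) - (\<Sum>m<3. (1 / fact m) *\<^sub>R iter_deriv f (replicate m d) x)) \<le> K * norm d ^ 3 / fact 3"
      using taylor_bound[OF f, of "[]" 3 K x d] d(2) m by simp
    also have "\<dots> \<le> K * norm d ^ 3" using K by (simp add: fact_numeral field_simps)
    finally show ?thesis by (simp add: numeral_3_eq_3 algebra_simps)
  qed
  \<comment> \<open>The Lipschitz constant bounds the derivative: difference quotients along
    \<open>k\<close> are tested against the derivative itself.\<close>
  show "norm (iter_deriv f [k] x) \<le> K * norm k" for x k
  proof -
    have "(iter_deriv f [] has_derivative (\<lambda>k. iter_deriv f [k] x)) (at x)"
      using class_C_deriv[OF f, of "[]" x] m by simp
    then have fd: "(f has_derivative (\<lambda>k. iter_deriv f [k] x)) (at (x + 0 *\<^sub>R k))" by simp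
    have "((\<lambda>s. x + s *\<^sub>R k) has_derivative (\<lambda>r. r *\<^sub>R k)) (at 0)"
      by (auto intro!: derivative_eq_intros)
    from has_derivative_compose[OF this fd]
    have "((\<lambda>s. f (x + s *\<^sub>R k)) has_derivative (\<lambda>r. r *\<^sub>R iter_deriv f [k] x)) (at 0)"
      using linear_scale[OF l1] by simp
    then have "((\<lambda>s. f (x + s *\<^sub>R k) \<bullet> iter_deriv f [k] x) has_derivative (\<lambda>r. r *\<^sub>R iter_deriv f [k] x \<bullet> iter_deriv f [k] x)) (at 0)"
      by (rule has_derivative_inner_left)
    then have "DERIV (\<lambda>s. f (x + s *\<^sub>R k) \<bullet> iter_deriv f [k] x) 0 :> (norm (iter_deriv f [k] x))^2"
      by (simp add: has_field_derivative_def mult_commute_abs power2_norm_eq_inner)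
    then have lim: "((\<lambda>s. (f (x + s *\<^sub>R k) \<bullet> iter_deriv f [k] x - f x \<bullet> iter_deriv f [k] x) / s) \<longlongrightarrow> (norm (iter_deriv f [k] x))^2) (at 0)"
      by (simp add: DERIV_def)
    have b: "(f (x + s *\<^sub>R k) \<bullet> iter_deriv f [k] x - f x \<bullet> iter_deriv f [k] x) / s \<le> K * norm k * norm (iter_deriv f [k] x)" if "s \<noteq> 0" for s
    proof -
      have "\<bar>(f (x + s *\<^sub>R k) - f x) \<bullet> iter_deriv f [k] x\<bar> \<le> norm (f (x + s *\<^sub>R k) - f x) * norm (iter_deriv f [k] x)"
        by (rule Cauchy_Schwarz_ineq2)
      also have "\<dots> \<le> K * norm (s *\<^sub>R k) * norm (iter_deriv f [k] x)"
        using lip[of "x + s *\<^sub>R k" x] by (intro mult_right_mono) auto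
      finally have "\<bar>(f (x + s *\<^sub>R k) - f x) \<bullet> iter_deriv f [k] x\<bar> / \<bar>s\<bar> \<le> K * norm k * norm (iter_deriv f [k] x)"
        using that by (simp add: field_simps)
      moreover have "(f (x + s *\<^sub>R k) \<bullet> iter_deriv f [k] x - f x \<bullet> iter_deriv f [k] x) / s \<le> \<bar>(f (x + s *\<^sub>R k) - f x) \<bullet> iter_deriv f [k] x\<bar> / \<bar>s\<bar>"
        unfolding abs_divide[symmetric] inner_diff_left by (rule abs_ge_self)
      ultimately show ?thesis by linarith
    qed
    have "(norm (iter_deriv f [k] x))^2 \<le> K * norm k * norm (iter_deriv f [k] x)"
      by (rule tendsto_upperbound[OF lim]) (use b in \<open>auto simp: eventually_at_filter\<close>)
    then show ?thesis using K
      by (cases "norm (iter_deriv f [k] x) = 0") (auto simp: power2_eq_square mult_le_cancel_right)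
  qed
qed

section \<open>The gradient\<close>

lemma gderiv_unique:
  assumes "GDERIV f x :> D" "GDERIV f x :> D'" shows "D = D'"
proof -
  have "(\<lambda>h. h \<bullet> D) = (\<lambda>h. h \<bullet> D')" using assms has_derivative_unique unfolding gderiv_def by blast
  then have "(D - D') \<bullet> (D - D') = 0" by (simp add: inner_diff_right fun_eq_iff)
  then show ?thesis by simp
qed

lemma gradI: "GDERIV f x :> D \<Longrightarrow> grad f x = D"
  unfolding grad_def by (rule the_equality) (auto intro: gderiv_unique)

lemma grad_gderiv:
  fixes f :: "'a::euclidean_space \<Rightarrow> real"
  assumes "class_C m f" "1 \<le> m"
  shows "GDERIV f x :> grad f x" "grad f x \<bullet> k = iter_deriv f [k] x"
proof -
  have d: "(f has_derivative (\<lambda>k. iter_deriv f [k] x)) (at x)"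
    using class_C_deriv[OF assms(1), of "[]" x] assms(2) by simp
  have lin: "linear (\<lambda>k. iter_deriv f [k] x)" using class_C_linear[OF assms(1), of "[]" x] assms(2) by simp
  \<comment> \<open>The Riesz vector of the derivative.\<close>
  define D where "D = (\<Sum>b\<in>Basis. iter_deriv f [b] x *\<^sub>R b)"
  have D: "iter_deriv f [k] x = k \<bullet> D" for k
  proof -
    have "iter_deriv f [k] x = iter_deriv f [\<Sum>b\<in>Basis. (k \<bullet> b) *\<^sub>R b] x" by (simp add: euclidean_representation)
    also have "\<dots> = (\<Sum>b\<in>Basis. (k \<bullet> b) * iter_deriv f [b] x)"
      by (subst linear_sum[OF lin]) (simp only: linear_scale[OF lin] real_scaleR_def)
    also have "\<dots> = k \<bullet> D" by (simp add: D_def inner_sum_right mult.commute)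
    finally show ?thesis .
  qed
  have g: "GDERIV f x :> D" using d unfolding gderiv_def D[abs_def] .
  then have e: "grad f x = D" by (rule gradI)
  show "GDERIV f x :> grad f x" using g e by simp
  show "grad f x \<bullet> k = iter_deriv f [k] x" using D e by (simp add: inner_commute)
qed

text \<open>\<open>iter_deriv\<close> differentiates along the last list entry first, so the
  direction that is paired with the gradient appears at the end of the list.\<close>

lemma iter_deriv_grad:
  fixes f :: "'a::euclidean_space \<Rightarrow> real"
  assumes f: "class_C m f" and len: "length ks < m"
  shows "iter_deriv (grad f) ks x \<bullet> v = iter_deriv f (ks @ [v]) x"
  using len
proof (induction ks arbitrary: x v)
  case Nil then show ?case using grad_gderiv(2)[OF f] by simp
next
  case (Cons k ks)
  have len: "length ks < m" "length (ks @ [v]) < m" for v using Cons.prems by auto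
  have IH: "(\<lambda>x. iter_deriv (grad f) ks x \<bullet> v) = iter_deriv f (ks @ [v])" for v
    using Cons.IH len by auto
  have d: "iter_deriv (grad f) ks differentiable (at x)"
    unfolding differentiable_componentwise_within[of "iter_deriv (grad f) ks"] IH
    using f len unfolding class_C_def by auto
  then have "(iter_deriv (grad f) ks has_derivative frechet_derivative (iter_deriv (grad f) ks) (at x)) (at x)"
    by (simp add: frechet_derivative_works)
  from has_derivative_inner_left[OF this, of v]
  have "(iter_deriv f (ks @ [v]) has_derivative (\<lambda>k. frechet_derivative (iter_deriv (grad f) ks) (at x) k \<bullet> v)) (at x)"
    unfolding IH .
  from frechet_derivative_at[OF this, symmetric] show ?case by (simp add: fun_eq_iff)
qed

lemma class_C_grad:
  fixes f :: "'a::euclidean_space \<Rightarrow> real"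
  assumes f: "class_C (Suc m) f"
  shows "class_C m (grad f)"
  unfolding class_C_def
proof (intro conjI allI impI)
  have IH: "(\<lambda>x. iter_deriv (grad f) ks x \<bullet> v) = iter_deriv f (ks @ [v])" if "length ks < Suc m" for ks v
    using iter_deriv_grad[OF f that] by auto
  show "iter_deriv (grad f) ks differentiable at x" if "length ks < m" for ks x
    unfolding differentiable_componentwise_within[of "iter_deriv (grad f) ks"]
    using IH[of ks] f that unfolding class_C_def by auto
  show "continuous_on UNIV (iter_deriv (grad f) ks)" if "length ks = m" for ks
    unfolding continuous_on_componentwise[of UNIV "iter_deriv (grad f) ks"]
  proof
    fix i :: 'a
    have "length ks < Suc m" using that by simp
    have "continuous_on UNIV (iter_deriv f (ks @ [i]))"
      using class_C_cont[OF f, of "ks @ [i]"] that by simp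
    then show "continuous_on UNIV (\<lambda>x. iter_deriv (grad f) ks x \<bullet> i)"
      by (subst IH[OF \<open>length ks < Suc m\<close>])
  qed
qed

text \<open>Testing against the derivative vector itself transfers the bound from the scalar
  derivatives of one order more.\<close>

lemma dbound_grad:
  fixes f :: "'a::euclidean_space \<Rightarrow> real"
  assumes f: "class_C n f" and d: "dbound (Suc m) K f" and m: "m < n"
  shows "dbound m K (grad f)"
  unfolding dbound_def
proof (intro allI impI)
  fix ks :: "'a list" and x assume len: "length ks = m"
  define v where "v = iter_deriv (grad f) ks x"
  have "v \<bullet> v = iter_deriv f (ks @ [v]) x" unfolding v_def using iter_deriv_grad[OF f] len m by blast
  also have "\<dots> \<le> K * (\<Prod>k\<leftarrow>ks @ [v]. norm k)"
    using d[unfolded dbound_def, rule_format, of "ks @ [v]" x] len by simp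
  finally have *: "norm v * norm v \<le> K * (\<Prod>k\<leftarrow>ks. norm k) * norm v"
    by (simp add: power2_norm_eq_inner[symmetric] power2_eq_square)
  have nn: "0 \<le> K * (\<Prod>k\<leftarrow>ks. norm k)"
  proof -
    obtain b :: 'a where b: "b \<in> Basis" using SOME_Basis by blast
    have "0 \<le> norm (iter_deriv f (ks @ [b]) x)" by simp
    also have "\<dots> \<le> K * (\<Prod>k\<leftarrow>ks @ [b]. norm k)"
      using d[unfolded dbound_def, rule_format, of "ks @ [b]" x] len by simp
    finally show ?thesis using b by simp
  qed
  show "norm (iter_deriv (grad f) ks x) \<le> K * (\<Prod>k\<leftarrow>ks. norm k)"
    using * nn unfolding v_def[symmetric] by (cases "norm v = 0") (auto simp: mult_le_cancel_right)
qed

text \<open>Both sides are read off from the second difference of \<open>f\<close>, which is symmetric in \<open>k\<close> and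
  \<open>l\<close>, up to an error of third order; scaling \<open>k\<close> and \<open>l\<close> removes the error.\<close>

lemma hessian_symmetric:
  fixes f :: "'a::euclidean_space \<Rightarrow> real"
  assumes f: "class_C m f" and m: "3 \<le> m" and K: "dbound 3 K f"
  shows "iter_deriv f [k, l] x = iter_deriv f [l, k] x"
proof -
  define H where "H = (\<lambda>x k l. iter_deriv f [k, l] x)"
  have bil: "bilinear (H x)" for x unfolding H_def using class_C_bilinear[OF f] m by auto
  have K0: "0 \<le> K"
  proof -
    obtain b :: 'a where b: "b \<in> Basis" using SOME_Basis by blast
    have "0 \<le> norm (iter_deriv f [b, b, b] 0)" by simp
    also have "\<dots> \<le> K" using K[unfolded dbound_def, rule_format, of "[b, b, b]" 0] b by simp
    finally show ?thesis .
  qed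
  have t3: "\<bar>f (x + d) - f x - iter_deriv f [d] x - H x d d / 2\<bar> \<le> K * norm d ^ 3" for x d
  proof -
    have "\<bar>f (x + d) - (\<Sum>m<3. (1 / fact m) *\<^sub>R iter_deriv f (replicate m d) x)\<bar> \<le> K * norm d ^ 3 / fact 3"
      using taylor_bound[OF f, of "[]" 3 K x d] K m by simp
    also have "\<dots> \<le> K * norm d ^ 3" using K0 by (simp add: fact_numeral field_simps)
    finally show ?thesis by (simp add: numeral_3_eq_3 H_def algebra_simps)
  qed
  have t2: "\<bar>iter_deriv f [l] (x + k) - iter_deriv f [l] x - H x k l\<bar> \<le> K * norm l * (norm k)^2" for x k l
  proof -
    have "\<bar>iter_deriv f [l] (x + k) - (\<Sum>m<2. (1 / fact m) *\<^sub>R iter_deriv f (replicate m k @ [l]) x)\<bar> \<le> K * norm l * norm k ^ 2 / fact 2"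
      using taylor_bound[OF f, of "[l]" 2 K x k] K m by (simp add: numeral_3_eq_3 numeral_2_eq_2)
    also have "\<dots> \<le> K * norm l * norm k ^ 2" using K0 by (simp add: fact_numeral field_simps)
    finally show ?thesis by (simp add: numeral_2_eq_2 H_def algebra_simps)
  qed
  have t1: "\<bar>H (x + k) l l - H x l l\<bar> \<le> K * (norm l)^2 * norm k" for x k l
    using taylor_bound[OF f, of "[l, l]" 1 K x k] K m by (simp add: H_def numeral_3_eq_3 power2_eq_square ac_simps)
  \<comment> \<open>Four error terms enter, each at most \<open>K * (norm k + norm l) ^ 3\<close>:
    two from \<open>t3\<close>, one from \<open>t2\<close>, and half of one from
    \<open>t1\<close>.\<close>
  have key: "\<bar>(f (x + k + l) - f (x + k) - f (x + l) + f x) - H x k l\<bar> \<le> 4 * K * (norm k + norm l) ^ 3" for k l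
  proof -
    have e: "norm l \<le> norm k + norm l" "norm k \<le> norm k + norm l" by auto
    have 1: "K * norm l ^ 3 \<le> K * (norm k + norm l) ^ 3" using K0 by (intro mult_left_mono power_mono e) auto
    have "norm l * (norm k)^2 \<le> (norm k + norm l) * (norm k + norm l)^2" by (intro mult_mono power_mono e) auto
    then have "K * (norm l * (norm k)^2) \<le> K * (norm k + norm l) ^ 3" using K0 by (intro mult_left_mono) (auto simp: power3_eq_cube power2_eq_square)
    then have 2: "K * norm l * (norm k)^2 \<le> K * (norm k + norm l) ^ 3" by (simp add: mult.assoc)
    have "(norm l)^2 * norm k \<le> (norm k + norm l)^2 * (norm k + norm l)" by (intro mult_mono power_mono e) auto
    then have "K * ((norm l)^2 * norm k) \<le> K * (norm k + norm l) ^ 3" using K0 by (intro mult_left_mono) (auto simp: power3_eq_cube power2_eq_square)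
    then have 3: "K * (norm l)^2 * norm k \<le> K * (norm k + norm l) ^ 3" by (simp add: mult.assoc)
    show ?thesis using t3[of "x + k" l] t3[of x l] t2[of l x k] t1[of x k l] 1 2 3
      by (simp add: abs_if split: if_splits)
  qed
  have "\<bar>H x k l - H x l k\<bar> = 0"
  proof (rule ccontr)
    assume "\<not> ?thesis"
    then have pos: "0 < \<bar>H x k l - H x l k\<bar>" by simp
    define c where "c = 8 * K * (norm k + norm l) ^ 3"
    have c0: "0 \<le> c" unfolding c_def using K0 by simp
    have "s * \<bar>H x k l - H x l k\<bar> \<le> s * (s * c)" if s: "0 < s" for s
    proof -
      have "H x (s *\<^sub>R k) (s *\<^sub>R l) = s * s * H x k l" "H x (s *\<^sub>R l) (s *\<^sub>R k) = s * s * H x l k"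
        using bil[of x] by (simp_all add: bilinear_lmul bilinear_rmul)
      moreover have "f (x + s *\<^sub>R l + s *\<^sub>R k) = f (x + s *\<^sub>R k + s *\<^sub>R l)" by (simp add: ac_simps)
      ultimately have "\<bar>s * s * H x k l - s * s * H x l k\<bar> \<le> 8 * K * (norm (s *\<^sub>R k) + norm (s *\<^sub>R l)) ^ 3"
        using key[of "s *\<^sub>R k" "s *\<^sub>R l"] key[of "s *\<^sub>R l" "s *\<^sub>R k"] by (simp add: add.commute)
      also have "norm (s *\<^sub>R k) + norm (s *\<^sub>R l) = s * (norm k + norm l)" using s by (simp add: algebra_simps)
      finally have "\<bar>s * s * (H x k l - H x l k)\<bar> \<le> s * s * (s * c)"
        by (simp add: c_def power_mult_distrib power3_eq_cube algebra_simps)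
      then have "s * (s * \<bar>H x k l - H x l k\<bar>) \<le> s * (s * (s * c))" using s by (simp add: abs_mult mult.assoc)
      then show ?thesis using s by (simp add: mult_le_cancel_left)
    qed
    then have "\<bar>H x k l - H x l k\<bar> \<le> s * c" if "0 < s" for s using that by (simp add: mult_le_cancel_left)
    \<comment> \<open>A scale at which the right-hand side falls below the supposedly positive
      left-hand side.\<close>
    from this[of "\<bar>H x k l - H x l k\<bar> / (2 * (c + 1))"] pos c0
    show False by (simp add: field_simps) (smt (verit) mult_pos_pos mult_nonneg_nonneg)
  qed
  then show ?thesis by (simp add: H_def)
qed

section \<open>The coefficients of the scheme and of the equation\<close>

text \<open>\<open>g\<close> stands for the gradient of the objective and \<open>xs\<close> for its
  minimiser. A single \<open>K \<ge> 1\<close> dominates the Lipschitz, growth and derivative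
  bounds, so that the later constants depend on \<open>K\<close>, \<open>\<mu>\<close> and the
  dimension, never on \<open>t\<close>, \<open>x\<close> or \<open>h\<close>. The norm of the pair
  \<open>(1, x - xs)\<close> is the weight called \<open>w\<close> below.\<close>

locale coeffs =
  fixes g :: "real^'n \<Rightarrow> real^'n" and g1 :: "real^'n \<Rightarrow> real^'n \<Rightarrow> real^'n" and g2 :: "real^'n \<Rightarrow> real^'n \<Rightarrow> real^'n \<Rightarrow> real^'n"
    and \<sigma> :: "real \<Rightarrow> real^'n \<Rightarrow> real^'n^'n" and \<sigma>1 :: "real \<Rightarrow> real^'n \<Rightarrow> real^'n \<Rightarrow> real^'n^'n"
    and \<sigma>2 :: "real \<Rightarrow> real^'n \<Rightarrow> real^'n \<Rightarrow> real^'n \<Rightarrow> real^'n^'n"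
    and xs :: "real^'n" and K \<mu> :: real
  assumes K1: "1 \<le> K" and mu: "0 < \<mu>"
    and gs: "smooth3 K g g1 g2"
    and ss: "\<And>t. 0 \<le> t \<Longrightarrow> smooth3 K (\<sigma> t) (\<sigma>1 t) (\<sigma>2 t)"
    and g0: "g xs = 0"
    and mono: "\<And>x y. (g y - g x) \<bullet> (y - x) \<ge> \<mu> * (norm (y - x))^2"
    and growth: "\<And>t x. 0 \<le> t \<Longrightarrow> norm (\<sigma> t x) \<le> K * norm (1::real, x - xs)"
    and tlip: "\<And>t s x. 0 \<le> t \<Longrightarrow> 0 \<le> s \<Longrightarrow> norm (\<sigma> t x - \<sigma> s x) \<le> K * \<bar>t - s\<bar>"
    and scont: "continuous_on ({0..} \<times> UNIV) (\<lambda>(t, x). \<sigma> t x)"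

text \<open>Banach's fixed point theorem for the gradient step \<open>x - e * g x\<close>. The
  choice \<open>e = \<mu> / L'^2\<close> minimises the squared contraction factor
  \<open>1 - 2 * e * \<mu> + e^2 * L'^2\<close>, with minimum \<open>1 - \<mu>^2 / L'^2\<close>;
  \<open>L' \<ge> \<mu>\<close> keeps it nonnegative.\<close>

lemma ex_zero_monotone:
  fixes g :: "'a::euclidean_space \<Rightarrow> 'a"
  assumes L: "L-lipschitz_on UNIV g" and m: "strongly_monotone \<mu> g" and mu: "0 < \<mu>"
  obtains z where "g z = 0"
proof -
  define L' where "L' = max L \<mu>"
  have L': "0 < L'" "\<mu> \<le> L'" using mu by (auto simp: L'_def)
  have lip: "norm (g y - g x) \<le> L' * norm (y - x)" for x y
  proof -
    have "norm (g y - g x) \<le> L * norm (y - x)" using lipschitz_onD[OF L, of y x] by (simp add: dist_norm)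
    also have "\<dots> \<le> L' * norm (y - x)" by (intro mult_right_mono) (auto simp: L'_def)
    finally show ?thesis .
  qed
  define e where "e = \<mu> / L'^2"
  have e0: "0 < e" using mu L' by (simp add: e_def)
  define c where "c = sqrt (1 - \<mu>^2 / L'^2)"
  have q: "0 \<le> 1 - \<mu>^2 / L'^2" "1 - \<mu>^2 / L'^2 < 1" using L' mu by (auto intro: power_mono)
  have c: "0 \<le> c" "c < 1" using q by (auto simp: c_def)
  have "\<exists>!x. x - e *\<^sub>R g x = x"
  proof (rule banach_fix_type[OF c], intro allI)
    fix x y
    define d u where "d = x - y" and "u = g x - g y"
    have "(norm (d - e *\<^sub>R u))^2 = (norm d)^2 - 2 * e * (u \<bullet> d) + e^2 * (norm u)^2"
      unfolding power2_norm_eq_inner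
      by (simp add: inner_diff_left inner_diff_right inner_commute power2_eq_square algebra_simps)
    also have "\<dots> \<le> (norm d)^2 - 2 * e * (\<mu> * (norm d)^2) + e^2 * (L' * norm d)^2"
    proof -
      have 1: "\<mu> * (norm d)^2 \<le> u \<bullet> d" using m unfolding strongly_monotone_def u_def d_def by blast
      have "2 * e * (\<mu> * (norm d)^2) \<le> 2 * e * (u \<bullet> d)" using 1 e0 by (intro mult_left_mono) auto
      moreover have "e^2 * (norm u)^2 \<le> e^2 * (L' * norm d)^2" unfolding u_def d_def by (intro mult_left_mono power_mono lip) auto
      ultimately show ?thesis by linarith
    qed
    also have "\<dots> = (1 - \<mu>^2 / L'^2) * (norm d)^2"
      using L' by (simp add: e_def power_mult_distrib power2_eq_square field_simps)
    also have "\<dots> = (c * norm d)^2" using q by (simp add: c_def power_mult_distrib)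
    finally have "norm (d - e *\<^sub>R u) \<le> c * norm d" by (rule power2_le_imp_le) (use c in auto)
    then show "dist (x - e *\<^sub>R g x) (y - e *\<^sub>R g y) \<le> c * dist x y"
      by (simp add: dist_norm d_def u_def algebra_simps)
  qed
  then obtain z where "z - e *\<^sub>R g z = z" by blast
  then have "g z = 0" using e0 by simp
  then show ?thesis by (rule that)
qed

text \<open>By the mean value theorem along segments from \<open>z\<close>, strong monotonicity
  makes \<open>F\<close> no smaller away from the critical point. Conversely a minimiser is
  critical, and strong monotonicity leaves room for one critical point only.\<close>

lemma minimizer_zero:
  fixes F :: "'a::euclidean_space \<Rightarrow> real"
  assumes F: "class_C m F" "1 \<le> m" and mon: "strongly_monotone \<mu> (grad F)" and mu: "0 < \<mu>"
    and z: "grad F z = 0"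
  shows "minimizer F = z"
  unfolding minimizer_def
proof (rule the_equality)
  have dm: "(F has_derivative (\<lambda>k. grad F x \<bullet> k)) (at x)" for x
    using grad_gderiv(1)[OF F, of x] unfolding gderiv_def by (simp add: inner_commute)
  show "\<forall>y. F z \<le> F y"
  proof
    fix y
    define \<psi> where "\<psi> = (\<lambda>s. F (z + s *\<^sub>R (y - z)))"
    have D: "DERIV \<psi> s :> grad F (z + s *\<^sub>R (y - z)) \<bullet> (y - z)" for s
    proof -
      have "((\<lambda>s. z + s *\<^sub>R (y - z)) has_derivative (\<lambda>r. r *\<^sub>R (y - z))) (at s)"
        by (auto intro!: derivative_eq_intros)
      from has_derivative_compose[OF this dm] show ?thesis
        unfolding \<psi>_def has_field_derivative_def by (simp add: mult_commute_abs)
    qed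
    have "\<exists>s>0. s < 1 \<and> \<psi> 1 - \<psi> 0 = (1 - 0) * (grad F (z + s *\<^sub>R (y - z)) \<bullet> (y - z))"
      by (rule MVT2[of 0 1]) (use D in auto)
    then obtain s where s: "0 < s" "s < 1" "\<psi> 1 - \<psi> 0 = grad F (z + s *\<^sub>R (y - z)) \<bullet> (y - z)" by auto
    have "\<mu> * (norm (s *\<^sub>R (y - z)))^2 \<le> (grad F (z + s *\<^sub>R (y - z)) - grad F z) \<bullet> (z + s *\<^sub>R (y - z) - z)"
      using mon unfolding strongly_monotone_def by (metis add_diff_cancel_left')
    then have "\<mu> * (norm (s *\<^sub>R (y - z)))^2 \<le> s * (grad F (z + s *\<^sub>R (y - z)) \<bullet> (y - z))"
      unfolding z by simp
    moreover have "0 \<le> \<mu> * (norm (s *\<^sub>R (y - z)))^2" using mu by simp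
    ultimately have "0 \<le> s * (grad F (z + s *\<^sub>R (y - z)) \<bullet> (y - z))" by linarith
    then have "0 \<le> \<psi> 1 - \<psi> 0" using s by (simp add: zero_le_mult_iff)
    then show "F z \<le> F y" by (simp add: \<psi>_def)
  qed
  fix x assume x: "\<forall>y. F x \<le> F y"
  have "(\<lambda>k. grad F x \<bullet> k) = (\<lambda>v. 0)"
    by (rule differential_zero_maxmin[OF _ open_UNIV dm]) (use x in auto)
  then have "grad F x \<bullet> grad F x = 0" by meson
  then have gx: "grad F x = 0" by simp
  have "\<mu> * (norm (x - z))^2 \<le> (grad F x - grad F z) \<bullet> (x - z)"
    using mon unfolding strongly_monotone_def by blast
  then have "\<mu> * (norm (x - z))^2 \<le> 0" using gx z by simp
  then show "x = z" using mu by (simp add: mult_le_0_iff)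
qed

lemma dbound_mono: "dbound m K f \<Longrightarrow> K \<le> K' \<Longrightarrow> dbound m K' f"
  unfolding dbound_def
proof (intro allI impI)
  fix ks :: "'a list" and x
  assume *: "\<forall>ks x. length ks = m \<longrightarrow> norm (iter_deriv f ks x) \<le> K * prod_list (map norm ks)"
    and K: "K \<le> K'" and len: "length ks = m"
  have "norm (iter_deriv f ks x) \<le> K * prod_list (map norm ks)" using * len by blast
  also have "\<dots> \<le> K' * prod_list (map norm ks)"
    by (intro mult_right_mono K prod_list_nonneg) auto
  finally show "norm (iter_deriv f ks x) \<le> K' * prod_list (map norm ks)" .
qed

text \<open>Translates the assumptions into the locale. For the second claim, the gradient of the
  squared norm of \<open>grad F\<close> is twice the transposed Hessian applied to
  \<open>grad F\<close>; symmetry of the Hessian removes the transpose, and \<open>h / 4\<close>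
  becomes \<open>h / 2\<close>.\<close>

lemma coeffs_exist:
  fixes F :: "real^'n \<Rightarrow> real" and \<sigma> :: "real \<Rightarrow> real^'n \<Rightarrow> real^'n^'n"
  assumes F: "F_strong h_max h\<^sub>0 \<mu> F" and s: "sigma_strong F \<sigma>"
  obtains K g1 g2 \<sigma>1 \<sigma>2 where "coeffs (grad F) g1 g2 \<sigma> \<sigma>1 \<sigma>2 (minimizer F) K \<mu>"
    "\<And>x h. grad (modified_objective F h) x = grad F x + (h / 2) *\<^sub>R g1 x (grad F x)"
proof -
  have F5: "class_C 5 F" and mu: "0 < \<mu>" and mon: "strongly_monotone \<mu> (grad F)"
    and b: "bounded_deriv 3 F" "bounded_deriv 4 F" using F by (auto simp: F_strong_def)
  obtain L where L: "L-lipschitz_on UNIV (grad F)" using F by (auto simp: F_strong_def)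
  obtain z where z: "grad F z = 0" by (rule ex_zero_monotone[OF L mon mu])
  have zm: "minimizer F = z" by (rule minimizer_zero[OF F5 _ mon mu z]) simp
  note d3 = dbound_deriv_norm[OF F5 _ b(1), simplified] and d4 = dbound_deriv_norm[OF F5 _ b(2), simplified]
  obtain \<sigma>b where sb: "bounded (\<sigma>b ` {0..})"
    and s1: "\<And>t x1 x2. t \<ge> 0 \<Longrightarrow> norm (\<sigma> t x2 - \<sigma> t x1) \<le> \<sigma>b t * norm (x2 - x1)"
    and s2: "\<And>t x. t \<ge> 0 \<Longrightarrow> norm (\<sigma> t x) / (1 + norm (x - minimizer F)) \<le> \<sigma>b t"
    using s[unfolded sigma_strong_def, THEN conjunct2, THEN conjunct1] by blast
  obtain S where S: "\<And>t. t \<ge> 0 \<Longrightarrow> \<bar>\<sigma>b t\<bar> \<le> S" using sb unfolding bounded_iff by force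
  obtain S2 where S2: "\<And>t r. t \<ge> 0 \<Longrightarrow> r \<in> deriv_ratios 2 (\<sigma> t) \<Longrightarrow> r \<le> S2"
    using s[unfolded sigma_strong_def bdd_above_def, THEN conjunct2, THEN conjunct2, THEN conjunct2, THEN conjunct1] by blast
  obtain S3 where S3: "\<And>t r. t \<ge> 0 \<Longrightarrow> r \<in> deriv_ratios 3 (\<sigma> t) \<Longrightarrow> r \<le> S3"
    using s[unfolded sigma_strong_def bdd_above_def, THEN conjunct2, THEN conjunct2, THEN conjunct2, THEN conjunct2, THEN conjunct1] by blast
  obtain Lt where Lt: "\<And>t1 t2 x. t1 \<ge> 0 \<Longrightarrow> t2 \<ge> 0 \<Longrightarrow> norm (\<sigma> t2 x - \<sigma> t1 x) \<le> Lt * \<bar>t2 - t1\<bar>"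
    using s[unfolded sigma_strong_def, THEN conjunct2, THEN conjunct2, THEN conjunct2, THEN conjunct2, THEN conjunct2] by blast
  have sC: "\<And>t. t \<ge> 0 \<Longrightarrow> class_C 3 (\<sigma> t)"
    using s[unfolded sigma_strong_def, THEN conjunct2, THEN conjunct2, THEN conjunct1] by blast
  \<comment> \<open>The factor in \<open>2 * S\<close> compares \<open>1 + norm y\<close> with the
    norm of the pair \<open>(1, y)\<close>. The seminorms of orders three and four of
    \<open>F\<close> bound the second and third derivatives of its gradient.\<close>
  define K where "K = Max {1, L, deriv_norm 3 F, deriv_norm 4 F, 2 * S, S2, S3, Lt}"
  have Kb: "1 \<le> K" "L \<le> K" "deriv_norm 3 F \<le> K" "deriv_norm 4 F \<le> K" "2 * S \<le> K" "S2 \<le> K" "S3 \<le> K" "Lt \<le> K"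
    unfolding K_def by (rule Max_ge; simp)+
  have S0: "0 \<le> S" using S[of 0] by simp
  define g1 where "g1 = (\<lambda>x k. iter_deriv (grad F) [k] x)"
  define g2 where "g2 = (\<lambda>x k l. iter_deriv (grad F) [k, l] x)"
  have C4: "class_C 4 (grad F)" using class_C_grad[of 4 F] F5 by simp
  have gs: "smooth3 K (grad F) g1 g2"
    unfolding g1_def g2_def
  proof (rule smooth3I[OF C4])
    show "norm (grad F y - grad F x) \<le> K * norm (y - x)" for x y
    proof -
      have "norm (grad F y - grad F x) \<le> L * norm (y - x)" using lipschitz_onD[OF L, of y x] by (simp add: dist_norm)
      also have "\<dots> \<le> K * norm (y - x)" by (intro mult_right_mono Kb) auto
      finally show ?thesis .
    qed
    show "dbound 2 K (grad F)" by (rule dbound_grad[OF F5]) (use dbound_mono[OF d3 Kb(3)] in \<open>auto simp: numeral_3_eq_3 numeral_2_eq_2\<close>)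
    show "dbound 3 K (grad F)" by (rule dbound_grad[OF F5]) (use dbound_mono[OF d4 Kb(4)] in auto)
  qed (use Kb in auto)
  have c: "coeffs (grad F) g1 g2 \<sigma> (\<lambda>t x k. iter_deriv (\<sigma> t) [k] x) (\<lambda>t x k l. iter_deriv (\<sigma> t) [k, l] x) (minimizer F) K \<mu>"
  proof
    show "1 \<le> K" "0 < \<mu>" "smooth3 K (grad F) g1 g2" "grad F (minimizer F) = 0" using Kb mu gs z zm by auto
    show "\<mu> * (norm (y - x))^2 \<le> (grad F y - grad F x) \<bullet> (y - x)" for x y
      using mon unfolding strongly_monotone_def by blast
    show "continuous_on ({0..} \<times> UNIV) (\<lambda>(t, x). \<sigma> t x)" by (rule s[unfolded sigma_strong_def, THEN conjunct1])
    show "norm (\<sigma> t x - \<sigma> s x) \<le> K * \<bar>t - s\<bar>" if "0 \<le> t" "0 \<le> s" for t s x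
    proof -
      have "norm (\<sigma> t x - \<sigma> s x) \<le> Lt * \<bar>t - s\<bar>" by (rule Lt[OF that(2,1)])
      also have "\<dots> \<le> K * \<bar>t - s\<bar>" by (intro mult_right_mono Kb) auto
      finally show ?thesis .
    qed
    show "norm (\<sigma> t x) \<le> K * norm (1::real, x - minimizer F)" if t: "0 \<le> t" for t x
    proof -
      have "norm (1::real) \<le> norm (1::real, x - minimizer F)" by (rule norm_fst_le)
      moreover have "norm (x - minimizer F) \<le> norm (1::real, x - minimizer F)" by (rule norm_snd_le)
      ultimately have w: "1 + norm (x - minimizer F) \<le> 2 * norm (1::real, x - minimizer F)" by simp
      have p: "0 < 1 + norm (x - minimizer F)" by (simp add: add_pos_nonneg)
      have "norm (\<sigma> t x) / (1 + norm (x - minimizer F)) \<le> S" using s2[OF t, of x] S[OF t] by linarith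
      then have "norm (\<sigma> t x) \<le> S * (1 + norm (x - minimizer F))" using p by (simp add: field_simps)
      also have "\<dots> \<le> S * (2 * norm (1::real, x - minimizer F))" using w S0 by (intro mult_left_mono)
      also have "\<dots> \<le> K * norm (1::real, x - minimizer F)"
        using mult_right_mono[OF Kb(5), of "norm (1::real, x - minimizer F)"] by (simp add: ac_simps)
      finally show ?thesis .
    qed
    show "smooth3 K (\<sigma> t) (\<lambda>x k. iter_deriv (\<sigma> t) [k] x) (\<lambda>x k l. iter_deriv (\<sigma> t) [k, l] x)" if t: "0 \<le> t" for t
    proof (rule smooth3I[OF sC[OF t]])
      show "norm (\<sigma> t y - \<sigma> t x) \<le> K * norm (y - x)" for x y
      proof -
        have "norm (\<sigma> t y - \<sigma> t x) \<le> \<sigma>b t * norm (y - x)" by (rule s1[OF t])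
        also have "\<dots> \<le> K * norm (y - x)" using S[OF t] S0 Kb(5) by (intro mult_right_mono) auto
        finally show ?thesis .
      qed
      show "dbound 2 K (\<sigma> t)" by (rule dboundI[OF sC[OF t]]) (use S2[OF t] Kb(6) in \<open>auto intro: order_trans\<close>)
      show "dbound 3 K (\<sigma> t)" by (rule dboundI[OF sC[OF t]]) (use S3[OF t] Kb(7) in \<open>auto intro: order_trans\<close>)
    qed (use Kb in auto)
  qed
  have "grad (modified_objective F h) x = grad F x + (h / 2) *\<^sub>R g1 x (grad F x)" for x h
  proof (rule gradI)
    have dF: "(F has_derivative (\<lambda>k. k \<bullet> grad F x)) (at x)"
      using grad_gderiv(1)[OF F5, of x] unfolding gderiv_def by simp
    have dg: "(grad F has_derivative g1 x) (at x)"
      using class_C_deriv[OF C4, of "[]" x] by (simp add: g1_def)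
    have sym: "g1 x k \<bullet> l = g1 x l \<bullet> k" for k l
      unfolding g1_def using iter_deriv_grad[OF F5, of "[k]" x l] iter_deriv_grad[OF F5, of "[l]" x k]
        hessian_symmetric[OF F5 _ d3, of k l x] by simp
    have "((\<lambda>x. F x + h / 4 * (grad F x \<bullet> grad F x)) has_derivative (\<lambda>k. k \<bullet> grad F x + h / 4 * (grad F x \<bullet> g1 x k + g1 x k \<bullet> grad F x))) (at x)"
      by (intro derivative_intros dF dg)
    moreover have "k \<bullet> grad F x + h / 4 * (grad F x \<bullet> g1 x k + g1 x k \<bullet> grad F x) = k \<bullet> (grad F x + (h / 2) *\<^sub>R g1 x (grad F x))" for k
      using sym[of k "grad F x"] by (simp add: inner_add_right inner_commute field_simps)
    ultimately show "GDERIV (modified_objective F h) x :> grad F x + (h / 2) *\<^sub>R g1 x (grad F x)"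
      unfolding gderiv_def modified_objective_def[abs_def] power2_norm_eq_inner by simp
  qed
  with c show ?thesis by (rule that)
qed

section \<open>The weight and the Gaussian moments\<close>

lemma smooth3D:
  assumes "smooth3 K f f1 f2"
  shows "f \<in> borel_measurable borel" "(\<lambda>x. f1 x k) \<in> borel_measurable borel" "(\<lambda>x. f2 x k l) \<in> borel_measurable borel"
    "linear (f1 x)" "bilinear (f2 x)" "norm (f1 x k) \<le> K * norm k" "norm (f2 x k l) \<le> K * norm k * norm l"
    "norm (f (x + d) - f x) \<le> K * norm d" "norm (f1 (x + d) k - f1 x k) \<le> K * norm d * norm k"
    "norm (f (x + d) - f x - f1 x d - (1/2) *\<^sub>R f2 x d d) \<le> K * norm d ^ 3"
  using assms unfolding smooth3_def by blast+

text \<open>For steps of length at most one the second order expansion gives the quadratic bound,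
  since the cube is then below the square; for longer steps the Lipschitz bounds give it.\<close>

lemma smooth3_taylor1:
  assumes s: "smooth3 K f f1 f2" and K: "0 \<le> K"
  shows "norm (f (x + d) - f x - f1 x d) \<le> 2 * K * (norm d)^2"
proof (cases "norm d \<le> 1")
  case True
  have "norm (f (x + d) - f x - f1 x d) \<le> norm (f (x + d) - f x - f1 x d - (1/2) *\<^sub>R f2 x d d) + norm ((1/2) *\<^sub>R f2 x d d)"
    by (metis diff_add_cancel norm_triangle_ineq)
  also have "\<dots> \<le> K * norm d ^ 3 + K * (norm d)^2 / 2"
    using smooth3D(10)[OF s, of x d] smooth3D(7)[OF s, of x d d] by (intro add_mono) (auto simp: power2_eq_square)
  also have "norm d ^ 3 \<le> (norm d)^2" using True by (intro power_decreasing) auto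
  finally have "norm (f (x + d) - f x - f1 x d) \<le> K * (norm d)^2 + K * (norm d)^2 / 2"
    using K by (simp add: mult_left_mono)
  moreover have "0 \<le> K * (norm d)^2" using K by simp
  ultimately show ?thesis by linarith
next
  case False
  have "norm (f (x + d) - f x - f1 x d) \<le> norm (f (x + d) - f x) + norm (f1 x d)" by (rule norm_triangle_ineq4)
  also have "\<dots> \<le> 2 * K * norm d" using smooth3D(8)[OF s, of x d] smooth3D(6)[OF s, of x d] by simp
  also have "\<dots> \<le> 2 * K * (norm d)^2" using False K mult_left_mono[of 1 "norm d" "norm d"]
    by (intro mult_left_mono) (auto simp: power2_eq_square)
  finally show ?thesis .
qed

section \<open>Integrals against the standard Gaussian law\<close>

abbreviation \<nu> :: "(real^'n) measure" where "\<nu> \<equiv> gauss 1"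

definition N1 :: "real^'n \<Rightarrow> real" where "N1 z = 1 + norm z"

lemma N1_ge [simp]: "1 \<le> N1 z" and N1_pos [simp]: "0 < N1 z" and N1_nn [simp]: "0 \<le> N1 z"
  and norm_le_N1: "norm z \<le> N1 z"
  by (auto simp: N1_def add_pos_nonneg)

lemma N1_meas [measurable]: "N1 \<in> borel_measurable borel"
  unfolding N1_def[abs_def] by measurable

lemma N1_int: "integrable (\<nu> :: (real^'n) measure) (\<lambda>z. N1 z ^ k)"
proof -
  have "integrable (\<nu> :: (real^'n) measure) (\<lambda>z. \<Sum>i\<le>k. real (k choose i) * norm z ^ (k - i))"
    by (intro Bochner_Integration.integrable_sum integrable_mult_right integrable_gauss_norm) auto
  moreover have "N1 z ^ k = (\<Sum>i\<le>k. real (k choose i) * norm z ^ (k - i))" for z :: "real^'n"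
    unfolding N1_def by (subst binomial_ring) simp
  ultimately show ?thesis by simp
qed

text \<open>One constant for all Gaussian integrals: six is the highest order that occurs, and
  \<open>N1 \<ge> 1\<close> lets it dominate the lower ones.\<close>

definition gam :: "'n::finite itself \<Rightarrow> real" where "gam _ = (\<integral>z. N1 z ^ 6 \<partial>(\<nu> :: (real^'n) measure))"

lemma N1_le: "k \<le> 6 \<Longrightarrow> (\<integral>z. N1 z ^ k \<partial>(\<nu> :: (real^'n) measure)) \<le> gam TYPE('n)"
  unfolding gam_def by (intro integral_mono N1_int power_increasing) auto

lemma gam_ge1: "1 \<le> gam TYPE('n::finite)"
proof -
  interpret prob_space "\<nu> :: (real^'n) measure" by (rule prob_space_gauss) simp
  show ?thesis using N1_le[where 'n='n, of 0] prob_space by simp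
qed

lemma nu_integrable:
  fixes f :: "real^'n \<Rightarrow> real"
  assumes "f \<in> borel_measurable borel" "\<And>z. \<bar>f z\<bar> \<le> c * N1 z ^ k"
  shows "integrable \<nu> f"
  by (rule Bochner_Integration.integrable_bound[OF integrable_mult_right[OF N1_int, of c k]])
     (use assms in \<open>auto intro!: AE_I2 order_trans[OF assms(2)]\<close>)

lemma nu_bound:
  fixes f :: "real^'n \<Rightarrow> real"
  assumes "f \<in> borel_measurable borel" "\<And>z. \<bar>f z\<bar> \<le> c * N1 z ^ k" "k \<le> 6" "0 \<le> c"
  shows "\<bar>\<integral>z. f z \<partial>\<nu>\<bar> \<le> c * gam TYPE('n)"
proof -
  have "\<bar>\<integral>z. f z \<partial>\<nu>\<bar> \<le> (\<integral>z. \<bar>f z\<bar> \<partial>\<nu>)" by (rule integral_abs_bound)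
  also have "\<dots> \<le> (\<integral>z. c * N1 z ^ k \<partial>(\<nu> :: (real^'n) measure))"
  proof (rule integral_mono)
    show "integrable \<nu> (\<lambda>z. \<bar>f z\<bar>)" by (rule integrable_abs[OF nu_integrable[OF assms(1,2)]])
    show "integrable \<nu> (\<lambda>z::real^'n. c * N1 z ^ k)" by (intro integrable_mult_right N1_int)
  qed (rule assms(2))
  also have "\<dots> \<le> c * gam TYPE('n)" using N1_le[where 'n='n, OF assms(3)] assms(4) by (simp add: mult_left_mono)
  finally show ?thesis .
qed

lemma nu_linear:
  fixes f :: "real^'n \<Rightarrow> real"
  assumes "linear f" shows "integrable \<nu> f" "(\<integral>z. f z \<partial>\<nu>) = 0"
proof -
  define e where "e = (\<lambda>i. f (axis i 1))"
  have "f z = (\<Sum>i\<in>UNIV. z $ i * e i)" for z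
  proof -
    have "f z = f (\<Sum>i\<in>UNIV. z $ i *\<^sub>R axis i 1)" using basis_expansion[of z] by (simp add: scalar_mult_eq_scaleR)
    then show ?thesis by (simp add: linear_sum[OF assms] linear_scale[OF assms] e_def)
  qed
  then have f: "f = (\<lambda>z. \<Sum>i\<in>UNIV. z $ i * e i)" by auto
  have c: "integrable \<nu> (\<lambda>z::real^'n. z $ i)" for i using gauss_coord(1)[of 1 i 1] by simp
  have m: "(\<integral>z. z $ i \<partial>(\<nu> :: (real^'n) measure)) = 0" for i by (rule gauss_mean) simp
  show "integrable \<nu> f" unfolding f using c by auto
  show "(\<integral>z. f z \<partial>\<nu>) = 0" unfolding f using c m by simp
qed

text \<open>The coordinates are uncorrelated with unit variance, which leaves the diagonal of
  \<open>f\<close>.\<close>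

lemma nu_bilinear:
  fixes f :: "real^'n \<Rightarrow> real^'n \<Rightarrow> real"
  assumes "bilinear f" shows "integrable \<nu> (\<lambda>z. f z z)" "(\<integral>z. f z z \<partial>\<nu>) = (\<Sum>i\<in>UNIV. f (axis i 1) (axis i 1))"
proof -
  define e where "e = (\<lambda>i j. f (axis i 1) (axis j 1))"
  have f: "f z z = (\<Sum>i\<in>UNIV. \<Sum>j\<in>UNIV. z $ i * z $ j * e i j)" for z
  proof -
    have "f z z = f (\<Sum>i\<in>UNIV. z $ i *\<^sub>R axis i 1) (\<Sum>i\<in>UNIV. z $ i *\<^sub>R axis i 1)" using basis_expansion[of z] by (simp add: scalar_mult_eq_scaleR)
    also have "\<dots> = (\<Sum>(i,j)\<in>UNIV \<times> UNIV. f (z $ i *\<^sub>R axis i 1) (z $ j *\<^sub>R axis j 1))"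
      by (rule bilinear_sum[OF assms])
    also have "\<dots> = (\<Sum>i\<in>UNIV. \<Sum>j\<in>UNIV. z $ i * z $ j * e i j)"
      unfolding sum.cartesian_product[symmetric] e_def by (simp add: bilinear_lmul[OF assms] bilinear_rmul[OF assms] ac_simps)
    finally show ?thesis .
  qed
  have c: "integrable \<nu> (\<lambda>z::real^'n. z $ i * z $ j)" and m: "(\<integral>z. z $ i * z $ j \<partial>(\<nu> :: (real^'n) measure)) = (if i = j then 1 else 0)" for i j
    using gauss_cov[of 1 i j] by auto
  show "integrable \<nu> (\<lambda>z. f z z)" unfolding f using c by auto
  have "(\<integral>z. f z z \<partial>\<nu>) = (\<Sum>i\<in>UNIV. \<Sum>j\<in>UNIV. (if i = j then 1 else 0) * e i j)" unfolding f using c m by simp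
  also have "\<dots> = (\<Sum>i\<in>UNIV. e i i)" by (simp add: if_distrib[of "\<lambda>x. x * _"] cong: if_cong)
  finally show "(\<integral>z. f z z \<partial>\<nu>) = (\<Sum>i\<in>UNIV. f (axis i 1) (axis i 1))" by (simp add: e_def)
qed

section \<open>The weight, and contraction of one step of the scheme in moments\<close>

context coeffs
begin

text \<open>This is the square root of \<open>1 + norm (x - xs)^2\<close>. As a norm of a pair it
  obeys a triangle inequality, and its square is a polynomial.\<close>

definition w :: "real^'n \<Rightarrow> real" where "w x = norm (1::real, x - xs)"

lemma w_ge1 [simp]: "1 \<le> w x" and w_pos [simp]: "0 < w x" and w_nn [simp]: "0 \<le> w x"
  and w_ne [simp]: "w x \<noteq> 0"
  and dist_le_w: "norm (x - xs) \<le> w x"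
proof -
  show "1 \<le> w x" unfolding w_def using norm_fst_le[of "1::real" "x - xs"] by simp
  then show "0 < w x" "0 \<le> w x" "w x \<noteq> 0" by auto
  show "norm (x - xs) \<le> w x" unfolding w_def by (rule norm_snd_le)
qed

lemma w_sq: "(w x)^2 = 1 + (norm (x - xs))^2"
  by (simp add: w_def norm_Pair)

lemma w_add: "w (x + d) \<le> w x + norm d"
proof -
  have "(1::real, x + d - xs) = (1, x - xs) + (0, d)" by simp
  then have "w (x + d) \<le> norm (1::real, x - xs) + norm (0::real, d)" unfolding w_def by (metis norm_triangle_ineq)
  then show ?thesis by (simp add: w_def norm_Pair)
qed

lemma w_meas [measurable]: "w \<in> borel_measurable borel"
  unfolding w_def[abs_def] by (intro borel_measurable_continuous_onI continuous_intros)

lemma K0: "0 \<le> K" "0 < K" using K1 by auto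

lemma g_growth: "norm (g x) \<le> K * norm (x - xs)" "norm (g x) \<le> K * w x"
proof -
  show 1: "norm (g x) \<le> K * norm (x - xs)" using smooth3D(8)[OF gs, of xs "x - xs"] g0 by simp
  then show "norm (g x) \<le> K * w x" using mult_left_mono[OF dist_le_w[of x] K0(1)] by linarith
qed

lemma s_growth: "0 \<le> t \<Longrightarrow> norm (\<sigma> t x) \<le> K * w x" using growth by (simp add: w_def)

text \<open>Strong monotonicity is tested along \<open>s *\<^sub>R k\<close> and divided by
  \<open>s^2\<close>; the linearisation error that remains is of order \<open>s\<close> and is made
  smaller than \<open>e\<close>.\<close>

lemma g1_mono: "\<mu> * (norm k)^2 \<le> g1 x k \<bullet> k"
proof (rule field_le_epsilon)
  fix e :: real assume e: "0 < e"
  define c where "c = 2 * K * norm k ^ 3"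
  have c0: "0 \<le> c" using K0 by (simp add: c_def)
  define s where "s = e / (c + 1)"
  have s: "0 < s" "s * c \<le> e" using e c0 by (auto simp: s_def field_simps)
  have "\<mu> * (norm (s *\<^sub>R k))^2 \<le> (g (x + s *\<^sub>R k) - g x) \<bullet> (s *\<^sub>R k)" using mono[where x=x and y="x + s *\<^sub>R k"] by simp
  also have "\<dots> = g1 x (s *\<^sub>R k) \<bullet> (s *\<^sub>R k) + (g (x + s *\<^sub>R k) - g x - g1 x (s *\<^sub>R k)) \<bullet> (s *\<^sub>R k)"
    by (simp add: inner_diff_left algebra_simps)
  also have "\<dots> \<le> g1 x (s *\<^sub>R k) \<bullet> (s *\<^sub>R k) + 2 * K * (norm (s *\<^sub>R k))^2 * norm (s *\<^sub>R k)"
    using smooth3_taylor1[OF gs K0(1), of x "s *\<^sub>R k"]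
    by (intro add_left_mono order_trans[OF norm_cauchy_schwarz] mult_right_mono) auto
  also have "\<dots> = s^2 * (g1 x k \<bullet> k + s * c)"
    using s by (simp add: linear_scale[OF smooth3D(4)[OF gs]] c_def power2_eq_square power3_eq_cube algebra_simps)
  finally have "s^2 * (\<mu> * (norm k)^2) \<le> s^2 * (g1 x k \<bullet> k + s * c)" by (simp add: power_mult_distrib ac_simps)
  then have "\<mu> * (norm k)^2 \<le> g1 x k \<bullet> k + s * c" using s by (simp add: mult_le_cancel_left)
  then show "\<mu> * (norm k)^2 \<le> g1 x k \<bullet> k + e" using s by linarith
qed

text \<open>Differences of the drift and its derivative share the same lower bound
  \<open>\<mu>\<close> and upper bound \<open>K\<close>; expanding the square gives the same factor
  for both.\<close>

lemma drift_contr: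
  assumes h: "0 \<le> h"
  shows "(norm (d - h *\<^sub>R (g (x + d) - g x)))^2 \<le> (1 - 2 * \<mu> * h + K^2 * h^2) * (norm d)^2"
    and "(norm (d - h *\<^sub>R g1 x d))^2 \<le> (1 - 2 * \<mu> * h + K^2 * h^2) * (norm d)^2"
proof -
  have *: "(norm (d - h *\<^sub>R u))^2 \<le> (1 - 2 * \<mu> * h + K^2 * h^2) * (norm d)^2"
    if u: "\<mu> * (norm d)^2 \<le> u \<bullet> d" "norm u \<le> K * norm d" for u
  proof -
    have "(norm (d - h *\<^sub>R u))^2 = (norm d)^2 - 2 * h * (u \<bullet> d) + h^2 * (norm u)^2"
      unfolding power2_norm_eq_inner
      by (simp add: inner_diff_left inner_diff_right inner_commute power2_eq_square algebra_simps)
    also have "\<dots> \<le> (norm d)^2 - 2 * h * (\<mu> * (norm d)^2) + h^2 * (K * norm d)^2"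
    proof -
      have "2 * h * (\<mu> * (norm d)^2) \<le> 2 * h * (u \<bullet> d)" using u h by (intro mult_left_mono) auto
      moreover have "h^2 * (norm u)^2 \<le> h^2 * (K * norm d)^2" using u by (intro mult_left_mono power_mono) auto
      ultimately show ?thesis by linarith
    qed
    finally show ?thesis by (simp add: power_mult_distrib algebra_simps)
  qed
  show "(norm (d - h *\<^sub>R (g (x + d) - g x)))^2 \<le> (1 - 2 * \<mu> * h + K^2 * h^2) * (norm d)^2"
    by (rule *) (use mono[where x=x and y="x + d"] smooth3D(8)[OF gs, of x d] in auto)
  show "(norm (d - h *\<^sub>R g1 x d))^2 \<le> (1 - 2 * \<mu> * h + K^2 * h^2) * (norm d)^2"
    by (rule *) (use g1_mono smooth3D(6)[OF gs] in auto)
qed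

text \<open>The squared norm is \<open>A + \<xi>\<close>, where \<open>\<xi>\<close> is of order
  \<open>h\<close> and has mean of order \<open>h^2\<close>, because its part linear in
  \<open>z\<close> is centred. In the expanded cube, \<open>A^3\<close> contracts at the rate
  \<open>6 * \<mu>\<close> and everything else is of order \<open>h^2\<close>:
  \<open>287 = 12 + 150 + 125\<close> counts the three terms with \<open>\<xi>\<close>, and the
  other constants come from cubing \<open>1 - 2 * \<mu> * h + K^2 * h^2\<close>.\<close>

lemma sixth_moment:
  fixes a :: "real^'n" and S :: "real^'n^'n"
  assumes h: "0 < h" "h \<le> 1" and a: "(norm a)^2 \<le> (1 - 2 * \<mu> * h + K^2 * h^2) * D^2" and S: "norm S \<le> K * D" and D: "0 < D"
  shows "(\<integral>z. norm (a + h *\<^sub>R (S *v z)) ^ 6 \<partial>\<nu>) \<le>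
    (1 - 6 * \<mu> * h + (287 * K^6 * gam TYPE('n) + 3 * K^2 + 3 * (2 * \<mu> + K^2)^2 + (2 * \<mu> + K^2)^3) * h^2) * D ^ 6"
proof -
  let ?\<gamma> = "gam TYPE('n)"
  define A where "A = (norm a)^2"
  define \<rho> where "\<rho> = 1 - 2 * \<mu> * h + K^2 * h^2"
  define \<xi> where "\<xi> = (\<lambda>z. 2 * h * (a \<bullet> (S *v z)) + h^2 * (norm (S *v z))^2)"
  have [measurable]: "(\<lambda>z. S *v z) \<in> borel_measurable borel" by measurable
  have [measurable]: "\<xi> \<in> borel_measurable borel" unfolding \<xi>_def by measurable
  have KD: "0 \<le> K * D" using K0 D by simp
  have nS: "norm (S *v z) \<le> K * D * N1 z" for z
  proof -
    have "norm (S *v z) \<le> norm S * norm z" by (rule norm_matrix_vector_mult)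
    also have "\<dots> \<le> (K * D) * N1 z" using S KD norm_le_N1 by (intro mult_mono) auto
    finally show ?thesis .
  qed
  have h2: "h^2 \<le> h" "h^2 \<le> 1" using h by (auto simp: power2_eq_square mult_le_one)
  have A1: "A \<le> (2 * K^2) * D^2"
  proof -
    have "\<rho> \<le> 2 * K^2"
    proof -
      have "K^2 * h^2 \<le> K^2 * 1" using h2 by (intro mult_left_mono) auto
      moreover have "1 \<le> K^2" using K1 by (simp add: one_le_power)
      moreover have "0 \<le> 2 * \<mu> * h" using mu h by simp
      ultimately show ?thesis unfolding \<rho>_def by linarith
    qed
    then show ?thesis using a unfolding A_def \<rho>_def[symmetric] by (meson mult_right_mono order_trans zero_le_power2)
  qed
  have na: "norm a \<le> 2 * K * D"
  proof (rule power2_le_imp_le)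
    show "(norm a)^2 \<le> (2 * K * D)^2" proof -
      have "0 \<le> K^2 * D^2" by simp
      moreover have "(2 * K * D)^2 = 4 * (K^2 * D^2)" by (simp add: power_mult_distrib)
      ultimately show ?thesis using A1 unfolding A_def by linarith
    qed
  qed (use K0 D in auto)
  have xb: "\<bar>\<xi> z\<bar> \<le> (5 * K^2 * h * D^2) * N1 z ^ 2" for z
  proof -
    have "\<bar>a \<bullet> (S *v z)\<bar> \<le> norm a * norm (S *v z)" by (rule Cauchy_Schwarz_ineq2)
    also have "\<dots> \<le> (2 * K * D) * (K * D * N1 z)" using na nS K0 D by (intro mult_mono) auto
    finally have "2 * h * \<bar>a \<bullet> (S *v z)\<bar> \<le> 2 * h * ((2 * K * D) * (K * D * N1 z))" using h by (intro mult_left_mono) auto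
    moreover have "\<bar>2 * h * (a \<bullet> (S *v z))\<bar> = 2 * h * \<bar>a \<bullet> (S *v z)\<bar>" using h by (simp add: abs_mult)
    ultimately have 1: "\<bar>2 * h * (a \<bullet> (S *v z))\<bar> \<le> 2 * h * ((2 * K * D) * (K * D * N1 z))" by simp
    have "N1 z * 1 \<le> N1 z * N1 z" by (intro mult_left_mono) auto
    then have "(4 * h * K^2 * D^2) * N1 z \<le> (4 * h * K^2 * D^2) * (N1 z)^2" using h by (intro mult_left_mono) (auto simp: power2_eq_square)
    then have q1: "\<bar>2 * h * (a \<bullet> (S *v z))\<bar> \<le> 4 * h * K^2 * D^2 * (N1 z)^2"
      using 1 by (simp add: power2_eq_square ac_simps)
    have "(norm (S *v z))^2 \<le> (K * D * N1 z)^2" by (intro power_mono nS) auto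
    then have "h^2 * (norm (S *v z))^2 \<le> h * (K * D * N1 z)^2" using h2 h by (intro mult_mono) auto
    then have 2: "\<bar>h^2 * (norm (S *v z))^2\<bar> \<le> h * K^2 * D^2 * (N1 z)^2" by (simp add: power_mult_distrib ac_simps)
    have "\<bar>\<xi> z\<bar> \<le> 4 * h * K^2 * D^2 * (N1 z)^2 + h * K^2 * D^2 * (N1 z)^2"
      unfolding \<xi>_def using q1 2 by linarith
    then show ?thesis by (simp add: algebra_simps)
  qed
  define c where "c = 5 * K^2 * h * D^2"
  have c0: "0 \<le> c" unfolding c_def using h by simp
  have xb: "\<bar>\<xi> z\<bar> \<le> c * N1 z ^ 2" for z using xb by (simp add: c_def)
  have xb2: "\<bar>(\<xi> z)^2\<bar> \<le> c^2 * N1 z ^ 4" for z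
    using power_mono[OF xb[of z], of 2] by (simp add: power_mult_distrib flip: power_mult)
  have xb3: "\<bar>(\<xi> z)^3\<bar> \<le> c^3 * N1 z ^ 6" for z
    using power_mono[OF xb[of z], of 3] by (simp add: power_mult_distrib power_abs flip: power_mult)
  have i1: "integrable \<nu> \<xi>" by (rule nu_integrable[OF _ xb]) simp
  have i2: "integrable \<nu> (\<lambda>z. (\<xi> z)^2)" by (rule nu_integrable[OF _ xb2]) simp
  have i3: "integrable \<nu> (\<lambda>z. (\<xi> z)^3)" by (rule nu_integrable[OF _ xb3]) simp
  have e1: "(\<integral>z. \<xi> z \<partial>\<nu>) \<le> h^2 * (K * D)^2 * ?\<gamma>"
  proof -
    have l: "linear (\<lambda>z. a \<bullet> (S *v z))" by (rule linearI) (auto simp: matrix_vector_right_distrib inner_add_right matrix_vector_mult_scaleR)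
    have b: "\<bar>(norm (S *v z))^2\<bar> \<le> (K * D)^2 * N1 z ^ 2" for z using power_mono[OF nS[of z], of 2] by (simp add: power_mult_distrib)
    have "(\<integral>z. \<xi> z \<partial>\<nu>) = h^2 * (\<integral>z. (norm (S *v z))^2 \<partial>\<nu>)"
      unfolding \<xi>_def using nu_linear[OF l] nu_integrable[OF _ b] by simp
    also have "\<dots> \<le> h^2 * ((K * D)^2 * ?\<gamma>)"
      using nu_bound[OF _ b] by (intro mult_left_mono) auto
    finally show ?thesis by simp
  qed
  have e2: "(\<integral>z. (\<xi> z)^2 \<partial>\<nu>) \<le> c^2 * ?\<gamma>" using nu_bound[OF _ xb2] by auto
  have e3: "(\<integral>z. (\<xi> z)^3 \<partial>\<nu>) \<le> c^3 * ?\<gamma>" using nu_bound[OF _ xb3] c0 by auto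
  have eq: "norm (a + h *\<^sub>R (S *v z)) ^ 6 = A^3 + 3 * A^2 * \<xi> z + 3 * A * (\<xi> z)^2 + (\<xi> z)^3" for z
  proof -
    have "norm (a + h *\<^sub>R (S *v z)) ^ 6 = ((norm (a + h *\<^sub>R (S *v z)))^2) ^ 3" by (simp flip: power_mult)
    also have "(norm (a + h *\<^sub>R (S *v z)))^2 = A + \<xi> z"
      unfolding A_def \<xi>_def power2_norm_eq_inner
      by (simp add: inner_add_left inner_add_right inner_commute power2_eq_square algebra_simps)
    also have "(A + \<xi> z)^3 = A^3 + 3 * A^2 * \<xi> z + 3 * A * (\<xi> z)^2 + (\<xi> z)^3"
      by (simp add: power3_eq_cube power2_eq_square algebra_simps)
    finally show ?thesis .
  qed
  interpret prob_space "\<nu> :: (real^'n) measure" by (rule prob_space_gauss) simp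
  have A0: "0 \<le> A" by (simp add: A_def)
  have "(\<integral>z. norm (a + h *\<^sub>R (S *v z)) ^ 6 \<partial>\<nu>) = A^3 + 3 * A^2 * (\<integral>z. \<xi> z \<partial>\<nu>) + 3 * A * (\<integral>z. (\<xi> z)^2 \<partial>\<nu>) + (\<integral>z. (\<xi> z)^3 \<partial>\<nu>)"
    unfolding eq using i1 i2 i3 prob_space by simp
  also have "\<dots> \<le> A^3 + 3 * ((2 * K^2) * D^2)^2 * (h^2 * (K * D)^2 * ?\<gamma>) + 3 * ((2 * K^2) * D^2) * (c^2 * ?\<gamma>) + c^3 * ?\<gamma>"
  proof -
    have g: "0 \<le> ?\<gamma>" using gam_ge1[where 'n='n] by simp
    have "3 * A^2 * (\<integral>z. \<xi> z \<partial>\<nu>) \<le> 3 * A^2 * (h^2 * (K * D)^2 * ?\<gamma>)" using e1 by (intro mult_left_mono) auto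
    also have "\<dots> \<le> 3 * ((2 * K^2) * D^2)^2 * (h^2 * (K * D)^2 * ?\<gamma>)" using A0 A1 g by (intro mult_right_mono mult_left_mono power_mono) (auto simp: ac_simps)
    finally have 1: "3 * A^2 * (\<integral>z. \<xi> z \<partial>\<nu>) \<le> 3 * ((2 * K^2) * D^2)^2 * (h^2 * (K * D)^2 * ?\<gamma>)" .
    have "3 * A * (\<integral>z. (\<xi> z)^2 \<partial>\<nu>) \<le> 3 * A * (c^2 * ?\<gamma>)" using e2 A0 by (intro mult_left_mono) auto
    also have "\<dots> \<le> 3 * ((2 * K^2) * D^2) * (c^2 * ?\<gamma>)" using A1 g by (intro mult_right_mono) (auto simp: ac_simps)
    finally show ?thesis using 1 e3 by linarith
  qed
  also have "\<dots> = A^3 + ((12 + 150) * K^6 * h^2 + 125 * K^6 * h^3) * D^6 * ?\<gamma>"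
    unfolding c_def by (simp add: power2_eq_square power3_eq_cube power_mult_distrib numeral_eq_Suc algebra_simps)
  finally have r1: "(\<integral>z. norm (a + h *\<^sub>R (S *v z)) ^ 6 \<partial>\<nu>) \<le> A^3 + (162 * K^6 * h^2 + 125 * K^6 * h^3) * D^6 * ?\<gamma>" by simp
  define t where "t = K^2 * h^2 - 2 * \<mu> * h"
  define b where "b = 2 * \<mu> + K^2"
  have b0: "0 \<le> b" unfolding b_def using mu by simp
  have r: "\<rho> = 1 + t" by (simp add: \<rho>_def t_def)
  have tb: "\<bar>t\<bar> \<le> b * h"
  proof -
    have "K^2 * h^2 \<le> K^2 * h" using h2 by (intro mult_left_mono) auto
    moreover have "0 \<le> K^2 * h^2" by simp
    moreover have "0 \<le> 2 * \<mu> * h" using mu h by simp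
    moreover have "b * h = 2 * \<mu> * h + K^2 * h" by (simp add: b_def algebra_simps)
    ultimately show ?thesis unfolding t_def by linarith
  qed
  have t2: "t^2 \<le> b^2 * h^2" using power_mono[OF tb, of 2] by (simp add: power_mult_distrib)
  have t3: "t^3 \<le> b^3 * h^2"
  proof -
    have "t^3 \<le> \<bar>t\<bar>^3" by (simp add: power_abs[symmetric] abs_ge_self)
    also have "\<dots> \<le> (b * h)^3" by (intro power_mono tb) auto
    also have "\<dots> = b^3 * (h^2 * h)" by (simp add: power_mult_distrib power3_eq_cube power2_eq_square)
    also have "\<dots> \<le> b^3 * (h^2 * 1)" using b0 h by (intro mult_left_mono) auto
    finally show ?thesis by simp
  qed
  have r3: "\<rho>^3 \<le> 1 - 6 * \<mu> * h + (3 * K^2 + 3 * b^2 + b^3) * h^2"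
  proof -
    have "\<rho>^3 = 1 + 3 * t + 3 * t^2 + t^3" unfolding r by (simp add: power3_eq_cube power2_eq_square algebra_simps)
    also have "\<dots> \<le> 1 + 3 * t + 3 * (b^2 * h^2) + b^3 * h^2" using t2 t3 by linarith
    also have "\<dots> = 1 - 6 * \<mu> * h + (3 * K^2 + 3 * b^2 + b^3) * h^2" by (simp add: t_def algebra_simps)
    finally show ?thesis .
  qed
  have "A^3 \<le> (\<rho> * D^2)^3" using a A0 unfolding A_def \<rho>_def by (intro power_mono) auto
  also have "\<dots> = \<rho>^3 * D^6" by (simp add: power_mult_distrib flip: power_mult)
  also have "\<dots> \<le> (1 - 6 * \<mu> * h + (3 * K^2 + 3 * b^2 + b^3) * h^2) * D^6" using r3 D by (intro mult_right_mono) auto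
  finally have A3: "A^3 \<le> (1 - 6 * \<mu> * h + (3 * K^2 + 3 * b^2 + b^3) * h^2) * D^6" .
  have "125 * K^6 * h^3 \<le> 125 * K^6 * h^2"
  proof -
    have "h^3 \<le> h^2" using h by (intro power_decreasing) auto
    then show ?thesis by (intro mult_left_mono) auto
  qed
  then have "(162 * K^6 * h^2 + 125 * K^6 * h^3) * D^6 * ?\<gamma> \<le> (287 * K^6 * h^2) * D^6 * ?\<gamma>"
    using gam_ge1[where 'n='n] D by (intro mult_right_mono) (auto simp: ac_simps)
  with r1 A3 show ?thesis unfolding b_def[symmetric] by (simp add: algebra_simps)
qed

definition kap :: real where
  "kap = 287 * K^6 * gam TYPE('n) + 3 * K^2 + 3 * (2 * \<mu> + K^2)^2 + (2 * \<mu> + K^2)^3"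

text \<open>Step sizes for which the scheme is contracting at all orders that are used.\<close>

definition small :: "real \<Rightarrow> bool" where
  "small h \<longleftrightarrow> 0 < h \<and> h \<le> 1 \<and> kap * h \<le> 2 * \<mu> \<and> 2 * K^2 * gam TYPE('n) * h \<le> \<mu> \<and> \<mu> * h \<le> 1"

text \<open>Of the rate \<open>6 * \<mu>\<close>, the part \<open>2 * \<mu>\<close> pays for the
  terms of order \<open>h^2\<close>.\<close>

lemma sixth_moment_small:
  fixes a :: "real^'n" and S :: "real^'n^'n"
  assumes h: "small h" and a: "(norm a)^2 \<le> (1 - 2 * \<mu> * h + K^2 * h^2) * D^2" and S: "norm S \<le> K * D" and D: "0 < D"
  shows "(\<integral>z. norm (a + h *\<^sub>R (S *v z)) ^ 6 \<partial>\<nu>) \<le> (1 - 4 * \<mu> * h) * D ^ 6"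
    and "integrable \<nu> (\<lambda>z. norm (a + h *\<^sub>R (S *v z)) ^ 6)"
proof -
  have "(\<integral>z. norm (a + h *\<^sub>R (S *v z)) ^ 6 \<partial>\<nu>) \<le> (1 - 6 * \<mu> * h + kap * h^2) * D ^ 6"
    unfolding kap_def using h by (intro sixth_moment a S D) (auto simp: small_def)
  also have "\<dots> \<le> (1 - 4 * \<mu> * h) * D ^ 6"
  proof (rule mult_right_mono)
    have "kap * h * h \<le> 2 * \<mu> * h" using h by (intro mult_right_mono) (auto simp: small_def)
    then show "1 - 6 * \<mu> * h + kap * h^2 \<le> 1 - 4 * \<mu> * h" by (simp add: power2_eq_square)
  qed (use D in simp)
  finally show "(\<integral>z. norm (a + h *\<^sub>R (S *v z)) ^ 6 \<partial>\<nu>) \<le> (1 - 4 * \<mu> * h) * D ^ 6" .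
  have b: "\<bar>norm (a + h *\<^sub>R (S *v z)) ^ 6\<bar> \<le> (norm a + \<bar>h\<bar> * norm S)^6 * N1 z ^ 6" for z
  proof -
    have "norm (a + h *\<^sub>R (S *v z)) \<le> norm a + \<bar>h\<bar> * (norm S * norm z)"
      by (intro norm_triangle_le add_left_mono) (auto intro!: mult_left_mono norm_matrix_vector_mult)
    also have "\<dots> \<le> (norm a + \<bar>h\<bar> * norm S) * N1 z" by (simp add: N1_def algebra_simps)
    finally have "norm (a + h *\<^sub>R (S *v z)) ^ 6 \<le> ((norm a + \<bar>h\<bar> * norm S) * N1 z)^6" by (intro power_mono) auto
    then show ?thesis by (simp add: power_mult_distrib)
  qed
  show "integrable \<nu> (\<lambda>z. norm (a + h *\<^sub>R (S *v z)) ^ 6)"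
    by (rule nu_integrable[OF _ b]) measurable
qed

text \<open>One step of the scheme at fixed noise \<open>z\<close>; \<open>\<Phi>1\<close> and
  \<open>\<Phi>2\<close> are its first two derivatives in \<open>x\<close>.\<close>

definition \<Phi> :: "real \<Rightarrow> real \<Rightarrow> real^'n \<Rightarrow> real^'n \<Rightarrow> real^'n" where
  "\<Phi> t h x z = x - h *\<^sub>R g x + h *\<^sub>R (\<sigma> t x *v z)"

definition \<Phi>1 :: "real \<Rightarrow> real \<Rightarrow> real^'n \<Rightarrow> real^'n \<Rightarrow> real^'n \<Rightarrow> real^'n" where
  "\<Phi>1 t h x z k = (k - h *\<^sub>R g1 x k) + h *\<^sub>R (\<sigma>1 t x k *v z)"

definition \<Phi>2 :: "real \<Rightarrow> real \<Rightarrow> real^'n \<Rightarrow> real^'n \<Rightarrow> real^'n \<Rightarrow> real^'n \<Rightarrow> real^'n" where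
  "\<Phi>2 t h x z k l = h *\<^sub>R (\<sigma>2 t x k l *v z) - h *\<^sub>R g2 x k l"

text \<open>The dissipation of the drift is discarded here: a growth of the squared weight at rate
  \<open>\<mu>\<close> is outweighed in \<open>mixed_moment\<close> by the decay of the sixth
  moment. The growth consists of terms of order \<open>h^2\<close>, and the factor two in the
  matching condition of \<open>small\<close> comes from
  \<open>1 + gam \<le> 2 * gam\<close>.\<close>

lemma w_second_moment:
  assumes h: "small h" and t: "0 \<le> t"
  shows "(\<integral>z. (w (\<Phi> t h x z))^2 \<partial>\<nu>) \<le> (1 + \<mu> * h) * (w x)^2" "integrable \<nu> (\<lambda>z. (w (\<Phi> t h x z))^2)"
proof -
  let ?\<gamma> = "gam TYPE('n)"
  interpret prob_space "\<nu> :: (real^'n) measure" by (rule prob_space_gauss) simp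
  define a where "a = (x - xs) - h *\<^sub>R g x"
  define S where "S = \<sigma> t x"
  have hh: "0 < h" "h \<le> 1" "2 * K^2 * ?\<gamma> * h \<le> \<mu>" using h by (auto simp: small_def)
  have eq: "(w (\<Phi> t h x z))^2 = 1 + (norm a)^2 + 2 * h * (a \<bullet> (S *v z)) + h^2 * (norm (S *v z))^2" for z
  proof -
    have "\<Phi> t h x z - xs = a + h *\<^sub>R (S *v z)" by (simp add: \<Phi>_def a_def S_def)
    then show ?thesis unfolding w_sq power2_norm_eq_inner
      by (simp add: inner_add_left inner_add_right inner_commute power2_eq_square algebra_simps)
  qed
  have l: "linear (\<lambda>z. a \<bullet> (S *v z))" by (rule linearI) (auto simp: matrix_vector_right_distrib inner_add_right matrix_vector_mult_scaleR)
  have nS: "norm (S *v z) \<le> K * w x * N1 z" for z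
  proof -
    have "norm (S *v z) \<le> norm S * norm z" by (rule norm_matrix_vector_mult)
    also have "\<dots> \<le> (K * w x) * N1 z" using s_growth[OF t] K0 norm_le_N1 unfolding S_def by (intro mult_mono) auto
    finally show ?thesis .
  qed
  have [measurable]: "(\<lambda>z. S *v z) \<in> borel_measurable borel" by measurable
  have b: "\<bar>(norm (S *v z))^2\<bar> \<le> (K * w x)^2 * N1 z ^ 2" for z
    using power_mono[OF nS[of z], of 2] by (simp add: power_mult_distrib)
  have i: "integrable \<nu> (\<lambda>z. (norm (S *v z))^2)" by (rule nu_integrable[OF _ b]) measurable
  show "integrable \<nu> (\<lambda>z. (w (\<Phi> t h x z))^2)" unfolding eq using i nu_linear(1)[OF l] by auto
  have e: "(\<integral>z. (norm (S *v z))^2 \<partial>\<nu>) \<le> (K * w x)^2 * ?\<gamma>"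
    using nu_bound[OF _ b] by auto
  have a: "(norm a)^2 \<le> (1 + K^2 * h^2) * (norm (x - xs))^2"
  proof -
    have "(norm a)^2 \<le> (1 - 2 * \<mu> * h + K^2 * h^2) * (norm (x - xs))^2"
      using drift_contr(1)[of h "x - xs" xs] hh g0 by (simp add: a_def)
    also have "\<dots> \<le> (1 + K^2 * h^2) * (norm (x - xs))^2" using mu hh by (intro mult_right_mono) auto
    finally show ?thesis .
  qed
  have "(\<integral>z. (w (\<Phi> t h x z))^2 \<partial>\<nu>) = 1 + (norm a)^2 + h^2 * (\<integral>z. (norm (S *v z))^2 \<partial>\<nu>)"
    unfolding eq using i nu_linear[OF l] prob_space by simp
  also have "\<dots> \<le> 1 + (1 + K^2 * h^2) * (norm (x - xs))^2 + h^2 * ((K * w x)^2 * ?\<gamma>)"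
    using a e by (intro add_mono mult_left_mono) auto
  also have "\<dots> \<le> (w x)^2 + (K^2 * h^2) * (w x)^2 + h^2 * ((K * w x)^2 * ?\<gamma>)"
    unfolding w_sq by (simp add: algebra_simps)
  also have "\<dots> = (1 + h * (h * K^2 * (1 + ?\<gamma>))) * (w x)^2"
    by (simp add: power_mult_distrib power2_eq_square algebra_simps)
  also have "\<dots> \<le> (1 + h * \<mu>) * (w x)^2"
  proof -
    have "h * K^2 * (1 + ?\<gamma>) \<le> h * K^2 * (2 * ?\<gamma>)" using gam_ge1[where 'n='n] hh by (intro mult_left_mono) auto
    also have "\<dots> \<le> \<mu>" using hh(3) by (simp add: ac_simps)
    finally have "h * (h * K^2 * (1 + ?\<gamma>)) \<le> h * \<mu>" using hh by (intro mult_left_mono) auto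
    then show ?thesis by (intro mult_right_mono) auto
  qed
  finally show "(\<integral>z. (w (\<Phi> t h x z))^2 \<partial>\<nu>) \<le> (1 + \<mu> * h) * (w x)^2" by (simp add: mult.commute)
qed

text \<open>Young's inequality reduces the mixed moments to the second moment of the weight and to the
  sixth moment of the increment.\<close>

lemma mixed_moment:
  fixes \<zeta> :: "real^'n \<Rightarrow> real"
  assumes h: "small h" and t: "0 \<le> t" and D: "0 < D" and j: "j \<in> {1, 2, 3}"
    and [measurable]: "\<zeta> \<in> borel_measurable borel" and z0: "\<And>z. 0 \<le> \<zeta> z"
    and m: "(\<integral>z. \<zeta> z ^ 6 \<partial>\<nu>) \<le> (1 - 4 * \<mu> * h) * D ^ 6" "integrable \<nu> (\<lambda>z. \<zeta> z ^ 6)"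
    and \<Phi>m: "\<Phi> t h x \<in> borel_measurable borel"
  shows "integrable \<nu> (\<lambda>z. w (\<Phi> t h x z) * \<zeta> z ^ j)"
    "(\<integral>z. w (\<Phi> t h x z) * \<zeta> z ^ j \<partial>\<nu>) \<le> (1 - \<mu> / 6 * h) * w x * D ^ j"
proof -
  interpret prob_space "\<nu> :: (real^'n) measure" by (rule prob_space_gauss) simp
  note [measurable] = \<Phi>m
  define v where "v = (\<lambda>z. w (\<Phi> t h x z))"
  \<comment> \<open>Young's inequality for \<open>v / w x\<close> and
    \<open>(\<zeta> / D) ^ j\<close>, scaled back. The power \<open>2 * j\<close> of
    \<open>\<zeta> / D\<close> is interpolated between the constant one and the sixth power.\<close>
  define R where "R = (\<lambda>z. (1/2) * ((v z)^2 / w x * D ^ j + w x * D ^ j * ((real j * (\<zeta> z ^ 6 / D ^ 6) + (3 - real j)) / 3)))"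
  have iv: "integrable \<nu> (\<lambda>z. (v z)^2)" and ev: "(\<integral>z. (v z)^2 \<partial>\<nu>) \<le> (1 + \<mu> * h) * (w x)^2"
    using w_second_moment[OF h t, of x] by (auto simp: v_def)
  have iR: "integrable \<nu> R" unfolding R_def using iv m(2) by auto
  have le: "v z * \<zeta> z ^ j \<le> R z" for z
  proof -
    define s where "s = \<zeta> z / D"
    have s0: "0 \<le> s" using z0 D by (simp add: s_def)
    have zs: "\<zeta> z = s * D" using D by (simp add: s_def)
    have y: "(s ^ j)^2 \<le> (real j * s ^ 6 + (3 - real j)) / 3"
    proof -
      define q where "q = s^2"
      have q0: "0 \<le> q" by (simp add: q_def)
      \<comment> \<open>The double root at \<open>q = 1\<close> is the equality case of the weighted
        mean inequality, for \<open>j = 1\<close> and for \<open>j = 2\<close>.\<close>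
      have "0 \<le> (q - 1)^2 * (q + 2)" "0 \<le> (q - 1)^2 * (2 * q + 1)" using q0 by (auto intro!: mult_nonneg_nonneg)
      then have "3 * q \<le> q^3 + 2" "3 * q^2 \<le> 2 * q^3 + 1" by (auto simp: power2_eq_square power3_eq_cube algebra_simps)
      moreover have "q^3 = s^6" "q^2 = s^4" by (simp_all add: q_def flip: power_mult)
      ultimately have "3 * s^2 \<le> s^6 + 2" "3 * s^4 \<le> 2 * s^6 + 1" by (simp_all add: q_def)
      then show ?thesis using j by (auto simp flip: power_mult)
    qed
    have "m * n \<le> (1/2) * (m^2 + r)" if "n^2 \<le> r" for m n r :: real
      using sum_squares_bound[of m n] that by simp
    from this[OF y] have "v z / w x * s ^ j \<le> (1/2) * ((v z / w x)^2 + (real j * s ^ 6 + (3 - real j)) / 3)" .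
    then have "(w x * D ^ j) * (v z / w x * s ^ j) \<le> (w x * D ^ j) * ((1/2) * ((v z / w x)^2 + (real j * s ^ 6 + (3 - real j)) / 3))"
      using D by (intro mult_left_mono) auto
    also have "\<dots> = R z"
      using D by (simp add: R_def zs power_mult_distrib power_divide power2_eq_square field_simps)
    also have "(w x * D ^ j) * (v z / w x * s ^ j) = v z * \<zeta> z ^ j" by (simp add: zs power_mult_distrib)
    finally show ?thesis .
  qed
  have nn: "0 \<le> v z * \<zeta> z ^ j" for z using z0 by (simp add: v_def)
  have i: "integrable \<nu> (\<lambda>z. v z * \<zeta> z ^ j)"
  proof (rule Bochner_Integration.integrable_bound[OF iR])
    have "norm (v z * \<zeta> z ^ j) \<le> norm (R z)" for z using le[of z] nn[of z] by simp
    then show "AE z in \<nu>. norm (v z * \<zeta> z ^ j) \<le> norm (R z)" by simp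
  qed (simp add: v_def)
  then show "integrable \<nu> (\<lambda>z. w (\<Phi> t h x z) * \<zeta> z ^ j)" by (simp add: v_def)
  have mh: "0 \<le> \<mu> * h" using mu h by (simp add: small_def)
  have "(\<integral>z. v z * \<zeta> z ^ j \<partial>\<nu>) \<le> (\<integral>z. R z \<partial>\<nu>)" by (rule integral_mono[OF i iR le])
  also have "\<dots> = (1/2) * ((\<integral>z. (v z)^2 \<partial>\<nu>) / w x * D ^ j + w x * D ^ j * ((real j * ((\<integral>z. \<zeta> z ^ 6 \<partial>\<nu>) / D ^ 6) + (3 - real j)) / 3))"
    unfolding R_def using iv m(2) prob_space by simp
  also have "\<dots> \<le> (1/2) * ((1 + \<mu> * h) * (w x)^2 / w x * D ^ j + w x * D ^ j * ((real j * ((1 - 4 * \<mu> * h) * D ^ 6 / D ^ 6) + (3 - real j)) / 3))"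
    using ev m(1) D by (intro mult_left_mono add_mono mult_right_mono divide_right_mono) auto
  \<comment> \<open>The growth of the weight contributes \<open>1 / 2\<close>, the decay of the
    sixth moment \<open>- 2 * j / 3\<close>; the worst case is \<open>j = 1\<close>, with net rate
    \<open>- 1 / 6\<close>.\<close>
  also have "\<dots> = w x * D ^ j * (1 + (1 / 2 - 2 / 3 * real j) * (\<mu> * h))"
    using D by (simp add: power2_eq_square field_simps)
  also have "\<dots> \<le> w x * D ^ j * (1 + (- 1 / 6) * (\<mu> * h))"
    using D mh j by (intro mult_left_mono add_left_mono mult_right_mono) auto
  also have "\<dots> = (1 - \<mu> / 6 * h) * w x * D ^ j" by (simp add: algebra_simps)
  finally show "(\<integral>z. w (\<Phi> t h x z) * \<zeta> z ^ j \<partial>\<nu>) \<le> (1 - \<mu> / 6 * h) * w x * D ^ j" by (simp add: v_def)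
qed

end

section \<open>Propagation of Taylor jets by the scheme\<close>

text \<open>A linear map is a finite combination of its values on the axes, so measurability in the
  base point for each fixed direction gives joint measurability.\<close>

lemma linear_measurable:
  fixes p :: "'a \<Rightarrow> real^'n \<Rightarrow> 'b::euclidean_space"
  assumes l: "\<And>y. linear (p y)" and m: "\<And>k. (\<lambda>y. p y k) \<in> borel_measurable R"
    and [measurable]: "Y \<in> N \<rightarrow>\<^sub>M R" "V \<in> borel_measurable N"
  shows "(\<lambda>om. p (Y om) (V om)) \<in> borel_measurable N"
proof -
  have "p y v = (\<Sum>i\<in>UNIV. v $ i *\<^sub>R p y (axis i 1))" for y v
  proof -
    have "p y v = p y (\<Sum>i\<in>UNIV. v $ i *\<^sub>R axis i 1)" using basis_expansion[of v] by (simp add: scalar_mult_eq_scaleR)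
    then show ?thesis by (simp add: linear_sum[OF l] linear_scale[OF l])
  qed
  then have "(\<lambda>om. p (Y om) (V om)) = (\<lambda>om. \<Sum>i\<in>UNIV. V om $ i *\<^sub>R p (Y om) (axis i 1))" by (rule ext)
  also have "\<dots> \<in> borel_measurable N"
  proof (intro borel_measurable_sum borel_measurable_scaleR)
    fix i :: 'n
    show "(\<lambda>om. V om $ i) \<in> borel_measurable N" by measurable
    show "(\<lambda>om. p (Y om) (axis i 1)) \<in> borel_measurable N" by (rule measurable_compose[OF _ m]) measurable
  qed
  finally show ?thesis .
qed

lemma bilinear_measurable:
  fixes q :: "'a \<Rightarrow> real^'n \<Rightarrow> real^'n \<Rightarrow> 'b::euclidean_space"
  assumes l: "\<And>y. bilinear (q y)" and m: "\<And>k l. (\<lambda>y. q y k l) \<in> borel_measurable R"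
    and [measurable]: "Y \<in> N \<rightarrow>\<^sub>M R" "V \<in> borel_measurable N" "W \<in> borel_measurable N"
  shows "(\<lambda>om. q (Y om) (V om) (W om)) \<in> borel_measurable N"
proof -
  have 1: "(\<lambda>om. q (Y om) k (W om)) \<in> borel_measurable N" for k
    by (rule linear_measurable[of "\<lambda>y. q y k", OF _ m]) (use l in \<open>auto simp: bilinear_def\<close>)
  have "(\<lambda>om. (\<lambda>om k. q (Y om) k (W om)) om (V om)) \<in> borel_measurable N"
    by (rule linear_measurable[where R = N and p = "\<lambda>om k. q (Y om) k (W om)", OF _ 1]) (use l in \<open>auto simp: bilinear_def\<close>)
  then show ?thesis .
qed

section \<open>Pathwise bounds for one step, and the transition operator on Taylor
  expansions\<close>

context coeffs
begin

lemma \<Phi>_joint [measurable]: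
  assumes "0 \<le> t" shows "(\<lambda>x. \<Phi> t h (fst x) (snd x)) \<in> borel_measurable (borel \<Otimes>\<^sub>M borel)"
  using smooth3D(1)[OF gs] smooth3D(1)[OF ss[OF assms]] unfolding \<Phi>_def by measurable

lemma \<Phi>1_joint:
  assumes "0 \<le> t" shows "(\<lambda>x. \<Phi>1 t h (fst x) (snd x) k) \<in> borel_measurable (borel \<Otimes>\<^sub>M borel)"
  using smooth3D(2)[OF gs, of k] smooth3D(2)[OF ss[OF assms], of k] unfolding \<Phi>1_def by measurable

lemma \<Phi>2_joint:
  assumes "0 \<le> t" shows "(\<lambda>x. \<Phi>2 t h (fst x) (snd x) k l) \<in> borel_measurable (borel \<Otimes>\<^sub>M borel)"
  using smooth3D(3)[OF gs, of k l] smooth3D(3)[OF ss[OF assms], of k l] unfolding \<Phi>2_def by measurable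

lemma \<Phi>_meas: "\<Phi> t h x \<in> borel_measurable borel" unfolding \<Phi>_def by measurable
lemma \<Phi>1_meas: "(\<lambda>z. \<Phi>1 t h x z k) \<in> borel_measurable borel" unfolding \<Phi>1_def by measurable
lemma \<Phi>2_meas: "(\<lambda>z. \<Phi>2 t h x z k l) \<in> borel_measurable borel" unfolding \<Phi>2_def by measurable

lemma \<Phi>1_linear:
  assumes "0 \<le> t" shows "linear (\<Phi>1 t h x z)"
proof -
  note l = smooth3D(4)[OF gs, of x] smooth3D(4)[OF ss[OF assms], of x]
  show ?thesis unfolding \<Phi>1_def
    by (rule linearI) (simp_all add: linear_add[OF l(1)] linear_add[OF l(2)] linear_scale[OF l(1)] linear_scale[OF l(2)]
      matrix_vector_mult_add_rdistrib scaleR_matrix_vector_assoc[symmetric] algebra_simps)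
qed

lemma \<Phi>2_bilinear:
  assumes "0 \<le> t" shows "bilinear (\<Phi>2 t h x z)"
proof -
  note l = smooth3D(5)[OF gs, of x] smooth3D(5)[OF ss[OF assms], of x]
  show ?thesis unfolding bilinear_def \<Phi>2_def
    by (intro conjI allI linearI)
      (simp_all add: bilinear_ladd[OF l(1)] bilinear_ladd[OF l(2)] bilinear_radd[OF l(1)] bilinear_radd[OF l(2)]
       bilinear_lmul[OF l(1)] bilinear_lmul[OF l(2)] bilinear_rmul[OF l(1)] bilinear_rmul[OF l(2)]
      matrix_vector_mult_add_rdistrib scaleR_matrix_vector_assoc[symmetric] algebra_simps)
qed

text \<open>The noise and drift parts of the step and of its Taylor errors enter as
  \<open>h S z - h b\<close>, with one bound for the matrix and for the drift part.\<close>

lemma step_matrix_bound: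
  assumes "norm b \<le> B" "norm S \<le> B" and h: "0 \<le> h"
  shows "norm (h *\<^sub>R (S *v z) - h *\<^sub>R b) \<le> h * B * N1 z"
proof -
  have "norm (h *\<^sub>R (S *v z) - h *\<^sub>R b) \<le> h * (norm S * norm z) + h * norm b"
    using h by (intro order_trans[OF norm_triangle_ineq4] add_mono) (auto intro!: mult_left_mono norm_matrix_vector_mult)
  also have "\<dots> \<le> h * (B * norm z) + h * B" using assms by (intro add_mono mult_left_mono mult_right_mono) auto
  finally show ?thesis by (simp add: N1_def algebra_simps)
qed

text \<open>Bounds for each value of the noise, at the price of a factor \<open>N1 z\<close>. They
  do not contract; they serve for integrability and for terms that have a factor \<open>h\<close> to
  spare.\<close>

lemma step_bounds:
  assumes h: "0 < h" "h \<le> 1" and t: "0 \<le> t"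
  shows "norm (\<Phi> t h x z - x) \<le> h * K * w x * N1 z"
    and "w (\<Phi> t h x z) \<le> 2 * K * w x * N1 z"
    and "norm (\<Phi>1 t h x z k) \<le> 2 * K * norm k * N1 z"
    and "norm (\<Phi>2 t h x z k l) \<le> h * K * norm k * norm l * N1 z"
    and "norm (\<Phi> t h (x + d) z - \<Phi> t h x z) \<le> 2 * K * norm d * N1 z"
    and "norm (\<Phi> t h (x + d) z - \<Phi> t h x z - \<Phi>1 t h x z d) \<le> 2 * h * K * (norm d)^2 * N1 z"
    and "norm (\<Phi> t h (x + d) z - \<Phi> t h x z - \<Phi>1 t h x z d - (1/2) *\<^sub>R \<Phi>2 t h x z d d) \<le> h * K * norm d ^ 3 * N1 z"
proof -
  have h0: "0 \<le> h" using h by simp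
  note sm = ss[OF t]
  have KN: "1 \<le> K * N1 z" using mult_mono[of 1 K 1 "N1 z"] K1 by simp
  have one: "norm (k + u) \<le> 2 * K * norm k * N1 z" if u: "norm u \<le> h * (K * norm k) * N1 z" for k u :: "real^'n"
  proof -
    have "h * (K * norm k * N1 z) \<le> 1 * (K * norm k * N1 z)" using h K0 by (intro mult_right_mono) auto
    then have 1: "norm u \<le> K * norm k * N1 z" using u by (simp add: mult.assoc)
    have 2: "norm k \<le> K * norm k * N1 z" using mult_left_mono[OF KN, of "norm k"] by (simp add: ac_simps)
    show ?thesis using norm_triangle_ineq[of k u] 1 2 by linarith
  qed
  have "\<Phi> t h x z - x = h *\<^sub>R (\<sigma> t x *v z) - h *\<^sub>R g x" by (simp add: \<Phi>_def)
  then show 1: "norm (\<Phi> t h x z - x) \<le> h * K * w x * N1 z"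
    using step_matrix_bound[OF g_growth(2)[of x] s_growth[OF t, of x] h0, of z] by (simp add: ac_simps)
  have "w (\<Phi> t h x z) \<le> w x + norm (\<Phi> t h x z - x)" using w_add[of x "\<Phi> t h x z - x"] by simp
  also have "\<dots> \<le> w x * (K * N1 z) + h * (K * w x * N1 z)"
    using 1 mult_left_mono[OF KN, of "w x"] by (intro add_mono) (auto simp: ac_simps)
  also have "\<dots> \<le> w x * (K * N1 z) + 1 * (K * w x * N1 z)" using h K0 by (intro add_left_mono mult_right_mono) auto
  finally show "w (\<Phi> t h x z) \<le> 2 * K * w x * N1 z" by (simp add: ac_simps)
  have e1: "\<Phi>1 t h x z k = k + (h *\<^sub>R (\<sigma>1 t x k *v z) - h *\<^sub>R g1 x k)" by (simp add: \<Phi>1_def)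
  show "norm (\<Phi>1 t h x z k) \<le> 2 * K * norm k * N1 z"
    unfolding e1 by (rule one[OF step_matrix_bound[OF smooth3D(6)[OF gs] smooth3D(6)[OF sm] h0]])
  show "norm (\<Phi>2 t h x z k l) \<le> h * K * norm k * norm l * N1 z"
    unfolding \<Phi>2_def using step_matrix_bound[OF smooth3D(7)[OF gs, of x k l] smooth3D(7)[OF sm, of x k l] h0, of z] by (simp add: ac_simps)
  have e: "\<Phi> t h (x + d) z - \<Phi> t h x z = d + (h *\<^sub>R ((\<sigma> t (x + d) - \<sigma> t x) *v z) - h *\<^sub>R (g (x + d) - g x))"
    by (simp add: \<Phi>_def matrix_vector_mult_diff_rdistrib algebra_simps)
  show "norm (\<Phi> t h (x + d) z - \<Phi> t h x z) \<le> 2 * K * norm d * N1 z"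
    unfolding e by (rule one[OF step_matrix_bound[OF smooth3D(8)[OF gs] smooth3D(8)[OF sm] h0]])
  have e2: "\<Phi> t h (x + d) z - \<Phi> t h x z - \<Phi>1 t h x z d =
     h *\<^sub>R ((\<sigma> t (x + d) - \<sigma> t x - \<sigma>1 t x d) *v z) - h *\<^sub>R (g (x + d) - g x - g1 x d)"
    unfolding e \<Phi>1_def by (simp add: matrix_vector_mult_diff_rdistrib algebra_simps)
  show "norm (\<Phi> t h (x + d) z - \<Phi> t h x z - \<Phi>1 t h x z d) \<le> 2 * h * K * (norm d)^2 * N1 z"
    unfolding e2 using step_matrix_bound[OF smooth3_taylor1[OF gs K0(1), of x d] smooth3_taylor1[OF sm K0(1), of x d] h0, of z] by (simp add: ac_simps)
  have e3: "\<Phi> t h (x + d) z - \<Phi> t h x z - \<Phi>1 t h x z d - (1/2) *\<^sub>R \<Phi>2 t h x z d d =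
     h *\<^sub>R ((\<sigma> t (x + d) - \<sigma> t x - \<sigma>1 t x d - (1/2) *\<^sub>R \<sigma>2 t x d d) *v z) - h *\<^sub>R (g (x + d) - g x - g1 x d - (1/2) *\<^sub>R g2 x d d)"
    unfolding e2 \<Phi>2_def by (simp add: matrix_vector_mult_diff_rdistrib scaleR_matrix_vector_assoc[symmetric] algebra_simps)
  show "norm (\<Phi> t h (x + d) z - \<Phi> t h x z - \<Phi>1 t h x z d - (1/2) *\<^sub>R \<Phi>2 t h x z d d) \<le> h * K * norm d ^ 3 * N1 z"
    unfolding e3 using step_matrix_bound[OF smooth3D(10)[OF gs, of x d] smooth3D(10)[OF sm, of x d] h0, of z] by (simp add: ac_simps)
qed

text \<open>With \<open>lam = \<mu> / 12\<close>, the product \<open>k2 * lam\<close> exceeds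
  \<open>2 * K^2 * gam\<close>, the coefficient of the term with \<open>\<Phi>2\<close> in the
  second derivative of a composition. Likewise \<open>k3 * lam\<close> exceeds the coefficient of
  the lower order terms in its Taylor remainder.\<close>

definition k2 :: real where "k2 = 1 + 24 * K^2 * gam TYPE('n) / \<mu>"
definition k3 :: real where "k3 = 1 + 12 * (2 * K^2 + 8 * k2 * K^3) * gam TYPE('n) / \<mu>"

lemma k2_ge1: "1 \<le> k2" and k3_ge1: "1 \<le> k3"
proof -
  show k: "1 \<le> k2" unfolding k2_def using mu gam_ge1[where 'n='n] by simp
  show "1 \<le> k3" unfolding k3_def using mu gam_ge1[where 'n='n] k K0 by simp
qed

text \<open>Second order Taylor expansions of \<open>u\<close> whose coefficients grow linearly. The weights
  \<^const>\<open>k2\<close> and \<^const>\<open>k3\<close> of the higher orders are chosen such that the lower order terms which the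
  chain rule produces are absorbed by the contraction. Working with expansions instead of derivatives
  avoids all differentiation under the integral sign.\<close>

definition jet :: "real \<Rightarrow> (real^'n \<Rightarrow> real) \<Rightarrow> (real^'n \<Rightarrow> real^'n \<Rightarrow> real) \<Rightarrow> (real^'n \<Rightarrow> real^'n \<Rightarrow> real^'n \<Rightarrow> real) \<Rightarrow> bool" where
  "jet A u p q \<longleftrightarrow> u \<in> borel_measurable borel \<and>
    (\<forall>k. (\<lambda>x. p x k) \<in> borel_measurable borel) \<and> (\<forall>k l. (\<lambda>x. q x k l) \<in> borel_measurable borel) \<and>
    (\<forall>x. linear (p x)) \<and> (\<forall>x. bilinear (q x)) \<and>
    (\<forall>x k. \<bar>p x k\<bar> \<le> A * w x * norm k) \<and> (\<forall>x k l. \<bar>q x k l\<bar> \<le> k2 * A * w x * norm k * norm l) \<and>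
    (\<forall>x d. \<bar>u (x + d) - u x - p x d - q x d d / 2\<bar> \<le> k3 * A * (w x + w (x + d)) * norm d ^ 3)"

lemma jetD:
  assumes "jet A u p q"
  shows "u \<in> borel_measurable borel" "(\<lambda>x. p x k) \<in> borel_measurable borel" "(\<lambda>x. q x k l) \<in> borel_measurable borel"
    "linear (p x)" "bilinear (q x)" "\<bar>p x k\<bar> \<le> A * w x * norm k" "\<bar>q x k l\<bar> \<le> k2 * A * w x * norm k * norm l"
    "\<bar>u (x + d) - u x - p x d - q x d d / 2\<bar> \<le> k3 * A * (w x + w (x + d)) * norm d ^ 3"
  using assms unfolding jet_def by blast+

lemma jet_growth:
  assumes j: "jet A u p q" and A: "0 \<le> A"
  shows "\<bar>u (x + d) - u x\<bar> \<le> 4 * k2 * k3 * A * (w x + norm d)^4"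
proof -
  define s where "s = w x + norm d"
  have s: "1 \<le> s" "w x \<le> s" "norm d \<le> s" "w (x + d) \<le> s" "0 \<le> s"
    using w_add[of x d] w_ge1[of x] norm_ge_zero[of d] unfolding s_def by linarith+
  have k: "1 \<le> k2 * k3" "k2 \<le> k2 * k3" "k3 \<le> k2 * k3"
    using k2_ge1 k3_ge1 mult_mono[of 1 k2 1 k3] by auto
  have "\<bar>p x d\<bar> \<le> A * w x * norm d" by (rule jetD(6)[OF j])
  also have "\<dots> \<le> A * s * s" using A s by (intro mult_mono) auto
  finally have 1: "\<bar>p x d\<bar> \<le> A * s^2" by (simp add: power2_eq_square ac_simps)
  have "\<bar>q x d d\<bar> \<le> k2 * A * w x * norm d * norm d" by (rule jetD(7)[OF j])
  also have "\<dots> \<le> k2 * A * s * s * s" using A s k2_ge1 by (intro mult_mono) auto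
  finally have 2: "\<bar>q x d d\<bar> \<le> k2 * A * s^3" by (simp add: power3_eq_cube ac_simps)
  have "\<bar>u (x + d) - u x - p x d - q x d d / 2\<bar> \<le> k3 * A * (w x + w (x + d)) * norm d ^ 3" by (rule jetD(8)[OF j])
  also have "\<dots> \<le> k3 * A * (s + s) * s ^ 3" using A s k3_ge1 by (intro mult_mono add_mono power_mono) auto
  finally have 3: "\<bar>u (x + d) - u x - p x d - q x d d / 2\<bar> \<le> 2 * (k3 * A * s^4)" by (simp add: power3_eq_cube power4_eq_xxxx ac_simps)
  have i1: "s^2 \<le> s^4" "s^3 \<le> s^4" using s(1) by (auto intro: power_increasing)
  have m1: "A * s^2 \<le> k2 * k3 * (A * s^4)"
    using mult_mono[OF k(1) mult_left_mono[OF i1(1) A]] A s k2_ge1 k3_ge1 by simp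
  have m2: "k2 * A * s^3 \<le> k2 * k3 * (A * s^4)"
    using mult_mono[OF k(2) mult_left_mono[OF i1(2) A]] A s k2_ge1 k3_ge1 by simp
  have m3: "k3 * A * s^4 \<le> k2 * k3 * (A * s^4)"
    using mult_right_mono[OF k(3), of "A * s^4"] A s by simp
  have m0: "0 \<le> k2 * k3 * (A * s^4)" using A s k2_ge1 k3_ge1 by simp
  have "\<bar>u (x + d) - u x\<bar> \<le> \<bar>p x d\<bar> + \<bar>q x d d\<bar> / 2 + \<bar>u (x + d) - u x - p x d - q x d d / 2\<bar>" by linarith
  also have "\<dots> \<le> 4 * (k2 * k3 * (A * s^4))" using 1 2 3 m1 m2 m3 m0 by linarith
  finally show ?thesis by (simp add: s_def ac_simps)
qed

lemma step_integrable:
  assumes h: "0 < h" "h \<le> 1" and t: "0 \<le> t" and [measurable]: "u \<in> borel_measurable borel"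
    and u: "\<And>y. \<bar>u y\<bar> \<le> C * w y ^ 4" and C: "0 \<le> C"
  shows "integrable \<nu> (\<lambda>z. u (\<Phi> t h x z))"
proof (rule nu_integrable)
  note [measurable] = \<Phi>_meas
  show "(\<lambda>z. u (\<Phi> t h x z)) \<in> borel_measurable borel" by measurable
  show "\<bar>u (\<Phi> t h x z)\<bar> \<le> (C * (2 * K * w x)^4) * N1 z ^ 4" for z
  proof -
    have "\<bar>u (\<Phi> t h x z)\<bar> \<le> C * w (\<Phi> t h x z) ^ 4" by (rule u)
    also have "\<dots> \<le> C * (2 * K * w x * N1 z)^4" using C by (intro mult_left_mono power_mono step_bounds(2)[OF h t]) auto
    finally show ?thesis by (simp add: power_mult_distrib ac_simps)
  qed
qed

text \<open>Expansion at \<open>xs\<close>, where the weight is one. The growth has order four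
  because the cubic remainder carries a further weight; \<open>64 = 4 * 2^4\<close>.\<close>

lemma jet_growth4:
  assumes j: "jet A u p q" and A: "0 \<le> A"
  shows "\<bar>u y\<bar> \<le> (\<bar>u xs\<bar> + 64 * k2 * k3 * A) * w y ^ 4"
proof -
  have "\<bar>u y\<bar> \<le> \<bar>u xs\<bar> + 4 * k2 * k3 * A * (w xs + norm (y - xs))^4"
    using jet_growth[OF j A, of xs "y - xs"] by simp
  also have "w xs = 1" by (simp add: w_def norm_Pair)
  also have "4 * k2 * k3 * A * (1 + norm (y - xs))^4 \<le> 4 * k2 * k3 * A * (2 * w y)^4"
  proof (intro mult_left_mono power_mono)
    show "1 + norm (y - xs) \<le> 2 * w y" using dist_le_w[of y] w_ge1[of y] by linarith
  qed (use A k2_ge1 k3_ge1 in auto)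
  also have "\<bar>u xs\<bar> \<le> \<bar>u xs\<bar> * w y ^ 4" using mult_left_mono[of 1 "w y ^ 4" "\<bar>u xs\<bar>"] by (simp add: one_le_power)
  finally show ?thesis by (simp add: power_mult_distrib algebra_simps)
qed

text \<open>Half of the rate \<open>\<mu> / 6\<close> of \<open>mixed_moment\<close>; the other half
  absorbs the lower order terms of the chain rule.\<close>

definition lam :: real where "lam = \<mu> / 12"

text \<open>The transition operator; \<open>Pp\<close> and \<open>Pq\<close> are what the chain rule
  under the integral would give for its first two derivatives. They are candidates for expansion
  coefficients, and the expansion is verified directly.\<close>

definition Pu :: "real \<Rightarrow> real \<Rightarrow> (real^'n \<Rightarrow> real) \<Rightarrow> real^'n \<Rightarrow> real" where
  "Pu t h u x = (\<integral>z. u (\<Phi> t h x z) \<partial>\<nu>)"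
definition Pp :: "real \<Rightarrow> real \<Rightarrow> (real^'n \<Rightarrow> real^'n \<Rightarrow> real) \<Rightarrow> real^'n \<Rightarrow> real^'n \<Rightarrow> real" where
  "Pp t h p x k = (\<integral>z. p (\<Phi> t h x z) (\<Phi>1 t h x z k) \<partial>\<nu>)"
definition Pq :: "real \<Rightarrow> real \<Rightarrow> (real^'n \<Rightarrow> real^'n \<Rightarrow> real) \<Rightarrow> (real^'n \<Rightarrow> real^'n \<Rightarrow> real^'n \<Rightarrow> real) \<Rightarrow> real^'n \<Rightarrow> real^'n \<Rightarrow> real^'n \<Rightarrow> real" where
  "Pq t h p q x k l = (\<integral>z. q (\<Phi> t h x z) (\<Phi>1 t h x z k) (\<Phi>1 t h x z l) + p (\<Phi> t h x z) (\<Phi>2 t h x z k l) \<partial>\<nu>)"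

lemma nu_integral_measurable:
  fixes f :: "real^'n \<Rightarrow> real^'n \<Rightarrow> real"
  assumes "(\<lambda>x. f (fst x) (snd x)) \<in> borel_measurable (borel \<Otimes>\<^sub>M borel)"
  shows "(\<lambda>x. \<integral>z. f x z \<partial>\<nu>) \<in> borel_measurable borel"
proof -
  interpret prob_space "\<nu> :: (real^'n) measure" by (rule prob_space_gauss) simp
  have "sets (borel \<Otimes>\<^sub>M (\<nu> :: (real^'n) measure)) = sets (borel \<Otimes>\<^sub>M borel)" by (intro sets_pair_measure_cong) auto
  then have "(\<lambda>x. f (fst x) (snd x)) \<in> borel_measurable (borel \<Otimes>\<^sub>M \<nu>)"
    using assms measurable_cong_sets by blast
  then have "(\<lambda>(x, z). f x z) \<in> borel_measurable (borel \<Otimes>\<^sub>M \<nu>)" by (simp add: split_beta')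
  then show ?thesis by (rule borel_measurable_lebesgue_integral)
qed

lemma Pu_meas:
  assumes "0 \<le> t" "u \<in> borel_measurable borel"
  shows "Pu t h u \<in> borel_measurable borel"
  unfolding Pu_def[abs_def]
  by (rule nu_integral_measurable[where f = "\<lambda>x z. u (\<Phi> t h x z)"])
    (rule measurable_compose[OF \<Phi>_joint[OF assms(1)] assms(2)])

lemma sixth_\<Phi>1:
  assumes h: "small h" and t: "0 \<le> t" and k: "k \<noteq> 0"
  shows "(\<integral>z. norm (\<Phi>1 t h x z k) ^ 6 \<partial>\<nu>) \<le> (1 - 4 * \<mu> * h) * norm k ^ 6" "integrable \<nu> (\<lambda>z. norm (\<Phi>1 t h x z k) ^ 6)"
  unfolding \<Phi>1_def using h k
  by (intro sixth_moment_small[OF h drift_contr(2)] smooth3D(6)[OF ss[OF t]]; simp add: small_def)+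

text \<open>The Taylor remainder of a composition involves true differences of the step; they
  contract like the linearised step.\<close>

lemma sixth_\<Phi>_diff:
  assumes h: "small h" and t: "0 \<le> t" and d: "d \<noteq> 0"
  shows "(\<integral>z. norm (\<Phi> t h (x + d) z - \<Phi> t h x z) ^ 6 \<partial>\<nu>) \<le> (1 - 4 * \<mu> * h) * norm d ^ 6" "integrable \<nu> (\<lambda>z. norm (\<Phi> t h (x + d) z - \<Phi> t h x z) ^ 6)"
proof -
  have e: "\<Phi> t h (x + d) z - \<Phi> t h x z = (d - h *\<^sub>R (g (x + d) - g x)) + h *\<^sub>R ((\<sigma> t (x + d) - \<sigma> t x) *v z)" for z
    by (simp add: \<Phi>_def matrix_vector_mult_diff_rdistrib algebra_simps)
  show "(\<integral>z. norm (\<Phi> t h (x + d) z - \<Phi> t h x z) ^ 6 \<partial>\<nu>) \<le> (1 - 4 * \<mu> * h) * norm d ^ 6" "integrable \<nu> (\<lambda>z. norm (\<Phi> t h (x + d) z - \<Phi> t h x z) ^ 6)"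
    unfolding e using h d
    by (intro sixth_moment_small[OF h drift_contr(1)] smooth3D(8)[OF ss[OF t]]; simp add: small_def)+
qed

text \<open>The leading part of the order \<open>j\<close> estimate is the weight times a
  \<open>j\<close>-th power of a linearised or true increment of the step, so
  \<open>mixed_moment\<close> contracts it at the rate \<open>\<mu> / 6\<close>. What the chain rule
  adds involves lower order coefficients of the jet and a factor \<open>h\<close>; by the choice of
  \<open>k2\<close> and \<open>k3\<close> it uses up at most the rate \<open>lam\<close>.\<close>

lemma jet_step:
  assumes h: "small h" and t: "0 \<le> t" and j: "jet A u p q" and A: "0 \<le> A"
  shows "jet (A * (1 - lam * h)) (Pu t h u) (Pp t h p) (Pq t h p q)"
proof -
  let ?\<gamma> = "gam TYPE('n)"
  have h1: "0 < h" "h \<le> 1" and mh: "\<mu> * h \<le> 1" using h by (auto simp: small_def)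
  note um = jetD(1)[OF j] and pm = jetD(2)[OF j] and qm = jetD(3)[OF j]
  note pl = jetD(4)[OF j] and ql = jetD(5)[OF j] and pb = jetD(6)[OF j] and qb = jetD(7)[OF j] and ub = jetD(8)[OF j]
  note B = step_bounds[OF h1 t]
  have g1: "1 \<le> ?\<gamma>" by (rule gam_ge1)
  have k0: "0 \<le> k2" "0 \<le> k3" using k2_ge1 k3_ge1 by auto
  define lm where "lm = \<mu> / 6"
  have lam2: "lm * h = 2 * (lam * h)" by (simp add: lm_def lam_def)
  have lh: "0 \<le> lam * h" using mu h1 by (simp add: lam_def)
  have pm1: "(\<lambda>z. p (\<Phi> t h x z) (\<Phi>1 t h x z k)) \<in> borel_measurable borel" for x k
    by (rule linear_measurable[OF pl pm \<Phi>_meas \<Phi>1_meas])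
  have pm2: "(\<lambda>z. p (\<Phi> t h x z) (\<Phi>2 t h x z k l)) \<in> borel_measurable borel" for x k l
    by (rule linear_measurable[OF pl pm \<Phi>_meas \<Phi>2_meas])
  have qm1: "(\<lambda>z. q (\<Phi> t h x z) (\<Phi>1 t h x z k) (\<Phi>1 t h x z l)) \<in> borel_measurable borel" for x k l
    by (rule bilinear_measurable[OF ql qm \<Phi>_meas \<Phi>1_meas \<Phi>1_meas])
  have pbd1: "\<bar>p (\<Phi> t h x z) (\<Phi>1 t h x z k)\<bar> \<le> A * (w (\<Phi> t h x z) * norm (\<Phi>1 t h x z k) ^ 1)" for x z k
    using pb by (simp add: mult.assoc)
  have pbN: "\<bar>p (\<Phi> t h x z) (\<Phi>1 t h x z k)\<bar> \<le> (A * (2 * K * w x) * (2 * K * norm k)) * N1 z ^ 2" for x z k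
  proof -
    have "\<bar>p (\<Phi> t h x z) (\<Phi>1 t h x z k)\<bar> \<le> A * w (\<Phi> t h x z) * norm (\<Phi>1 t h x z k)" by (rule pb)
    also have "\<dots> \<le> A * (2 * K * w x * N1 z) * (2 * K * norm k * N1 z)"
      using A K0 by (intro mult_mono mult_left_mono B) auto
    finally show ?thesis by (simp add: power2_eq_square ac_simps)
  qed
  have pi1: "integrable \<nu> (\<lambda>z. p (\<Phi> t h x z) (\<Phi>1 t h x z k))" for x k
    by (rule nu_integrable[OF pm1 pbN])
  have p2N: "\<bar>p (\<Phi> t h x z) (\<Phi>2 t h x z k l)\<bar> \<le> (A * (2 * K * w x) * (h * K * norm k * norm l)) * N1 z ^ 2" for x z k l
  proof -
    have "\<bar>p (\<Phi> t h x z) (\<Phi>2 t h x z k l)\<bar> \<le> A * w (\<Phi> t h x z) * norm (\<Phi>2 t h x z k l)" by (rule pb)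
    also have "\<dots> \<le> A * (2 * K * w x * N1 z) * (h * K * norm k * norm l * N1 z)"
      using A K0 by (intro mult_mono mult_left_mono B) auto
    finally show ?thesis by (simp add: power2_eq_square ac_simps)
  qed
  have pi2: "integrable \<nu> (\<lambda>z. p (\<Phi> t h x z) (\<Phi>2 t h x z k l))" for x k l
    by (rule nu_integrable[OF pm2 p2N])
  have pe2: "(\<integral>z. \<bar>p (\<Phi> t h x z) (\<Phi>2 t h x z k l)\<bar> \<partial>\<nu>) \<le> (2 * K^2 * ?\<gamma>) * h * A * w x * norm k * norm l" for x k l
  proof -
    have "\<bar>\<integral>z. \<bar>p (\<Phi> t h x z) (\<Phi>2 t h x z k l)\<bar> \<partial>\<nu>\<bar> \<le> (A * (2 * K * w x) * (h * K * norm k * norm l)) * ?\<gamma>"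
      by (rule nu_bound[of _ _ 2]) (use pm2 p2N A K0 h1 in auto)
    then show ?thesis by (simp add: power2_eq_square ac_simps)
  qed
  have qN: "\<bar>q (\<Phi> t h x z) (\<Phi>1 t h x z k) (\<Phi>1 t h x z l)\<bar> \<le> (k2 * A * (2 * K * w x) * (2 * K * norm k) * (2 * K * norm l)) * N1 z ^ 3" for x z k l
  proof -
    have "\<bar>q (\<Phi> t h x z) (\<Phi>1 t h x z k) (\<Phi>1 t h x z l)\<bar> \<le> k2 * A * w (\<Phi> t h x z) * norm (\<Phi>1 t h x z k) * norm (\<Phi>1 t h x z l)" by (rule qb)
    also have "\<dots> \<le> k2 * A * (2 * K * w x * N1 z) * (2 * K * norm k * N1 z) * (2 * K * norm l * N1 z)"
      using A K0 k0 by (intro mult_mono mult_left_mono B) auto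
    finally show ?thesis by (simp add: power3_eq_cube ac_simps)
  qed
  have qi: "integrable \<nu> (\<lambda>z. q (\<Phi> t h x z) (\<Phi>1 t h x z k) (\<Phi>1 t h x z l))" for x k l
    by (rule nu_integrable[OF qm1 qN])
  have ui: "integrable \<nu> (\<lambda>z. u (\<Phi> t h x z))" for x
    by (rule step_integrable[OF h1 t um jet_growth4[OF j A]]) (use A k0 in auto)
  have mix1: "integrable \<nu> (\<lambda>z. w (\<Phi> t h x z) * norm (\<Phi>1 t h x z k) ^ i)"
    "(\<integral>z. w (\<Phi> t h x z) * norm (\<Phi>1 t h x z k) ^ i \<partial>\<nu>) \<le> (1 - lm * h) * w x * norm k ^ i"
    if "i \<in> {1,2,3}" "k \<noteq> 0" for x k i
    using mixed_moment[OF h t _ that(1) _ _ sixth_\<Phi>1[OF h t that(2)] \<Phi>_meas, of x x] that(2) \<Phi>1_meas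
    unfolding lm_def by auto
  have mix2: "integrable \<nu> (\<lambda>z. w (\<Phi> t h y z) * norm (\<Phi> t h (x + d) z - \<Phi> t h x z) ^ 3)"
    "(\<integral>z. w (\<Phi> t h y z) * norm (\<Phi> t h (x + d) z - \<Phi> t h x z) ^ 3 \<partial>\<nu>) \<le> (1 - lm * h) * w y * norm d ^ 3"
    if "d \<noteq> 0" for x y d
  proof -
    have "(\<lambda>z. norm (\<Phi> t h (x + d) z - \<Phi> t h x z)) \<in> borel_measurable borel"
      using \<Phi>_meas by measurable
    from mixed_moment[OF h t _ _ this _ sixth_\<Phi>_diff[OF h t that] \<Phi>_meas, of 3 y] that
    show "integrable \<nu> (\<lambda>z. w (\<Phi> t h y z) * norm (\<Phi> t h (x + d) z - \<Phi> t h x z) ^ 3)"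
      "(\<integral>z. w (\<Phi> t h y z) * norm (\<Phi> t h (x + d) z - \<Phi> t h x z) ^ 3 \<partial>\<nu>) \<le> (1 - lm * h) * w y * norm d ^ 3"
      unfolding lm_def by auto
  qed
  have le: "1 - lm * h \<le> 1 - lam * h" using lam2 lh by linarith
  show ?thesis
    unfolding jet_def
  proof (intro conjI allI)
    show "Pu t h u \<in> borel_measurable borel" by (rule Pu_meas[OF t um])
    show "(\<lambda>x. Pp t h p x k) \<in> borel_measurable borel" for k
      unfolding Pp_def
      by (rule nu_integral_measurable[where f = "\<lambda>x z. p (\<Phi> t h x z) (\<Phi>1 t h x z k)"])
        (rule linear_measurable[OF pl pm \<Phi>_joint[OF t] \<Phi>1_joint[OF t]])
    show "(\<lambda>x. Pq t h p q x k l) \<in> borel_measurable borel" for k l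
      unfolding Pq_def
      by (rule nu_integral_measurable[where f = "\<lambda>x z. q (\<Phi> t h x z) (\<Phi>1 t h x z k) (\<Phi>1 t h x z l) + p (\<Phi> t h x z) (\<Phi>2 t h x z k l)"])
        (intro borel_measurable_add bilinear_measurable[OF ql qm \<Phi>_joint[OF t] \<Phi>1_joint[OF t] \<Phi>1_joint[OF t]]
          linear_measurable[OF pl pm \<Phi>_joint[OF t] \<Phi>2_joint[OF t]])
    show "linear (Pp t h p x)" for x
      unfolding Pp_def
      by (rule linearI) (simp_all add: linear_add[OF \<Phi>1_linear[OF t]] linear_scale[OF \<Phi>1_linear[OF t]] linear_add[OF pl] linear_scale[OF pl] pi1)
    show "bilinear (Pq t h p q x)" for x
      unfolding Pq_def bilinear_def
      by (intro conjI allI linearI)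
       (simp_all add: linear_add[OF \<Phi>1_linear[OF t]] linear_scale[OF \<Phi>1_linear[OF t]] linear_add[OF pl] linear_scale[OF pl] pi2 qi
         bilinear_ladd[OF \<Phi>2_bilinear[OF t]] bilinear_radd[OF \<Phi>2_bilinear[OF t]] bilinear_lmul[OF \<Phi>2_bilinear[OF t]] bilinear_rmul[OF \<Phi>2_bilinear[OF t]]
         bilinear_ladd[OF ql] bilinear_radd[OF ql] bilinear_lmul[OF ql] bilinear_rmul[OF ql] algebra_simps)
    show "\<bar>Pp t h p x k\<bar> \<le> A * (1 - lam * h) * w x * norm k" for x k
    proof (cases "k = 0")
      case True
      have "Pp t h p x k = 0" unfolding Pp_def True using linear_0[OF \<Phi>1_linear[OF t]] linear_0[OF pl] by simp
      then show ?thesis using True by simp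
    next
      case False
      have "\<bar>Pp t h p x k\<bar> \<le> (\<integral>z. \<bar>p (\<Phi> t h x z) (\<Phi>1 t h x z k)\<bar> \<partial>\<nu>)" unfolding Pp_def by (rule integral_abs_bound)
      also have "\<dots> \<le> (\<integral>z. A * (w (\<Phi> t h x z) * norm (\<Phi>1 t h x z k) ^ 1) \<partial>\<nu>)"
        by (rule integral_mono[OF integrable_abs[OF pi1] integrable_mult_right[OF mix1(1)]]) (use pbd1 False in auto)
      also have "\<dots> = A * (\<integral>z. w (\<Phi> t h x z) * norm (\<Phi>1 t h x z k) ^ 1 \<partial>\<nu>)" by simp
      also have "\<dots> \<le> A * ((1 - lm * h) * w x * norm k ^ 1)" using A mix1(2)[of 1 k x] False by (intro mult_left_mono) auto
      also have "\<dots> \<le> A * ((1 - lam * h) * w x * norm k ^ 1)" using A le by (intro mult_left_mono mult_right_mono) auto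
      finally show ?thesis by (simp add: ac_simps)
    qed
    show "\<bar>Pq t h p q x k l\<bar> \<le> k2 * (A * (1 - lam * h)) * w x * norm k * norm l" for x k l
    proof (cases "k = 0 \<or> l = 0")
      case True
      have "Pq t h p q x k l = 0" unfolding Pq_def
        using True linear_0[OF \<Phi>1_linear[OF t]] linear_0[OF pl] bilinear_lzero[OF ql] bilinear_rzero[OF ql]
          bilinear_lzero[OF \<Phi>2_bilinear[OF t]] bilinear_rzero[OF \<Phi>2_bilinear[OF t]] by auto
      then show ?thesis using True by auto
    next
      case False
      then have kl: "k \<noteq> 0" "l \<noteq> 0" by auto
      \<comment> \<open>Balances Young's inequality between the two directions, so that the weighted
        sum of squares reproduces exactly \<open>norm k * norm l\<close>.\<close>
      define r where "r = norm l / norm k"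
      have r: "0 < r" using kl by (simp add: r_def)
      have q1: "\<bar>q (\<Phi> t h x z) (\<Phi>1 t h x z k) (\<Phi>1 t h x z l)\<bar> \<le>
         k2 * A * ((1/2) * (r * (w (\<Phi> t h x z) * norm (\<Phi>1 t h x z k) ^ 2) + (w (\<Phi> t h x z) * norm (\<Phi>1 t h x z l) ^ 2) / r))" for z
      proof -
        define a b where "a = norm (\<Phi>1 t h x z k)" and "b = norm (\<Phi>1 t h x z l)"
        have "2 * (sqrt r * a) * (b / sqrt r) \<le> (sqrt r * a)^2 + (b / sqrt r)^2" by (rule sum_squares_bound)
        then have ab: "a * b \<le> (1/2) * (r * a^2 + b^2 / r)" using r by (simp add: power_mult_distrib power_divide)
        have "\<bar>q (\<Phi> t h x z) (\<Phi>1 t h x z k) (\<Phi>1 t h x z l)\<bar> \<le> k2 * A * w (\<Phi> t h x z) * a * b"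
          unfolding a_def b_def by (rule qb)
        also have "\<dots> = k2 * A * w (\<Phi> t h x z) * (a * b)" by simp
        also have "\<dots> \<le> k2 * A * w (\<Phi> t h x z) * ((1/2) * (r * a^2 + b^2 / r))"
          using A k0 by (intro mult_left_mono ab) auto
        finally show ?thesis unfolding a_def b_def by (simp add: algebra_simps)
      qed
      have "(\<integral>z. \<bar>q (\<Phi> t h x z) (\<Phi>1 t h x z k) (\<Phi>1 t h x z l)\<bar> \<partial>\<nu>) \<le>
        (\<integral>z. k2 * A * ((1/2) * (r * (w (\<Phi> t h x z) * norm (\<Phi>1 t h x z k) ^ 2) + (w (\<Phi> t h x z) * norm (\<Phi>1 t h x z l) ^ 2) / r)) \<partial>\<nu>)"
        by (rule integral_mono[OF integrable_abs[OF qi] _ q1]) (use mix1(1)[of 2 k x] mix1(1)[of 2 l x] kl in auto)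
      also have "\<dots> = k2 * A * ((1/2) * (r * (\<integral>z. w (\<Phi> t h x z) * norm (\<Phi>1 t h x z k) ^ 2 \<partial>\<nu>) + (\<integral>z. w (\<Phi> t h x z) * norm (\<Phi>1 t h x z l) ^ 2 \<partial>\<nu>) / r))"
        using mix1(1)[of 2 k x] mix1(1)[of 2 l x] kl by simp
      also have "\<dots> \<le> k2 * A * ((1/2) * (r * ((1 - lm * h) * w x * norm k ^ 2) + ((1 - lm * h) * w x * norm l ^ 2) / r))"
        using A k0 r mix1(2)[of 2 k x] mix1(2)[of 2 l x] kl
        by (intro mult_left_mono add_mono divide_right_mono) auto
      also have "\<dots> = k2 * A * (1 - lm * h) * w x * norm k * norm l"
        using kl by (simp add: r_def power2_eq_square field_simps)
      finally have Q: "(\<integral>z. \<bar>q (\<Phi> t h x z) (\<Phi>1 t h x z k) (\<Phi>1 t h x z l)\<bar> \<partial>\<nu>) \<le> k2 * A * (1 - lm * h) * w x * norm k * norm l" .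
      have "\<bar>Pq t h p q x k l\<bar> \<le> (\<integral>z. \<bar>q (\<Phi> t h x z) (\<Phi>1 t h x z k) (\<Phi>1 t h x z l)\<bar> \<partial>\<nu>) + (\<integral>z. \<bar>p (\<Phi> t h x z) (\<Phi>2 t h x z k l)\<bar> \<partial>\<nu>)"
      proof -
        have "Pq t h p q x k l = (\<integral>z. q (\<Phi> t h x z) (\<Phi>1 t h x z k) (\<Phi>1 t h x z l) \<partial>\<nu>) + (\<integral>z. p (\<Phi> t h x z) (\<Phi>2 t h x z k l) \<partial>\<nu>)"
          unfolding Pq_def using qi pi2 by simp
        moreover have "\<bar>\<integral>z. q (\<Phi> t h x z) (\<Phi>1 t h x z k) (\<Phi>1 t h x z l) \<partial>\<nu>\<bar> \<le> (\<integral>z. \<bar>q (\<Phi> t h x z) (\<Phi>1 t h x z k) (\<Phi>1 t h x z l)\<bar> \<partial>\<nu>)"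
          by (rule integral_abs_bound)
        moreover have "\<bar>\<integral>z. p (\<Phi> t h x z) (\<Phi>2 t h x z k l) \<partial>\<nu>\<bar> \<le> (\<integral>z. \<bar>p (\<Phi> t h x z) (\<Phi>2 t h x z k l)\<bar> \<partial>\<nu>)"
          by (rule integral_abs_bound)
        ultimately show ?thesis by linarith
      qed
      also have "\<dots> \<le> k2 * A * (1 - lm * h) * w x * norm k * norm l + (2 * K^2 * ?\<gamma>) * h * A * w x * norm k * norm l"
        by (intro add_mono Q pe2)
      also have "\<dots> = (k2 * (1 - lm * h) + (2 * K^2 * ?\<gamma>) * h) * (A * w x * norm k * norm l)" by (simp add: algebra_simps)
      also have "\<dots> \<le> (k2 * (1 - lam * h)) * (A * w x * norm k * norm l)"
      proof (rule mult_right_mono)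
        have "2 * K^2 * ?\<gamma> \<le> k2 * lam" using mu by (simp add: k2_def lam_def field_simps)
        then have "2 * K^2 * ?\<gamma> * h \<le> k2 * lam * h" using h1 by (intro mult_right_mono) auto
        then show "k2 * (1 - lm * h) + (2 * K^2 * ?\<gamma>) * h \<le> k2 * (1 - lam * h)" unfolding lam2 by (simp add: algebra_simps)
      qed (use A in auto)
      finally show ?thesis by (simp add: ac_simps)
    qed
    show "\<bar>Pu t h u (x + d) - Pu t h u x - Pp t h p x d - Pq t h p q x d d / 2\<bar>
       \<le> k3 * (A * (1 - lam * h)) * (w x + w (x + d)) * norm d ^ 3" for x d
    proof (cases "d = 0")
      case True
      have "Pp t h p x 0 = 0" unfolding Pp_def using linear_0[OF \<Phi>1_linear[OF t]] linear_0[OF pl] by simp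
      moreover have "Pq t h p q x 0 0 = 0" unfolding Pq_def
        using linear_0[OF \<Phi>1_linear[OF t]] linear_0[OF pl] bilinear_lzero[OF ql]
          bilinear_lzero[OF \<Phi>2_bilinear[OF t]] by simp
      ultimately show ?thesis using True by simp
    next
      case False
      define \<eta> where "\<eta> = (\<lambda>z. \<Phi> t h (x + d) z - \<Phi> t h x z)"
      \<comment> \<open>Error of the new expansion before integration. It consists of the error of
        the old expansion at the increment \<open>\<eta>\<close> and of the effect of replacing
        \<open>\<eta>\<close> by its own second order expansion; the latter carries a factor
        \<open>h\<close>.\<close>
      define R where "R = (\<lambda>z. u (\<Phi> t h (x + d) z) - u (\<Phi> t h x z) - p (\<Phi> t h x z) (\<Phi>1 t h x z d)
         - (q (\<Phi> t h x z) (\<Phi>1 t h x z d) (\<Phi>1 t h x z d) + p (\<Phi> t h x z) (\<Phi>2 t h x z d d)) / 2)"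
      have iR: "integrable \<nu> R" unfolding R_def using ui pi1 pi2 qi by auto
      have eR: "(\<integral>z. R z \<partial>\<nu>) = Pu t h u (x + d) - Pu t h u x - Pp t h p x d - Pq t h p q x d d / 2"
        unfolding R_def Pu_def Pp_def Pq_def using ui pi1 pi2 qi by simp
      define c where "c = (2 * K^2 + 8 * k2 * K^3) * h * A * w x * norm d ^ 3"
      have c0: "0 \<le> c" unfolding c_def using K0 k0 h1 A by simp
      have Rb: "\<bar>R z\<bar> \<le> k3 * A * (w (\<Phi> t h x z) * norm (\<eta> z) ^ 3 + w (\<Phi> t h (x + d) z) * norm (\<eta> z) ^ 3) + c * N1 z ^ 3" for z
      proof -
        define y where "y = \<Phi> t h x z"
        define \<zeta> where "\<zeta> = \<Phi>1 t h x z d"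
        define \<theta> where "\<theta> = \<Phi>2 t h x z d d"
        define r where "r = \<eta> z - \<zeta> - (1/2) *\<^sub>R \<theta>"
        have y': "\<Phi> t h (x + d) z = y + \<eta> z" by (simp add: y_def \<eta>_def)
        have pe: "p y (\<eta> z) = p y \<zeta> + p y \<theta> / 2 + p y r"
        proof -
          have "\<eta> z = \<zeta> + (1/2) *\<^sub>R \<theta> + r" by (simp add: r_def)
          then show ?thesis by (simp add: linear_add[OF pl] linear_scale[OF pl])
        qed
        \<comment> \<open>Each product contains one factor of first order in \<open>norm d\<close>
          and the difference \<open>\<eta> z - \<zeta>\<close> of second order, hence the cube of
          \<open>norm d\<close>.\<close>
        have qe: "q y (\<eta> z) (\<eta> z) - q y \<zeta> \<zeta> = q y (\<eta> z) (\<eta> z - \<zeta>) + q y (\<eta> z - \<zeta>) \<zeta>"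
          by (simp add: bilinear_rsub[OF ql] bilinear_lsub[OF ql])
        have "R z = (u (y + \<eta> z) - u y - p y (\<eta> z) - q y (\<eta> z) (\<eta> z) / 2) + p y r + (q y (\<eta> z) (\<eta> z) - q y \<zeta> \<zeta>) / 2"
          unfolding R_def y' pe y_def[symmetric] \<zeta>_def[symmetric] \<theta>_def[symmetric] by (simp add: field_simps)
        moreover have "\<bar>a + b + (c' + e) / 2\<bar> \<le> \<bar>a\<bar> + \<bar>b\<bar> + (\<bar>c'\<bar> + \<bar>e\<bar>) / 2" for a b c' e :: real
        proof -
          have "\<bar>a + b + (c' + e) / 2\<bar> \<le> \<bar>a\<bar> + \<bar>b\<bar> + \<bar>(c' + e) / 2\<bar>" by linarith
          moreover have "\<bar>(c' + e) / 2\<bar> \<le> (\<bar>c'\<bar> + \<bar>e\<bar>) / 2" by simp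
          ultimately show ?thesis by linarith
        qed
        ultimately have r0: "\<bar>R z\<bar> \<le> \<bar>u (y + \<eta> z) - u y - p y (\<eta> z) - q y (\<eta> z) (\<eta> z) / 2\<bar> + \<bar>p y r\<bar> + (\<bar>q y (\<eta> z) (\<eta> z - \<zeta>)\<bar> + \<bar>q y (\<eta> z - \<zeta>) \<zeta>\<bar>) / 2"
          unfolding qe by metis
        have r1: "\<bar>u (y + \<eta> z) - u y - p y (\<eta> z) - q y (\<eta> z) (\<eta> z) / 2\<bar> \<le> k3 * A * (w y + w (y + \<eta> z)) * norm (\<eta> z) ^ 3" by (rule ub)
        have r2: "\<bar>p y r\<bar> \<le> (2 * K^2 * h * A * w x * norm d ^ 3) * N1 z ^ 3"
        proof -
          have "\<bar>p y r\<bar> \<le> A * w y * norm r" by (rule pb)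
          also have "\<dots> \<le> A * (2 * K * w x * N1 z) * (h * K * norm d ^ 3 * N1 z)"
            unfolding y_def r_def \<zeta>_def \<theta>_def \<eta>_def using A K0 by (intro mult_mono mult_left_mono B) auto
          also have "\<dots> = (2 * K^2 * h * A * w x * norm d ^ 3) * N1 z ^ 2" by (simp add: power2_eq_square ac_simps)
          also have "\<dots> \<le> (2 * K^2 * h * A * w x * norm d ^ 3) * N1 z ^ 3"
            using A K0 h1 by (intro mult_left_mono power_increasing) auto
          finally show ?thesis .
        qed
        have qq: "\<bar>q y a b\<bar> \<le> (8 * k2 * K^3 * h * A * w x * norm d ^ 3) * N1 z ^ 3"
          if ab: "norm a * norm b \<le> (2 * K * norm d * N1 z) * (2 * h * K * (norm d)^2 * N1 z)" for a b
        proof -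
          have "\<bar>q y a b\<bar> \<le> k2 * A * w y * (norm a * norm b)" using qb[of y a b] by (simp add: mult.assoc)
          also have "\<dots> \<le> k2 * A * (2 * K * w x * N1 z) * ((2 * K * norm d * N1 z) * (2 * h * K * (norm d)^2 * N1 z))"
          proof (rule mult_mono[OF _ ab])
            show "k2 * A * w y \<le> k2 * A * (2 * K * w x * N1 z)"
              unfolding y_def using A k0 by (intro mult_left_mono B) auto
          qed (use A K0 k0 in auto)
          also have "\<dots> = (8 * k2 * K^3 * h * A * w x * norm d ^ 3) * N1 z ^ 3" by (simp add: power2_eq_square power3_eq_cube ac_simps)
          finally show ?thesis .
        qed
        have r3: "norm (\<eta> z) * norm (\<eta> z - \<zeta>) \<le> (2 * K * norm d * N1 z) * (2 * h * K * (norm d)^2 * N1 z)"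
          unfolding \<eta>_def \<zeta>_def using K0 by (intro mult_mono B) auto
        have r4: "norm (\<eta> z - \<zeta>) * norm \<zeta> \<le> (2 * K * norm d * N1 z) * (2 * h * K * (norm d)^2 * N1 z)"
          by (subst mult.commute) (unfold \<eta>_def \<zeta>_def, use K0 in \<open>intro mult_mono B; auto\<close>)
        have "\<bar>R z\<bar> \<le> k3 * A * (w y + w (y + \<eta> z)) * norm (\<eta> z) ^ 3 + (2 * K^2 * h * A * w x * norm d ^ 3) * N1 z ^ 3 + (8 * k2 * K^3 * h * A * w x * norm d ^ 3) * N1 z ^ 3"
        proof -
          have "a \<le> b' + c' + e'" if "a \<le> b + c + (e + f) / 2" "b \<le> b'" "c \<le> c'" "e \<le> e'" "f \<le> e'" for a b c e f b' c' e' :: real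
          proof -
            have "(e + f) / 2 \<le> e'" using that by simp
            then show ?thesis using that by linarith
          qed
          from this[OF r0 r1 r2 qq[OF r3] qq[OF r4]] show ?thesis .
        qed
        then show ?thesis unfolding y' c_def y_def[symmetric] by (simp add: algebra_simps)
      qed
      have cN: "integrable \<nu> (\<lambda>z::real^'n. c * N1 z ^ 3)" by (intro integrable_mult_right N1_int)
      have ii: "integrable \<nu> (\<lambda>z. k3 * A * (w (\<Phi> t h x z) * norm (\<eta> z) ^ 3 + w (\<Phi> t h (x + d) z) * norm (\<eta> z) ^ 3))"
        unfolding \<eta>_def by (intro integrable_mult_right Bochner_Integration.integrable_add mix2(1) False)
      have "\<bar>\<integral>z. R z \<partial>\<nu>\<bar> \<le> (\<integral>z. \<bar>R z\<bar> \<partial>\<nu>)" by (rule integral_abs_bound)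
      also have "\<dots> \<le> (\<integral>z. k3 * A * (w (\<Phi> t h x z) * norm (\<eta> z) ^ 3 + w (\<Phi> t h (x + d) z) * norm (\<eta> z) ^ 3) + c * N1 z ^ 3 \<partial>\<nu>)"
        by (rule integral_mono[OF integrable_abs[OF iR] Bochner_Integration.integrable_add[OF ii cN] Rb])
      also have "\<dots> = k3 * A * ((\<integral>z. w (\<Phi> t h x z) * norm (\<eta> z) ^ 3 \<partial>\<nu>) + (\<integral>z. w (\<Phi> t h (x + d) z) * norm (\<eta> z) ^ 3 \<partial>\<nu>)) + c * (\<integral>z. N1 z ^ 3 \<partial>(\<nu> :: (real^'n) measure))"
        using mix2(1)[OF False, of x x] mix2(1)[OF False, of "x + d" x] cN N1_int unfolding \<eta>_def by (simp add: N1_int)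
      also have "\<dots> \<le> k3 * A * ((1 - lm * h) * w x * norm d ^ 3 + (1 - lm * h) * w (x + d) * norm d ^ 3) + c * ?\<gamma>"
        unfolding \<eta>_def using A k0 c0 by (intro add_mono mult_left_mono mix2(2) False N1_le) auto
      also have "\<dots> \<le> k3 * A * ((1 - lm * h) * w x * norm d ^ 3 + (1 - lm * h) * w (x + d) * norm d ^ 3)
          + k3 * lam * h * A * (w x + w (x + d)) * norm d ^ 3"
      proof -
        \<comment> \<open>The purpose of \<open>k3\<close>: half of the contraction rate pays for
          the terms collected in \<open>c\<close>.\<close>
        have "(2 * K^2 + 8 * k2 * K^3) * ?\<gamma> \<le> k3 * lam" using mu by (simp add: k3_def lam_def field_simps)
        then have "((2 * K^2 + 8 * k2 * K^3) * ?\<gamma>) * (h * A * w x * norm d ^ 3) \<le> (k3 * lam) * (h * A * (w x + w (x + d)) * norm d ^ 3)"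
        proof (rule mult_mono)
          show "h * A * w x * norm d ^ 3 \<le> h * A * (w x + w (x + d)) * norm d ^ 3"
            using h1 A by (intro mult_right_mono mult_left_mono) auto
        qed (use h1 A mu k0 in \<open>auto simp: lam_def\<close>)
        then show ?thesis unfolding c_def by (simp add: ac_simps)
      qed
      also have "\<dots> = k3 * (A * (1 - lam * h)) * (w x + w (x + d)) * norm d ^ 3"
        unfolding lam2 by (simp add: algebra_simps)
      finally show ?thesis unfolding eR .
    qed
  qed
qed

text \<open>The increment \<open>h S z - h g\<close> is inserted into the expansion of
  \<open>u\<close>. Terms linear in \<open>z\<close> vanish, the quadratic one gives the sum over
  the columns of \<open>\<sigma>\<close>, and the remainder is cubic in an increment of order
  \<open>h\<close>. In the constant, \<open>3 * K\<close> bounds the two weights and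
  \<open>K^3\<close> the cube.\<close>

lemma scheme_local:
  assumes h: "0 < h" "h \<le> 1" and t: "0 \<le> t" and j: "jet A u p q" and A: "0 \<le> A"
  shows "\<bar>Pu t h u x - (u x - h * p x (g x) + h^2 / 2 * (q x (g x) (g x) + (\<Sum>i\<in>UNIV. q x (column i (\<sigma> t x)) (column i (\<sigma> t x)))))\<bar>
    \<le> 3 * K^4 * gam TYPE('n) * k3 * A * h^3 * w x ^ 4"
proof -
  let ?\<gamma> = "gam TYPE('n)"
  interpret prob_space "\<nu> :: (real^'n) measure" by (rule prob_space_gauss) simp
  note um = jetD(1)[OF j] and pl = jetD(4)[OF j] and ql = jetD(5)[OF j] and ub = jetD(8)[OF j]
  have k0: "0 \<le> k2" "0 \<le> k3" using k2_ge1 k3_ge1 by auto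
  note B = step_bounds[OF h t]
  define S where "S = \<sigma> t x"
  define \<delta> where "\<delta> = (\<lambda>z. h *\<^sub>R (S *v z) - h *\<^sub>R g x)"
  have d: "\<Phi> t h x z = x + \<delta> z" for z by (simp add: \<Phi>_def \<delta>_def S_def)
  have ui: "integrable \<nu> (\<lambda>z. u (\<Phi> t h x z))"
    by (rule step_integrable[OF h t um jet_growth4[OF j A]]) (use A k0 in auto)
  have l1: "linear (\<lambda>z. p x (S *v z))" by (rule linearI) (simp_all add: matrix_vector_right_distrib matrix_vector_mult_scaleR linear_add[OF pl] linear_scale[OF pl])
  have l2: "linear (\<lambda>z. q x (g x) (S *v z) + q x (S *v z) (g x))"
    by (rule linearI) (simp_all add: matrix_vector_right_distrib matrix_vector_mult_scaleR bilinear_ladd[OF ql] bilinear_radd[OF ql] bilinear_lmul[OF ql] bilinear_rmul[OF ql] algebra_simps)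
  have l3: "bilinear (\<lambda>z z'. q x (S *v z) (S *v z'))" unfolding bilinear_def
    by (intro conjI allI linearI) (simp_all add: matrix_vector_right_distrib matrix_vector_mult_scaleR bilinear_ladd[OF ql] bilinear_radd[OF ql] bilinear_lmul[OF ql] bilinear_rmul[OF ql])
  have P: "p x (\<delta> z) = h * p x (S *v z) - h * p x (g x)" for z
    unfolding \<delta>_def by (simp add: linear_diff[OF pl] linear_scale[OF pl])
  have Q: "q x (\<delta> z) (\<delta> z) = h^2 * q x (g x) (g x) - h^2 * (q x (g x) (S *v z) + q x (S *v z) (g x)) + h^2 * q x (S *v z) (S *v z)" for z
    unfolding \<delta>_def by (simp add: bilinear_lsub[OF ql] bilinear_rsub[OF ql] bilinear_lmul[OF ql] bilinear_rmul[OF ql] power2_eq_square algebra_simps)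
  define T where "T = (\<lambda>z. u x + p x (\<delta> z) + q x (\<delta> z) (\<delta> z) / 2)"
  have iT: "integrable \<nu> T" unfolding T_def P Q using nu_linear(1)[OF l1] nu_linear(1)[OF l2] nu_bilinear(1)[OF l3] by auto
  have "(\<integral>z. T z \<partial>\<nu>) = u x - h * p x (g x) + (h^2 * q x (g x) (g x) + h^2 * (\<integral>z. q x (S *v z) (S *v z) \<partial>\<nu>)) / 2"
    unfolding T_def P Q using nu_linear[OF l1] nu_linear[OF l2] nu_bilinear(1)[OF l3] prob_space
    by simp
  also have "\<dots> = u x - h * p x (g x) + h^2 / 2 * (q x (g x) (g x) + (\<Sum>i\<in>UNIV. q x (column i (\<sigma> t x)) (column i (\<sigma> t x))))"
    unfolding nu_bilinear(2)[OF l3] by (simp add: matrix_vector_mult_basis S_def algebra_simps)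
  finally have eT: "(\<integral>z. T z \<partial>\<nu>) = u x - h * p x (g x) + h^2 / 2 * (q x (g x) (g x) + (\<Sum>i\<in>UNIV. q x (column i (\<sigma> t x)) (column i (\<sigma> t x))))" .
  have b: "\<bar>u (\<Phi> t h x z) - T z\<bar> \<le> (3 * K^4 * k3 * A * h^3 * w x ^ 4) * N1 z ^ 4" for z
  proof -
    have dz: "norm (\<delta> z) \<le> h * K * w x * N1 z" using B(1)[of x z] by (simp add: d)
    have ww: "w x + w (x + \<delta> z) \<le> 3 * K * w x * N1 z"
    proof -
      have "1 \<le> K * N1 z" using mult_mono[of 1 K 1 "N1 z"] K1 by simp
      then have "w x \<le> K * w x * N1 z" using mult_left_mono[of 1 "K * N1 z" "w x"] by (simp add: ac_simps)
      then show ?thesis using B(2)[of x z] unfolding d by linarith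
    qed
    have "\<bar>u (x + \<delta> z) - u x - p x (\<delta> z) - q x (\<delta> z) (\<delta> z) / 2\<bar> \<le> k3 * A * (w x + w (x + \<delta> z)) * norm (\<delta> z) ^ 3" by (rule ub)
    also have "\<dots> \<le> k3 * A * (3 * K * w x * N1 z) * (h * K * w x * N1 z) ^ 3"
      using k0 A K0 h by (intro mult_mono mult_left_mono power_mono ww dz) auto
    also have "\<dots> = (3 * K^4 * k3 * A * h^3 * w x ^ 4) * N1 z ^ 4"
      by (simp add: power_mult_distrib power3_eq_cube power4_eq_xxxx ac_simps)
    finally show ?thesis unfolding d T_def by (simp add: algebra_simps)
  qed
  have "\<bar>Pu t h u x - (\<integral>z. T z \<partial>\<nu>)\<bar> = \<bar>\<integral>z. u (\<Phi> t h x z) - T z \<partial>\<nu>\<bar>" unfolding Pu_def using ui iT by simp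
  also have "\<dots> \<le> (3 * K^4 * k3 * A * h^3 * w x ^ 4) * ?\<gamma>"
    by (rule nu_bound[OF _ b]) (use borel_measurable_integrable[OF ui] borel_measurable_integrable[OF iT] k0 A K0 h in auto)
  finally show ?thesis unfolding eT by (simp add: ac_simps)
qed

end

section \<open>Limits of expectations and Riemann sums along the solution\<close>

context prob_space
begin

text \<open>Vitali's theorem in a usable form: domination up to \<open>e\<close> times functions
  with bounded means, for every \<open>e\<close>, expresses uniform integrability. That the limit is
  integrable follows from Fatou's lemma.\<close>

lemma dominated_convergence_eps:
  fixes T :: "nat \<Rightarrow> 'a \<Rightarrow> real"
  assumes [measurable]: "\<And>m. T m \<in> borel_measurable M" "L \<in> borel_measurable M"
    and lim: "AE om in M. (\<lambda>m. T m om) \<longlonglongrightarrow> L om"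
    and dom: "\<And>e. e > 0 \<Longrightarrow> \<exists>V. integrable M V \<and> (\<forall>m om. om \<in> space M \<longrightarrow> \<bar>T m om\<bar> \<le> V om + e * Q m om)"
    and Q: "\<And>m. integrable M (Q m)" "\<And>m om. om \<in> space M \<Longrightarrow> 0 \<le> Q m om" "\<And>m. (\<integral>om. Q m om \<partial>M) \<le> c"
  shows "integrable M L" "(\<lambda>m. \<integral>om. T m om \<partial>M) \<longlonglongrightarrow> (\<integral>om. L om \<partial>M)"
proof -
  have "0 \<le> (\<integral>om. Q 0 om \<partial>M)" by (rule integral_nonneg_AE) (use Q(2) in auto)
  then have c0: "0 \<le> c" using Q(3)[of 0] by linarith
  have iT: "integrable M (T m)" for m
  proof -
    obtain V where V: "integrable M V" "\<And>m om. om \<in> space M \<Longrightarrow> \<bar>T m om\<bar> \<le> V om + 1 * Q m om"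
      using dom[of 1] by auto
    show ?thesis
    proof (rule Bochner_Integration.integrable_bound[OF Bochner_Integration.integrable_add[OF V(1) Q(1)[of m]]])
      show "AE om in M. norm (T m om) \<le> norm (V om + Q m om)"
      proof (rule AE_I2)
        fix om assume "om \<in> space M"
        from V(2)[OF this, of m] show "norm (T m om) \<le> norm (V om + Q m om)" by simp
      qed
    qed simp
  qed
  show iL: "integrable M L"
  proof -
    obtain V where V: "integrable M V" "\<And>m om. om \<in> space M \<Longrightarrow> \<bar>T m om\<bar> \<le> V om + 1 * Q m om"
      using dom[of 1] by auto
    have "(\<integral>\<^sup>+ om. norm (L om) \<partial>M) = (\<integral>\<^sup>+ om. liminf (\<lambda>m. ennreal (norm (T m om))) \<partial>M)"
    proof (rule nn_integral_cong_AE)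
      show "AE om in M. ennreal (norm (L om)) = liminf (\<lambda>m. ennreal (norm (T m om)))"
        using lim
      proof eventually_elim
        case (elim om)
        then have "(\<lambda>m. ennreal (norm (T m om))) \<longlonglongrightarrow> ennreal (norm (L om))"
          by (intro tendsto_ennrealI tendsto_norm)
        then show ?case by (metis lim_imp_Liminf trivial_limit_sequentially)
      qed
    qed
    also have "\<dots> \<le> liminf (\<lambda>m. \<integral>\<^sup>+ om. ennreal (norm (T m om)) \<partial>M)"
      by (rule nn_integral_liminf) measurable
    also have "\<dots> \<le> ennreal ((\<integral>om. V om \<partial>M) + c)"
    proof (rule Liminf_le, simp, rule always_eventually, rule allI)
      fix m
      have "(\<integral>\<^sup>+ om. ennreal (norm (T m om)) \<partial>M) = ennreal (\<integral>om. norm (T m om) \<partial>M)"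
        using iT by (intro nn_integral_eq_integral) auto
      also have "\<dots> \<le> ennreal (\<integral>om. V om + 1 * Q m om \<partial>M)"
        using iT V Q(1) by (intro ennreal_leI integral_mono) auto
      also have "\<dots> \<le> ennreal ((\<integral>om. V om \<partial>M) + c)" using V Q by (intro ennreal_leI) auto
      finally show "(\<integral>\<^sup>+ om. ennreal (norm (T m om)) \<partial>M) \<le> ennreal ((\<integral>om. V om \<partial>M) + c)" .
    qed
    also have "\<dots> < \<infinity>" by simp
    finally show ?thesis by (intro integrableI_bounded) auto
  qed
  show "(\<lambda>m. \<integral>om. T m om \<partial>M) \<longlonglongrightarrow> (\<integral>om. L om \<partial>M)"
  proof (rule LIMSEQ_I)
    fix r :: real assume r: "0 < r"
    define e where "e = r / (2 * (c + 1))"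
    have e: "0 < e" "e * c < r / 2"
    proof -
      show e0: "0 < e" using r c0 by (simp add: e_def)
      have "c + 1 \<noteq> 0" using c0 by linarith
      then have "e * (c + 1) = r / 2" by (simp add: e_def field_simps)
      then show "e * c < r / 2" using e0 by (simp add: distrib_left)
    qed
    obtain V where V: "integrable M V" "\<And>m om. om \<in> space M \<Longrightarrow> \<bar>T m om\<bar> \<le> V om + e * Q m om"
      using dom[OF e(1)] by auto
    note [measurable] = borel_measurable_integrable[OF V(1)]
    \<comment> \<open>The error capped by an integrable function, to which dominated convergence
      applies. Since \<open>norm (T - L)\<close> exceeds the cap by at most \<open>e * Q\<close>,
      capping loses at most \<open>e * c\<close> in the mean.\<close>
    define U where "U = (\<lambda>m om. min \<bar>T m om - L om\<bar> (\<bar>V om\<bar> + \<bar>L om\<bar>))"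
    have iV: "integrable M (\<lambda>om. \<bar>V om\<bar> + \<bar>L om\<bar>)" using V(1) iL by auto
    have "(\<lambda>m. \<integral>om. U m om \<partial>M) \<longlonglongrightarrow> (\<integral>om. 0 \<partial>M)"
    proof (rule integral_dominated_convergence[OF _ _ iV])
      show "AE om in M. (\<lambda>m. U m om) \<longlonglongrightarrow> 0"
        using lim
      proof eventually_elim
        case (elim om)
        have "(\<lambda>m. min \<bar>T m om - L om\<bar> (\<bar>V om\<bar> + \<bar>L om\<bar>)) \<longlonglongrightarrow> min \<bar>L om - L om\<bar> (\<bar>V om\<bar> + \<bar>L om\<bar>)"
          by (intro tendsto_intros elim)
        then show ?case by (simp add: U_def)
      qed
      show "AE om in M. norm (U m om) \<le> \<bar>V om\<bar> + \<bar>L om\<bar>" for m by (simp add: U_def)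
    qed (auto simp: U_def)
    then have "eventually (\<lambda>m. (\<integral>om. U m om \<partial>M) < r / 2) sequentially"
      using r by (intro order_tendstoD(2)[of _ 0]) auto
    then obtain N where N: "\<And>m. m \<ge> N \<Longrightarrow> (\<integral>om. U m om \<partial>M) < r / 2" unfolding eventually_sequentially by auto
    have iU: "integrable M (U m)" for m
      by (rule Bochner_Integration.integrable_bound[OF iV]) (auto simp: U_def)
    show "\<exists>no. \<forall>m\<ge>no. norm ((\<integral>om. T m om \<partial>M) - (\<integral>om. L om \<partial>M)) < r"
    proof (intro exI allI impI)
      fix m assume m: "N \<le> m"
      have "\<bar>(\<integral>om. T m om \<partial>M) - (\<integral>om. L om \<partial>M)\<bar> = \<bar>\<integral>om. T m om - L om \<partial>M\<bar>" using iT iL by simp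
      also have "\<dots> \<le> (\<integral>om. \<bar>T m om - L om\<bar> \<partial>M)" by (rule integral_abs_bound)
      also have "\<dots> \<le> (\<integral>om. U m om + e * Q m om \<partial>M)"
      proof (rule integral_mono)
        fix om assume w: "om \<in> space M"
        show "\<bar>T m om - L om\<bar> \<le> U m om + e * Q m om"
          using V(2)[OF w, of m] Q(2)[OF w, of m] e(1) by (auto simp: U_def min_def)
      qed (use iT iL iU Q(1) in auto)
      also have "\<dots> = (\<integral>om. U m om \<partial>M) + e * (\<integral>om. Q m om \<partial>M)" using iU Q(1) by simp
      also have "\<dots> < r / 2 + r / 2"
      proof (rule add_less_le_mono[OF N[OF m]])
        have "e * (\<integral>om. Q m om \<partial>M) \<le> e * c" using e(1) Q(3) by (intro mult_left_mono) auto
        then show "e * (\<integral>om. Q m om \<partial>M) \<le> r / 2" using e(2) by linarith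
      qed
      finally show "norm ((\<integral>om. T m om \<partial>M) - (\<integral>om. L om \<partial>M)) < r" by simp
    qed
  qed
qed

lemma fatou_bound:
  fixes T :: "nat \<Rightarrow> 'a \<Rightarrow> real"
  assumes [measurable]: "\<And>m. T m \<in> borel_measurable M" "L \<in> borel_measurable M"
    and lim: "AE om in M. (\<lambda>m. T m om) \<longlonglongrightarrow> L om"
    and T: "\<And>m. integrable M (T m)" "\<And>m om. om \<in> space M \<Longrightarrow> 0 \<le> T m om" "\<And>m. (\<integral>om. T m om \<partial>M) \<le> c"
  shows "integrable M L" "(\<integral>om. L om \<partial>M) \<le> c"
proof -
  have "0 \<le> (\<integral>om. T 0 om \<partial>M)" by (rule integral_nonneg_AE) (use T(2) in auto)
  then have c0: "0 \<le> c" using T(3)[of 0] by linarith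
  have L0: "AE om in M. 0 \<le> L om"
  proof -
    have "AE om in M. om \<in> space M" by (rule AE_space)
    with lim show ?thesis
    proof eventually_elim
      case (elim om) then show ?case by (intro LIMSEQ_le_const[OF elim(1)]) (auto simp: T)
    qed
  qed
  have le: "(\<integral>\<^sup>+ om. ennreal (L om) \<partial>M) \<le> ennreal c"
  proof -
    have "(\<integral>\<^sup>+ om. ennreal (L om) \<partial>M) = (\<integral>\<^sup>+ om. liminf (\<lambda>m. ennreal (T m om)) \<partial>M)"
    proof (rule nn_integral_cong_AE)
      show "AE om in M. ennreal (L om) = liminf (\<lambda>m. ennreal (T m om))"
        using lim
      proof eventually_elim
        case (elim om)
        then have "(\<lambda>m. ennreal (T m om)) \<longlonglongrightarrow> ennreal (L om)" by (rule tendsto_ennrealI)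
        then show ?case by (metis lim_imp_Liminf trivial_limit_sequentially)
      qed
    qed
    also have "\<dots> \<le> liminf (\<lambda>m. \<integral>\<^sup>+ om. ennreal (T m om) \<partial>M)"
      by (rule nn_integral_liminf) measurable
    also have "\<dots> \<le> ennreal c"
    proof (rule Liminf_le, simp, rule always_eventually, rule allI)
      fix m
      have "(\<integral>\<^sup>+ om. ennreal (T m om) \<partial>M) = ennreal (\<integral>om. T m om \<partial>M)"
        using T by (intro nn_integral_eq_integral) (auto intro!: AE_I2)
      then show "(\<integral>\<^sup>+ om. ennreal (T m om) \<partial>M) \<le> ennreal c" using T(3)[of m] by (simp add: ennreal_leI)
    qed
    finally show ?thesis .
  qed
  show iL: "integrable M L"
  proof (rule integrableI_nonneg[OF _ L0])
    show "(\<integral>\<^sup>+ om. ennreal (L om) \<partial>M) < \<infinity>" using le by (simp add: le_less_trans)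
  qed measurable
  have "ennreal (\<integral>om. L om \<partial>M) \<le> ennreal c"
    using le nn_integral_eq_integral[OF iL L0] by simp
  then show "(\<integral>om. L om \<partial>M) \<le> c" using c0 by (simp add: ennreal_le_iff)
qed

text \<open>Cauchy-Schwarz twice costs a factor \<open>n ^ 3\<close>; summing the moments costs a
  further \<open>n\<close>, so only the total length \<open>n * D\<close> remains.\<close>

lemma sum_pow4:
  fixes v :: "nat \<Rightarrow> 'a \<Rightarrow> 'b::{second_countable_topology,real_normed_vector,banach}"
  assumes [measurable]: "\<And>j. j < n \<Longrightarrow> v j \<in> borel_measurable M"
    and i: "\<And>j. j < n \<Longrightarrow> integrable M (\<lambda>om. norm (v j om) ^ 4)"
    and b: "\<And>j. j < n \<Longrightarrow> (\<integral>om. norm (v j om) ^ 4 \<partial>M) \<le> c" and D: "0 \<le> D"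
  shows "integrable M (\<lambda>om. norm (\<Sum>j<n. D *\<^sub>R v j om) ^ 4)"
    "(\<integral>om. norm (\<Sum>j<n. D *\<^sub>R v j om) ^ 4 \<partial>M) \<le> (real n * D) ^ 4 * c"
proof -
  have le: "norm (\<Sum>j<n. D *\<^sub>R v j om) ^ 4 \<le> D ^ 4 * real n ^ 3 * (\<Sum>j<n. norm (v j om) ^ 4)" for om
  proof -
    have "norm (\<Sum>j<n. D *\<^sub>R v j om) \<le> D * (\<Sum>j<n. norm (v j om))"
      unfolding sum_distrib_left using D by (intro sum_norm_le) auto
    then have "norm (\<Sum>j<n. D *\<^sub>R v j om) ^ 4 \<le> (D * (\<Sum>j<n. norm (v j om))) ^ 4" by (intro power_mono) auto
    also have "\<dots> = D ^ 4 * ((\<Sum>j<n. norm (v j om))^2)^2" by (simp add: power_mult_distrib flip: power_mult)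
    also have "\<dots> \<le> D ^ 4 * (real n * (\<Sum>j<n. (norm (v j om))^2))^2"
      using sum_squared_le_sum_of_squares[of "\<lambda>j. norm (v j om)" "{..<n}"]
      by (intro mult_left_mono power_mono) (auto simp: mult.commute)
    also have "\<dots> = D ^ 4 * (real n)^2 * (\<Sum>j<n. (norm (v j om))^2)^2" by (simp add: power_mult_distrib)
    also have "\<dots> \<le> D ^ 4 * (real n)^2 * (real n * (\<Sum>j<n. ((norm (v j om))^2)^2))"
      using sum_squared_le_sum_of_squares[of "\<lambda>j. (norm (v j om))^2" "{..<n}"]
      by (intro mult_left_mono) (auto simp: mult.commute)
    also have "\<dots> = D ^ 4 * real n ^ 3 * (\<Sum>j<n. norm (v j om) ^ 4)"
    proof -
      have "((norm (v j om))^2)^2 = norm (v j om) ^ 4" for j by (simp flip: power_mult)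
      then show ?thesis by (simp add: power2_eq_square[of "real n"] power3_eq_cube)
    qed
    finally show ?thesis .
  qed
  have iB: "integrable M (\<lambda>om. D ^ 4 * real n ^ 3 * (\<Sum>j<n. norm (v j om) ^ 4))"
    using i by (intro integrable_mult_right Bochner_Integration.integrable_sum) auto
  show iS: "integrable M (\<lambda>om. norm (\<Sum>j<n. D *\<^sub>R v j om) ^ 4)"
  proof (rule Bochner_Integration.integrable_bound[OF iB])
    have "(\<lambda>om. \<Sum>j<n. D *\<^sub>R v j om) \<in> borel_measurable M" by (intro borel_measurable_sum borel_measurable_scaleR) auto
    then show "(\<lambda>om. norm (\<Sum>j<n. D *\<^sub>R v j om) ^ 4) \<in> borel_measurable M" by measurable
  qed (use le in \<open>auto intro!: AE_I2 order_trans[OF le]\<close>)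
  have "(\<integral>om. norm (\<Sum>j<n. D *\<^sub>R v j om) ^ 4 \<partial>M) \<le> (\<integral>om. D ^ 4 * real n ^ 3 * (\<Sum>j<n. norm (v j om) ^ 4) \<partial>M)"
    by (rule integral_mono[OF iS iB le])
  also have "\<dots> = D ^ 4 * real n ^ 3 * (\<Sum>j<n. (\<integral>om. norm (v j om) ^ 4 \<partial>M))" using i by (simp add: Bochner_Integration.integral_sum)
  also have "\<dots> \<le> D ^ 4 * real n ^ 3 * (\<Sum>j<n. c)" using b D by (intro mult_left_mono sum_mono) auto
  also have "\<dots> = (real n * D) ^ 4 * c" by (simp add: power_mult_distrib power3_eq_cube power4_eq_xxxx)
  finally show "(\<integral>om. norm (\<Sum>j<n. D *\<^sub>R v j om) ^ 4 \<partial>M) \<le> (real n * D) ^ 4 * c" .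
qed

end

section \<open>Riemann sums on uniform partitions\<close>

definition pt :: "real \<Rightarrow> real \<Rightarrow> nat \<Rightarrow> nat \<Rightarrow> real" where
  "pt a b n j = a + (b - a) * real j / real n"

lemma pt_0 [simp]: "pt a b n 0 = a" by (simp add: pt_def)
lemma pt_end [simp]: "0 < n \<Longrightarrow> pt a b n n = b" by (simp add: pt_def)

lemma pt_Suc_diff: "pt a b n (Suc j) - pt a b n j = (b - a) / real n"
  unfolding pt_def by (simp add: ring_distribs add_divide_distrib diff_divide_distrib)

lemma pt_bounds: "a \<le> b \<Longrightarrow> j \<le> n \<Longrightarrow> a \<le> pt a b n j \<and> pt a b n j \<le> b"
proof -
  assume ab: "a \<le> b" "j \<le> n"
  have "(b - a) * (real j / real n) \<le> (b - a) * 1" using ab by (intro mult_left_mono) (auto simp: divide_le_eq)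
  moreover have "0 \<le> (b - a) * (real j / real n)" using ab by simp
  ultimately show ?thesis by (simp add: pt_def)
qed

lemma pt_mono: "a \<le> b \<Longrightarrow> pt a b n j \<le> pt a b n (Suc j)"
proof -
  assume "a \<le> b"
  then have "0 \<le> (b - a) / real n" by simp
  then show ?thesis using pt_Suc_diff[of a b n j] by linarith
qed

lemma riemann_integral_tendsto:
  fixes f :: "real \<Rightarrow> 'b::euclidean_space"
  assumes ab: "a \<le> b" and f: "continuous_on {a..b} f"
  shows "(\<lambda>m. \<Sum>j<Suc m. ((b - a) / real (Suc m)) *\<^sub>R f (pt a b (Suc m) j)) \<longlonglongrightarrow> integral {a..b} f"
proof (rule LIMSEQ_I)
  fix r :: real assume r: "0 < r"
  define e where "e = r / (2 * (b - a + 1))"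
  have e: "0 < e" "e * (b - a) < r"
  proof -
    show e0: "0 < e" using r ab by (simp add: e_def)
    have "b - a + 1 \<noteq> 0" using ab by linarith
    then have "e * (b - a + 1) = r / 2" by (simp add: e_def field_simps)
    moreover have "e * (b - a + 1) = e * (b - a) + e" by (simp add: distrib_left)
    ultimately show "e * (b - a) < r" using e0 r by linarith
  qed
  have "uniformly_continuous_on {a..b} f" using f by (intro compact_uniformly_continuous) auto
  then obtain d where d: "0 < d" "\<And>s s'. s \<in> {a..b} \<Longrightarrow> s' \<in> {a..b} \<Longrightarrow> dist s' s < d \<Longrightarrow> dist (f s') (f s) < e"
    using e(1) unfolding uniformly_continuous_on_def by metis
  obtain N where N: "(b - a) / d < real N" using reals_Archimedean2 by blast
  show "\<exists>no. \<forall>m\<ge>no. norm ((\<Sum>j<Suc m. ((b - a) / real (Suc m)) *\<^sub>R f (pt a b (Suc m) j)) - integral {a..b} f) < r"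
  proof (intro exI allI impI)
    fix m assume m: "N \<le> m"
    define n where "n = Suc m"
    define D where "D = (b - a) / real n"
    have nD: "real n * D = b - a" by (simp add: D_def n_def)
    have Dd: "D < d"
    proof -
      have "(b - a) / d < real n" using N m by (simp add: n_def)
      then show ?thesis using d(1) by (simp add: D_def n_def field_simps)
    qed
    have I: "integral {a..pt a b n k} f = (\<Sum>j<k. integral {pt a b n j..pt a b n (Suc j)} f)" if "k \<le> n" for k
      using that
    proof (induction k)
      case (Suc k)
      have p: "a \<le> pt a b n k" "pt a b n k \<le> pt a b n (Suc k)" "pt a b n (Suc k) \<le> b"
        using pt_bounds[OF ab, of k n] pt_bounds[OF ab, of "Suc k" n] pt_mono[OF ab, of n k] Suc.prems by auto
      have "f integrable_on {a..pt a b n (Suc k)}"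
        by (intro integrable_continuous_interval continuous_on_subset[OF f]) (use p in auto)
      from Henstock_Kurzweil_Integration.integral_combine[OF p(1,2) this] Suc show ?case by simp
    qed simp
    have "norm ((\<Sum>j<n. D *\<^sub>R f (pt a b n j)) - integral {a..b} f) = norm (\<Sum>j<n. D *\<^sub>R f (pt a b n j) - integral {pt a b n j..pt a b n (Suc j)} f)"
      using I[OF order_refl] by (simp add: sum_subtractf n_def del: sum.lessThan_Suc)
    also have "\<dots> \<le> (\<Sum>j<n. e * D)"
    proof (rule sum_norm_le)
      fix j assume "j \<in> {..<n}"
      then have j: "j < n" by simp
      let ?s = "pt a b n j" and ?t = "pt a b n (Suc j)"
      have p: "a \<le> ?s" "?s \<le> ?t" "?t \<le> b" "?t - ?s = D"
        using pt_bounds[OF ab, of j n] pt_bounds[OF ab, of "Suc j" n] pt_mono[OF ab, of n j] pt_Suc_diff[of a b n j] j by (auto simp: D_def)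
      have fi: "f integrable_on {?s..?t}"
        by (intro integrable_continuous_interval continuous_on_subset[OF f]) (use p in auto)
      have "integral {?s..?t} f - D *\<^sub>R f ?s = integral {?s..?t} (\<lambda>u. f u - f ?s)"
        using fi p by (subst Henstock_Kurzweil_Integration.integral_diff) auto
      also have "norm \<dots> \<le> e * (?t - ?s)"
      proof (rule integral_bound[OF p(2)])
        show "continuous_on {?s..?t} (\<lambda>u. f u - f ?s)"
          by (intro continuous_intros continuous_on_subset[OF f]) (use p in auto)
        show "norm (f u - f ?s) \<le> e" if "u \<in> {?s..?t}" for u
        proof -
          have "dist u ?s < d" using that p Dd by (auto simp: dist_real_def)
          then have "dist (f u) (f ?s) < e" using d(2)[of ?s u] that p by auto
          then show ?thesis by (simp add: dist_norm)
        qed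
      qed
      finally show "norm (D *\<^sub>R f ?s - integral {?s..?t} f) \<le> e * D" using p by (simp add: norm_minus_commute)
    qed
    also have "\<dots> = e * (b - a)" using nD by (simp add: mult.left_commute)
    also have "\<dots> < r" by (rule e)
    finally show "norm ((\<Sum>j<Suc m. ((b - a) / real (Suc m)) *\<^sub>R f (pt a b (Suc m) j)) - integral {a..b} f) < r"
      by (simp add: n_def D_def)
  qed
qed

context wiener
begin

lemma conv_prob_diff:
  fixes X :: "nat \<Rightarrow> 'w \<Rightarrow> 'b::{real_normed_vector, second_countable_topology}"
  assumes X: "conv_prob X U" and Z: "conv_prob Z V"
    and [measurable]: "\<And>m. X m \<in> borel_measurable M" "U \<in> borel_measurable M" "\<And>m. Z m \<in> borel_measurable M" "V \<in> borel_measurable M"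
  shows "conv_prob (\<lambda>m om. X m om - Z m om) (\<lambda>om. U om - V om)"
  unfolding conv_prob_def
proof (intro allI impI)
  fix e :: real assume e: "0 < e"
  have le: "prob {om \<in> space M. norm (X m om - Z m om - (U om - V om)) > e} \<le>
    prob {om \<in> space M. norm (X m om - U om) > e / 2} + prob {om \<in> space M. norm (Z m om - V om) > e / 2}" for m
  proof (rule prob_union_le)
    show "{om \<in> space M. norm (X m om - Z m om - (U om - V om)) > e} \<subseteq> {om \<in> space M. norm (X m om - U om) > e / 2} \<union> {om \<in> space M. norm (Z m om - V om) > e / 2}"
    proof
      fix om assume w: "om \<in> {om \<in> space M. norm (X m om - Z m om - (U om - V om)) > e}"
      have "norm (X m om - Z m om - (U om - V om)) \<le> norm (X m om - U om) + norm (Z m om - V om)"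
        using norm_triangle_ineq4[of "X m om - U om" "Z m om - V om"] by (simp add: algebra_simps)
      then show "om \<in> {om \<in> space M. norm (X m om - U om) > e / 2} \<union> {om \<in> space M. norm (Z m om - V om) > e / 2}"
        using w by auto
    qed
  qed measurable
  have "(\<lambda>m. prob {om \<in> space M. norm (X m om - U om) > e / 2}) \<longlonglongrightarrow> 0"
    "(\<lambda>m. prob {om \<in> space M. norm (Z m om - V om) > e / 2}) \<longlonglongrightarrow> 0"
    using X Z half_gt_zero[OF e] unfolding conv_prob_def by blast+
  from tendsto_add[OF this]
  have lim: "(\<lambda>m. prob {om \<in> space M. norm (X m om - U om) > e / 2} + prob {om \<in> space M. norm (Z m om - V om) > e / 2}) \<longlonglongrightarrow> 0"
    by simp
  show "(\<lambda>m. prob {om \<in> space M. norm (X m om - Z m om - (U om - V om)) > e}) \<longlonglongrightarrow> 0"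
    by (intro tendsto_sandwich[OF _ _ tendsto_const lim] always_eventually allI le) auto
qed

lemma pt_grid: "0 \<le> a \<Longrightarrow> a \<le> b \<Longrightarrow> grid n (pt a b n)"
  unfolding grid_def using pt_mono by simp

lemma mart_append:
  assumes "\<And>j. j \<le> n \<Longrightarrow> \<tau> (n + j) = \<theta> j" "\<And>j. j \<le> n \<Longrightarrow> \<tau> j = \<rho> j"
  shows "mart \<tau> (\<lambda>j. \<Phi> (\<tau> j)) (n + n) om = mart \<rho> (\<lambda>j. \<Phi> (\<rho> j)) n om + mart \<theta> (\<lambda>j. \<Phi> (\<theta> j)) n om"
proof -
  let ?f = "\<lambda>j. \<Phi> (\<tau> j) om *v incr (\<tau> j) (\<tau> (Suc j)) om"
  have "(\<Sum>j<n + n. ?f j) = (\<Sum>j<n. ?f j) + (\<Sum>j<n. ?f (n + j))"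
  proof -
    have "(\<Sum>j<n + m. ?f j) = (\<Sum>j<n. ?f j) + (\<Sum>j<m. ?f (n + j))" for m
      by (induction m) (simp_all add: add.assoc)
    then show ?thesis .
  qed
  moreover have "(\<Sum>j<n. ?f j) = (\<Sum>j<n. \<Phi> (\<rho> j) om *v incr (\<rho> j) (\<rho> (Suc j)) om)"
    using assms(2) by (intro sum.cong) (auto simp: Suc_leI)
  moreover have "(\<Sum>j<n. ?f (n + j)) = (\<Sum>j<n. \<Phi> (\<theta> j) om *v incr (\<theta> j) (\<theta> (Suc j)) om)"
    using assms(1)[symmetric] by (intro sum.cong) (auto simp: Suc_leI)
  ultimately show ?thesis by (simp add: mart_def)
qed

text \<open>The integrals over \<open>[0, a]\<close> and \<open>[0, b]\<close> are given separately.
  A partition of \<open>[0, b]\<close> is concatenated from uniform ones of \<open>[0, a]\<close>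
  and \<open>[a, b]\<close>, so that its sum minus the sum over \<open>[0, a]\<close> is exactly the
  sum over \<open>[a, b]\<close>.\<close>

lemma ito_increment_riemann:
  fixes \<Phi> :: "real \<Rightarrow> 'w \<Rightarrow> real^'n^'m"
  assumes ab: "0 \<le> a" "a \<le> b" and Ia: "ito_integral M F B \<Phi> a Ia" and Ib: "ito_integral M F B \<Phi> b Ib"
    and c: "path_cont b \<Phi>"
  shows "conv_prob (\<lambda>m. mart (pt a b (Suc m)) (\<lambda>j. \<Phi> (pt a b (Suc m) j)) (Suc m)) (\<lambda>om. Ib om - Ia om)"
proof -
  have ad: "\<Phi> s \<in> borel_measurable (F s)" if "s \<in> {0..b}" for s using Ib that by (auto simp: ito_integral_def)
  have Im: "Ia \<in> borel_measurable M" "Ib \<in> borel_measurable M" using Ia Ib by (auto simp: ito_integral_def)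
  have ca: "path_cont a \<Phi>" using c ab unfolding path_cont_def by (auto intro: continuous_on_subset)
  \<comment> \<open>Indices up to \<open>Suc m\<close> run through \<open>[0, a]\<close>, later ones
    through \<open>[a, b]\<close>; both formulas give \<open>a\<close> at the junction.\<close>
  define \<tau> where "\<tau> = (\<lambda>m j. if j \<le> Suc m then pt 0 a (Suc m) j else pt a b (Suc m) (j - Suc m))"
  have t1: "\<tau> m (Suc m + j) = pt a b (Suc m) j" if "j \<le> Suc m" for m j by (cases j) (auto simp: \<tau>_def)
  have t2: "\<tau> m j = pt 0 a (Suc m) j" if "j \<le> Suc m" for m j using that by (simp add: \<tau>_def)
  have dif: "\<tau> m (Suc j) - \<tau> m j = (if j < Suc m then a / real (Suc m) else (b - a) / real (Suc m))" for m j
  proof (cases "j < Suc m")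
    case True
    then show ?thesis using pt_Suc_diff[of 0 a "Suc m" j] by (simp add: \<tau>_def)
  next
    case False
    then obtain i where i: "j = Suc m + i" using le_Suc_ex not_less by blast
    have "\<tau> m (Suc m + i) = pt a b (Suc m) i" by (cases i) (auto simp: \<tau>_def)
    moreover have "\<tau> m (Suc (Suc m + i)) = pt a b (Suc m) (Suc i)" by (simp add: \<tau>_def)
    ultimately show ?thesis using pt_Suc_diff[of a b "Suc m" i] i by simp
  qed
  have g: "grid (Suc m + Suc m) (\<tau> m)" for m
    unfolding grid_def
  proof (intro conjI allI impI)
    show "0 \<le> \<tau> m 0" by (simp add: \<tau>_def)
    show "\<tau> m j \<le> \<tau> m (Suc j)" for j
    proof -
      have "0 \<le> \<tau> m (Suc j) - \<tau> m j" unfolding dif using ab by auto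
      then show ?thesis by simp
    qed
  qed
  have mesh0: "eventually (\<lambda>m. x / real (Suc m) < e) sequentially" if "0 < e" for e x :: real
  proof -
    have "(\<lambda>m. x * inverse (real (Suc m))) \<longlonglongrightarrow> x * 0" by (intro tendsto_intros LIMSEQ_inverse_real_of_nat)
    then show ?thesis using that by (intro order_tendstoD(2)[of _ 0]) (auto simp: divide_inverse)
  qed
  have cb: "conv_prob (\<lambda>m. mart (\<tau> m) (\<lambda>j. \<Phi> (\<tau> m j)) (Suc m + Suc m)) Ib"
  proof (rule ito_integral_riemann[OF _ Ib c g])
    show "0 \<le> b" using ab by simp
    show "\<tau> m 0 = 0" "\<tau> m (Suc m + Suc m) = b" for m by (auto simp: \<tau>_def)
    fix e :: real assume e: "0 < e"
    show "eventually (\<lambda>m. \<forall>j<Suc m + Suc m. \<tau> m (Suc j) - \<tau> m j < e) sequentially"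
      using mesh0[OF e, of a] mesh0[OF e, of "b - a"] unfolding dif by eventually_elim auto
  qed
  have ca: "conv_prob (\<lambda>m. mart (pt 0 a (Suc m)) (\<lambda>j. \<Phi> (pt 0 a (Suc m) j)) (Suc m)) Ia"
  proof (rule ito_integral_riemann[OF ab(1) Ia ca])
    show "grid (Suc m) (pt 0 a (Suc m))" for m by (rule pt_grid) (use ab in auto)
    fix e :: real assume e: "0 < e"
    show "eventually (\<lambda>m. \<forall>j<Suc m. pt 0 a (Suc m) (Suc j) - pt 0 a (Suc m) j < e) sequentially"
      using mesh0[OF e, of a] unfolding pt_Suc_diff by eventually_elim simp
  qed auto
  have rng: "\<tau> m j \<in> {0..b}" if "j \<le> Suc m + Suc m" for m j
    using grid_mono[OF g[of m], of j "Suc m + Suc m"] grid_nonneg[OF g[of m] that] that by (auto simp: \<tau>_def)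
  have mb: "mart (\<tau> m) (\<lambda>j. \<Phi> (\<tau> m j)) (Suc m + Suc m) \<in> borel_measurable M" for m
    by (rule mart_meas[OF g]) (use ad rng in \<open>auto simp: adapted_def simp del: add_Suc add_Suc_right\<close>)
  have ma: "mart (pt 0 a (Suc m)) (\<lambda>j. \<Phi> (pt 0 a (Suc m) j)) (Suc m) \<in> borel_measurable M" for m
  proof (rule mart_meas)
    show "grid (Suc m) (pt 0 a (Suc m))" by (rule pt_grid) (use ab in auto)
    show "adapted (Suc m) (pt 0 a (Suc m)) (\<lambda>j. \<Phi> (pt 0 a (Suc m) j))"
      unfolding adapted_def
    proof (intro allI impI)
      fix j assume "j < Suc m"
      then show "\<Phi> (pt 0 a (Suc m) j) \<in> borel_measurable (F (pt 0 a (Suc m) j))"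
        using pt_bounds[OF ab(1), of j "Suc m"] ab by (intro ad) auto
    qed
  qed
  have "mart (\<tau> m) (\<lambda>j. \<Phi> (\<tau> m j)) (Suc m + Suc m) om - mart (pt 0 a (Suc m)) (\<lambda>j. \<Phi> (pt 0 a (Suc m) j)) (Suc m) om
    = mart (pt a b (Suc m)) (\<lambda>j. \<Phi> (pt a b (Suc m) j)) (Suc m) om" for m om
    using mart_append[of "Suc m" "\<tau> m" "pt a b (Suc m)" "pt 0 a (Suc m)" \<Phi> om] t1 t2 by simp
  with conv_prob_diff[OF cb ca mb Im(2) ma Im(1)] show ?thesis by (simp add: fun_eq_iff)
qed

end

section \<open>Fourth moments of the solution over one step\<close>

context coeffs
begin

text \<open>The drift of the modified equation, through the formula of \<open>coeffs_exist\<close>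
  for the gradient of the modified objective.\<close>

definition bb :: "real \<Rightarrow> real^'n \<Rightarrow> real^'n" where
  "bb h x = - (g x + (h / 2) *\<^sub>R g1 x (g x))"

text \<open>In \<open>64 = 8 * 8\<close>, one factor separates drift and noise, the other separates
  the current weight into the initial weight and the increment. \<open>cL\<close> doubles
  \<open>cX\<close> because half of the estimated quantity is absorbed in
  \<open>local_moment\<close>.\<close>

definition cX :: real where "cX = 64 * (16 * K^8 + bdg CARD('n) * K^4)"
definition cL :: real where "cL = 2 * cX"

text \<open>The total coefficient of \<open>h^2 * m4\<close> in \<open>moment_step\<close>.\<close>

definition cM :: real where "cM = 16 * K^2 * (1 + cL) + 11 * (1 + cL)"

text \<open>The bound with \<open>cX\<close> permits the absorption in \<open>local_moment\<close>;
  the bound with \<open>cM\<close> preserves half of the dissipation in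
  \<open>moment_step\<close>.\<close>

definition small2 :: "real \<Rightarrow> bool" where
  "small2 h \<longleftrightarrow> small h \<and> cX * h ^ 4 \<le> 1 / 2 \<and> cM * h \<le> \<mu>"

lemma cX0: "0 \<le> cX" and cL0: "0 \<le> cL" by (auto simp: cX_def cL_def bdg_def)

text \<open>Constants of the one-step error: \<open>cS\<close> for the noise sums, \<open>cD\<close>
  for the deviation of the drift sums from their frozen value, \<open>c2\<close> and
  \<open>c3\<close> for the terms linear and quadratic in the increment. The total \<open>cT\<close>
  adds the cubic remainders of the solution and of the scheme.\<close>

definition cS :: real where "cS = 16 * (bdg CARD('n) * K^4)"
definition cD :: real where "cD = 128 * K^8 * (1 + cL)"
definition c2 :: real where "c2 = 4 * K^2 * (1 + cL) + 4 * K^3 * (1 + cL)"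
definition c3 :: real where "c3 = 6 * K * (1 + cD + cS) + 8 * real CARD('n) * K^2 * (1 + cL)"
definition cT :: real where
  "cT = c2 + k2 * c3 / 2 + 3 * k3 * (1 + cL) + 3 * K^4 * gam TYPE('n) * k3"

lemma cT0: "0 \<le> cT"
proof -
  have k: "0 \<le> k2" "0 \<le> k3" "0 \<le> gam TYPE('n)" using k2_ge1 k3_ge1 gam_ge1[where 'n='n] by linarith+
  have "0 \<le> bdg CARD('n)" by (simp add: bdg_def)
  then show ?thesis unfolding cT_def c2_def c3_def cD_def cS_def using k cL0 K0 by (intro add_nonneg_nonneg mult_nonneg_nonneg divide_nonneg_nonneg) auto
qed

lemma bb_bound:
  assumes h: "0 \<le> h" "h \<le> 1"
  shows "norm (bb h x) \<le> 2 * K^2 * w x"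
proof -
  have "norm (g1 x (g x)) \<le> K * (K * w x)"
    using smooth3D(6)[OF gs, of x "g x"] g_growth(2)[of x] K0 by (meson mult_left_mono order_trans)
  then have "(h / 2) * norm (g1 x (g x)) \<le> (1 / 2) * (K * (K * w x))"
    using h by (intro mult_mono) auto
  moreover have "norm (bb h x) \<le> norm (g x) + (h / 2) * norm (g1 x (g x))"
    unfolding bb_def norm_minus_cancel using h by (intro order_trans[OF norm_triangle_ineq]) auto
  moreover have "1 * (K * w x) \<le> K * (K * w x)" using K1 K0 by (intro mult_right_mono) auto
  moreover have "0 \<le> K * (K * w x)" using K0 by simp
  moreover have "2 * K^2 * w x = 2 * (K * (K * w x))" by (simp add: power2_eq_square)
  ultimately show ?thesis using g_growth(2)[of x] by linarith
qed

lemma g_cont: "continuous_on UNIV g"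
  by (rule lipschitz_on_continuous_on[of K]) (use smooth3D(8)[OF gs] K0 in \<open>auto intro!: lipschitz_onI simp: dist_norm, metis add.commute diff_add_cancel\<close>)

text \<open>\<open>g1\<close> is Lipschitz in its base point and \<open>g\<close> grows linearly, so
  the correction of the drift is locally Lipschitz with a linearly growing constant.\<close>

lemma g1g_diff: "norm (g1 (x + d) (g (x + d)) - g1 x (g x)) \<le> K^2 * norm d * (2 * w x + norm d)"
proof -
  have e: "g1 (x + d) (g (x + d)) - g1 x (g x) = (g1 (x + d) (g (x + d)) - g1 x (g (x + d))) + g1 x (g (x + d) - g x)"
    by (simp add: linear_diff[OF smooth3D(4)[OF gs]])
  have "norm (g1 (x + d) (g (x + d)) - g1 x (g (x + d))) \<le> K * norm d * norm (g (x + d))" by (rule smooth3D(9)[OF gs])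
  also have "\<dots> \<le> K * norm d * (K * (w x + norm d))"
    using g_growth(2)[of "x + d"] w_add[of x d] K0 by (intro mult_left_mono) (auto intro: order_trans mult_left_mono)
  finally have 1: "norm (g1 (x + d) (g (x + d)) - g1 x (g (x + d))) \<le> K * norm d * (K * (w x + norm d))" .
  have "norm (g1 x (g (x + d) - g x)) \<le> K * norm (g (x + d) - g x)" by (rule smooth3D(6)[OF gs])
  also have "\<dots> \<le> K * (K * norm d)" using smooth3D(8)[OF gs, of x d] K0 by (intro mult_left_mono) auto
  also have "\<dots> \<le> K * (K * (norm d * w x))" using K0 mult_left_mono[OF w_ge1[of x], of "norm d"] by (intro mult_left_mono) auto
  finally have 2: "norm (g1 x (g (x + d) - g x)) \<le> K * (K * (norm d * w x))" .
  show ?thesis unfolding e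
    using 1 2 norm_triangle_ineq[of "g1 (x + d) (g (x + d)) - g1 x (g (x + d))" "g1 x (g (x + d) - g x)"]
    by (simp add: power2_eq_square algebra_simps)
qed

lemma g1g_cont: "continuous_on UNIV (\<lambda>x. g1 x (g x))"
proof (rule continuous_at_imp_continuous_on, rule ballI)
  fix x
  have lim: "((\<lambda>d::real^'n. K^2 * norm d * (2 * w x + norm d)) \<longlongrightarrow> K^2 * norm (0::real^'n) * (2 * w x + norm (0::real^'n))) (at 0)"
    by (intro tendsto_intros)
  have "((\<lambda>d. g1 (x + d) (g (x + d)) - g1 x (g x)) \<longlongrightarrow> 0) (at 0)"
    by (rule Lim_null_comparison[OF _ lim[simplified]]) (use g1g_diff in auto)
  then have "((\<lambda>d. g1 (x + d) (g (x + d))) \<longlongrightarrow> g1 x (g x)) (at 0)" by (simp add: LIM_zero_iff)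
  then show "isCont (\<lambda>x. g1 x (g x)) x" by (simp add: isCont_iff)
qed

lemma bb_cont: "continuous_on UNIV (bb h)"
  unfolding bb_def by (intro continuous_intros g_cont g1g_cont)

lemma bb_meas: "bb h \<in> borel_measurable borel"
  by (rule borel_measurable_continuous_onI[OF bb_cont])

end

section \<open>Riemann sums along the solution, and localisation\<close>

locale sde = coeffs g g1 g2 \<sigma> \<sigma>1 \<sigma>2 xs K \<mu> + wiener M F B
  for g :: "real^'n \<Rightarrow> real^'n" and g1 g2 \<sigma> \<sigma>1 \<sigma>2 xs K \<mu>
    and M :: "'w measure" and F and B :: "real \<Rightarrow> 'w \<Rightarrow> real^'n" +
  fixes h :: real and x0 :: "real^'n" and Y :: "real \<Rightarrow> 'w \<Rightarrow> real^'n"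
  assumes sm: "small2 h"
    and sol: "sde_solution M F B (bb h) (\<lambda>t x. sqrt h *\<^sub>R \<sigma> t x) x0 Y"
begin

lemma h01: "0 < h" "h \<le> 1" and h_small: "small h" using sm by (auto simp: small2_def small_def)

lemma Y_ad: "0 \<le> t \<Longrightarrow> Y t \<in> borel_measurable (F t)"
  using sol unfolding sde_solution_def by blast

lemma Y_meas: "0 \<le> t \<Longrightarrow> Y t \<in> borel_measurable M"
  using Y_ad F_meas by blast

lemma Y_cont: "om \<in> space M \<Longrightarrow> continuous_on {0..} (\<lambda>t. Y t om)"
  using sol unfolding sde_solution_def by blast

definition G :: "real \<Rightarrow> 'w \<Rightarrow> real^'n^'n" where "G s om = sqrt h *\<^sub>R \<sigma> s (Y s om)"

lemma G_ad: "0 \<le> s \<Longrightarrow> G s \<in> borel_measurable (F s)"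
proof -
  assume s: "0 \<le> s"
  have [measurable]: "\<sigma> s \<in> borel_measurable borel" by (rule smooth3D(1)[OF ss[OF s]])
  have [measurable]: "Y s \<in> borel_measurable (F s)" by (rule Y_ad[OF s])
  show ?thesis unfolding G_def[abs_def] by measurable
qed

lemma G_bound: "0 \<le> s \<Longrightarrow> norm (G s om) ^ 4 \<le> h^2 * K^4 * w (Y s om) ^ 4"
proof -
  assume s: "0 \<le> s"
  have "norm (G s om) ^ 4 = (sqrt h) ^ 4 * norm (\<sigma> s (Y s om)) ^ 4" using h01 by (simp add: G_def power_mult_distrib)
  also have "(sqrt h) ^ 4 = h^2" using h01 by (simp add: power4_eq_xxxx power2_eq_square)
  also have "h^2 * norm (\<sigma> s (Y s om)) ^ 4 \<le> h^2 * (K * w (Y s om)) ^ 4"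
    by (intro mult_left_mono power_mono s_growth s) auto
  finally show ?thesis by (simp add: power_mult_distrib ac_simps)
qed

lemma G_path: "path_cont t G"
  unfolding path_cont_def G_def
proof
  fix om assume w: "om \<in> space M"
  have "continuous_on {0..t} (\<lambda>s. (\<lambda>(t, x). \<sigma> t x) (s, Y s om))"
    by (rule continuous_on_compose2[OF scont]) (auto intro!: continuous_intros continuous_on_subset[OF Y_cont[OF w]])
  then show "continuous_on {0..t} (\<lambda>s. sqrt h *\<^sub>R \<sigma> s (Y s om))" by (intro continuous_intros) auto
qed

text \<open>Left endpoint sums of the drift; \<open>SS\<close> are those of the noise. The factors
  \<open>e j\<close> are indicators known at the left end of the cell: they localise before moments
  are available and are constantly one afterwards.\<close>

definition DD :: "real \<Rightarrow> real \<Rightarrow> nat \<Rightarrow> (nat \<Rightarrow> 'w \<Rightarrow> real) \<Rightarrow> 'w \<Rightarrow> real^'n" where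
  "DD a b n e om = (\<Sum>j<n. ((b - a) / real n) *\<^sub>R (e j om *\<^sub>R bb h (Y (pt a b n j) om)))"

definition SS :: "real \<Rightarrow> real \<Rightarrow> nat \<Rightarrow> (nat \<Rightarrow> 'w \<Rightarrow> real) \<Rightarrow> 'w \<Rightarrow> real^'n" where
  "SS a b n e = mart (pt a b n) (\<lambda>j om. e j om *\<^sub>R G (pt a b n j) om) n"

text \<open>The drift sums converge along almost every path, the noise sums only in probability.
  Along a subsequence both converge almost surely, and the integral equation identifies the
  limit.\<close>

lemma riemann_ae:
  assumes ab: "0 \<le> a" "a \<le> b"
  obtains r :: "nat \<Rightarrow> nat" where "strict_mono r"
    "AE om in M. (\<lambda>m. DD a b (Suc (r m)) (\<lambda>_ _. 1) om + SS a b (Suc (r m)) (\<lambda>_ _. 1) om) \<longlonglongrightarrow> Y b om - Y a om"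
proof -
  have ex: "\<exists>I. ito_integral M F B G t I \<and>
        (AE om in M. (\<lambda>u. bb h (Y u om)) absolutely_integrable_on {0..t} \<and>
           Y t om = x0 + integral {0..t} (\<lambda>u. bb h (Y u om)) + I om)" if "0 \<le> t" for t
    using sol that unfolding sde_solution_def G_def by blast
  obtain Ia where Ia: "ito_integral M F B G a Ia" "AE om in M. Y a om = x0 + integral {0..a} (\<lambda>u. bb h (Y u om)) + Ia om"
    using ex[OF ab(1)] by auto
  obtain Ib where Ib: "ito_integral M F B G b Ib" "AE om in M. Y b om = x0 + integral {0..b} (\<lambda>u. bb h (Y u om)) + Ib om"
    using ex[of b] ab by auto
  have Im: "Ia \<in> borel_measurable M" "Ib \<in> borel_measurable M" using Ia Ib by (auto simp: ito_integral_def)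
  have Sm: "SS a b (Suc m) (\<lambda>_ _. 1) \<in> borel_measurable M" for m
    unfolding SS_def
  proof (rule mart_meas)
    show "grid (Suc m) (pt a b (Suc m))" by (rule pt_grid[OF ab])
    show "adapted (Suc m) (pt a b (Suc m)) (\<lambda>j om. 1 *\<^sub>R G (pt a b (Suc m) j) om)"
      unfolding adapted_def using pt_bounds[OF ab(2)] ab by (auto intro!: G_ad intro: order_trans)
  qed
  have "conv_prob (\<lambda>m. SS a b (Suc m) (\<lambda>_ _. 1)) (\<lambda>om. Ib om - Ia om)"
    using ito_increment_riemann[OF ab Ia(1) Ib(1) G_path] by (simp add: SS_def)
  from conv_prob_subseq[OF this Sm] Im obtain r where r: "strict_mono r"
    "AE om in M. (\<lambda>m. SS a b (Suc (r m)) (\<lambda>_ _. 1) om) \<longlonglongrightarrow> Ib om - Ia om" by auto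
  have sp: "AE om in M. om \<in> space M" by (rule AE_space)
  have "AE om in M. (\<lambda>m. DD a b (Suc (r m)) (\<lambda>_ _. 1) om + SS a b (Suc (r m)) (\<lambda>_ _. 1) om) \<longlonglongrightarrow> Y b om - Y a om"
    using r(2) Ia(2) Ib(2) sp
  proof eventually_elim
    case (elim om)
    have c: "continuous_on {0..b} (\<lambda>u. bb h (Y u om))"
      by (rule continuous_on_compose2[OF bb_cont]) (auto intro!: continuous_on_subset[OF Y_cont[OF elim(4)]])
    have "(\<lambda>m. DD a b (Suc m) (\<lambda>_ _. 1) om) \<longlonglongrightarrow> integral {a..b} (\<lambda>u. bb h (Y u om))"
      unfolding DD_def scaleR_one
      by (rule riemann_integral_tendsto[OF ab(2), where f = "\<lambda>u. bb h (Y u om)"]) (rule continuous_on_subset[OF c], use ab in auto)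
    from LIMSEQ_subseq_LIMSEQ[OF this r(1)]
    have "(\<lambda>m. DD a b (Suc (r m)) (\<lambda>_ _. 1) om) \<longlonglongrightarrow> integral {a..b} (\<lambda>u. bb h (Y u om))" by (simp add: o_def)
    from tendsto_add[OF this elim(1)]
    have "(\<lambda>m. DD a b (Suc (r m)) (\<lambda>_ _. 1) om + SS a b (Suc (r m)) (\<lambda>_ _. 1) om) \<longlonglongrightarrow> integral {a..b} (\<lambda>u. bb h (Y u om)) + (Ib om - Ia om)" .
    moreover have I: "integral {0..a} (\<lambda>u. bb h (Y u om)) + integral {a..b} (\<lambda>u. bb h (Y u om)) = integral {0..b} (\<lambda>u. bb h (Y u om))"
      by (rule Henstock_Kurzweil_Integration.integral_combine[OF ab integrable_continuous_interval[OF c]])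
    ultimately show ?case unfolding elim(2,3) I[symmetric] by (simp add: algebra_simps)
  qed
  with r(1) show ?thesis by (rule that)
qed

text \<open>Both parts are of size \<open>h\<close> over a step: the drift because the elapsed time
  is, the noise because \<open>G\<close> carries \<open>sqrt h\<close> and a time \<open>h\<close>
  contributes another \<open>sqrt h\<close>. The bounds do not depend on \<open>n\<close>.\<close>

lemma riemann_pow4:
  assumes ab: "0 \<le> a" "a < b" "b \<le> a + h" and n: "0 < n"
    and e: "\<And>j. j < n \<Longrightarrow> e j \<in> borel_measurable (F (pt a b n j))" "\<And>j om. e j om = 0 \<or> e j om = 1"
    and i: "\<And>j. j < n \<Longrightarrow> integrable M (\<lambda>om. e j om * w (Y (pt a b n j) om) ^ 4)"
    and Q: "\<And>j. j < n \<Longrightarrow> (\<integral>om. e j om * w (Y (pt a b n j) om) ^ 4 \<partial>M) \<le> Q" and Q0: "0 \<le> Q"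
  shows "DD a b n e \<in> borel_measurable M" "SS a b n e \<in> borel_measurable M"
    "integrable M (\<lambda>om. norm (DD a b n e om) ^ 4)" "(\<integral>om. norm (DD a b n e om) ^ 4 \<partial>M) \<le> 16 * K^8 * h^4 * Q"
    "integrable M (\<lambda>om. norm (SS a b n e om) ^ 4)" "(\<integral>om. norm (SS a b n e om) ^ 4 \<partial>M) \<le> bdg CARD('n) * K^4 * h^4 * Q"
    "adapted n (pt a b n) (\<lambda>j om. e j om *\<^sub>R G (pt a b n j) om)"
    "\<And>j. j < n \<Longrightarrow> integrable M (\<lambda>om. norm (e j om *\<^sub>R G (pt a b n j) om) ^ 4)"
proof -
  have s0: "0 \<le> pt a b n j" if "j < n" for j using pt_bounds[of a b j n] that ab by auto
  define D where "D = (b - a) / real n"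
  have D: "0 < D" "real n * D = b - a" "real n * D \<le> h" using ab n by (auto simp: D_def)
  note [measurable] = bb_meas
  have Ym [measurable]: "Y (pt a b n j) \<in> borel_measurable M" if "j < n" for j by (rule Y_meas[OF s0[OF that]])
  have em [measurable]: "e j \<in> borel_measurable M" if "j < n" for j using e(1)[OF that] F_meas by blast
  have ee: "e j om ^ 4 = e j om" "0 \<le> e j om" for j om using e(2)[of j om] by auto
  define v where "v = (\<lambda>j om. e j om *\<^sub>R bb h (Y (pt a b n j) om))"
  have vm: "v j \<in> borel_measurable M" if "j < n" for j
    using Ym[OF that] em[OF that] unfolding v_def by measurable
  have vb: "norm (v j om) ^ 4 \<le> 16 * K^8 * (e j om * w (Y (pt a b n j) om) ^ 4)" for j om
  proof -
    have "norm (v j om) ^ 4 = e j om * norm (bb h (Y (pt a b n j) om)) ^ 4" by (simp add: v_def power_mult_distrib ee)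
    also have "\<dots> \<le> e j om * (2 * K^2 * w (Y (pt a b n j) om)) ^ 4"
      using h01 by (intro mult_left_mono power_mono bb_bound ee) auto
    finally show ?thesis by (simp add: power_mult_distrib ac_simps flip: power_mult)
  qed
  have vi: "integrable M (\<lambda>om. norm (v j om) ^ 4)" if "j < n" for j
    by (rule Bochner_Integration.integrable_bound[OF integrable_mult_right[OF i[OF that], of "16 * K^8"]])
      (use vm[OF that] vb ee(2) in \<open>auto intro!: AE_I2 order_trans[OF vb]\<close>)
  have vE: "(\<integral>om. norm (v j om) ^ 4 \<partial>M) \<le> 16 * K^8 * Q" if "j < n" for j
  proof -
    have "(\<integral>om. norm (v j om) ^ 4 \<partial>M) \<le> (\<integral>om. 16 * K^8 * (e j om * w (Y (pt a b n j) om) ^ 4) \<partial>M)"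
      by (rule integral_mono[OF vi[OF that] integrable_mult_right[OF i[OF that]] vb])
    also have "\<dots> \<le> 16 * K^8 * Q" using Q[OF that] by (simp add: mult_left_mono)
    finally show ?thesis .
  qed
  have DDv: "DD a b n e om = (\<Sum>j<n. D *\<^sub>R v j om)" for om by (simp add: DD_def D_def v_def)
  show "DD a b n e \<in> borel_measurable M"
    unfolding DDv[abs_def] using vm by (intro borel_measurable_sum borel_measurable_scaleR) auto
  note S4 = sum_pow4[of n v, OF vm vi vE less_imp_le[OF D(1)]]
  show "integrable M (\<lambda>om. norm (DD a b n e om) ^ 4)" unfolding DDv by (rule S4(1))
  have "(\<integral>om. norm (DD a b n e om) ^ 4 \<partial>M) \<le> (real n * D) ^ 4 * (16 * K^8 * Q)" unfolding DDv by (rule S4(2))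
  also have "\<dots> \<le> h ^ 4 * (16 * K^8 * Q)" using D Q0 n ab by (intro mult_right_mono power_mono) auto
  finally show "(\<integral>om. norm (DD a b n e om) ^ 4 \<partial>M) \<le> 16 * K^8 * h^4 * Q" by (simp add: ac_simps)
  have g: "grid n (pt a b n)" by (rule pt_grid) (use ab in auto)
  define H where "H = (\<lambda>j om. e j om *\<^sub>R G (pt a b n j) om)"
  have Hj: "H j \<in> borel_measurable (F (pt a b n j))" if "j < n" for j
    unfolding H_def using e(1)[OF that] G_ad[OF s0[OF that]] by measurable
  then show ad: "adapted n (pt a b n) (\<lambda>j om. e j om *\<^sub>R G (pt a b n j) om)" by (simp add: adapted_def H_def)
  then have adH: "adapted n (pt a b n) H" by (simp add: H_def)
  show "SS a b n e \<in> borel_measurable M" unfolding SS_def by (rule mart_meas[OF g ad])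
  have Hb: "norm (H j om) ^ 4 \<le> h^2 * K^4 * (e j om * w (Y (pt a b n j) om) ^ 4)" if "j < n" for j om
  proof -
    have "norm (H j om) ^ 4 = e j om * norm (G (pt a b n j) om) ^ 4" by (simp add: H_def power_mult_distrib ee)
    also have "\<dots> \<le> e j om * (h^2 * K^4 * w (Y (pt a b n j) om) ^ 4)" by (intro mult_left_mono G_bound s0 that ee)
    finally show ?thesis by (simp add: ac_simps)
  qed
  have Hi: "integrable M (\<lambda>om. norm (H j om) ^ 4)" if "j < n" for j
    by (rule Bochner_Integration.integrable_bound[OF integrable_mult_right[OF i[OF that], of "h^2 * K^4"]])
      (use F_meas[OF Hj[OF that]] Hb[OF that] ee(2) in \<open>auto intro!: AE_I2 order_trans[OF Hb[OF that]]\<close>)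
  then show "integrable M (\<lambda>om. norm (e j om *\<^sub>R G (pt a b n j) om) ^ 4)" if "j < n" for j
    using that by (simp add: H_def)
  have HE: "(\<integral>om. norm (H j om) ^ 4 \<partial>M) \<le> h^2 * K^4 * Q" if "j < n" for j
  proof -
    have "(\<integral>om. norm (H j om) ^ 4 \<partial>M) \<le> (\<integral>om. h^2 * K^4 * (e j om * w (Y (pt a b n j) om) ^ 4) \<partial>M)"
      by (rule integral_mono[OF Hi[OF that] integrable_mult_right[OF i[OF that]] Hb[OF that]])
    also have "\<dots> \<le> h^2 * K^4 * Q" using Q[OF that] by (simp add: mult_left_mono)
    finally show ?thesis .
  qed
  have c0: "0 \<le> h^2 * K^4 * Q" using Q0 by simp
  have Dj: "pt a b n (Suc j) - pt a b n j = D" for j by (simp add: pt_Suc_diff D_def)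
  note P4 = mart_pow4[OF g D(1) Dj D(2)[symmetric] adH c0 Hi HE order_refl]
  show "integrable M (\<lambda>om. norm (SS a b n e om) ^ 4)" using P4 by (simp add: SS_def H_def)
  have "(\<integral>om. norm (SS a b n e om) ^ 4 \<partial>M) \<le> bdg CARD('n) * (b - a)^2 * (h^2 * K^4 * Q)" using P4 by (simp add: SS_def H_def)
  also have "\<dots> \<le> bdg CARD('n) * h^2 * (h^2 * K^4 * Q)"
    using c0 ab by (intro mult_right_mono mult_left_mono power_mono) (auto simp: bdg_def)
  finally show "(\<integral>om. norm (SS a b n e om) ^ 4 \<partial>M) \<le> bdg CARD('n) * K^4 * h^4 * Q"
    by (simp add: power2_eq_square power4_eq_xxxx ac_simps)
qed

text \<open>The event that the path has stayed in a ball since time \<open>a\<close>. Its indicator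
  is adapted and nonincreasing in \<open>s\<close>, which takes the place of a stopping
  time.\<close>

definition AR :: "real \<Rightarrow> real \<Rightarrow> real \<Rightarrow> 'w set" where
  "AR R a s = {om \<in> space M. \<forall>u\<in>{a..s}. norm (Y u om - xs) \<le> R}"

text \<open>By continuity, rational times suffice. They are taken in \<open>[0, 1]\<close> and
  mapped affinely onto \<open>[a, s]\<close>, so that both endpoints are included whatever
  \<open>a\<close> and \<open>s\<close> are.\<close>

lemma AR_F:
  assumes "0 \<le> a" "a \<le> s" shows "AR R a s \<in> sets (F s)"
proof -
  have eq: "AR R a s = {om \<in> space (F s). \<forall>q::rat. 0 \<le> q \<and> q \<le> 1 \<longrightarrow> norm (Y (a + of_rat q * (s - a)) om - xs) \<le> R}"
  proof (intro set_eqI iffI)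
    fix om assume w: "om \<in> AR R a s"
    have "a + of_rat q * (s - a) \<in> {a..s}" if "0 \<le> q" "q \<le> 1" for q :: rat
    proof -
      have q: "0 \<le> (of_rat q :: real)" "(of_rat q :: real) \<le> 1" using that by auto
      have "of_rat q * (s - a) \<le> 1 * (s - a)" using q assms by (intro mult_right_mono) auto
      then show ?thesis using q assms by auto
    qed
    then show "om \<in> {om \<in> space (F s). \<forall>q::rat. 0 \<le> q \<and> q \<le> 1 \<longrightarrow> norm (Y (a + of_rat q * (s - a)) om - xs) \<le> R}"
      using w sub(1) by (auto simp: AR_def)
  next
    fix om assume w: "om \<in> {om \<in> space (F s). \<forall>q::rat. 0 \<le> q \<and> q \<le> 1 \<longrightarrow> norm (Y (a + of_rat q * (s - a)) om - xs) \<le> R}"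
    then have sp: "om \<in> space M" using sub(1) by auto
    define f where "f = (\<lambda>q::real. norm (Y (a + q * (s - a)) om - xs))"
    have fc: "continuous_on {0..1} f"
      unfolding f_def
      by (intro continuous_intros continuous_on_compose2[OF Y_cont[OF sp]]) (use assms in auto)
    \<comment> \<open>By continuity, a violation at one time would persist at a nearby rational time
      inside \<open>[0, 1]\<close>.\<close>
    have all: "f q \<le> R" if q: "q \<in> {0..1}" for q
    proof (rule ccontr)
      assume n: "\<not> f q \<le> R"
      then have "0 < f q - R" by simp
      then obtain d where d: "0 < d" "\<And>q'. q' \<in> {0..1} \<Longrightarrow> dist q' q < d \<Longrightarrow> dist (f q') (f q) < f q - R"
        using fc q unfolding continuous_on_iff by meson
      have "max 0 (q - d) < min 1 (q + d)" using q d by auto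
      then obtain r where r: "r \<in> \<rat>" "max 0 (q - d) < r" "r < min 1 (q + d)" using Rats_dense_in_real by blast
      from r(1) obtain r' where r': "r = of_rat r'" by (auto elim: Rats_cases)
      have "f r \<le> R" using w r r' by (auto simp: f_def)
      moreover have "dist (f r) (f q) < f q - R" using d(2)[of r] r by (auto simp: dist_real_def)
      ultimately show False by (simp add: dist_real_def)
    qed
    have "norm (Y u om - xs) \<le> R" if u: "u \<in> {a..s}" for u
    proof (cases "a = s")
      case True
      then have "u = a + 0 * (s - a)" using u by simp
      then show ?thesis using all[of 0] by (simp add: f_def)
    next
      case False
      define q where "q = (u - a) / (s - a)"
      have "q \<in> {0..1}" "u = a + q * (s - a)" using u False assms by (auto simp: q_def field_simps)
      then show ?thesis using all[of q] by (simp add: f_def)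
    qed
    then show "om \<in> AR R a s" using sp by (simp add: AR_def)
  qed
  have m: "Measurable.pred (F s) (\<lambda>om. 0 \<le> q \<and> q \<le> 1 \<longrightarrow> norm (Y (a + of_rat q * (s - a)) om - xs) \<le> R)" for q :: rat
  proof (cases "0 \<le> q \<and> q \<le> 1")
    case True
    then have q: "0 \<le> (of_rat q :: real)" "(of_rat q :: real) \<le> 1" by auto
    have "of_rat q * (s - a) \<le> 1 * (s - a)" using q assms by (intro mult_right_mono) auto
    then have "0 \<le> a + of_rat q * (s - a)" "a + of_rat q * (s - a) \<le> s" using q assms by auto
    then have [measurable]: "Y (a + of_rat q * (s - a)) \<in> borel_measurable (F s)"
      using F_meas_mono[OF _ Y_ad] by blast
    show ?thesis by measurable
  qed auto
  have "{om \<in> space (F s). \<forall>q::rat. 0 \<le> q \<and> q \<le> 1 \<longrightarrow> norm (Y (a + of_rat q * (s - a)) om - xs) \<le> R} \<in> sets (F s)"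
    using m by measurable
  then show ?thesis unfolding eq .
qed

lemma AR_mono: "u \<le> s \<Longrightarrow> AR R a s \<subseteq> AR R a u"
  by (auto simp: AR_def)

lemma pow4_w_add: "w (x + d) ^ 4 \<le> 8 * w x ^ 4 + 8 * norm d ^ 4"
proof -
  have "w (x + d) ^ 4 \<le> (w x + norm d) ^ 4" by (intro power_mono w_add) auto
  also have "\<dots> \<le> 8 * w x ^ 4 + 8 * norm d ^ 4"
    using norm_add_pow4_le[of "w x" "norm d"] by (simp add: abs_of_nonneg)
  finally show ?thesis .
qed

text \<open>The fourth moment of the increment is not known to be finite beforehand. On the
  localising events it is at most \<open>(2 * R) ^ 4\<close>, and its supremum \<open>S\<close> over
  the step satisfies \<open>S \<le> cX * h ^ 4 * (m4 + S)\<close>, where the last term is absorbed.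
  The resulting bound is free of \<open>R\<close>, and Fatou's lemma removes the
  localisation.\<close>

theorem local_moment:
  assumes a: "0 \<le> a" and s: "a \<le> s" "s \<le> a + h" and m: "integrable M (\<lambda>om. w (Y a om) ^ 4)"
  shows "integrable M (\<lambda>om. norm (Y s om - Y a om) ^ 4)"
    "(\<integral>om. norm (Y s om - Y a om) ^ 4 \<partial>M) \<le> cL * h ^ 4 * (\<integral>om. w (Y a om) ^ 4 \<partial>M)"
proof -
  define m4 where "m4 = (\<integral>om. w (Y a om) ^ 4 \<partial>M)"
  have m40: "0 \<le> m4" unfolding m4_def by simp
  have Ym: "Y u \<in> borel_measurable M" if "a \<le> u" for u using that a by (intro Y_meas) auto
  define \<phi> where "\<phi> = (\<lambda>R u om. indicat_real (AR R a u) om * norm (Y u om - Y a om) ^ 4)"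
  have ARm: "AR R a u \<in> sets M" if "a \<le> u" for R u using AR_F[OF a that] sub(2) by blast
  have \<phi>m: "\<phi> R u \<in> borel_measurable M" if "a \<le> u" for R u
    unfolding \<phi>_def using ARm[OF that] Ym[OF that] Ym[of a] by measurable
  have \<phi>b: "0 \<le> \<phi> R u om" "a \<le> u \<Longrightarrow> \<phi> R u om \<le> (2 * R) ^ 4" for R u om
  proof -
    show "0 \<le> \<phi> R u om" by (simp add: \<phi>_def)
    assume u: "a \<le> u"
    show "\<phi> R u om \<le> (2 * R) ^ 4"
    proof (cases "om \<in> AR R a u")
      case True
      then have "norm (Y u om - xs) \<le> R" "norm (Y a om - xs) \<le> R" using u by (auto simp: AR_def)
      then have "norm (Y u om - Y a om) \<le> 2 * R"
        using norm_triangle_ineq4[of "Y u om - xs" "Y a om - xs"] by simp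
      then have "norm (Y u om - Y a om) ^ 4 \<le> (2 * R) ^ 4" by (intro power_mono) auto
      then show ?thesis using True by (simp add: \<phi>_def)
    qed (simp add: \<phi>_def)
  qed
  have \<phi>i: "integrable M (\<phi> R u)" if "a \<le> u" for R u
    by (rule integrable_const_bound[where B = "(2 * R) ^ 4"]) (use \<phi>b \<phi>m that in auto)
  have key: "(\<integral>om. \<phi> R s om \<partial>M) \<le> cX * h ^ 4 * (m4 + \<beta>)"
    if \<beta>: "\<And>u. a \<le> u \<Longrightarrow> u \<le> a + h \<Longrightarrow> (\<integral>om. \<phi> R u om \<partial>M) \<le> \<beta>" and as: "a < s" "s \<le> a + h" for R \<beta> s
  proof -
    have \<beta>0: "0 \<le> \<beta>"
    proof -
      have "0 \<le> (\<integral>om. \<phi> R a om \<partial>M)" by (rule integral_nonneg_AE) (simp add: \<phi>b)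
      then show ?thesis using \<beta>[of a] h01 by simp
    qed
    \<comment> \<open>Each cell uses the event up to its own left end, which keeps the sums adapted.
      On the event up to time \<open>s\<close> all these indicators are one, so there the sums
      coincide with the unrestricted ones.\<close>
    define e where "e = (\<lambda>n j. indicat_real (AR R a (pt a s n j)))"
    have wi: "integrable M (\<lambda>om. indicat_real (AR R a u) om * w (Y u om) ^ 4)"
      "(\<integral>om. indicat_real (AR R a u) om * w (Y u om) ^ 4 \<partial>M) \<le> 8 * (m4 + \<beta>)" if u: "a \<le> u" "u \<le> a + h" for u
    proof -
      have le: "indicat_real (AR R a u) om * w (Y u om) ^ 4 \<le> 8 * w (Y a om) ^ 4 + 8 * \<phi> R u om" for om
        using pow4_w_add[of "Y a om" "Y u om - Y a om"] by (auto simp: \<phi>_def indicator_def)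
      have iB: "integrable M (\<lambda>om. 8 * w (Y a om) ^ 4 + 8 * \<phi> R u om)" using m \<phi>i[OF u(1)] by auto
      show i: "integrable M (\<lambda>om. indicat_real (AR R a u) om * w (Y u om) ^ 4)"
      proof (rule Bochner_Integration.integrable_bound[OF iB])
        show "(\<lambda>om. indicat_real (AR R a u) om * w (Y u om) ^ 4) \<in> borel_measurable M"
          using ARm[OF u(1)] Ym[OF u(1)] by measurable
        show "AE om in M. norm (indicat_real (AR R a u) om * w (Y u om) ^ 4) \<le> norm (8 * w (Y a om) ^ 4 + 8 * \<phi> R u om)"
          using le \<phi>b(1) by (intro AE_I2) (simp add: abs_of_nonneg)
      qed
      have "(\<integral>om. indicat_real (AR R a u) om * w (Y u om) ^ 4 \<partial>M) \<le> (\<integral>om. 8 * w (Y a om) ^ 4 + 8 * \<phi> R u om \<partial>M)"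
        by (rule integral_mono[OF i iB le])
      also have "\<dots> = 8 * m4 + 8 * (\<integral>om. \<phi> R u om \<partial>M)" using m \<phi>i[OF u(1)] by (simp add: m4_def)
      also have "\<dots> \<le> 8 * (m4 + \<beta>)" using \<beta>[OF u] by simp
      finally show "(\<integral>om. indicat_real (AR R a u) om * w (Y u om) ^ 4 \<partial>M) \<le> 8 * (m4 + \<beta>)" .
    qed
    have pb: "a \<le> pt a s n j" "pt a s n j \<le> a + h" "pt a s n j \<le> s" if "j < n" for n j
      using pt_bounds[of a s j n] as that by auto
    have em: "e n j \<in> borel_measurable (F (pt a s n j))" if "j < n" for n j
      unfolding e_def using AR_F[OF a pb(1)[OF that]] by measurable
    have e01: "e n j om = 0 \<or> e n j om = 1" for n j om by (simp add: e_def indicator_def)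
    have Q0: "0 \<le> 8 * (m4 + \<beta>)" using m40 \<beta>0 by simp
    have ei: "integrable M (\<lambda>om. e n j om * w (Y (pt a s n j) om) ^ 4)" if "j < n" for n j
      unfolding e_def by (rule wi(1)[OF pb(1,2)[OF that]])
    have eE: "(\<integral>om. e n j om * w (Y (pt a s n j) om) ^ 4 \<partial>M) \<le> 8 * (m4 + \<beta>)" if "j < n" for n j
      unfolding e_def by (rule wi(2)[OF pb(1,2)[OF that]])
    note P = riemann_pow4[OF a as zero_less_Suc em e01 ei eE Q0]
    have P': "DD a s (Suc n) (e (Suc n)) \<in> borel_measurable M" "SS a s (Suc n) (e (Suc n)) \<in> borel_measurable M"
      "integrable M (\<lambda>om. norm (DD a s (Suc n) (e (Suc n)) om) ^ 4)" "(\<integral>om. norm (DD a s (Suc n) (e (Suc n)) om) ^ 4 \<partial>M) \<le> 16 * K^8 * h^4 * (8 * (m4 + \<beta>))"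
      "integrable M (\<lambda>om. norm (SS a s (Suc n) (e (Suc n)) om) ^ 4)" "(\<integral>om. norm (SS a s (Suc n) (e (Suc n)) om) ^ 4 \<partial>M) \<le> bdg CARD('n) * K^4 * h^4 * (8 * (m4 + \<beta>))" for n
      by (rule P(1-6); assumption)+
    obtain r where r: "strict_mono r"
      "AE om in M. (\<lambda>m. DD a s (Suc (r m)) (\<lambda>_ _. 1) om + SS a s (Suc (r m)) (\<lambda>_ _. 1) om) \<longlonglongrightarrow> Y s om - Y a om"
      by (rule riemann_ae[OF a less_imp_le[OF as(1)]])
    define T where "T = (\<lambda>n om. indicat_real (AR R a s) om * norm (DD a s (Suc n) (e (Suc n)) om + SS a s (Suc n) (e (Suc n)) om) ^ 4)"
    have same: "DD a s n (e n) om = DD a s n (\<lambda>_ _. 1) om \<and> SS a s n (e n) om = SS a s n (\<lambda>_ _. 1) om" if w: "om \<in> AR R a s" for n om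
    proof -
      have "e n j om = 1" if "j < n" for j
        using w AR_mono[OF pb(3)[OF that], of R a] by (auto simp: e_def)
      then show ?thesis unfolding DD_def SS_def mart_def by (auto intro!: sum.cong)
    qed
    have lim: "AE om in M. (\<lambda>m. T (r m) om) \<longlonglongrightarrow> \<phi> R s om"
      using r(2)
    proof eventually_elim
      case (elim om)
      show ?case
      proof (cases "om \<in> AR R a s")
        case True
        have "(\<lambda>m. norm (DD a s (Suc (r m)) (\<lambda>_ _. 1) om + SS a s (Suc (r m)) (\<lambda>_ _. 1) om) ^ 4) \<longlonglongrightarrow> norm (Y s om - Y a om) ^ 4"
          by (intro tendsto_intros elim)
        then show ?thesis using True same[OF True] by (simp add: T_def \<phi>_def)
      qed (simp add: T_def \<phi>_def)
    qed
    have Tm: "T n \<in> borel_measurable M" for n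
    proof -
      have [measurable]: "AR R a s \<in> sets M" "DD a s (Suc n) (e (Suc n)) \<in> borel_measurable M"
        "SS a s (Suc n) (e (Suc n)) \<in> borel_measurable M"
        using ARm[of s R] as P'(1,2)[of n] by auto
      show ?thesis unfolding T_def by measurable
    qed
    have Tle: "T n om \<le> 8 * norm (DD a s (Suc n) (e (Suc n)) om) ^ 4 + 8 * norm (SS a s (Suc n) (e (Suc n)) om) ^ 4" for n om
      using norm_add_pow4_le[of "DD a s (Suc n) (e (Suc n)) om" "SS a s (Suc n) (e (Suc n)) om"]
      by (auto simp: T_def indicator_def)
    have iB: "integrable M (\<lambda>om. 8 * norm (DD a s (Suc n) (e (Suc n)) om) ^ 4 + 8 * norm (SS a s (Suc n) (e (Suc n)) om) ^ 4)" for n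
      using P'(3,5) by auto
    have Ti: "integrable M (T n)" for n
      by (rule Bochner_Integration.integrable_bound[OF iB[of n] Tm]) (use Tle in \<open>auto intro!: AE_I2 simp: T_def\<close>)
    have TE: "(\<integral>om. T n om \<partial>M) \<le> cX * h ^ 4 * (m4 + \<beta>)" for n
    proof -
      have "(\<integral>om. T n om \<partial>M) \<le> (\<integral>om. 8 * norm (DD a s (Suc n) (e (Suc n)) om) ^ 4 + 8 * norm (SS a s (Suc n) (e (Suc n)) om) ^ 4 \<partial>M)"
        by (rule integral_mono[OF Ti iB Tle])
      also have "\<dots> = 8 * (\<integral>om. norm (DD a s (Suc n) (e (Suc n)) om) ^ 4 \<partial>M) + 8 * (\<integral>om. norm (SS a s (Suc n) (e (Suc n)) om) ^ 4 \<partial>M)"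
        using P'(3,5) by simp
      also have "\<dots> \<le> 8 * (16 * K^8 * h^4 * (8 * (m4 + \<beta>))) + 8 * (bdg CARD('n) * K^4 * h^4 * (8 * (m4 + \<beta>)))"
        using P'(4,6) by (intro add_mono mult_left_mono) auto
      also have "\<dots> = cX * h ^ 4 * (m4 + \<beta>)" by (simp add: cX_def algebra_simps)
      finally show ?thesis .
    qed
    show ?thesis
      by (rule fatou_bound(2)[OF Tm \<phi>m lim Ti _ TE]) (use as in \<open>auto simp: T_def\<close>)
  qed
  have bnd: "(\<integral>om. \<phi> R u om \<partial>M) \<le> cL * h ^ 4 * m4" if u: "a \<le> u" "u \<le> a + h" for R u
  proof -
    define S where "S = (\<lambda>u. \<integral>om. \<phi> R u om \<partial>M) ` {a..a + h}"
    have ne: "S \<noteq> {}" using h01 by (auto simp: S_def)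
    have bdd: "bdd_above S"
    proof (rule bdd_aboveI)
      fix x assume "x \<in> S"
      then obtain v where v: "a \<le> v" "x = (\<integral>om. \<phi> R v om \<partial>M)" by (auto simp: S_def)
      have "(\<integral>om. \<phi> R v om \<partial>M) \<le> (\<integral>om. (2 * R) ^ 4 \<partial>M)" by (rule integral_mono[OF \<phi>i[OF v(1)]]) (use \<phi>b v in auto)
      then show "x \<le> (2 * R) ^ 4" using v by (simp add: prob_space)
    qed
    have up: "(\<integral>om. \<phi> R v om \<partial>M) \<le> Sup S" if "a \<le> v" "v \<le> a + h" for v
      using that by (intro cSup_upper bdd) (auto simp: S_def)
    have "0 \<le> (\<integral>om. \<phi> R a om \<partial>M)" by (rule integral_nonneg_AE) (simp add: \<phi>b)
    then have S0: "0 \<le> Sup S" using up[of a] h01 by linarith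
    have "Sup S \<le> cX * h ^ 4 * (m4 + Sup S)"
    proof (rule cSup_least[OF ne])
      fix x assume "x \<in> S"
      then obtain v where v: "a \<le> v" "v \<le> a + h" "x = (\<integral>om. \<phi> R v om \<partial>M)" by (auto simp: S_def)
      show "x \<le> cX * h ^ 4 * (m4 + Sup S)"
      proof (cases "a = v")
        case True
        then have "x = 0" using v by (simp add: \<phi>_def)
        then show ?thesis using cX0 m40 S0 h01 by simp
      next
        case False
        then show ?thesis using key[OF up, of v] v by simp
      qed
    qed
    also have "\<dots> = cX * h ^ 4 * m4 + cX * h ^ 4 * Sup S" by (simp add: algebra_simps)
    \<comment> \<open>The finite supremum can be subtracted: half of it moves to the left, whence
      \<open>cL = 2 * cX\<close>.\<close>
    also have "\<dots> \<le> cX * h ^ 4 * m4 + 1 / 2 * Sup S" using sm S0 by (intro add_left_mono mult_right_mono) (auto simp: small2_def)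
    finally have "Sup S \<le> cL * h ^ 4 * m4" by (simp add: cL_def)
    then show ?thesis using up[OF u] by linarith
  qed
  \<comment> \<open>A continuous path is bounded on \<open>[a, s]\<close>, hence it lies in the
    localising event for all large radii.\<close>
  have lim: "AE om in M. (\<lambda>m. \<phi> (real m) s om) \<longlonglongrightarrow> norm (Y s om - Y a om) ^ 4"
  proof (rule AE_I2)
    fix om assume w: "om \<in> space M"
    have cp: "compact ((\<lambda>u. norm (Y u om - xs)) ` {a..s})"
      by (intro compact_continuous_image continuous_intros continuous_on_subset[OF Y_cont[OF w]]) (use a in auto)
    obtain b where b: "\<And>u. u \<in> {a..s} \<Longrightarrow> norm (Y u om - xs) \<le> b"
      using bounded_imp_bdd_above[OF compact_imp_bounded[OF cp]] unfolding bdd_above_def by blast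
    obtain N where N: "b \<le> real N" using real_arch_simple by blast
    have "eventually (\<lambda>m. \<phi> (real m) s om = norm (Y s om - Y a om) ^ 4) sequentially"
      unfolding eventually_sequentially
    proof (intro exI allI impI)
      fix m assume "N \<le> m"
      then have "b \<le> real m" using N by linarith
      then have "om \<in> AR (real m) a s" using b w by (fastforce simp: AR_def)
      then show "\<phi> (real m) s om = norm (Y s om - Y a om) ^ 4" by (simp add: \<phi>_def)
    qed
    then show "(\<lambda>m. \<phi> (real m) s om) \<longlonglongrightarrow> norm (Y s om - Y a om) ^ 4" by (rule tendsto_eventually)
  qed
  have Lm: "(\<lambda>om. norm (Y s om - Y a om) ^ 4) \<in> borel_measurable M" using Ym[of s] Ym[of a] s by measurable
  note FB = fatou_bound[OF \<phi>m[OF s(1)] Lm lim \<phi>i[OF s(1)] \<phi>b(1) bnd[OF s]]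
  show "integrable M (\<lambda>om. norm (Y s om - Y a om) ^ 4)" by (rule FB(1))
  show "(\<integral>om. norm (Y s om - Y a om) ^ 4 \<partial>M) \<le> cL * h ^ 4 * (\<integral>om. w (Y a om) ^ 4 \<partial>M)"
    using FB(2) unfolding m4_def .
qed

end

section \<open>Local weak error of the solution\<close>

text \<open>In each product the smaller variable is replaced by the larger one.\<close>

lemma young4:
  fixes a b :: real
  assumes "0 \<le> a" "0 \<le> b"
  shows "a^3 * b \<le> a^4 + b^4" "a^2 * b^2 \<le> a^4 + b^4" "a * b^3 \<le> a^4 + b^4"
proof -
  have "a^3 * b \<le> a^4 + b^4 \<and> a^2 * b^2 \<le> a^4 + b^4 \<and> a * b^3 \<le> a^4 + b^4"
  proof (cases "a \<le> b")
    case True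
    have "a^3 * b \<le> b^3 * b" "a^2 * b^2 \<le> b^2 * b^2" "a * b^3 \<le> b * b^3"
      using True assms by (intro mult_right_mono power_mono; simp)+
    then have "a^3 * b \<le> b^4" "a^2 * b^2 \<le> b^4" "a * b^3 \<le> b^4" by (simp_all add: eval_nat_numeral ac_simps)
    then show ?thesis by (intro conjI add_increasing) auto
  next
    case False
    have "a^3 * b \<le> a^3 * a" "a^2 * b^2 \<le> a^2 * a^2" "a * b^3 \<le> a * a^3"
      using False assms by (intro mult_left_mono power_mono; simp)+
    then have "a^3 * b \<le> a^4" "a^2 * b^2 \<le> a^4" "a * b^3 \<le> a^4" by (simp_all add: eval_nat_numeral ac_simps)
    then show ?thesis by (intro conjI add_increasing2) auto
  qed
  then show "a^3 * b \<le> a^4 + b^4" "a^2 * b^2 \<le> a^4 + b^4" "a * b^3 \<le> a^4 + b^4" by auto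
qed

lemma young4_three:
  fixes a b c :: real
  assumes "0 \<le> a" "0 \<le> b" "0 \<le> c"
  shows "a^2 * (b * c) \<le> a^4 + b^4 + c^4"
proof -
  define m where "m = max b c"
  have m: "0 \<le> m" "b \<le> m" "c \<le> m" using assms by (auto simp: m_def)
  have "a^2 * (b * c) \<le> a^2 * (m * m)" using assms m by (intro mult_left_mono mult_mono) auto
  also have "\<dots> \<le> a^4 + m^4" using young4(2)[OF assms(1) m(1)] by (simp add: power2_eq_square)
  also have "m^4 \<le> b^4 + c^4" unfolding m_def by (cases "b \<le> c") (auto simp: max_def)
  finally show ?thesis by simp
qed

text \<open>A variable that is at least one lifts monomials of degree three to degree four.\<close>

lemma young4_one:
  fixes a b :: real
  assumes "1 \<le> a" "0 \<le> b"
  shows "a * b^2 \<le> a^4 + b^4" "a^2 * b \<le> a^4 + b^4"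
proof -
  have "a * b^2 \<le> a^2 * b^2" "a^2 * b \<le> a^3 * b"
    using assms power_increasing[of 1 2 a] power_increasing[of 2 3 a] by (auto intro!: mult_right_mono)
  then show "a * b^2 \<le> a^4 + b^4" "a^2 * b \<le> a^4 + b^4" using young4[of a b] assms by auto
qed

lemma integral_bound:
  fixes f V :: "'a \<Rightarrow> real"
  assumes "f \<in> borel_measurable M" "integrable M V" "\<And>om. om \<in> space M \<Longrightarrow> \<bar>f om\<bar> \<le> V om"
  shows "integrable M f" "\<bar>\<integral>om. f om \<partial>M\<bar> \<le> (\<integral>om. V om \<partial>M)"
proof -
  show i: "integrable M f"
    by (rule Bochner_Integration.integrable_bound[OF assms(2,1)]) (use assms(3) in \<open>auto intro!: AE_I2 simp: order_trans[OF _ abs_ge_self]\<close>)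
  have "\<bar>\<integral>om. f om \<partial>M\<bar> \<le> (\<integral>om. \<bar>f om\<bar> \<partial>M)" by (rule integral_abs_bound)
  also have "\<dots> \<le> (\<integral>om. V om \<partial>M)" by (rule integral_mono) (use i assms in auto)
  finally show "\<bar>\<integral>om. f om \<partial>M\<bar> \<le> (\<integral>om. V om \<partial>M)" .
qed

section \<open>A single step of the solution from a time with finite fourth moment\<close>

locale step = sde g g1 g2 \<sigma> \<sigma>1 \<sigma>2 xs K \<mu> M F B h x0 Y
  for g :: "real^'n \<Rightarrow> real^'n" and g1 g2 \<sigma> \<sigma>1 \<sigma>2 xs K \<mu>
    and M :: "'w measure" and F and B :: "real \<Rightarrow> 'w \<Rightarrow> real^'n" and h x0 Y +
  fixes a :: real
  assumes a0: "0 \<le> a" and m4i: "integrable M (\<lambda>om. w (Y a om) ^ 4)"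
begin

definition W :: "'w \<Rightarrow> real" where "W om = w (Y a om)"
definition m4 :: real where "m4 = (\<integral>om. W om ^ 4 \<partial>M)"
text \<open>The increment in units of \<open>h\<close>. By \<open>local_moment\<close> its fourth
  moment is at most \<open>cL * m4\<close>, so powers of \<open>h\<close> can be counted separately
  from moments.\<close>

definition P :: "real \<Rightarrow> 'w \<Rightarrow> real" where "P s om = norm (Y s om - Y a om) / h"

lemma W_ge1 [simp]: "1 \<le> W om" and W_nn [simp]: "0 \<le> W om" by (auto simp: W_def)
lemma P_nn [simp]: "0 \<le> P s om" using h01 by (simp add: P_def)
lemma hP: "norm (Y s om - Y a om) = h * P s om" using h01 by (simp add: P_def)

lemma Wi: "integrable M (\<lambda>om. W om ^ 4)" using m4i by (simp add: W_def)
lemma m4_nn [simp]: "0 \<le> m4" by (simp add: m4_def)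

lemma Ya [measurable]: "Y a \<in> borel_measurable M" by (rule Y_meas[OF a0])
lemma W_meas [measurable]: "W \<in> borel_measurable M" unfolding W_def[abs_def] by measurable

lemma Pi: "a \<le> s \<Longrightarrow> s \<le> a + h \<Longrightarrow> integrable M (\<lambda>om. P s om ^ 4)"
  and PE: "a \<le> s \<Longrightarrow> s \<le> a + h \<Longrightarrow> (\<integral>om. P s om ^ 4 \<partial>M) \<le> cL * m4"
proof -
  assume s: "a \<le> s" "s \<le> a + h"
  note L = local_moment[OF a0 s m4i]
  show "integrable M (\<lambda>om. P s om ^ 4)" using L(1) by (simp add: P_def power_divide)
  have "(\<integral>om. P s om ^ 4 \<partial>M) = (\<integral>om. norm (Y s om - Y a om) ^ 4 \<partial>M) / h ^ 4" by (simp add: P_def power_divide)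
  also have "\<dots> \<le> (cL * h ^ 4 * m4) / h ^ 4" using L(2) h01 by (intro divide_right_mono) (auto simp: m4_def W_def)
  finally show "(\<integral>om. P s om ^ 4 \<partial>M) \<le> cL * m4" using h01 by simp
qed

text \<open>Reduces error estimates to pointwise bounds of degree four in \<open>W\<close> and
  \<open>P\<close>.\<close>

lemma WP_bound:
  assumes s: "a \<le> s" "s \<le> a + h" and f: "f \<in> borel_measurable M"
    and le: "\<And>om. \<bar>f om\<bar> \<le> c * (W om ^ 4 + P s om ^ 4)" and c: "0 \<le> c"
  shows "integrable M f" "\<bar>\<integral>om. f om \<partial>M\<bar> \<le> c * (1 + cL) * m4"
proof -
  have V: "integrable M (\<lambda>om. c * (W om ^ 4 + P s om ^ 4))" using Wi Pi[OF s] by auto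
  note B = integral_bound[OF f V le]
  show "integrable M f" by (rule B)
  have "(\<integral>om. c * (W om ^ 4 + P s om ^ 4) \<partial>M) = c * (m4 + (\<integral>om. P s om ^ 4 \<partial>M))"
    using Wi Pi[OF s] by (simp add: m4_def)
  also have "\<dots> \<le> c * (m4 + cL * m4)" using PE[OF s] c by (intro mult_left_mono add_left_mono) auto
  finally show "\<bar>\<integral>om. f om \<partial>M\<bar> \<le> c * (1 + cL) * m4" using B(2) by (simp add: algebra_simps)
qed

lemma w_le: "w (Y s om) \<le> W om + h * P s om"
  using w_add[of "Y a om" "Y s om - Y a om"] by (simp add: hP W_def)

lemma w_le1: "w (Y s om) \<le> W om + P s om"
  using w_le[of s om] mult_right_mono[of h 1 "P s om"] h01 by simp

lemma wi: "a \<le> s \<Longrightarrow> s \<le> a + h \<Longrightarrow> integrable M (\<lambda>om. w (Y s om) ^ 4)"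
  and wE: "a \<le> s \<Longrightarrow> s \<le> a + h \<Longrightarrow> (\<integral>om. w (Y s om) ^ 4 \<partial>M) \<le> 16 * m4"
proof -
  assume s: "a \<le> s" "s \<le> a + h"
  note [measurable] = Y_meas[OF order_trans[OF a0 s(1)]]
  note L = local_moment[OF a0 s m4i]
  have le: "w (Y s om) ^ 4 \<le> 8 * W om ^ 4 + 8 * norm (Y s om - Y a om) ^ 4" for om
    using pow4_w_add[of "Y a om" "Y s om - Y a om"] by (simp add: W_def)
  have i: "integrable M (\<lambda>om. 8 * W om ^ 4 + 8 * norm (Y s om - Y a om) ^ 4)" using Wi L(1) by auto
  have B: "integrable M (\<lambda>om. w (Y s om) ^ 4)" "\<bar>\<integral>om. w (Y s om) ^ 4 \<partial>M\<bar> \<le> (\<integral>om. 8 * W om ^ 4 + 8 * norm (Y s om - Y a om) ^ 4 \<partial>M)"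
    by (rule integral_bound[OF _ i]; use le in \<open>simp add: abs_of_nonneg\<close>)+
  show "integrable M (\<lambda>om. w (Y s om) ^ 4)" by (rule B)
  have "(\<integral>om. 8 * W om ^ 4 + 8 * norm (Y s om - Y a om) ^ 4 \<partial>M) = 8 * m4 + 8 * (\<integral>om. norm (Y s om - Y a om) ^ 4 \<partial>M)"
    using Wi L(1) by (simp add: m4_def)
  moreover have "(\<integral>om. norm (Y s om - Y a om) ^ 4 \<partial>M) \<le> cL * h ^ 4 * m4" using L(2) by (simp add: m4_def W_def)
  moreover have "cL * h ^ 4 * m4 \<le> 1 * m4" using sm by (intro mult_right_mono) (auto simp: small2_def cL_def)
  ultimately show "(\<integral>om. w (Y s om) ^ 4 \<partial>M) \<le> 16 * m4" using B(2) by linarith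
qed

text \<open>Replacing the modified drift at time \<open>s\<close> by \<open>- g\<close> at the start
  of the step costs one order: the gradient moves by at most \<open>K * h * P\<close>, and the
  correction has a factor \<open>h\<close>.\<close>

lemma drift_diff: "norm (bb h (Y s om) + g (Y a om)) \<le> 2 * K^2 * h * (W om + P s om)"
proof -
  have K2: "K \<le> K^2" using K1 by (simp add: power2_eq_square)
  have 1: "norm (g (Y s om) - g (Y a om)) \<le> K * (h * P s om)"
    using smooth3D(8)[OF gs, of "Y a om" "Y s om - Y a om"] by (simp add: hP)
  also have "\<dots> \<le> K^2 * (h * P s om)" using K2 h01 by (intro mult_right_mono) auto
  finally have 1: "norm (g (Y s om) - g (Y a om)) \<le> K^2 * (h * P s om)" .
  have "norm (g1 (Y s om) (g (Y s om))) \<le> K * (K * w (Y s om))"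
    using smooth3D(6)[OF gs] g_growth(2) K0 by (meson mult_left_mono order_trans)
  also have "\<dots> \<le> K * (K * (W om + P s om))" using w_le1 K0 by (intro mult_left_mono) auto
  finally have "h / 2 * norm (g1 (Y s om) (g (Y s om))) \<le> h * (K * (K * (W om + P s om)))"
    using h01 by (intro mult_mono) auto
  then have 2: "norm ((h / 2) *\<^sub>R g1 (Y s om) (g (Y s om))) \<le> K^2 * (h * W om) + K^2 * (h * P s om)"
    using h01 by (simp add: power2_eq_square algebra_simps)
  have "bb h (Y s om) + g (Y a om) = - ((g (Y s om) - g (Y a om)) + (h / 2) *\<^sub>R g1 (Y s om) (g (Y s om)))"
    by (simp add: bb_def)
  then have "norm (bb h (Y s om) + g (Y a om)) \<le> norm (g (Y s om) - g (Y a om)) + norm ((h / 2) *\<^sub>R g1 (Y s om) (g (Y s om)))"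
    by (metis norm_minus_cancel norm_triangle_ineq)
  moreover have "0 \<le> K^2 * (h * W om)" using h01 by simp
  moreover have "2 * K^2 * h * (W om + P s om) = 2 * (K^2 * (h * W om)) + 2 * (K^2 * (h * P s om))" by (simp add: algebra_simps)
  ultimately show ?thesis using 1 2 by linarith
qed

text \<open>Fourth moments are finite throughout the step, so the localising factors are now
  constantly one.\<close>

abbreviation "Dn b n \<equiv> DD a b n (\<lambda>_ _. 1)"
abbreviation "Sn b n \<equiv> SS a b n (\<lambda>_ _. 1)"

lemma riemann_moments:
  assumes b: "a < b" "b \<le> a + h" and n: "0 < n"
  shows "Dn b n \<in> borel_measurable M" "Sn b n \<in> borel_measurable M"
    "integrable M (\<lambda>om. norm (Dn b n om) ^ 4)" "integrable M (\<lambda>om. norm (Sn b n om) ^ 4)"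
    "(\<integral>om. norm (Sn b n om) ^ 4 \<partial>M) \<le> cS * h ^ 4 * m4"
    "integrable M (\<lambda>om. norm (Dn b n om + Sn b n om) ^ 4)" "(\<integral>om. norm (Dn b n om + Sn b n om) ^ 4 \<partial>M) \<le> cL * h ^ 4 * m4"
    "adapted n (pt a b n) (\<lambda>j. G (pt a b n j))"
    "\<And>j. j < n \<Longrightarrow> integrable M (\<lambda>om. norm (G (pt a b n j) om) ^ 4)"
proof -
  have pb: "a \<le> pt a b n j" "pt a b n j \<le> a + h" if "j < n" for j using pt_bounds[of a b j n] b that by auto
  have i: "integrable M (\<lambda>om. 1 * w (Y (pt a b n j) om) ^ 4)" "(\<integral>om. 1 * w (Y (pt a b n j) om) ^ 4 \<partial>M) \<le> 16 * m4" if "j < n" for j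
    using wi[OF pb[OF that]] wE[OF pb[OF that]] by auto
  note R = riemann_pow4[of a b n "\<lambda>_ _. 1" "16 * m4", OF a0 b n _ _ i]
  show m: "Dn b n \<in> borel_measurable M" "Sn b n \<in> borel_measurable M" by (rule R; simp)+
  show i4: "integrable M (\<lambda>om. norm (Dn b n om) ^ 4)" "integrable M (\<lambda>om. norm (Sn b n om) ^ 4)" by (rule R; simp)+
  have E4: "(\<integral>om. norm (Dn b n om) ^ 4 \<partial>M) \<le> 16 * K^8 * h^4 * (16 * m4)"
    "(\<integral>om. norm (Sn b n om) ^ 4 \<partial>M) \<le> bdg CARD('n) * K^4 * h^4 * (16 * m4)" by (rule R; simp)+
  show "(\<integral>om. norm (Sn b n om) ^ 4 \<partial>M) \<le> cS * h ^ 4 * m4" using E4(2) by (simp add: cS_def ac_simps)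
  have I: "integrable M (\<lambda>om. 8 * norm (Dn b n om) ^ 4 + 8 * norm (Sn b n om) ^ 4)" using i4 by auto
  have B: "integrable M (\<lambda>om. norm (Dn b n om + Sn b n om) ^ 4)"
    "\<bar>\<integral>om. norm (Dn b n om + Sn b n om) ^ 4 \<partial>M\<bar> \<le> (\<integral>om. 8 * norm (Dn b n om) ^ 4 + 8 * norm (Sn b n om) ^ 4 \<partial>M)"
    by (rule integral_bound[OF _ I]; use m in \<open>simp add: norm_add_pow4_le\<close>)+
  show "integrable M (\<lambda>om. norm (Dn b n om + Sn b n om) ^ 4)" by (rule B)
  have "(\<integral>om. 8 * norm (Dn b n om) ^ 4 + 8 * norm (Sn b n om) ^ 4 \<partial>M) = 8 * (\<integral>om. norm (Dn b n om) ^ 4 \<partial>M) + 8 * (\<integral>om. norm (Sn b n om) ^ 4 \<partial>M)"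
    using i4 by simp
  also have "\<dots> \<le> 8 * (16 * K^8 * h^4 * (16 * m4)) + 8 * (bdg CARD('n) * K^4 * h^4 * (16 * m4))" using E4 by linarith
  also have "\<dots> = cL * h ^ 4 * m4" by (simp add: cL_def cX_def algebra_simps)
  finally show "(\<integral>om. norm (Dn b n om + Sn b n om) ^ 4 \<partial>M) \<le> cL * h ^ 4 * m4" using B(2) by linarith
  have "adapted n (pt a b n) (\<lambda>j om. 1 *\<^sub>R G (pt a b n j) om)" by (rule R; simp)
  then show "adapted n (pt a b n) (\<lambda>j. G (pt a b n j))" by simp
  have "integrable M (\<lambda>om. norm (1 *\<^sub>R G (pt a b n j) om) ^ 4)" if "j < n" for j using that by (intro R; simp)
  then show "\<And>j. j < n \<Longrightarrow> integrable M (\<lambda>om. norm (G (pt a b n j) om) ^ 4)" by simp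
qed

text \<open>Where \<open>x\<close> is below \<open>R * w\<close>, everything is controlled by
  \<open>w^4\<close>. Above, a power of \<open>w\<close> can be traded for \<open>x / R\<close>,
  which makes the coefficient of \<open>x^4\<close> small for large \<open>R\<close>. This is the
  domination that \<open>dominated_convergence_eps\<close> asks for.\<close>

lemma growth_split:
  fixes w x R :: real
  assumes "0 \<le> w" "0 \<le> x" "0 < R"
  shows "w^2 * x * (w + x) \<le> R * (1 + R) * w^4 + 2 / R^2 * (1 + 1 / R) * x^4"
proof (cases "x \<le> R * w")
  case True
  have "w^2 * x * (w + x) \<le> w^2 * (R * w) * (w + R * w)" using assms True by (intro mult_mono) auto
  also have "\<dots> = R * (1 + R) * w^4" by (simp add: power2_eq_square power4_eq_xxxx algebra_simps)
  also have "\<dots> \<le> R * (1 + R) * w^4 + 2 / R^2 * (1 + 1 / R) * x^4" using assms by simp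
  finally show ?thesis .
next
  case False
  then have wx: "w \<le> x / R" using assms by (simp add: field_simps)
  have "w^2 * x * (w + x) \<le> (x / R)^2 * x * (x / R + x)" using assms wx by (intro mult_mono power_mono) auto
  also have "\<dots> = 1 / R^2 * (1 + 1 / R) * x^4" by (simp add: power2_eq_square power4_eq_xxxx algebra_simps)
  also have "\<dots> \<le> 2 / R^2 * (1 + 1 / R) * x^4" using assms by (intro mult_right_mono divide_right_mono) auto
  also have "\<dots> \<le> R * (1 + R) * w^4 + 2 / R^2 * (1 + 1 / R) * x^4" using assms by simp
  finally show ?thesis .
qed

text \<open>Carries expectations of test functions from the Riemann sums over to the increment of
  the solution. The allowed growth is weaker than the fourth power of the increment, so uniformly
  bounded fourth moments give uniform integrability.\<close>

lemma riemann_limit: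
  fixes f :: "real^'n \<Rightarrow> real^'n \<Rightarrow> real"
  assumes b: "a < b" "b \<le> a + h"
    and fm: "\<And>V. V \<in> borel_measurable M \<Longrightarrow> (\<lambda>om. f (Y a om) (V om)) \<in> borel_measurable M"
    and fc: "\<And>y. continuous_on UNIV (f y)"
    and fb: "\<And>y x. \<bar>f y x\<bar> \<le> C * ((w y)^2 * norm x * (w y + norm x))" and C: "0 \<le> C"
    and E: "\<And>n. 0 < n \<Longrightarrow> \<bar>(\<integral>om. f (Y a om) (Dn b n om + Sn b n om) \<partial>M) - v n\<bar> \<le> c"
    and v: "(\<lambda>n. v (Suc n)) \<longlonglongrightarrow> l"
  shows "integrable M (\<lambda>om. f (Y a om) (Y b om - Y a om))" "\<bar>(\<integral>om. f (Y a om) (Y b om - Y a om) \<partial>M) - l\<bar> \<le> c"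
proof -
  obtain r where r: "strict_mono r" "AE om in M. (\<lambda>m. Dn b (Suc (r m)) om + Sn b (Suc (r m)) om) \<longlonglongrightarrow> Y b om - Y a om"
    by (rule riemann_ae[OF a0 less_imp_le[OF b(1)]])
  note R = riemann_moments[OF b zero_less_Suc]
  have Yb: "Y b \<in> borel_measurable M" using a0 b by (intro Y_meas) auto
  define T where "T = (\<lambda>m om. f (Y a om) (Dn b (Suc (r m)) om + Sn b (Suc (r m)) om))"
  have Tm: "T m \<in> borel_measurable M" for m unfolding T_def by (rule fm) (intro borel_measurable_add R)
  have Lm: "(\<lambda>om. f (Y a om) (Y b om - Y a om)) \<in> borel_measurable M" by (rule fm) (intro borel_measurable_diff Yb Ya)
  have lim: "AE om in M. (\<lambda>m. T m om) \<longlonglongrightarrow> f (Y a om) (Y b om - Y a om)"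
    using r(2)
  proof eventually_elim
    case (elim om)
    show ?case unfolding T_def by (rule continuous_on_tendsto_compose[OF fc elim]) auto
  qed
  have dom: "\<exists>V. integrable M V \<and> (\<forall>m om. om \<in> space M \<longrightarrow> \<bar>T m om\<bar> \<le> V om + e * norm (Dn b (Suc (r m)) om + Sn b (Suc (r m)) om) ^ 4)"
    if e: "0 < e" for e
  proof -
    \<comment> \<open>Large enough for the coefficient \<open>C * (2 / R^2 * (1 + 1 / R))\<close> of
      the fourth power to be at most \<open>e\<close>.\<close>
    define R where "R = 1 + 4 * C / e"
    have R: "1 \<le> R" "4 * C \<le> e * R" using e C by (auto simp: R_def field_simps)
    have "R \<le> R^2" using R(1) power_increasing[of 1 2 R] by simp
    then have "e * R \<le> e * R^2" using e by (intro mult_left_mono) auto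
    then have "4 * C \<le> e * R^2" using R(2) by linarith
    then have "4 * C / R^2 \<le> e" using R by (simp add: pos_divide_le_eq)
    then have "C * (2 / R^2 * 2) \<le> e" by (simp add: mult.commute)
    moreover have "C * (2 / R^2 * (1 + 1 / R)) \<le> C * (2 / R^2 * 2)" using R C by (intro mult_left_mono) auto
    ultimately have Ce: "C * (2 / R^2 * (1 + 1 / R)) \<le> e" by linarith
    have "\<bar>T m om\<bar> \<le> C * (R * (1 + R)) * W om ^ 4 + e * norm (Dn b (Suc (r m)) om + Sn b (Suc (r m)) om) ^ 4" (is "_ \<le> _ + e * ?x ^ 4") for m om
    proof -
      have "\<bar>T m om\<bar> \<le> C * ((W om)^2 * ?x * (W om + ?x))" unfolding T_def W_def by (rule fb)
      also have "\<dots> \<le> C * (R * (1 + R) * W om ^ 4 + 2 / R^2 * (1 + 1 / R) * ?x ^ 4)"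
        using R C by (intro mult_left_mono growth_split) auto
      also have "\<dots> = C * (R * (1 + R)) * W om ^ 4 + C * (2 / R^2 * (1 + 1 / R)) * ?x ^ 4" by (simp add: algebra_simps)
      also have "\<dots> \<le> C * (R * (1 + R)) * W om ^ 4 + e * ?x ^ 4" using Ce by (intro add_left_mono mult_right_mono) auto
      finally show ?thesis .
    qed
    then show ?thesis using Wi by (intro exI[of _ "\<lambda>om. C * (R * (1 + R)) * W om ^ 4"]) auto
  qed
  note DC = dominated_convergence_eps[OF Tm Lm lim dom R(6) _ R(7), simplified]
  show "integrable M (\<lambda>om. f (Y a om) (Y b om - Y a om))" by (rule DC(1))
  have "(\<lambda>m. v (Suc (r m))) \<longlonglongrightarrow> l" using LIMSEQ_subseq_LIMSEQ[OF v r(1)] by (simp add: o_def)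
  from tendsto_rabs[OF tendsto_diff[OF DC(2) this]]
  show "\<bar>(\<integral>om. f (Y a om) (Y b om - Y a om) \<partial>M) - l\<bar> \<le> c"
    by (rule LIMSEQ_le_const2) (use E in \<open>auto simp: T_def\<close>)
qed

end

lemma linear_inner_axis:
  fixes l :: "real^'n \<Rightarrow> real"
  assumes "linear l"
  shows "l x = (\<chi> i. l (axis i 1)) \<bullet> x"
proof -
  have "l x = l (\<Sum>i\<in>UNIV. x $ i *\<^sub>R axis i 1)" using basis_expansion[of x] by (simp add: scalar_mult_eq_scaleR)
  then show ?thesis by (simp add: linear_sum[OF assms] linear_scale[OF assms] inner_vec_def mult.commute)
qed

section \<open>First order terms: linear test functions of the increment\<close>

context step
begin

text \<open>The functional is the inner product with a vector known at time \<open>a\<close>, so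
  \<open>mart_mean\<close> applies to the noise sum.\<close>

lemma linear_noise:
  fixes l :: "real^'n \<Rightarrow> real^'n \<Rightarrow> real"
  assumes b: "a < b" "b \<le> a + h" and n: "0 < n"
    and l: "\<And>y. linear (l y)" "\<And>k. (\<lambda>y. l y k) \<in> borel_measurable borel" "\<And>y k. \<bar>l y k\<bar> \<le> A * w y ^ 3 * norm k" and A: "0 \<le> A"
  shows "integrable M (\<lambda>om. l (Y a om) (Sn b n om))" "(\<integral>om. l (Y a om) (Sn b n om) \<partial>M) = 0"
proof -
  note R = riemann_moments[OF b n]
  have g: "grid n (pt a b n)" by (rule pt_grid) (use a0 b in auto)
  define Z where "Z = (\<lambda>om. \<chi> i. l (Y a om) (axis i 1))"
  have Zl: "l (Y a om) x = Z om \<bullet> x" for om x unfolding Z_def by (rule linear_inner_axis[OF l(1)])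
  have Zm: "Z \<in> borel_measurable (F (pt a b n 0))"
    unfolding Z_def pt_0 by (rule measurable_vecI) (simp add: measurable_compose[OF Y_ad[OF a0] l(2)])
  have ZM: "Z \<in> borel_measurable M" using F_meas[OF Zm] .
  have Zn: "norm (Z om) \<le> real CARD('n) * A * W om ^ 3" for om
  proof -
    have "norm (Z om) \<le> (\<Sum>i\<in>UNIV. \<bar>Z om $ i\<bar>)" by (rule norm_le_l1_cart)
    also have "\<dots> \<le> (\<Sum>i\<in>(UNIV::'n set). A * W om ^ 3)"
      using l(3)[of "Y a om" "axis _ 1"] by (intro sum_mono) (simp add: Z_def W_def)
    finally show ?thesis by simp
  qed
  have i: "integrable M (\<lambda>om. norm (G (pt a b n j) om) * norm (Z om))" if j: "j < n" for j
  proof (rule integral_bound(1))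
    have "G (pt a b n j) \<in> borel_measurable (F (pt a b n j))" using R(8) j by (simp add: adapted_def)
    from F_meas[OF this] show "(\<lambda>om. norm (G (pt a b n j) om) * norm (Z om)) \<in> borel_measurable M" using ZM by measurable
    show "integrable M (\<lambda>om. real CARD('n) * A * (W om ^ 4 + norm (G (pt a b n j) om) ^ 4))" using Wi R(9)[OF j] by auto
    fix om
    have "norm (G (pt a b n j) om) * norm (Z om) \<le> norm (G (pt a b n j) om) * (real CARD('n) * A * W om ^ 3)"
      using Zn by (intro mult_left_mono) auto
    also have "\<dots> = real CARD('n) * A * (W om ^ 3 * norm (G (pt a b n j) om))" by simp
    also have "\<dots> \<le> real CARD('n) * A * (W om ^ 4 + norm (G (pt a b n j) om) ^ 4)"
      using A by (intro mult_left_mono young4) auto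
    finally show "\<bar>norm (G (pt a b n j) om) * norm (Z om)\<bar> \<le> real CARD('n) * A * (W om ^ 4 + norm (G (pt a b n j) om) ^ 4)" by simp
  qed
  note MM = mart_mean[OF g R(8) Zm i]
  show "integrable M (\<lambda>om. l (Y a om) (Sn b n om))" "(\<integral>om. l (Y a om) (Sn b n om) \<partial>M) = 0"
    unfolding Zl SS_def using MM by simp_all
qed

text \<open>Plays the role of the Ito formula for linear functionals: the noise is centred, so only
  the mean drift contributes. If that is known at each time up to \<open>c\<close>, the mean
  increment is known up to \<open>(b - a) * c\<close>.\<close>

lemma weak_linear:
  fixes l :: "real^'n \<Rightarrow> real^'n \<Rightarrow> real"
  assumes b: "a < b" "b \<le> a + h"
    and l: "\<And>y. linear (l y)" "\<And>k. (\<lambda>y. l y k) \<in> borel_measurable borel" "\<And>y k. \<bar>l y k\<bar> \<le> A * w y ^ 3 * norm k" and A: "0 \<le> A"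
    and \<beta>: "\<And>s. a \<le> s \<Longrightarrow> s \<le> b \<Longrightarrow> \<bar>(\<integral>om. l (Y a om) (bb h (Y s om)) \<partial>M) - \<beta> s\<bar> \<le> c"
    and lim: "(\<lambda>n. \<Sum>j<Suc n. (b - a) / real (Suc n) * \<beta> (pt a b (Suc n) j)) \<longlonglongrightarrow> L"
  shows "integrable M (\<lambda>om. l (Y a om) (Y b om - Y a om))" "\<bar>(\<integral>om. l (Y a om) (Y b om - Y a om) \<partial>M) - L\<bar> \<le> (b - a) * c"
proof -
  have lm: "(\<lambda>om. l (Y a om) (V om)) \<in> borel_measurable M" if "V \<in> borel_measurable M" for V
    by (rule linear_measurable[OF l(1,2) Ya that])
  have bi: "integrable M (\<lambda>om. l (Y a om) (bb h (Y s om)))" if s: "a \<le> s" "s \<le> a + h" for s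
  proof (rule integral_bound(1))
    have "Y s \<in> borel_measurable M" using s a0 by (intro Y_meas) auto
    then show "(\<lambda>om. l (Y a om) (bb h (Y s om))) \<in> borel_measurable M" by (intro lm measurable_compose[OF _ bb_meas])
    show "integrable M (\<lambda>om. 2 * K^2 * A * (W om ^ 4 + w (Y s om) ^ 4))" using Wi wi[OF s] by auto
    fix om
    have "\<bar>l (Y a om) (bb h (Y s om))\<bar> \<le> A * W om ^ 3 * norm (bb h (Y s om))" unfolding W_def by (rule l(3))
    also have "\<dots> \<le> A * W om ^ 3 * (2 * K^2 * w (Y s om))" using A h01 by (intro mult_left_mono bb_bound) auto
    also have "\<dots> = 2 * K^2 * A * (W om ^ 3 * w (Y s om))" by simp
    also have "\<dots> \<le> 2 * K^2 * A * (W om ^ 4 + w (Y s om) ^ 4)" using A by (intro mult_left_mono young4) auto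
    finally show "\<bar>l (Y a om) (bb h (Y s om))\<bar> \<le> 2 * K^2 * A * (W om ^ 4 + w (Y s om) ^ 4)" .
  qed
  have fb: "\<bar>l y x\<bar> \<le> A * ((w y)^2 * norm x * (w y + norm x))" for y x
  proof -
    have "\<bar>l y x\<bar> \<le> A * w y ^ 3 * norm x" by (rule l)
    also have "\<dots> = A * ((w y)^2 * norm x * w y)" by (simp add: power2_eq_square power3_eq_cube ac_simps)
    also have "\<dots> \<le> A * ((w y)^2 * norm x * (w y + norm x))" using A by (intro mult_left_mono) auto
    finally show ?thesis .
  qed
  have E: "\<bar>(\<integral>om. l (Y a om) (Dn b n om + Sn b n om) \<partial>M) - (\<Sum>j<n. (b - a) / real n * \<beta> (pt a b n j))\<bar> \<le> (b - a) * c" if n: "0 < n" for n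
  proof -
    have s: "a \<le> pt a b n j" "pt a b n j \<le> b" "pt a b n j \<le> a + h" if "j < n" for j
      using pt_bounds[of a b j n] that b by auto
    note N = linear_noise[OF b n l A]
    have D: "l (Y a om) (Dn b n om) = (\<Sum>j<n. (b - a) / real n * l (Y a om) (bb h (Y (pt a b n j) om)))" for om
      by (simp add: DD_def linear_sum[OF l(1)] linear_scale[OF l(1)])
    have Di: "integrable M (\<lambda>om. l (Y a om) (Dn b n om))" unfolding D using bi s by auto
    have "(\<integral>om. l (Y a om) (Dn b n om + Sn b n om) \<partial>M) = (\<integral>om. l (Y a om) (Dn b n om) \<partial>M)"
      using N Di by (simp add: linear_add[OF l(1)])
    also have "\<dots> = (\<Sum>j<n. (b - a) / real n * (\<integral>om. l (Y a om) (bb h (Y (pt a b n j) om)) \<partial>M))"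
      unfolding D using bi s by (subst Bochner_Integration.integral_sum) auto
    finally have "\<bar>(\<integral>om. l (Y a om) (Dn b n om + Sn b n om) \<partial>M) - (\<Sum>j<n. (b - a) / real n * \<beta> (pt a b n j))\<bar> =
      \<bar>\<Sum>j<n. (b - a) / real n * ((\<integral>om. l (Y a om) (bb h (Y (pt a b n j) om)) \<partial>M) - \<beta> (pt a b n j))\<bar>"
      by (simp add: sum_subtractf[symmetric] right_diff_distrib)
    also have "\<dots> \<le> (\<Sum>j<n. (b - a) / real n * c)"
    proof (rule order_trans[OF sum_abs sum_mono])
      fix j assume "j \<in> {..<n}"
      then show "\<bar>(b - a) / real n * ((\<integral>om. l (Y a om) (bb h (Y (pt a b n j) om)) \<partial>M) - \<beta> (pt a b n j))\<bar> \<le> (b - a) / real n * c"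
        unfolding abs_mult using \<beta>[OF s(1,2)] b by (intro mult_mono) auto
    qed
    also have "\<dots> = (b - a) * c" using n by simp
    finally show ?thesis .
  qed
  note RL = riemann_limit[where f = l, OF b lm linear_continuous_on fb A E lim]
  have bl: "bounded_linear (l y)" for y using l(1) by (simp add: linear_linear)
  show "integrable M (\<lambda>om. l (Y a om) (Y b om - Y a om))" "\<bar>(\<integral>om. l (Y a om) (Y b om - Y a om) \<partial>M) - L\<bar> \<le> (b - a) * c"
    by (rule RL; simp add: bl)+
qed

text \<open>The drift is frozen at the start of the step, with an error of order \<open>h\<close>.
  The growth \<open>w^3\<close> admits the derivative of \<open>w^4\<close> as a functional, for
  \<open>moment_step\<close>.\<close>

lemma weak_first:
  fixes l :: "real^'n \<Rightarrow> real^'n \<Rightarrow> real"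
  assumes b: "a \<le> b" "b \<le> a + h"
    and l: "\<And>y. linear (l y)" "\<And>k. (\<lambda>y. l y k) \<in> borel_measurable borel" "\<And>y k. \<bar>l y k\<bar> \<le> A * w y ^ 3 * norm k" and A: "0 \<le> A"
  shows "integrable M (\<lambda>om. l (Y a om) (g (Y a om)))" "integrable M (\<lambda>om. l (Y a om) (Y b om - Y a om))"
    "\<bar>(\<integral>om. l (Y a om) (Y b om - Y a om) \<partial>M) + (b - a) * (\<integral>om. l (Y a om) (g (Y a om)) \<partial>M)\<bar> \<le> 4 * K^2 * (1 + cL) * A * h^2 * m4"
    (is "\<bar>?D + (b - a) * ?E\<bar> \<le> ?r")
proof -
  note [measurable] = smooth3D(1)[OF gs] bb_meas
  have lm: "(\<lambda>om. l (Y a om) (V om)) \<in> borel_measurable M" if "V \<in> borel_measurable M" for V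
    by (rule linear_measurable[OF l(1,2) Ya that])
  show gi: "integrable M (\<lambda>om. l (Y a om) (g (Y a om)))"
  proof (rule integral_bound(1))
    show "(\<lambda>om. l (Y a om) (g (Y a om))) \<in> borel_measurable M" by (rule lm) measurable
    show "integrable M (\<lambda>om. A * K * W om ^ 4)" using Wi by auto
    fix om
    have "\<bar>l (Y a om) (g (Y a om))\<bar> \<le> A * W om ^ 3 * norm (g (Y a om))" unfolding W_def by (rule l(3))
    also have "\<dots> \<le> A * W om ^ 3 * (K * W om)" using A by (intro mult_left_mono) (auto simp: W_def g_growth)
    finally show "\<bar>l (Y a om) (g (Y a om))\<bar> \<le> A * K * W om ^ 4" by (simp add: eval_nat_numeral ac_simps)
  qed
  define c where "c = 4 * K^2 * (1 + cL) * A * h * m4"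
  have c0: "0 \<le> c" using A cL0 h01 by (simp add: c_def)
  have \<beta>: "\<bar>(\<integral>om. l (Y a om) (bb h (Y s om)) \<partial>M) - (- ?E)\<bar> \<le> c" if s: "a \<le> s" "s \<le> a + h" for s
  proof -
    have [measurable]: "Y s \<in> borel_measurable M" using s a0 by (intro Y_meas) auto
    have le: "\<bar>l (Y a om) (bb h (Y s om)) + l (Y a om) (g (Y a om))\<bar> \<le> 4 * K^2 * A * h * (W om ^ 4 + P s om ^ 4)" for om
    proof -
      have "\<bar>l (Y a om) (bb h (Y s om)) + l (Y a om) (g (Y a om))\<bar> \<le> A * W om ^ 3 * norm (bb h (Y s om) + g (Y a om))"
        unfolding W_def linear_add[OF l(1), symmetric] by (rule l(3))
      also have "\<dots> \<le> A * W om ^ 3 * (2 * K^2 * h * (W om + P s om))" using A by (intro mult_left_mono drift_diff) auto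
      also have "\<dots> = 2 * K^2 * A * h * (W om ^ 4 + W om ^ 3 * P s om)" by (simp add: eval_nat_numeral algebra_simps)
      also have "\<dots> \<le> 2 * K^2 * A * h * (W om ^ 4 + (W om ^ 4 + P s om ^ 4))"
        using A h01 by (intro mult_left_mono add_left_mono young4) auto
      also have "\<dots> \<le> 2 * K^2 * A * h * (2 * (W om ^ 4 + P s om ^ 4))" using A h01 by (intro mult_left_mono) auto
      finally show ?thesis by (simp add: algebra_simps)
    qed
    have m: "(\<lambda>om. l (Y a om) (bb h (Y s om)) + l (Y a om) (g (Y a om))) \<in> borel_measurable M"
      by (intro borel_measurable_add lm) measurable
    note B = WP_bound[OF s m le]
    have "integrable M (\<lambda>om. (l (Y a om) (bb h (Y s om)) + l (Y a om) (g (Y a om))) - l (Y a om) (g (Y a om)))"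
      by (intro Bochner_Integration.integrable_diff B(1) gi) (use A h01 in auto)
    then have bi: "integrable M (\<lambda>om. l (Y a om) (bb h (Y s om)))" by simp
    show ?thesis using B(2) bi gi A h01 by (simp add: c_def ac_simps)
  qed
  show "integrable M (\<lambda>om. l (Y a om) (Y b om - Y a om))"
    and "\<bar>?D + (b - a) * ?E\<bar> \<le> ?r"
  proof -
    have "integrable M (\<lambda>om. l (Y a om) (Y b om - Y a om)) \<and>
      \<bar>?D - (b - a) * (- ?E)\<bar> \<le> (b - a) * c"
    proof (cases "a = b")
      case True
      then show ?thesis by (simp add: linear_0[OF l(1)])
    next
      case False
      then have ab: "a < b" using b by simp
      have lim: "(\<lambda>n. \<Sum>j<Suc n. (b - a) / real (Suc n) * (- ?E)) \<longlonglongrightarrow> (b - a) * (- ?E)"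
        unfolding sum_constant card_lessThan by simp
      show ?thesis
        by (rule conjI; rule weak_linear[OF ab b(2) l A _ lim, of c]; rule \<beta>; use b in auto)
    qed
    moreover have "(b - a) * c \<le> h * c" using b c0 by (intro mult_right_mono) auto
    moreover have "h * c = ?r" by (simp add: c_def power2_eq_square)
    ultimately show "integrable M (\<lambda>om. l (Y a om) (Y b om - Y a om))"
      and "\<bar>?D + (b - a) * ?E\<bar> \<le> ?r"
      by auto
  qed
qed

end

text \<open>Left endpoint values of an affine function of time whose average over the step is
  \<open>\<alpha>\<close>; the discretisation error is of order \<open>1 / n\<close>.\<close>

lemma midpoint_sum:
  fixes h \<alpha> e :: real
  assumes "0 < n"
  shows "(\<Sum>j<n. h / real n * (\<alpha> - (h / 2 - h * (real j / real n)) * e)) = h * \<alpha> - (h^2 * e / 2) * inverse (real n)"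
proof -
  have s: "2 * (\<Sum>j<n. real j) = real n * (real n - 1)" for n by (induction n) (auto simp: algebra_simps)
  have "(\<Sum>j<n. h / real n * (\<alpha> - (h / 2 - h * (real j / real n)) * e)) =
    (\<Sum>j<n. h / real n * (\<alpha> - h / 2 * e)) + (\<Sum>j<n. (h / real n)^2 * e * real j)"
    unfolding sum.distrib[symmetric] by (intro sum.cong) (auto simp: power2_eq_square algebra_simps)
  also have "\<dots> = h * (\<alpha> - h / 2 * e) + (h / real n)^2 * e * (real n * (real n - 1) / 2)"
    using assms s[of n] by (simp add: sum_distrib_left[symmetric])
  also have "\<dots> = h * \<alpha> - (h^2 * e / 2) * inverse (real n)" using assms by (simp add: power2_eq_square field_simps)
  finally show ?thesis .
qed

context step
begin

text \<open>The modified drift gains its extra order here. At elapsed time \<open>r\<close> the mean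
  drift is \<open>- g - (h / 2 - r) g1 g\<close> up to order \<open>h^2\<close>: the part with
  \<open>h / 2\<close> is the correction, the part with \<open>r\<close> results from
  \<open>weak_first\<close> applied to \<open>g1\<close> of the increment. The bracket averages to
  zero over the step.\<close>

lemma weak_second:
  fixes p :: "real^'n \<Rightarrow> real^'n \<Rightarrow> real"
  assumes p: "\<And>y. linear (p y)" "\<And>k. (\<lambda>y. p y k) \<in> borel_measurable borel" "\<And>y k. \<bar>p y k\<bar> \<le> A * w y * norm k" and A: "0 \<le> A"
  shows "integrable M (\<lambda>om. p (Y a om) (g (Y a om)))" "integrable M (\<lambda>om. p (Y a om) (Y (a + h) om - Y a om))"
    "\<bar>(\<integral>om. p (Y a om) (Y (a + h) om - Y a om) \<partial>M) + h * (\<integral>om. p (Y a om) (g (Y a om)) \<partial>M)\<bar> \<le> c2 * A * h^3 * m4"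
    (is "\<bar>?D + h * ?E\<bar> \<le> ?r")
proof -
  note [measurable] = smooth3D(1)[OF gs] bb_meas
  have pm: "(\<lambda>om. p (Y a om) (V om)) \<in> borel_measurable M" if "V \<in> borel_measurable M" for V
    by (rule linear_measurable[OF p(1,2) Ya that])
  have p3: "\<bar>p y k\<bar> \<le> A * w y ^ 3 * norm k" for y k
  proof -
    have "A * w y * norm k \<le> A * w y ^ 3 * norm k"
      using A power_increasing[of 1 3 "w y"] by (intro mult_right_mono mult_left_mono) auto
    then show ?thesis using p(3)[of y k] by linarith
  qed
  have h0: "a \<le> a + h" "a < a + h" "0 \<le> h" using h01 by auto
  note F1 = weak_first[OF h0(1) order_refl p(1,2) p3 A]
  show pg: "integrable M (\<lambda>om. p (Y a om) (g (Y a om)))" and "integrable M (\<lambda>om. p (Y a om) (Y (a + h) om - Y a om))" by (rule F1)+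
  \<comment> \<open>The linearised change of the gradient is again a linear functional of the
    increment, to which the first order result applies.\<close>
  define q where "q = (\<lambda>y k. p y (g1 y k))"
  have q1: "linear (q y)" for y unfolding q_def using linear_compose[OF smooth3D(4)[OF gs] p(1)] by (simp add: o_def)
  have q2: "(\<lambda>y. q y k) \<in> borel_measurable borel" for k
    unfolding q_def by (rule linear_measurable[OF p(1,2) measurable_ident_sets[OF refl] smooth3D(2)[OF gs]])
  have q3: "\<bar>q y k\<bar> \<le> A * K * w y ^ 3 * norm k" for y k
  proof -
    have "\<bar>q y k\<bar> \<le> A * w y ^ 3 * norm (g1 y k)" unfolding q_def by (rule p3)
    also have "\<dots> \<le> A * w y ^ 3 * (K * norm k)" using A by (intro mult_left_mono smooth3D(6)[OF gs]) auto
    finally show ?thesis by (simp add: ac_simps)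
  qed
  have AK: "0 \<le> A * K" using A K0 by simp
  have g1gm [measurable]: "(\<lambda>x. g1 x (g x)) \<in> borel_measurable borel" by (rule borel_measurable_continuous_onI[OF g1g_cont])
  define e where "e = (\<integral>om. q (Y a om) (g (Y a om)) \<partial>M)"
  define c where "c = c2 * A * h^2 * m4"
  have \<beta>: "\<bar>(\<integral>om. p (Y a om) (bb h (Y s om)) \<partial>M) - (- ?E - (h / 2 - (s - a)) * e)\<bar> \<le> c" if s: "a \<le> s" "s \<le> a + h" for s
  proof -
    have [measurable]: "Y s \<in> borel_measurable M" using s a0 by (intro Y_meas) auto
    note Q = weak_first[OF s q1 q2 q3 AK]
    \<comment> \<open>What is left of the drift after removing \<open>- g\<close>, its linear change
      and the correction at the initial point. All of it is of order \<open>h^2\<close>.\<close>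
    define R where "R = (\<lambda>om. p (Y a om) (bb h (Y s om)) + p (Y a om) (g (Y a om)) + (h / 2) * q (Y a om) (g (Y a om)) + q (Y a om) (Y s om - Y a om))"
    have Rm: "R \<in> borel_measurable M"
      unfolding R_def by (intro borel_measurable_add borel_measurable_times borel_measurable_const pm linear_measurable[OF q1 q2 Ya]) measurable
    have Rle: "\<bar>R om\<bar> \<le> 4 * K^2 * A * h^2 * (W om ^ 4 + P s om ^ 4)" for om
    proof -
      define x d where "x = Y a om" and "d = Y s om - Y a om"
      have xd: "Y s om = x + d" "norm d = h * P s om" "w x = W om" by (auto simp: x_def d_def hP W_def)
      define r1 where "r1 = g (x + d) - g x - g1 x d"
      define r2 where "r2 = g1 (x + d) (g (x + d)) - g1 x (g x)"
      have "R om = p x (bb h (x + d) + g x + (h / 2) *\<^sub>R g1 x (g x) + g1 x d)"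
        unfolding R_def q_def x_def[symmetric] d_def[symmetric] xd by (simp add: linear_add[OF p(1)] linear_scale[OF p(1)])
      also have "bb h (x + d) + g x + (h / 2) *\<^sub>R g1 x (g x) + g1 x d = - (r1 + (h / 2) *\<^sub>R r2)"
        unfolding r1_def r2_def bb_def by (simp add: algebra_simps)
      finally have "\<bar>R om\<bar> \<le> A * W om * norm (r1 + (h / 2) *\<^sub>R r2)" using p(3)[of x "- (r1 + (h / 2) *\<^sub>R r2)"] by (metis norm_minus_cancel xd(3))
      also have "\<dots> \<le> A * W om * (2 * K^2 * h^2 * (P s om)^2 + K^2 * h^2 * (W om * P s om) + K^2 * h^2 * (P s om)^2)"
      proof (rule mult_left_mono)
        show "0 \<le> A * W om" using A by simp
        have "norm r1 \<le> 2 * K * (norm d)^2" unfolding r1_def by (rule smooth3_taylor1[OF gs K0(1)])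
        also have "\<dots> \<le> 2 * K^2 * (norm d)^2" using K1 by (intro mult_right_mono) (auto simp: power2_eq_square)
        finally have 1: "norm r1 \<le> 2 * K^2 * h^2 * (P s om)^2" by (simp add: xd(2) power_mult_distrib)
        have "norm r2 \<le> K^2 * norm d * (2 * w x + norm d)" unfolding r2_def by (rule g1g_diff)
        also have "\<dots> = K^2 * (h * P s om) * (2 * W om + h * P s om)" by (simp add: xd)
        also have "\<dots> \<le> K^2 * (h * P s om) * (2 * W om + 1 * P s om)"
          using h01 by (intro mult_left_mono add_left_mono mult_right_mono) auto
        finally have "(h / 2) * norm r2 \<le> (h / 2) * (K^2 * (h * P s om) * (2 * W om + 1 * P s om))" using h0 by (intro mult_left_mono) auto
        also have "\<dots> = K^2 * h^2 * (W om * P s om) + (1/2) * (K^2 * h^2 * (P s om)^2)" by (simp add: power2_eq_square algebra_simps)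
        also have "\<dots> \<le> K^2 * h^2 * (W om * P s om) + K^2 * h^2 * (P s om)^2" by simp
        finally show "norm (r1 + (h / 2) *\<^sub>R r2) \<le> 2 * K^2 * h^2 * (P s om)^2 + K^2 * h^2 * (W om * P s om) + K^2 * h^2 * (P s om)^2"
          using 1 norm_triangle_ineq[of r1 "(h / 2) *\<^sub>R r2"] h0 by simp
      qed
      also have "\<dots> =
        K^2 * A * h^2 * (3 * (W om * (P s om)^2) + (W om)^2 * P s om)" by (simp add: power2_eq_square algebra_simps)
      also have "\<dots> \<le> K^2 * A * h^2 * (3 * (W om ^ 4 + P s om ^ 4) + (W om ^ 4 + P s om ^ 4))"
        using A by (intro mult_left_mono add_mono young4_one) auto
      finally show ?thesis using A by (simp add: mult_left_mono algebra_simps)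
    qed
    have A4: "0 \<le> 4 * K^2 * A * h^2" using A by simp
    note B = WP_bound[OF s Rm Rle A4]
    note qi = integrable_mult_right[OF Q(1), of "h / 2"]
    have bb_eq: "p (Y a om) (bb h (Y s om)) = R om - (p (Y a om) (g (Y a om)) + (h / 2) * q (Y a om) (g (Y a om)) + q (Y a om) (Y s om - Y a om))" for om
      by (simp add: R_def)
    have "(\<integral>om. p (Y a om) (bb h (Y s om)) \<partial>M) = (\<integral>om. R om \<partial>M) - (?E + h / 2 * e + (\<integral>om. q (Y a om) (Y s om - Y a om) \<partial>M))"
      unfolding bb_eq e_def using B(1) pg Q(1,2) by simp
    then have "(\<integral>om. p (Y a om) (bb h (Y s om)) \<partial>M) - (- ?E - (h / 2 - (s - a)) * e) =
      (\<integral>om. R om \<partial>M) - ((\<integral>om. q (Y a om) (Y s om - Y a om) \<partial>M) + (s - a) * e)" by (simp add: algebra_simps)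
    moreover have "4 * K^2 * A * h^2 * (1 + cL) * m4 + 4 * K^2 * (1 + cL) * (A * K) * h^2 * m4 = c"
      by (simp add: c_def c2_def power2_eq_square power3_eq_cube algebra_simps)
    ultimately show ?thesis using B(2) Q(3)[folded e_def] by linarith
  qed
  have pt: "pt a (a + h) n j - a = h * (real j / real n)" for n j by (simp add: pt_def)
  have lim: "(\<lambda>n. \<Sum>j<Suc n. (a + h - a) / real (Suc n) * (- ?E - (h / 2 - (pt a (a + h) (Suc n) j - a)) * e)) \<longlonglongrightarrow> h * (- ?E)"
  proof -
    have "(\<lambda>n. h * (- ?E) - (h^2 * e / 2) * inverse (real (Suc n))) \<longlonglongrightarrow> h * (- ?E) - (h^2 * e / 2) * 0"
      by (intro tendsto_intros LIMSEQ_inverse_real_of_nat)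
    then show ?thesis unfolding pt by (simp only: midpoint_sum[OF zero_less_Suc] add_diff_cancel_left' mult_zero_right diff_zero)
  qed
  have "\<bar>?D - h * (- ?E)\<bar> \<le> (a + h - a) * c"
    by (rule weak_linear(2)[OF h0(2) order_refl p(1,2) p3 A \<beta> lim])
  then show "\<bar>?D + h * ?E\<bar> \<le> ?r"
    by (simp add: c_def power2_eq_square power3_eq_cube ac_simps)
qed

end

section \<open>Second order terms: quadratic test functions of the increment\<close>

lemma norm_column_le: "norm (column i A) \<le> norm A" for A :: "real^'n^'m"
  using norm_matrix_vector_mult[of A "axis i 1"] by (simp add: matrix_vector_mult_basis)

lemma norm_matrix_le_const:
  fixes A :: "real^'n^'m"
  assumes "\<And>i j. \<bar>A $ i $ j\<bar> \<le> c"
  shows "norm A \<le> real CARD('m) * (real CARD('n) * c)"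
proof -
  have "norm (A $ i) \<le> real CARD('n) * c" for i
    using norm_le_l1_cart[of "A $ i"] sum_mono[of UNIV "\<lambda>j. \<bar>A $ i $ j\<bar>" "\<lambda>_. c"] assms by fastforce
  then have "(\<Sum>i\<in>UNIV. norm (A $ i)) \<le> (\<Sum>i\<in>(UNIV::'m set). real CARD('n) * c)" by (intro sum_mono) auto
  moreover have "norm A \<le> (\<Sum>i\<in>UNIV. norm (A $ i))" unfolding norm_vec_def by (rule L2_set_le_sum) auto
  ultimately show ?thesis by simp
qed

lemma bilinear_inner_axis:
  fixes q :: "real^'n \<Rightarrow> real^'n \<Rightarrow> real"
  assumes q: "bilinear q"
  shows "q x y = x \<bullet> ((\<chi> i j. q (axis i 1) (axis j 1)) *v y)"
proof -
  have l: "linear (\<lambda>x. q x y)" "\<And>x. linear (q x)" for y using q by (auto simp: bilinear_def)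
  have "(\<chi> i j. q (axis i 1) (axis j 1)) *v y = (\<chi> i. q (axis i 1) y)"
    by (simp add: vec_eq_iff matrix_vector_mul_component linear_inner_axis[OF l(2), of _ y])
  then show ?thesis using linear_inner_axis[OF l(1), of x y] by (simp add: inner_commute)
qed

context step
begin

text \<open>Trace of the form \<open>q\<close> at the initial point against the diffusion
  coefficient at time \<open>s\<close>. For \<open>s = a\<close> it is the noise term of
  \<open>scheme_local\<close>.\<close>

definition Sg :: "(real^'n \<Rightarrow> real^'n \<Rightarrow> real^'n \<Rightarrow> real) \<Rightarrow> real \<Rightarrow> 'w \<Rightarrow> real" where
  "Sg q s om = (\<Sum>i\<in>UNIV. q (Y a om) (column i (\<sigma> s (Y s om))) (column i (\<sigma> s (Y s om))))"

context
  fixes q :: "real^'n \<Rightarrow> real^'n \<Rightarrow> real^'n \<Rightarrow> real" and A :: real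
  assumes q1: "\<And>y. bilinear (q y)" and q2: "\<And>k l. (\<lambda>y. q y k l) \<in> borel_measurable borel"
    and q3: "\<And>y k l. \<bar>q y k l\<bar> \<le> A * w y * norm k * norm l" and A: "0 \<le> A"
begin

lemma quadratic_meas:
  assumes "U \<in> borel_measurable M" "V \<in> borel_measurable M"
  shows "(\<lambda>om. q (Y a om) (U om) (V om)) \<in> borel_measurable M"
  by (rule bilinear_measurable[OF q1 q2 Ya assms])

lemma column_meas:
  assumes "a \<le> s"
  shows "(\<lambda>om. column i (\<sigma> s (Y s om))) \<in> borel_measurable M"
proof -
  have s: "0 \<le> s" using a0 assms by simp
  note [measurable] = smooth3D(1)[OF ss[OF s]] Y_meas[OF s]
  have "(\<lambda>om. \<sigma> s (Y s om) *v axis i 1) \<in> borel_measurable M" by measurable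
  then show ?thesis by (simp add: matrix_vector_mult_basis)
qed

text \<open>Within the step the diffusion coefficient changes by order \<open>h\<close>: in space
  through the increment \<open>h * P\<close>, in time through the Lipschitz bound in
  \<open>t\<close>.\<close>

lemma Sg_diff:
  assumes s: "a \<le> s" "s \<le> a + h"
  shows "\<bar>Sg q s om - Sg q a om\<bar> \<le> 8 * real CARD('n) * K^2 * A * h * (W om ^ 4 + P s om ^ 4)"
proof -
  have s0: "0 \<le> s" using a0 s by simp
  define u v where "u = (\<lambda>i. column i (\<sigma> s (Y s om)))" and "v = (\<lambda>i. column i (\<sigma> a (Y a om)))"
  define b p where "b = W om" and "p = P s om"
  have bp: "1 \<le> b" "0 \<le> p" by (auto simp: b_def p_def)
  have "norm (\<sigma> s (Y s om) - \<sigma> s (Y a om)) \<le> K * (h * p)"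
    using smooth3D(8)[OF ss[OF s0], of "Y a om" "Y s om - Y a om"] by (simp add: hP p_def)
  moreover have "norm (\<sigma> s (Y a om) - \<sigma> a (Y a om)) \<le> K * \<bar>s - a\<bar>" by (rule tlip[OF s0 a0])
  moreover have "K * \<bar>s - a\<bar> \<le> K * (h * b)" using s h01 bp K0 mult_mono[of "s - a" h 1 b] by (intro mult_left_mono) auto
  ultimately have D: "norm (\<sigma> s (Y s om) - \<sigma> a (Y a om)) \<le> K * h * (b + p)"
    using norm_triangle_ineq[of "\<sigma> s (Y s om) - \<sigma> s (Y a om)" "\<sigma> s (Y a om) - \<sigma> a (Y a om)"] by (simp add: algebra_simps)
  have one: "\<bar>q (Y a om) (u i) (u i) - q (Y a om) (v i) (v i)\<bar> \<le> 8 * K^2 * A * h * (b ^ 4 + p ^ 4)" for i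
  proof -
    have "u i - v i = column i (\<sigma> s (Y s om) - \<sigma> a (Y a om))" by (simp add: u_def v_def column_def vec_eq_iff)
    then have 1: "norm (u i - v i) \<le> K * h * (b + p)" using norm_column_le[of i "\<sigma> s (Y s om) - \<sigma> a (Y a om)"] D by simp
    have "norm (u i) \<le> K * w (Y s om)" unfolding u_def by (rule order_trans[OF norm_column_le s_growth[OF s0]])
    also have "\<dots> \<le> K * (b + p)" using w_le1[of s om] K0 by (intro mult_left_mono) (auto simp: b_def p_def)
    finally have 2: "norm (u i) \<le> K * (b + p)" .
    have "norm (v i) \<le> K * b" unfolding v_def b_def W_def by (rule order_trans[OF norm_column_le s_growth[OF a0]])
    also have "\<dots> \<le> K * (b + p)" using bp K0 by (intro mult_left_mono) auto
    finally have 3: "norm (v i) \<le> K * (b + p)" .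
    have "q (Y a om) (u i) (u i) - q (Y a om) (v i) (v i) = q (Y a om) (u i - v i) (u i) + q (Y a om) (v i) (u i - v i)"
      by (simp add: bilinear_lsub[OF q1] bilinear_rsub[OF q1])
    moreover have "\<bar>q (Y a om) (u i - v i) (u i)\<bar> \<le> A * b * (K * h * (b + p)) * (K * (b + p))"
      unfolding b_def W_def[symmetric] using A bp K0 h01
      by (intro order_trans[OF q3] mult_mono) (use 1 2 in \<open>auto simp: W_def b_def\<close>)
    moreover have "\<bar>q (Y a om) (v i) (u i - v i)\<bar> \<le> A * b * (K * (b + p)) * (K * h * (b + p))"
      using A bp K0 h01
      by (intro order_trans[OF q3] mult_mono) (use 1 3 in \<open>auto simp: W_def b_def\<close>)
    ultimately have "\<bar>q (Y a om) (u i) (u i) - q (Y a om) (v i) (v i)\<bar> \<le> A * b * (K * h * (b + p)) * (K * (b + p)) + A * b * (K * (b + p)) * (K * h * (b + p))"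
      by linarith
    also have "\<dots> = 2 * K^2 * A * h * (b^3 + 2 * (b^2 * p) + b * p^2)" by (simp add: power2_eq_square power3_eq_cube algebra_simps)
    also have "\<dots> \<le> 2 * K^2 * A * h * (b^4 + 2 * (b^4 + p^4) + (b^4 + p^4))"
      using A h01 bp by (intro mult_left_mono add_mono young4_one power_increasing) auto
    also have "\<dots> \<le> 2 * K^2 * A * h * (4 * (b^4 + p^4))"
      using A h01 by (intro mult_left_mono) auto
    finally show ?thesis by (simp add: algebra_simps)
  qed
  have "\<bar>Sg q s om - Sg q a om\<bar> \<le> (\<Sum>i\<in>(UNIV::'n set). 8 * K^2 * A * h * (b ^ 4 + p ^ 4))"
    unfolding Sg_def sum_subtractf[symmetric] by (rule order_trans[OF sum_abs sum_mono]) (rule one[unfolded u_def v_def])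
  then show ?thesis by (simp add: b_def p_def ac_simps)
qed

lemma Sg_a_integrable: "integrable M (Sg q a)"
proof (rule integral_bound(1))
  show "Sg q a \<in> borel_measurable M"
    unfolding Sg_def by (intro borel_measurable_sum quadratic_meas column_meas order_refl)
  show "integrable M (\<lambda>om. real CARD('n) * A * K^2 * W om ^ 4)" using Wi by auto
  fix om
  have "\<bar>q (Y a om) (column i (\<sigma> a (Y a om))) (column i (\<sigma> a (Y a om)))\<bar> \<le> A * K^2 * W om ^ 4" for i
  proof -
    have c: "norm (column i (\<sigma> a (Y a om))) \<le> K * W om" unfolding W_def by (rule order_trans[OF norm_column_le s_growth[OF a0]])
    have "\<bar>q (Y a om) (column i (\<sigma> a (Y a om))) (column i (\<sigma> a (Y a om)))\<bar> \<le> A * W om * (K * W om) * (K * W om)"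
      using A K0 by (intro order_trans[OF q3] mult_mono c) (auto simp: W_def)
    also have "\<dots> = A * K^2 * W om ^ 3" by (simp add: power2_eq_square power3_eq_cube)
    also have "\<dots> \<le> A * K^2 * W om ^ 4" using A by (intro mult_left_mono power_increasing) auto
    finally show ?thesis .
  qed
  then have "\<bar>Sg q a om\<bar> \<le> (\<Sum>i\<in>(UNIV::'n set). A * K^2 * W om ^ 4)"
    unfolding Sg_def by (intro order_trans[OF sum_abs sum_mono])
  then show "\<bar>Sg q a om\<bar> \<le> real CARD('n) * A * K^2 * W om ^ 4" by (simp add: ac_simps)
qed

text \<open>The weighted isometry \<open>mart_quad\<close>. The two factors \<open>G\<close>
  contribute \<open>h\<close>, the length of the step another \<open>h\<close>, and freezing the
  coefficient at time \<open>a\<close> costs one further order.\<close>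

lemma noise_quadratic:
  assumes n: "0 < n"
  shows "integrable M (\<lambda>om. q (Y a om) (Sn (a + h) n om) (Sn (a + h) n om))"
    "\<bar>(\<integral>om. q (Y a om) (Sn (a + h) n om) (Sn (a + h) n om) \<partial>M) - h^2 * (\<integral>om. Sg q a om \<partial>M)\<bar>
      \<le> 8 * real CARD('n) * K^2 * (1 + cL) * A * h^3 * m4"
    (is "\<bar>?E - h^2 * ?S\<bar> \<le> ?r")
proof -
  have b: "a < a + h" "a + h \<le> a + h" "a \<le> a + h" using h01 by auto
  note R = riemann_moments[OF b(1,2) n]
  let ?s = "pt a (a + h) n"
  have s: "a \<le> ?s j" "?s j \<le> a + h" "0 \<le> ?s j" if "j < n" for j using pt_bounds[OF b(3), of j n] that a0 by auto
  have g: "grid n ?s" by (rule pt_grid) (use a0 b in auto)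
  define Q where "Q = (\<lambda>om. \<chi> i j. q (Y a om) (axis i 1) (axis j 1))"
  have qQ: "q (Y a om) x y = x \<bullet> (Q om *v y)" for om x y unfolding Q_def by (rule bilinear_inner_axis[OF q1])
  have Qm: "Q \<in> borel_measurable (F (?s 0))"
    unfolding Q_def pt_0 by (intro measurable_vecI) (simp add: measurable_compose[OF Y_ad[OF a0] q2])
  have Qn: "norm (Q om) \<le> real CARD('n) * (real CARD('n) * (A * W om))" for om
    by (rule norm_matrix_le_const) (use q3[of "Y a om" "axis _ 1" "axis _ 1"] in \<open>simp add: Q_def W_def\<close>)
  have i: "integrable M (\<lambda>om. norm (Q om) * (norm (G (?s j) om))^2)" if j: "j < n" for j
  proof (rule integral_bound(1))
    have "G (?s j) \<in> borel_measurable (F (?s j))" using R(8) j by (simp add: adapted_def)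
    from F_meas[OF this] F_meas[OF Qm] show "(\<lambda>om. norm (Q om) * (norm (G (?s j) om))^2) \<in> borel_measurable M" by measurable
    show "integrable M (\<lambda>om. real CARD('n) * real CARD('n) * A * (W om ^ 4 + norm (G (?s j) om) ^ 4))" using Wi R(9)[OF j] by auto
    fix om
    have "norm (Q om) * (norm (G (?s j) om))^2 \<le> real CARD('n) * (real CARD('n) * (A * W om)) * (norm (G (?s j) om))^2"
      using Qn by (intro mult_right_mono) auto
    also have "\<dots> = real CARD('n) * real CARD('n) * A * (W om * (norm (G (?s j) om))^2)" by simp
    also have "\<dots> \<le> real CARD('n) * real CARD('n) * A * (W om ^ 4 + norm (G (?s j) om) ^ 4)"
      using A by (intro mult_left_mono young4_one) auto
    finally show "\<bar>norm (Q om) * (norm (G (?s j) om))^2\<bar> \<le> real CARD('n) * real CARD('n) * A * (W om ^ 4 + norm (G (?s j) om) ^ 4)" by simp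
  qed
  note MQ = mart_quad[OF g R(8) Qm i]
  have SSn: "Sn (a + h) n = mart ?s (\<lambda>j. G (?s j)) n" by (simp add: SS_def)
  show "integrable M (\<lambda>om. q (Y a om) (Sn (a + h) n om) (Sn (a + h) n om))" unfolding qQ SSn using MQ by blast
  have col: "(\<Sum>i\<in>UNIV. column i (G t om) \<bullet> (Q om *v column i (G t om))) = h * Sg q t om" for t om
  proof -
    have "column i (G t om) = sqrt h *\<^sub>R column i (\<sigma> t (Y t om))" for i by (simp add: G_def column_def vec_eq_iff)
    then have "q (Y a om) (column i (G t om)) (column i (G t om)) = h * q (Y a om) (column i (\<sigma> t (Y t om))) (column i (\<sigma> t (Y t om)))" for i
      using h01 by (simp add: bilinear_lmul[OF q1] bilinear_rmul[OF q1] mult.assoc[symmetric])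
    then show ?thesis by (simp add: qQ[symmetric] Sg_def sum_distrib_left)
  qed
  have E: "?E = (\<Sum>j<n. h / real n * (h * (\<integral>om. Sg q (?s j) om \<partial>M)))"
    unfolding qQ SSn using MQ by (simp add: col pt_Suc_diff)
  define c where "c = 8 * real CARD('n) * K^2 * (1 + cL) * A * h * m4"
  have Ed: "\<bar>(\<integral>om. Sg q t om \<partial>M) - ?S\<bar> \<le> c" if t: "a \<le> t" "t \<le> a + h" for t
  proof -
    have m: "(\<lambda>om. Sg q t om - Sg q a om) \<in> borel_measurable M"
      unfolding Sg_def by (intro borel_measurable_diff borel_measurable_sum quadratic_meas column_meas order_refl t)
    note IB = WP_bound[OF t m Sg_diff[OF t]]
    have "integrable M (\<lambda>om. (Sg q t om - Sg q a om) + Sg q a om)" by (intro Bochner_Integration.integrable_add IB(1) Sg_a_integrable) (use A h01 in auto)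
    then have "integrable M (Sg q t)" by simp
    then have "(\<integral>om. Sg q t om - Sg q a om \<partial>M) = (\<integral>om. Sg q t om \<partial>M) - ?S"
      by (rule Bochner_Integration.integral_diff[OF _ Sg_a_integrable])
    with IB(2) A h01 show ?thesis by (simp add: c_def ac_simps)
  qed
  have h2: "h^2 * ?S = (\<Sum>j<n. h / real n * (h * ?S))" using n by (simp add: power2_eq_square)
  have "\<bar>?E - h^2 * ?S\<bar> =
    \<bar>\<Sum>j<n. h / real n * h * ((\<integral>om. Sg q (?s j) om \<partial>M) - ?S)\<bar>"
    unfolding E h2 sum_subtractf[symmetric] by (simp only: right_diff_distrib mult.assoc)
  also have "\<dots> \<le> (\<Sum>j<n. h / real n * h * c)"
  proof (rule order_trans[OF sum_abs sum_mono])
    fix j assume "j \<in> {..<n}"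
    then show "\<bar>h / real n * h * ((\<integral>om. Sg q (?s j) om \<partial>M) - ?S)\<bar> \<le> h / real n * h * c"
      unfolding abs_mult using Ed[OF s(1,2)] h01 by (intro mult_mono) auto
  qed
  also have "\<dots> = ?r" using n by (simp add: c_def power3_eq_cube ac_simps)
  finally show "\<bar>?E - h^2 * ?S\<bar>
      \<le> ?r" .
qed

text \<open>At each time the drift differs from its frozen value by order \<open>h\<close>, so the
  sum over the step does by order \<open>h^2\<close>; the fourth power gives
  \<open>h ^ 8\<close>.\<close>

lemma drift_remainder:
  assumes n: "0 < n"
  shows "integrable M (\<lambda>om. norm (Dn (a + h) n om + h *\<^sub>R g (Y a om)) ^ 4)"
    "(\<integral>om. norm (Dn (a + h) n om + h *\<^sub>R g (Y a om)) ^ 4 \<partial>M) \<le> cD * h ^ 8 * m4"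
proof -
  have b: "a \<le> a + h" using h01 by auto
  let ?s = "pt a (a + h) n"
  have s: "a \<le> ?s j" "?s j \<le> a + h" "0 \<le> ?s j" if "j < n" for j using pt_bounds[OF b, of j n] that a0 by auto
  note [measurable] = smooth3D(1)[OF gs] bb_meas
  define v where "v = (\<lambda>j om. bb h (Y (?s j) om) + g (Y a om))"
  have vm: "v j \<in> borel_measurable M" if "j < n" for j
  proof -
    note [measurable] = Y_meas[OF s(3)[OF that]]
    show ?thesis unfolding v_def by measurable
  qed
  have eq: "Dn (a + h) n om + h *\<^sub>R g (Y a om) = (\<Sum>j<n. (h / real n) *\<^sub>R v j om)" for om
    using n by (simp add: DD_def v_def scaleR_right_distrib sum.distrib sum_constant_scaleR del: sum_constant)
  have vb: "norm (v j om) ^ 4 \<le> 128 * K^8 * h^4 * (W om ^ 4 + P (?s j) om ^ 4)" for j om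
  proof -
    have "norm (v j om) ^ 4 \<le> (2 * K^2 * h * (W om + P (?s j) om)) ^ 4" unfolding v_def by (intro power_mono drift_diff) auto
    also have "\<dots> = 16 * K^8 * h^4 * (W om + P (?s j) om) ^ 4" by (simp add: power_mult_distrib flip: power_mult)
    also have "\<dots> \<le> 16 * K^8 * h^4 * (8 * W om ^ 4 + 8 * P (?s j) om ^ 4)"
      using norm_add_pow4_le[of "W om" "P (?s j) om"] by (intro mult_left_mono) (auto simp: abs_of_nonneg)
    finally show ?thesis by (simp add: algebra_simps)
  qed
  have IB: "integrable M (\<lambda>om. norm (v j om) ^ 4)" "(\<integral>om. norm (v j om) ^ 4 \<partial>M) \<le> cD * h^4 * m4" if j: "j < n" for j
  proof -
    have m: "(\<lambda>om. norm (v j om) ^ 4) \<in> borel_measurable M" using vm[OF j] by measurable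
    have B: "integrable M (\<lambda>om. norm (v j om) ^ 4)" "\<bar>\<integral>om. norm (v j om) ^ 4 \<partial>M\<bar> \<le> 128 * K^8 * h^4 * (1 + cL) * m4"
      by (rule WP_bound[where c = "128 * K^8 * h^4", OF s(1,2)[OF j] m]; use vb in simp)+
    show "integrable M (\<lambda>om. norm (v j om) ^ 4)" by (rule B)
    show "(\<integral>om. norm (v j om) ^ 4 \<partial>M) \<le> cD * h^4 * m4" using B(2) by (simp add: cD_def ac_simps)
  qed
  have D0: "0 \<le> h / real n" using h01 by simp
  note S4 = sum_pow4[of n v, OF vm IB D0]
  show "integrable M (\<lambda>om. norm (Dn (a + h) n om + h *\<^sub>R g (Y a om)) ^ 4)" unfolding eq by (rule S4(1))
  have "real n * (h / real n) = h" using n by simp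
  then have "(real n * (h / real n)) ^ 4 * (cD * h^4 * m4) = cD * h ^ 8 * m4" by (simp add: eval_nat_numeral)
  then show "(\<integral>om. norm (Dn (a + h) n om + h *\<^sub>R g (Y a om)) ^ 4 \<partial>M) \<le> cD * h ^ 8 * m4"
    using S4(2) unfolding eq by (simp only:)
qed

text \<open>\<open>v\<close> is the deviation of the drift sum, of order \<open>h^2\<close>. The
  terms without \<open>v\<close> are kept exactly, and every term with \<open>v\<close> is of order
  \<open>h^3\<close>.\<close>

lemma quadratic_remainder:
  fixes x u v S :: "real^'n"
  assumes u: "norm u \<le> K * w x" and d: "norm v = h^2 * d" and s: "norm S = h * s" and nn: "0 \<le> d" "0 \<le> s"
  shows "\<bar>q x (v - h *\<^sub>R u + S) (v - h *\<^sub>R u + S) - (h^2 * q x u u - h * q x u S - h * q x S u + q x S S)\<bar>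
    \<le> 6 * K * A * h^3 * (w x ^ 4 + d ^ 4 + s ^ 4)"
proof -
  define b where "b = w x"
  have b: "1 \<le> b" by (simp add: b_def)
  define U where "U = S - h *\<^sub>R u"
  have Un: "norm U \<le> h * (s + K * b)"
  proof -
    have "norm U \<le> norm S + norm (h *\<^sub>R u)" unfolding U_def by (rule norm_triangle_ineq4)
    also have "\<dots> \<le> h * s + h * (K * b)" using mult_left_mono[OF u, of h] h01 s by (simp add: b_def)
    finally show ?thesis by (simp only: distrib_left)
  qed
  have "q x (v - h *\<^sub>R u + S) (v - h *\<^sub>R u + S) - (h^2 * q x u u - h * q x u S - h * q x S u + q x S S) = q x v U + q x U v + q x v v"
    by (simp add: U_def bilinear_ladd[OF q1] bilinear_radd[OF q1] bilinear_lsub[OF q1] bilinear_rsub[OF q1]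
      bilinear_lmul[OF q1] bilinear_rmul[OF q1] power2_eq_square algebra_simps)
  moreover have "\<bar>q x v U\<bar> \<le> A * b * (h^2 * d) * (h * (s + K * b))"
    using A b nn K0 h01 Un by (intro order_trans[OF q3] mult_mono) (auto simp: b_def d)
  moreover have "\<bar>q x U v\<bar> \<le> A * b * (h * (s + K * b)) * (h^2 * d)"
    using A b nn K0 h01 Un by (intro order_trans[OF q3] mult_mono) (auto simp: b_def d)
  moreover have "\<bar>q x v v\<bar> \<le> A * b * (h^2 * d) * (h^2 * d)" using q3[of x v v] by (simp add: b_def d)
  moreover have "A * b * (h^2 * d) * (h^2 * d) \<le> A * b * (h^2 * d) * (h * d)"
    using A b nn h01 by (intro mult_left_mono mult_right_mono) (auto simp: power2_eq_square mult_left_le)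
  ultimately have "\<bar>q x (v - h *\<^sub>R u + S) (v - h *\<^sub>R u + S) - (h^2 * q x u u - h * q x u S - h * q x S u + q x S S)\<bar> \<le>
    A * b * (h^2 * d) * (h * (s + K * b)) + A * b * (h * (s + K * b)) * (h^2 * d) + A * b * (h^2 * d) * (h * d)" by linarith
  also have "\<dots> = A * h^3 * (2 * (b * (d * s)) + 2 * K * (b^2 * d) + b * d^2)"
    by (simp add: power2_eq_square power3_eq_cube algebra_simps)
  also have "\<dots> \<le> A * h^3 * (2 * (b^4 + d^4 + s^4) + 2 * K * (b^4 + d^4) + (b^4 + d^4))"
  proof (intro mult_left_mono add_mono young4_one b nn)
    have "b * (d * s) \<le> b^2 * (d * s)" using b nn power_increasing[of 1 2 b] by (intro mult_right_mono) auto
    then show "b * (d * s) \<le> b^4 + d^4 + s^4" using young4_three[of b d s] b nn by simp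
  qed (use A h01 K0 in auto)
  also have "\<dots> \<le> A * h^3 * (6 * K * (b^4 + d^4 + s^4))"
  proof (rule mult_left_mono)
    define X where "X = b^4 + d^4 + s^4"
    have X: "b^4 + d^4 \<le> X" "0 \<le> X" by (auto simp: X_def)
    have "2 * K * (b^4 + d^4) \<le> 2 * K * X" using X K0 by (intro mult_left_mono) auto
    moreover have "1 * X \<le> K * X" using X K1 by (intro mult_right_mono) auto
    ultimately show "2 * (b^4 + d^4 + s^4) + 2 * K * (b^4 + d^4) + (b^4 + d^4) \<le> 6 * K * (b^4 + d^4 + s^4)"
      unfolding X_def[symmetric] using X by linarith
  qed (use A h01 in auto)
  also have "\<dots> = 6 * K * A * h^3 * (w x ^ 4 + d ^ 4 + s ^ 4)" by (simp add: b_def)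
  finally show ?thesis .
qed

text \<open>The increment is approximated by \<open>- h g\<close> plus noise plus a deviation of
  order \<open>h^2\<close>. The mixed terms of gradient and noise are linear in the noise and vanish
  in the mean; the squares give the same two terms as in \<open>scheme_local\<close>.\<close>

lemma weak_quadratic:
  shows "integrable M (\<lambda>om. q (Y a om) (g (Y a om)) (g (Y a om)))"
    "integrable M (\<lambda>om. q (Y a om) (Y (a + h) om - Y a om) (Y (a + h) om - Y a om))"
    "\<bar>(\<integral>om. q (Y a om) (Y (a + h) om - Y a om) (Y (a + h) om - Y a om) \<partial>M)
      - h^2 * ((\<integral>om. q (Y a om) (g (Y a om)) (g (Y a om)) \<partial>M) + (\<integral>om. Sg q a om \<partial>M))\<bar> \<le> c3 * A * h^3 * m4"
    (is "\<bar>?Q - h^2 * (?G + ?S)\<bar> \<le> ?r")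
proof -
  note [measurable] = smooth3D(1)[OF gs]
  have gm: "(\<lambda>om. g (Y a om)) \<in> borel_measurable M" by measurable
  have b: "a < a + h" "a + h \<le> a + h" using h01 by auto
  have gW: "norm (g (Y a om)) \<le> K * W om" for om unfolding W_def by (rule g_growth)
  show gg: "integrable M (\<lambda>om. q (Y a om) (g (Y a om)) (g (Y a om)))"
  proof (rule integral_bound(1))
    show "(\<lambda>om. q (Y a om) (g (Y a om)) (g (Y a om))) \<in> borel_measurable M" by (rule quadratic_meas[OF gm gm])
    show "integrable M (\<lambda>om. A * K^2 * W om ^ 4)" using Wi by auto
    fix om
    have "\<bar>q (Y a om) (g (Y a om)) (g (Y a om))\<bar> \<le> A * W om * (K * W om) * (K * W om)"
      using A K0 by (intro order_trans[OF q3] mult_mono gW) (auto simp: W_def)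
    also have "\<dots> = A * K^2 * W om ^ 3" by (simp add: power2_eq_square power3_eq_cube)
    also have "\<dots> \<le> A * K^2 * W om ^ 4" using A by (intro mult_left_mono power_increasing) auto
    finally show "\<bar>q (Y a om) (g (Y a om)) (g (Y a om))\<bar> \<le> A * K^2 * W om ^ 4" .
  qed
  define v0 where "v0 = h^2 * (?G + ?S)"
  have E: "\<bar>(\<integral>om. q (Y a om) (Dn (a + h) n om + Sn (a + h) n om) (Dn (a + h) n om + Sn (a + h) n om) \<partial>M) - v0\<bar> \<le> ?r" if n: "0 < n" for n
  proof -
    note R = riemann_moments[OF b n]
    note N = noise_quadratic[OF n]
    note DR = drift_remainder[OF n]
    define D S where "D = Dn (a + h) n" and "S = Sn (a + h) n"
    have DS: "D \<in> borel_measurable M" "S \<in> borel_measurable M" unfolding D_def S_def by (rule R)+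
    have lin: "linear (\<lambda>k. q y (g y) k)" "linear (\<lambda>k. q y k (g y))" for y using q1[of y] by (auto simp: bilinear_def)
    have lb: "\<bar>q y (g y) k\<bar> \<le> A * K * w y ^ 3 * norm k" "\<bar>q y k (g y)\<bar> \<le> A * K * w y ^ 3 * norm k" for y k
    proof -
      have "\<bar>q y (g y) k\<bar> \<le> A * w y * (K * w y) * norm k" "\<bar>q y k (g y)\<bar> \<le> A * w y * norm k * (K * w y)"
        using A K0 by (auto intro!: order_trans[OF q3] mult_mono g_growth)
      moreover have "A * w y * (K * w y) * norm k = A * K * norm k * (w y)^2" "A * w y * norm k * (K * w y) = A * K * norm k * (w y)^2"
        by (simp_all add: power2_eq_square)
      moreover have "A * K * norm k * (w y)^2 \<le> A * K * norm k * w y ^ 3" using A K0 by (intro mult_left_mono power_increasing) auto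
      ultimately show "\<bar>q y (g y) k\<bar> \<le> A * K * w y ^ 3 * norm k" "\<bar>q y k (g y)\<bar> \<le> A * K * w y ^ 3 * norm k"
        by (auto simp: ac_simps)
    qed
    have lmm: "(\<lambda>y. q y (g y) k) \<in> borel_measurable borel" "(\<lambda>y. q y k (g y)) \<in> borel_measurable borel" for k
      by (rule bilinear_measurable[OF q1 q2 measurable_ident_sets[OF refl]]; measurable)+
    have AK: "0 \<le> A * K" using A K0 by simp
    note L1 = linear_noise[OF b n lin(1) lmm(1) lb(1) AK, folded S_def]
    note L2 = linear_noise[OF b n lin(2) lmm(2) lb(2) AK, folded S_def]
    define Rem where "Rem = (\<lambda>om. q (Y a om) (D om + S om) (D om + S om) -
      (h^2 * q (Y a om) (g (Y a om)) (g (Y a om)) - h * q (Y a om) (g (Y a om)) (S om) - h * q (Y a om) (S om) (g (Y a om)) + q (Y a om) (S om) (S om)))"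
    have Rm: "Rem \<in> borel_measurable M"
      unfolding Rem_def by (intro borel_measurable_add borel_measurable_diff borel_measurable_times borel_measurable_const quadratic_meas DS gm)
    \<comment> \<open>Deviation and noise are measured in units of \<open>h^2\<close> and
      \<open>h\<close>, so that each term in the bracket has a mean comparable to
      \<open>m4\<close>.\<close>
    define V where "V = (\<lambda>om. 6 * K * A * h^3 * (W om ^ 4 + norm (D om + h *\<^sub>R g (Y a om)) ^ 4 / h^8 + norm (S om) ^ 4 / h^4))"
    have Vi: "integrable M V" unfolding V_def using Wi DR(1) R(4) by (auto simp: D_def S_def)
    have le: "\<bar>Rem om\<bar> \<le> V om" for om
    proof -
      have "\<bar>Rem om\<bar> \<le> 6 * K * A * h^3 * (w (Y a om) ^ 4 + (norm (D om + h *\<^sub>R g (Y a om)) / h^2) ^ 4 + (norm (S om) / h) ^ 4)"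
        using quadratic_remainder[OF g_growth(2)[of "Y a om"], of "D om + h *\<^sub>R g (Y a om)" "norm (D om + h *\<^sub>R g (Y a om)) / h^2" "S om" "norm (S om) / h"] h01
        by (simp add: Rem_def)
      then show ?thesis by (simp add: V_def W_def power_divide flip: power_mult)
    qed
    note IB = integral_bound[OF Rm Vi le]
    have "(\<integral>om. V om \<partial>M) = 6 * K * A * h^3 * (m4 + (\<integral>om. norm (D om + h *\<^sub>R g (Y a om)) ^ 4 \<partial>M) / h^8 + (\<integral>om. norm (S om) ^ 4 \<partial>M) / h^4)"
      unfolding V_def using Wi DR(1) R(4) by (simp add: D_def S_def m4_def)
    also have "\<dots> \<le> 6 * K * A * h^3 * (m4 + cD * h^8 * m4 / h^8 + cS * h^4 * m4 / h^4)"
      using DR(2) R(5) A K0 h01 by (intro mult_left_mono add_mono divide_right_mono) (auto simp: D_def S_def)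
    also have "\<dots> = 6 * K * (1 + cD + cS) * A * h^3 * m4" using h01 by (simp add: algebra_simps)
    finally have VE: "(\<integral>om. V om \<partial>M) \<le> 6 * K * (1 + cD + cS) * A * h^3 * m4" .
    have eq: "q (Y a om) (D om + S om) (D om + S om) = Rem om +
      (h^2 * q (Y a om) (g (Y a om)) (g (Y a om)) - h * q (Y a om) (g (Y a om)) (S om) - h * q (Y a om) (S om) (g (Y a om)) + q (Y a om) (S om) (S om))" for om
      by (simp add: Rem_def)
    have "(\<integral>om. q (Y a om) (D om + S om) (D om + S om) \<partial>M) = (\<integral>om. Rem om \<partial>M) +
      (h^2 * ?G + (\<integral>om. q (Y a om) (S om) (S om) \<partial>M))"
      unfolding eq using IB(1) gg L1 L2 N(1)[folded S_def] by simp
    then have "(\<integral>om. q (Y a om) (D om + S om) (D om + S om) \<partial>M) - v0 =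
      (\<integral>om. Rem om \<partial>M) + ((\<integral>om. q (Y a om) (S om) (S om) \<partial>M) - h^2 * ?S)"
      by (simp add: v0_def algebra_simps)
    moreover have "6 * K * (1 + cD + cS) * A * h^3 * m4 + 8 * real CARD('n) * K^2 * (1 + cL) * A * h^3 * m4 = ?r"
      by (simp add: c3_def algebra_simps)
    ultimately show ?thesis using IB(2) VE N(2)[folded S_def] unfolding D_def[symmetric] S_def[symmetric] by linarith
  qed
  have fb: "\<bar>q y x x\<bar> \<le> A * ((w y)^2 * norm x * (w y + norm x))" for y x
  proof -
    have "\<bar>q y x x\<bar> \<le> A * (w y * (norm x * norm x))" using q3[of y x x] by (simp add: ac_simps)
    also have "\<dots> \<le> A * ((w y)^2 * (norm x * (w y + norm x)))"
      using A power_increasing[of 1 2 "w y"] by (intro mult_left_mono mult_mono) auto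
    finally show ?thesis by (simp add: ac_simps)
  qed
  have qc: "continuous_on UNIV (\<lambda>x. q y x x)" for y
    using q1[of y] by (intro bounded_bilinear.continuous_on[of "q y"]) (auto simp: bilinear_conv_bounded_bilinear)
  have lim: "(\<lambda>n. v0) \<longlonglongrightarrow> v0" by simp
  note RL = riemann_limit[where f = "\<lambda>y x. q y x x", OF b quadratic_meas qc fb A E lim]
  show "integrable M (\<lambda>om. q (Y a om) (Y (a + h) om - Y a om) (Y (a + h) om - Y a om))"
    "\<bar>?Q
      - h^2 * (?G + ?S)\<bar> \<le> ?r"
    unfolding v0_def[symmetric] by (rule RL; assumption)+
qed

end

end

section \<open>Comparison of one step with the scheme, and the moment recursion\<close>

context step
begin

lemma jet_integrable:
  assumes j: "jet A u p q" and A: "0 \<le> A" and s: "a \<le> s" "s \<le> a + h"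
  shows "integrable M (\<lambda>om. u (Y s om))"
proof (rule integral_bound(1))
  have [measurable]: "Y s \<in> borel_measurable M" using s a0 by (intro Y_meas) auto
  note [measurable] = jetD(1)[OF j]
  show "(\<lambda>om. u (Y s om)) \<in> borel_measurable M" by measurable
  show "integrable M (\<lambda>om. (\<bar>u xs\<bar> + 64 * k2 * k3 * A) * w (Y s om) ^ 4)" using wi[OF s] by auto
  show "\<bar>u (Y s om)\<bar> \<le> (\<bar>u xs\<bar> + 64 * k2 * k3 * A) * w (Y s om) ^ 4" for om by (rule jet_growth4[OF j A])
qed

text \<open>Both expectations agree with that of the second order expansion \<open>T\<close> up to
  \<open>h^3\<close>: for the scheme pointwise by \<open>scheme_local\<close>, for the solution
  through \<open>weak_second\<close>, \<open>weak_quadratic\<close> and the cubic remainder.\<close>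

theorem one_step:
  assumes j: "jet A u p q" and A: "0 \<le> A"
  shows "integrable M (\<lambda>om. Pu a h u (Y a om))"
    "\<bar>(\<integral>om. u (Y (a + h) om) \<partial>M) - (\<integral>om. Pu a h u (Y a om) \<partial>M)\<bar> \<le> cT * A * h^3 * m4"
proof -
  have k: "0 \<le> k2" "0 \<le> k3" using k2_ge1 k3_ge1 by auto
  have s: "a \<le> a + h" "a + h \<le> a + h" "a \<le> a" using h01 by auto
  have [measurable]: "Y (a + h) \<in> borel_measurable M" using a0 h01 by (intro Y_meas) auto
  note [measurable] = jetD(1)[OF j] smooth3D(1)[OF gs]
  note jl = jetD(4)[OF j] and jq = jetD(5)[OF j]
  have kA: "0 \<le> k2 * A" using k A by simp
  note L = weak_second[of p A, OF jl jetD(2)[OF j] jetD(6)[OF j] A]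
  note Q = weak_quadratic[of q "k2 * A", OF jq jetD(3)[OF j] jetD(7)[OF j] kA]
  note Si = Sg_a_integrable[of q "k2 * A", OF jq jetD(3)[OF j] jetD(7)[OF j] kA]
  note Ui = jet_integrable[OF j A s(1,2)] and ui = jet_integrable[OF j A s(3,1)]
  let ?y = "\<lambda>om. Y a om" and ?d = "\<lambda>om. Y (a + h) om - Y a om"
  let ?Ep = "\<integral>om. p (?y om) (?d om) \<partial>M" and ?Eg = "\<integral>om. p (?y om) (g (?y om)) \<partial>M"
    and ?Eq = "\<integral>om. q (?y om) (?d om) (?d om) \<partial>M" and ?Eqg = "\<integral>om. q (?y om) (g (?y om)) (g (?y om)) \<partial>M"
    and ?ES = "\<integral>om. Sg q a om \<partial>M" and ?Eu = "\<integral>om. u (?y om) \<partial>M"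
    and ?EP = "\<integral>om. Pu a h u (?y om) \<partial>M" and ?EU = "\<integral>om. u (Y (a + h) om) \<partial>M"
  have pm: "(\<lambda>om. p (?y om) (V om)) \<in> borel_measurable M" if "V \<in> borel_measurable M" for V
    by (rule linear_measurable[OF jl jetD(2)[OF j] Ya that])
  have qm: "(\<lambda>om. q (?y om) (U om) (V om)) \<in> borel_measurable M" if "U \<in> borel_measurable M" "V \<in> borel_measurable M" for U V
    by (rule bilinear_measurable[OF jq jetD(3)[OF j] Ya that])
  define r where "r = (\<lambda>om. u (Y (a + h) om) - (u (?y om) + p (?y om) (?d om) + q (?y om) (?d om) (?d om) / 2))"
  have rm: "r \<in> borel_measurable M"
    unfolding r_def by (intro borel_measurable_diff borel_measurable_add borel_measurable_divide pm qm) measurable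
  have rle: "\<bar>r om\<bar> \<le> 3 * k3 * A * h^3 * (W om ^ 4 + P (a + h) om ^ 4)" for om
  proof -
    let ?P = "P (a + h) om"
    have "\<bar>r om\<bar> \<le> k3 * A * (w (?y om) + w (Y (a + h) om)) * norm (?d om) ^ 3"
      using jetD(8)[OF j, of "?y om" "?d om"] by (simp add: r_def algebra_simps)
    also have "\<dots> \<le> k3 * A * (W om + (W om + ?P)) * norm (?d om) ^ 3"
      using A k w_le1[of "a + h" om] by (intro mult_right_mono mult_left_mono) (auto simp: W_def)
    also have "\<dots> = k3 * A * h^3 * (2 * (W om * ?P ^ 3) + ?P ^ 4)" by (simp add: hP power_mult_distrib eval_nat_numeral algebra_simps)
    also have "\<dots> \<le> k3 * A * h^3 * (2 * (W om ^ 4 + ?P ^ 4) + ?P ^ 4)"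
      using A k h01 by (intro mult_left_mono add_mono young4) auto
    also have "\<dots> \<le> k3 * A * h^3 * (3 * (W om ^ 4 + ?P ^ 4))" using A k h01 by (intro mult_left_mono) auto
    finally show ?thesis by (simp add: algebra_simps)
  qed
  have kA3: "0 \<le> 3 * k3 * A * h^3" using A k h01 by simp
  note Br = WP_bound[OF s(1,2) rm rle kA3]
  have Er: "\<bar>\<integral>om. r om \<partial>M\<bar> \<le> 3 * k3 * (1 + cL) * A * h^3 * m4" using Br(2) by (simp add: ac_simps)
  define T where "T = (\<lambda>om. u (?y om) - h * p (?y om) (g (?y om)) + h^2 / 2 * (q (?y om) (g (?y om)) (g (?y om)) + Sg q a om))"
  have Ti: "integrable M T" unfolding T_def using ui L(1) Q(1) Si by auto
  have ET: "(\<integral>om. T om \<partial>M) = ?Eu - h * ?Eg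
     + h^2 / 2 * (?Eqg + ?ES)"
    unfolding T_def using ui L(1) Q(1) Si by simp
  have Pm: "(\<lambda>om. Pu a h u (?y om)) \<in> borel_measurable M" by (rule measurable_compose[OF Ya Pu_meas[OF a0 jetD(1)[OF j]]])
  define r' where "r' = (\<lambda>om. Pu a h u (?y om) - T om)"
  have rm': "r' \<in> borel_measurable M" unfolding r'_def using Pm Ti by auto
  have V': "integrable M (\<lambda>om. 3 * K^4 * gam TYPE('n) * k3 * A * h^3 * W om ^ 4)" using Wi by auto
  have rle': "\<bar>r' om\<bar> \<le> 3 * K^4 * gam TYPE('n) * k3 * A * h^3 * W om ^ 4" for om
    unfolding r'_def T_def Sg_def W_def by (rule scheme_local[OF h01 a0 j A])
  note Br' = integral_bound[OF rm' V' rle']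
  have "integrable M (\<lambda>om. r' om + T om)" by (intro Bochner_Integration.integrable_add Br'(1) Ti)
  then show Pi: "integrable M (\<lambda>om. Pu a h u (Y a om))" by (simp add: r'_def)
  have "?EP = (\<integral>om. r' om + T om \<partial>M)" by (simp add: r'_def)
  also have "\<dots> = (\<integral>om. r' om \<partial>M) + (\<integral>om. T om \<partial>M)" by (intro Bochner_Integration.integral_add Br'(1) Ti)
  finally have EP: "?EP = (\<integral>om. r' om \<partial>M) + (\<integral>om. T om \<partial>M)" .
  have "?EU = (\<integral>om. r om + (u (?y om) + p (?y om) (?d om) + q (?y om) (?d om) (?d om) / 2) \<partial>M)" by (simp add: r_def)
  also have "\<dots> = (\<integral>om. r om \<partial>M) + (?Eu + ?Ep + ?Eq / 2)"
    using Br(1) ui L(2) Q(2) by simp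
  finally have EU: "?EU = \<dots>" .
  have E': "\<bar>\<integral>om. r' om \<partial>M\<bar> \<le> 3 * K^4 * gam TYPE('n) * k3 * A * h^3 * m4" using Br'(2) by (simp add: m4_def)
  have "?EU - ?EP =
    (?Ep + h * ?Eg) +
    (?Eq - h^2 * (?Eqg + ?ES)) / 2
    + (\<integral>om. r om \<partial>M) - (\<integral>om. r' om \<partial>M)"
    unfolding EU EP ET by (simp add: field_simps)
  moreover have "cT * A * h^3 * m4 = c2 * A * h^3 * m4 + (c3 * (k2 * A) * h^3 * m4) / 2 + 3 * k3 * (1 + cL) * A * h^3 * m4 + 3 * K^4 * gam TYPE('n) * k3 * A * h^3 * m4"
    by (simp add: cT_def algebra_simps)
  moreover have "\<bar>(?Eq - h^2 * (?Eqg + ?ES)) / 2\<bar> \<le> (c3 * (k2 * A) * h^3 * m4) / 2"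
    using Q(3) by (simp only: abs_divide abs_numeral divide_right_mono)
  ultimately show "\<bar>?EU - ?EP\<bar> \<le> cT * A * h^3 * m4"
    using L(3) Er E' by linarith
qed

text \<open>Lyapunov estimate for \<open>w^4\<close>. The term linear in the increment yields the
  dissipation \<open>2 * \<mu> * h * m4\<close> up to a constant; the rest is of order
  \<open>h^2 * m4\<close> and consumes at most half of it.\<close>

lemma moment_step:
  shows "(\<integral>om. w (Y (a + h) om) ^ 4 \<partial>M) \<le> (1 - \<mu> * h) * m4 + 2 * \<mu> * h"
proof -
  have s: "a \<le> a + h" "a + h \<le> a + h" "a \<le> a" using h01 by auto
  note [measurable] = smooth3D(1)[OF gs]
  let ?y = "\<lambda>om. Y a om" and ?d = "\<lambda>om. Y (a + h) om - Y a om" and ?P = "P (a + h)"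
  \<comment> \<open>The derivative of \<open>w^4\<close>.\<close>
  define l where "l = (\<lambda>x k. 4 * ((w x)^2 * ((x - xs) \<bullet> k)))"
  have l1: "linear (l x)" for x unfolding l_def by (rule linearI) (simp_all add: inner_add_right algebra_simps)
  have l2: "(\<lambda>x. l x k) \<in> borel_measurable borel" for k unfolding l_def by measurable
  have l3: "\<bar>l x k\<bar> \<le> 4 * w x ^ 3 * norm k" for x k
  proof -
    have "\<bar>(x - xs) \<bullet> k\<bar> \<le> w x * norm k"
      using Cauchy_Schwarz_ineq2[of "x - xs" k] mult_right_mono[OF dist_le_w[of x], of "norm k"] by simp
    then have "(w x)^2 * \<bar>(x - xs) \<bullet> k\<bar> \<le> (w x)^2 * (w x * norm k)" by (intro mult_left_mono) auto
    then show ?thesis by (simp add: l_def abs_mult eval_nat_numeral ac_simps)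
  qed
  note L = weak_first[OF s(1,2) l1 l2 l3, simplified]
  have lg: "2 * \<mu> * (W om ^ 4) - 2 * \<mu> \<le> l (?y om) (g (?y om))" for om
  proof -
    have "\<mu> * ((W om)^2 - 1) \<le> (?y om - xs) \<bullet> g (?y om)"
      using mono[where x = xs and y = "?y om"] by (simp add: W_def w_sq g0 inner_commute)
    then have "4 * ((W om)^2 * (\<mu> * ((W om)^2 - 1))) \<le> l (?y om) (g (?y om))"
      unfolding l_def W_def by (intro mult_left_mono) auto
    \<comment> \<open>Completing the square trades the term quadratic in \<open>W\<close> for a
      constant.\<close>
    moreover have "4 * ((W om)^2 * (\<mu> * ((W om)^2 - 1))) = 2 * \<mu> * (W om ^ 4) - 2 * \<mu> + 2 * \<mu> * ((W om)^2 - 1)^2"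
      by (simp add: power2_eq_square power4_eq_xxxx algebra_simps)
    moreover have "0 \<le> 2 * \<mu> * ((W om)^2 - 1)^2" using mu by simp
    ultimately show ?thesis by linarith
  qed
  have le: "w (Y (a + h) om) ^ 4 \<le> W om ^ 4 + l (?y om) (?d om) + h^2 * (8 * W om ^ 4 + 11 * ?P om ^ 4)" for om
  proof -
    \<comment> \<open>In the product space the weight is a norm and the increment moves only the
      second component, so \<open>norm_add_pow4\<close> applies.\<close>
    have "w (Y (a + h) om) = norm ((1::real, ?y om - xs) + (0, ?d om))" by (simp add: w_def)
    then have "w (Y (a + h) om) ^ 4 \<le> W om ^ 4 + 4 * ((W om)^2 * ((?y om - xs) \<bullet> ?d om)) + 8 * ((W om)^2 * (h * ?P om)^2) + 3 * (h * ?P om) ^ 4"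
      using norm_add_pow4[of "(1::real, ?y om - xs)" "(0::real, ?d om)"] by (simp add: W_def w_def hP[symmetric])
    also have "4 * ((W om)^2 * ((?y om - xs) \<bullet> ?d om)) = l (?y om) (?d om)" by (simp add: l_def W_def)
    finally have 1: "w (Y (a + h) om) ^ 4 \<le> W om ^ 4 + l (?y om) (?d om) + 8 * ((W om)^2 * (h * ?P om)^2) + 3 * (h * ?P om) ^ 4" .
    have "8 * ((W om)^2 * (h * ?P om)^2) = h^2 * (8 * ((W om)^2 * (?P om)^2))" by (simp add: power_mult_distrib)
    also have "\<dots> \<le> h^2 * (8 * (W om ^ 4 + ?P om ^ 4))" by (intro mult_left_mono young4) auto
    finally have 2: "8 * ((W om)^2 * (h * ?P om)^2) \<le> h^2 * (8 * (W om ^ 4 + ?P om ^ 4))" .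
    have "h ^ 4 \<le> h^2" using h01 by (intro power_decreasing) auto
    then have "h ^ 4 * (3 * ?P om ^ 4) \<le> h^2 * (3 * ?P om ^ 4)" by (intro mult_right_mono) auto
    then have "3 * (h * ?P om) ^ 4 \<le> h^2 * (3 * ?P om ^ 4)" by (simp add: power_mult_distrib)
    then show ?thesis using 1 2 by (simp add: algebra_simps)
  qed
  have "(\<integral>om. w (Y (a + h) om) ^ 4 \<partial>M) \<le> (\<integral>om. W om ^ 4 + l (?y om) (?d om) + h^2 * (8 * W om ^ 4 + 11 * ?P om ^ 4) \<partial>M)"
    by (rule integral_mono[OF wi[OF s(1,2)] _ le]) (use Wi Pi[OF s(1,2)] L(2) in auto)
  also have "\<dots> = m4 + (\<integral>om. l (?y om) (?d om) \<partial>M) + h^2 * (8 * m4 + 11 * (\<integral>om. ?P om ^ 4 \<partial>M))"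
    using Wi Pi[OF s(1,2)] L(2) by (simp add: m4_def)
  also have "\<dots> \<le> m4 + (\<integral>om. l (?y om) (?d om) \<partial>M) + h^2 * (8 * m4 + 11 * (cL * m4))"
    using PE[OF s(1,2)] by (intro add_left_mono mult_left_mono) auto
  finally have 1: "(\<integral>om. w (Y (a + h) om) ^ 4 \<partial>M) \<le> \<dots>" .
  have "2 * \<mu> * m4 - 2 * \<mu> = (\<integral>om. 2 * \<mu> * (W om ^ 4) - 2 * \<mu> \<partial>M)" using Wi by (simp add: m4_def prob_space)
  also have "\<dots> \<le> (\<integral>om. l (?y om) (g (?y om)) \<partial>M)" by (rule integral_mono[OF _ L(1) lg]) (use Wi in auto)
  finally have "h * (2 * \<mu> * m4 - 2 * \<mu>) \<le> h * (\<integral>om. l (?y om) (g (?y om)) \<partial>M)" using h01 by (intro mult_left_mono) auto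
  moreover have "\<bar>(\<integral>om. l (?y om) (?d om) \<partial>M) + h * (\<integral>om. l (?y om) (g (?y om)) \<partial>M)\<bar> \<le> 16 * K^2 * (1 + cL) * h^2 * m4"
    using L(3) by (simp add: ac_simps)
  ultimately have 2: "(\<integral>om. l (?y om) (?d om) \<partial>M) \<le> 16 * K^2 * (1 + cL) * h^2 * m4 - h * (2 * \<mu> * m4 - 2 * \<mu>)" by linarith
  have "h^2 * (8 * m4 + 11 * (cL * m4)) \<le> h^2 * (11 * m4 + 11 * (cL * m4))" by (intro mult_left_mono) auto
  moreover have "16 * K^2 * (1 + cL) * h^2 * m4 + h^2 * (11 * m4 + 11 * (cL * m4)) = (cM * h) * (h * m4)"
    by (simp add: cM_def power2_eq_square algebra_simps)
  moreover have "(cM * h) * (h * m4) \<le> \<mu> * (h * m4)" using sm h01 by (intro mult_right_mono) (auto simp: small2_def)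
  ultimately have "(\<integral>om. w (Y (a + h) om) ^ 4 \<partial>M) \<le> m4 + \<mu> * (h * m4) - h * (2 * \<mu> * m4 - 2 * \<mu>)" using 1 2 by linarith
  then show ?thesis by (simp add: algebra_simps)
qed

end

context sde
begin

lemma step_at: "0 \<le> a \<Longrightarrow> integrable M (\<lambda>om. w (Y a om) ^ 4) \<Longrightarrow> step g g1 g2 \<sigma> \<sigma>1 \<sigma>2 xs K \<mu> M F B h x0 Y a"
  by unfold_locales

text \<open>The map from \<open>m\<close> to \<open>(1 - \<mu> * h) * m + 2 * \<mu> * h\<close> has
  the fixed point \<open>2\<close>, so the bound \<open>w x0 ^ 4 + 2\<close> is preserved from step
  to step.\<close>

lemma moments:
  shows "integrable M (\<lambda>om. w (Y (real n * h) om) ^ 4) \<and> (\<integral>om. w (Y (real n * h) om) ^ 4 \<partial>M) \<le> w x0 ^ 4 + 2"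
proof (induction n)
  case 0
  have [measurable]: "Y 0 \<in> borel_measurable M" by (rule Y_meas) simp
  have ae: "AE om in M. w (Y 0 om) ^ 4 = w x0 ^ 4" using sol unfolding sde_solution_def by (auto elim: AE_mp)
  have "integrable M (\<lambda>om. w (Y 0 om) ^ 4) \<longleftrightarrow> integrable M (\<lambda>om. w x0 ^ 4)" by (intro integrable_cong_AE ae) auto
  moreover have "(\<integral>om. w (Y 0 om) ^ 4 \<partial>M) = (\<integral>om. w x0 ^ 4 \<partial>M)" by (intro integral_cong_AE ae) auto
  ultimately show ?case by (simp add: prob_space)
next
  case (Suc n)
  interpret step g g1 g2 \<sigma> \<sigma>1 \<sigma>2 xs K \<mu> M F B h x0 Y "real n * h"
    by (rule step_at) (use Suc h01 in auto)
  have eq: "real (Suc n) * h = real n * h + h" by (simp add: algebra_simps)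
  have 1: "0 \<le> 1 - \<mu> * h" "0 \<le> \<mu> * h" using h_small h01 mu by (auto simp: small_def)
  have "(\<integral>om. w (Y (real n * h + h) om) ^ 4 \<partial>M) \<le> (1 - \<mu> * h) * m4 + 2 * \<mu> * h" by (rule moment_step)
  also have "\<dots> \<le> (1 - \<mu> * h) * (w x0 ^ 4 + 2) + 2 * \<mu> * h"
    using Suc 1 by (intro add_right_mono mult_left_mono) (auto simp: m4_def W_def)
  also have "\<dots> = w x0 ^ 4 + 2 - (\<mu> * h) * w x0 ^ 4" by (simp add: algebra_simps)
  also have "\<dots> \<le> w x0 ^ 4 + 2" using 1 by simp
  finally show ?case unfolding eq using wi[of "real n * h + h"] h01 by simp
qed

end

section \<open>The scheme as a Markov chain\<close>

context coeffs
begin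

text \<open>The scheme as a deterministic function of the noise. The step from \<open>n\<close> to
  \<open>n + 1\<close> reads the noise with index \<open>n + 1\<close>, so the state after
  \<open>n\<close> steps depends on the entries \<open>1\<close> to \<open>n\<close>.\<close>

primrec run :: "real \<Rightarrow> real^'n \<Rightarrow> nat \<Rightarrow> (nat \<Rightarrow> real^'n) \<Rightarrow> real^'n" where
  "run h x 0 f = x"
| "run h x (Suc n) f = \<Phi> (real n * h) h (run h x n f) (f (Suc n))"

lemma run_restrict: "run h x n (restrict f {1..n}) = run h x n f"
proof -
  have "run h x n (restrict f {1..m}) = run h x n f" if "n \<le> m" for m using that by (induction n) auto
  then show ?thesis by simp
qed

lemma run_meas:
  assumes h: "0 \<le> h"
  shows "run h x n \<in> borel_measurable (PiM {1..n} (\<lambda>_. borel))"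
proof -
  \<comment> \<open>The index set \<open>{1..m}\<close> is kept fixed during the induction on
    \<open>n\<close>.\<close>
  have "run h x n \<in> borel_measurable (PiM {1..m} (\<lambda>_. borel))" if "n \<le> m" for m
    using that
  proof (induction n)
    case (Suc n)
    have 1: "run h x n \<in> borel_measurable (PiM {1..m} (\<lambda>_. borel))" using Suc by simp
    have 2: "(\<lambda>f. f (Suc n)) \<in> borel_measurable (PiM {1..m} (\<lambda>_. borel))"
      using Suc.prems by (intro measurable_component_singleton) auto
    have "0 \<le> real n * h" using h by simp
    from measurable_compose[OF measurable_Pair[OF 1 2] \<Phi>_joint[OF this]] show ?case by simp
  next
    case 0
    have "run h x 0 = (\<lambda>_. x)" by (rule ext) simp
    then show ?case by simp
  qed
  then show ?thesis by simp
qed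

end

locale scheme = coeffs g g1 g2 \<sigma> \<sigma>1 \<sigma>2 xs K \<mu> + prob_space M
  for g :: "real^'n \<Rightarrow> real^'n" and g1 g2 \<sigma> \<sigma>1 \<sigma>2 xs K \<mu> and M :: "'v measure" +
  fixes \<gamma> :: "nat \<Rightarrow> 'v \<Rightarrow> real^'n" and h :: real and x0 :: "real^'n"
  assumes hs: "small h" and ind: "indep_vars (\<lambda>_. borel) \<gamma> {1..}"
    and law: "\<And>n. 1 \<le> n \<Longrightarrow> distr M borel (\<gamma> n) = \<nu>"
begin

definition X :: "nat \<Rightarrow> 'v \<Rightarrow> real^'n" where "X n om = run h x0 n (\<lambda>i. \<gamma> i om)"

lemma h01: "0 < h" "h \<le> 1" using hs by (auto simp: small_def)

lemma X_Suc: "X (Suc n) om = \<Phi> (real n * h) h (X n om) (\<gamma> (Suc n) om)" by (simp add: X_def)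

text \<open>\<open>X n\<close> is a function of the first \<open>n\<close> noise variables, which
  form a block disjoint from the next one.\<close>

lemma X_indep: "indep_var borel (X n) borel (\<gamma> (Suc n))"
proof -
  have "indep_var (PiM {1..n} (\<lambda>_. borel)) (\<lambda>om. restrict (\<lambda>i. \<gamma> i om) {1..n}) (PiM {Suc n} (\<lambda>_. borel)) (\<lambda>om. restrict (\<lambda>i. \<gamma> i om) {Suc n})"
    by (rule indep_var_restrict[OF ind]) auto
  from indep_var_compose[OF this run_meas[of h x0 n] measurable_component_singleton[of "Suc n"]]
  have "indep_var borel (run h x0 n \<circ> (\<lambda>om. restrict (\<lambda>i. \<gamma> i om) {1..n})) borel ((\<lambda>f. f (Suc n)) \<circ> (\<lambda>om. restrict (\<lambda>i. \<gamma> i om) {Suc n}))"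
    using h01 by simp
  moreover have "run h x0 n \<circ> (\<lambda>om. restrict (\<lambda>i. \<gamma> i om) {1..n}) = X n"
    unfolding X_def[abs_def] o_def run_restrict ..
  moreover have "(\<lambda>f. f (Suc n)) \<circ> (\<lambda>om. restrict (\<lambda>i. \<gamma> i om) {Suc n}) = \<gamma> (Suc n)" by auto
  ultimately show ?thesis by simp
qed

lemma X_meas [measurable]: "X n \<in> borel_measurable M"
  and \<gamma>_meas: "\<gamma> (Suc n) \<in> borel_measurable M"
  using X_indep indep_var_rv1 indep_var_rv2 by blast+

text \<open>Finiteness only, which makes test functions integrable; the moments that enter the error
  estimate, uniform in time, are those of the solution.\<close>

lemma X_moment: "integrable M (\<lambda>om. w (X n om) ^ 4)"
proof (induction n)
  case 0
  then show ?case by (simp add: X_def)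
next
  case (Suc n)
  note [measurable] = \<gamma>_meas[of n]
  have N1m: "(N1 :: real^'n \<Rightarrow> real) \<in> borel_measurable borel" unfolding N1_def by measurable
  have t: "0 \<le> real n * h" using h01 by simp
  have "integrable \<nu> (\<lambda>z :: real^'n. N1 z ^ 4)" by (rule nu_integrable[of _ 1 4]) (use N1m in auto)
  then have "integrable M (\<lambda>om. N1 (\<gamma> (Suc n) om) ^ 4)"
    using N1m by (simp add: law[of "Suc n", symmetric] integrable_distr_eq)
  moreover have "indep_var borel ((\<lambda>x. w x ^ 4) \<circ> X n) borel ((\<lambda>z. N1 z ^ 4) \<circ> \<gamma> (Suc n))"
    by (rule indep_var_compose[OF X_indep]) (use N1m in measurable)
  ultimately have i: "integrable M (\<lambda>om. w (X n om) ^ 4 * N1 (\<gamma> (Suc n) om) ^ 4)"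
    using indep_var_integrable[of "(\<lambda>x. w x ^ 4) \<circ> X n" "(\<lambda>z. N1 z ^ 4) \<circ> \<gamma> (Suc n)"] Suc by (simp add: o_def)
  show ?case
  proof (rule integral_bound(1))
    show "(\<lambda>om. w (X (Suc n) om) ^ 4) \<in> borel_measurable M" by measurable
    show "integrable M (\<lambda>om. (2 * K) ^ 4 * (w (X n om) ^ 4 * N1 (\<gamma> (Suc n) om) ^ 4))" using i by simp
    show "\<bar>w (X (Suc n) om) ^ 4\<bar> \<le> (2 * K) ^ 4 * (w (X n om) ^ 4 * N1 (\<gamma> (Suc n) om) ^ 4)" for om
      using power_mono[OF step_bounds(2)[OF h01 t, of "X n om" "\<gamma> (Suc n) om"], of 4] by (simp add: X_Suc power_mult_distrib ac_simps)
  qed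
qed

lemma X_integrable:
  assumes u: "u \<in> borel_measurable borel" "\<And>y. \<bar>u y\<bar> \<le> C * w y ^ 4"
  shows "integrable M (\<lambda>om. u (X n om))"
  by (rule integral_bound(1)[OF measurable_compose[OF X_meas u(1)] integrable_mult_right[OF X_moment] u(2)])

text \<open>Fubini for the joint law of \<open>X n\<close> and the next noise, a product by
  \<open>X_indep\<close>.\<close>

lemma markov:
  assumes u: "u \<in> borel_measurable borel" "\<And>y. \<bar>u y\<bar> \<le> C * w y ^ 4"
  shows "(\<integral>om. u (X (Suc n) om) \<partial>M) = (\<integral>om. Pu (real n * h) h u (X n om) \<partial>M)"
proof -
  have t: "0 \<le> real n * h" using h01 by simp
  note [measurable] = \<gamma>_meas[of n] u(1) \<Phi>_joint[OF t, of h]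
  let ?f = "\<lambda>z. u (\<Phi> (real n * h) h (fst z) (snd z))"
  have pair: "distr M borel (X n) \<Otimes>\<^sub>M \<nu> = distr M (borel \<Otimes>\<^sub>M borel) (\<lambda>om. (X n om, \<gamma> (Suc n) om))"
    using X_indep[of n] law[of "Suc n"] unfolding indep_var_distribution_eq by simp
  interpret X: prob_space "distr M borel (X n)" by (rule prob_space_distr) measurable
  interpret N: prob_space "\<nu> :: (real^'n) measure" by (rule prob_space_gauss) simp
  interpret pair_sigma_finite "distr M borel (X n)" "\<nu> :: (real^'n) measure" ..
  have i: "integrable (distr M borel (X n) \<Otimes>\<^sub>M \<nu>) ?f"
    unfolding pair using X_integrable[OF u, of "Suc n"] by (subst integrable_distr_eq) (auto simp: X_Suc)
  have "(\<integral>om. u (X (Suc n) om) \<partial>M) = (\<integral>z. ?f z \<partial>(distr M borel (X n) \<Otimes>\<^sub>M \<nu>))"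
    unfolding pair by (subst integral_distr) (auto simp: X_Suc)
  also have "\<dots> = (\<integral>x. Pu (real n * h) h u x \<partial>distr M borel (X n))"
    using integral_fst'[OF i] by (simp add: Pu_def)
  also have "\<dots> = (\<integral>om. Pu (real n * h) h u (X n om) \<partial>M)"
    by (rule integral_distr) (use Pu_meas[OF t u(1)] in auto)
  finally show ?thesis .
qed

end

section \<open>The global weak error\<close>

context coeffs
begin

text \<open>The gradient of \<open>\<phi>\<close> grows at most linearly from its value at
  \<open>xs\<close>, which the weight absorbs. Bounded second and third derivatives fit because
  \<open>w\<close>, \<open>k2\<close> and \<open>k3\<close> are at least one. This produces the sum
  of seminorms in the theorem.\<close>

lemma jet_smooth:
  fixes \<phi> :: "real^'n \<Rightarrow> real"
  assumes f: "class_C 3 \<phi>" and b: "bounded_deriv 2 \<phi>" "bounded_deriv 3 \<phi>"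
  shows "jet (norm (grad \<phi> xs) + deriv_norm 2 \<phi> + deriv_norm 3 \<phi>) \<phi> (\<lambda>x k. iter_deriv \<phi> [k] x) (\<lambda>x k l. iter_deriv \<phi> [k, l] x)"
proof -
  let ?a = "norm (grad \<phi> xs)" and ?K2 = "deriv_norm 2 \<phi>" and ?K3 = "deriv_norm 3 \<phi>"
  have d2: "dbound 2 ?K2 \<phi>" and d3: "dbound 3 ?K3 \<phi>" by (rule dbound_deriv_norm[OF f]; use b in simp)+
  have K: "0 \<le> ?K2" "0 \<le> ?K3" "0 \<le> ?a" using b by (auto intro: deriv_norm_nonneg)
  define A where "A = ?a + ?K2 + ?K3"
  have A: "?K2 \<le> A" "?K3 \<le> A" "0 \<le> A" using K by (auto simp: A_def)
  have p: "\<bar>iter_deriv \<phi> [k] x\<bar> \<le> A * w x * norm k" for x k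
  proof -
    have "\<bar>iter_deriv \<phi> [k] (xs + (x - xs)) - iter_deriv \<phi> [k] xs\<bar> \<le> ?K2 * norm k * norm (x - xs)"
      using taylor_bound[OF f, of "[k]" 1 ?K2 xs "x - xs"] d2 by (simp add: numeral_2_eq_2)
    moreover have "?K2 * norm k * norm (x - xs) \<le> ?K2 * norm k * w x" using K dist_le_w[of x] by (intro mult_left_mono) auto
    moreover have "\<bar>iter_deriv \<phi> [k] xs\<bar> \<le> ?a * norm k"
      using Cauchy_Schwarz_ineq2[of "grad \<phi> xs" k] grad_gderiv(2)[OF f, of xs k] by simp
    moreover have "?a * norm k \<le> ?a * norm k * w x" using K mult_left_mono[OF w_ge1[of x], of "?a * norm k"] by simp
    moreover have "0 \<le> ?K3 * norm k * w x" using K by simp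
    moreover have "A * w x * norm k = ?a * norm k * w x + ?K2 * norm k * w x + ?K3 * norm k * w x" by (simp add: A_def algebra_simps)
    ultimately show ?thesis by simp
  qed
  have q: "\<bar>iter_deriv \<phi> [k, l] x\<bar> \<le> k2 * A * w x * norm k * norm l" for x k l
  proof -
    have "\<bar>iter_deriv \<phi> [k, l] x\<bar> \<le> ?K2 * (norm k * norm l)" using d2[unfolded dbound_def, rule_format, of "[k, l]" x] by simp
    also have "\<dots> \<le> (k2 * A * w x) * (norm k * norm l)"
    proof (intro mult_right_mono)
      have "1 * A \<le> k2 * A" using A k2_ge1 by (intro mult_right_mono) auto
      moreover have "k2 * A * 1 \<le> k2 * A * w x" using A k2_ge1 by (intro mult_left_mono) auto
      ultimately show "?K2 \<le> k2 * A * w x" using A by linarith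
    qed auto
    finally show ?thesis by (simp add: ac_simps)
  qed
  have r: "\<bar>\<phi> (x + d) - \<phi> x - iter_deriv \<phi> [d] x - iter_deriv \<phi> [d, d] x / 2\<bar> \<le> k3 * A * (w x + w (x + d)) * norm d ^ 3" for x d
  proof -
    have "\<bar>\<phi> (x + d) - \<phi> x - iter_deriv \<phi> [d] x - iter_deriv \<phi> [d, d] x / 2\<bar> \<le> ?K3 * norm d ^ 3 / 6"
      using taylor_bound[OF f, of "[]" 3 ?K3 x d] d3 by (simp add: eval_nat_numeral algebra_simps)
    also have "\<dots> \<le> ?K3 * norm d ^ 3" using K by simp
    also have "\<dots> \<le> k3 * A * (w x + w (x + d)) * norm d ^ 3"
    proof (intro mult_right_mono)
      have "1 * A \<le> k3 * A" using A k3_ge1 by (intro mult_right_mono) auto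
      moreover have "1 \<le> w x + w (x + d)" using w_ge1[of x] w_nn[of "x + d"] by linarith
      then have "k3 * A * 1 \<le> k3 * A * (w x + w (x + d))" using A k3_ge1 by (intro mult_left_mono) auto
      ultimately show "?K3 \<le> k3 * A * (w x + w (x + d))" using A by linarith
    qed auto
    finally show ?thesis .
  qed
  have m: "\<phi> \<in> borel_measurable borel" "(\<lambda>x. iter_deriv \<phi> [k] x) \<in> borel_measurable borel" "(\<lambda>x. iter_deriv \<phi> [k, l] x) \<in> borel_measurable borel" for k l
    using class_C_cont[OF f, of "[]"] class_C_cont[OF f, of "[k]"] class_C_cont[OF f, of "[k, l]"]
    by (auto intro!: borel_measurable_continuous_onI)
  show ?thesis
    unfolding jet_def A_def[symmetric] using m p q r class_C_linear[OF f, of "[]"] class_C_bilinear[OF f] by simp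
qed

text \<open>Apart from positivity of \<open>h\<close>, every condition is implied by one of the form
  \<open>c * h ^ k < d\<close> with \<open>d > 0\<close>.\<close>

lemma eventually_small2: "\<forall>\<^sub>F h in at_right 0. small2 h"
proof -
  have lin: "\<forall>\<^sub>F h in at_right 0. c * h ^ k < d" if "0 < d" "0 < k" for c d :: real and k
  proof (rule order_tendstoD(2)[OF _ that(1)])
    have "((\<lambda>h. c * h ^ k) \<longlongrightarrow> c * 0 ^ k) (at_right 0)" by (intro tendsto_intros)
    moreover have "c * 0 ^ k = 0" using that by simp
    ultimately show "((\<lambda>h. c * h ^ k) \<longlongrightarrow> 0) (at_right 0)" by (simp only:)
  qed
  have "\<forall>\<^sub>F h in at_right 0. 1 * h ^ 1 < (1::real)" "\<forall>\<^sub>F h in at_right 0. kap * h ^ 1 < 2 * \<mu>"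
    "\<forall>\<^sub>F h in at_right 0. 2 * K^2 * gam TYPE('n) * h ^ 1 < \<mu>" "\<forall>\<^sub>F h in at_right 0. \<mu> * h ^ 1 < 1"
    "\<forall>\<^sub>F h in at_right 0. cX * h ^ 4 < 1 / 2" "\<forall>\<^sub>F h in at_right 0. cM * h ^ 1 < \<mu>"
    by (rule lin; use mu in simp)+
  with eventually_at_right_less[of "0::real"] show ?thesis by eventually_elim (auto simp: small2_def small_def)
qed

text \<open>With \<open>n = norm (x - xs)\<close>, the bounds
  \<open>w x ^ 4 \<le> 2 + 2 * n ^ 4\<close> and \<open>n ^ 4 \<le> 1 + n ^ 5\<close> bring the
  moment bound into the form of the theorem; the constants add up to six.\<close>

lemma w_pow4_le: "w x ^ 4 + 2 \<le> 6 * (1 + norm (x - xs) ^ 5)"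
proof -
  define n where "n = norm (x - xs)"
  have n: "0 \<le> n" by (simp add: n_def)
  have "n ^ 4 \<le> 1 + n ^ 5"
  proof (cases "n \<le> 1")
    case True
    then have "n ^ 4 \<le> 1" using n by (simp add: power_le_one)
    moreover have "0 \<le> n ^ 5" using n by simp
    ultimately show ?thesis by linarith
  next
    case False
    then have "n ^ 4 \<le> n ^ 5" by (intro power_increasing) auto
    then show ?thesis by simp
  qed
  moreover have "w x ^ 4 \<le> 2 + 2 * n ^ 4"
  proof -
    have "w x ^ 4 = ((w x)^2)^2" by simp
    also have "\<dots> = 1 + 2 * n^2 + (n^2)^2" unfolding w_sq n_def[symmetric] by (simp add: power2_sum)
    also have "\<dots> \<le> 2 + 2 * (n^2)^2" using sum_squares_bound[of 1 "n^2"] by simp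
    finally show ?thesis by simp
  qed
  moreover have "0 \<le> n ^ 5" using n by simp
  ultimately have "w x ^ 4 + 2 \<le> 6 + 6 * n ^ 5" by linarith
  then show ?thesis unfolding n_def by simp
qed

end

context sde
begin

lemma weak_error:
  assumes sch: "scheme g g1 g2 \<sigma> \<sigma>1 \<sigma>2 xs K \<mu> N \<gamma> h" and j: "jet A \<phi> p q" and A: "0 \<le> A"
  shows "integrable N (\<lambda>om. \<phi> (run h x0 n (\<lambda>i. \<gamma> i om)))" "integrable M (\<lambda>om. \<phi> (Y (real n * h) om))"
    "\<bar>(\<integral>om. \<phi> (run h x0 n (\<lambda>i. \<gamma> i om)) \<partial>N) - (\<integral>om. \<phi> (Y (real n * h) om) \<partial>M)\<bar> \<le> cT / lam * A * (w x0 ^ 4 + 2) * h^2"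
proof -
  interpret S: scheme g g1 g2 \<sigma> \<sigma>1 \<sigma>2 xs K \<mu> N \<gamma> h x0 by (rule sch)
  have step: "step g g1 g2 \<sigma> \<sigma>1 \<sigma>2 xs K \<mu> M F B h x0 Y (real m * h)" for m
    by (rule step_at) (use moments[of m] h01 in auto)
  have X: "run h x0 m (\<lambda>i. \<gamma> i om) = S.X m om" for m om by (simp add: S.X_def)
  define r where "r = 1 - lam * h"
  have lam: "0 < lam" "0 \<le> r" "0 < lam * h" "1 - r = lam * h" using mu h_small h01 by (auto simp: lam_def r_def small_def)
  \<comment> \<open>As \<open>\<sigma>\<close> depends on time, stage \<open>i\<close> uses the
    transition that starts at time \<open>(n - Suc i) * h\<close>, counted back from the final
    time.\<close>
  define V where "V = rec_nat \<phi> (\<lambda>i v. Pu (real (n - Suc i) * h) h v)"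
  have V: "V 0 = \<phi>" "V (Suc i) = Pu (real (n - Suc i) * h) h (V i)" for i by (auto simp: V_def)
  have Vj: "\<exists>p q. jet (A * r ^ i) (V i) p q" for i
  proof (induction i)
    case 0
    then show ?case using j by (auto simp: V)
  next
    case (Suc i)
    then obtain p q where pq: "jet (A * r ^ i) (V i) p q" by blast
    have "0 \<le> A * r ^ i" using A lam by simp
    from jet_step[OF h_small _ pq this, of "real (n - Suc i) * h"] show ?case
      using h01 by (auto simp: V r_def ac_simps)
  qed
  have Ar: "0 \<le> A * r ^ i" for i using A lam by simp
  have Vm: "V i \<in> borel_measurable borel" for i using Vj[of i] jetD(1) by blast
  have Vg: "\<bar>V i y\<bar> \<le> (\<bar>V i xs\<bar> + 64 * k2 * k3 * (A * r ^ i)) * w y ^ 4" for i y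
    using Vj[of i] jet_growth4[OF _ Ar[of i]] by blast
  \<comment> \<open>For the scheme the telescoping is exact by the Markov property, so the error
    arises from the solution alone.\<close>
  have ES: "(\<integral>om. \<phi> (S.X n om) \<partial>N) = (\<integral>om. V i (S.X (n - i) om) \<partial>N)" if "i \<le> n" for i
    using that
  proof (induction i)
    case (Suc i)
    have "n - i = Suc (n - Suc i)" using Suc.prems by simp
    then show ?case using Suc S.markov[OF Vm Vg, of i "n - Suc i"] by (simp add: V)
  qed (simp add: V)
  define c where "c = cT * A * h^3 * (w x0 ^ 4 + 2)"
  have EY: "\<bar>(\<integral>om. V i (Y (real (n - i) * h) om) \<partial>M) - (\<integral>om. V (Suc i) (Y (real (n - Suc i) * h) om) \<partial>M)\<bar> \<le> c * r ^ i" if "i < n" for i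
  proof -
    interpret step g g1 g2 \<sigma> \<sigma>1 \<sigma>2 xs K \<mu> M F B h x0 Y "real (n - Suc i) * h" by (rule step)
    obtain p q where pq: "jet (A * r ^ i) (V i) p q" using Vj by blast
    have "n - i = Suc (n - Suc i)" using that by simp
    then have eq: "real (n - i) * h = real (n - Suc i) * h + h" by (simp add: algebra_simps)
    have "\<bar>(\<integral>om. V i (Y (real (n - i) * h) om) \<partial>M) - (\<integral>om. V (Suc i) (Y (real (n - Suc i) * h) om) \<partial>M)\<bar> \<le> cT * (A * r ^ i) * h^3 * m4"
      unfolding eq V by (rule one_step(2)[OF pq Ar])
    also have "\<dots> \<le> cT * (A * r ^ i) * h^3 * (w x0 ^ 4 + 2)"
      using moments[of "n - Suc i"] cT0 Ar[of i] h01 by (intro mult_left_mono) (auto simp: m4_def W_def)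
    finally show ?thesis by (simp add: c_def ac_simps)
  qed
  have tel: "\<bar>(\<integral>om. \<phi> (Y (real n * h) om) \<partial>M) - (\<integral>om. V i (Y (real (n - i) * h) om) \<partial>M)\<bar> \<le> (\<Sum>k<i. c * r ^ k)" if "i \<le> n" for i
    using that
  proof (induction i)
    case (Suc i)
    then show ?case using EY[of i] by simp
  qed (simp add: V)
  \<comment> \<open>After \<open>n\<close> stages both sides are evaluated at the same deterministic
    starting point.\<close>
  have Y0: "(\<integral>om. V n (Y 0 om) \<partial>M) = V n x0"
  proof -
    have [measurable]: "Y 0 \<in> borel_measurable M" "V n \<in> borel_measurable borel" by (auto intro: Y_meas Vm)
    have "AE om in M. Y 0 om = x0" using sol unfolding sde_solution_def by blast
    then have "(\<integral>om. V n (Y 0 om) \<partial>M) = (\<integral>om. V n x0 \<partial>M)" by (intro integral_cong_AE) auto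
    then show ?thesis by (simp add: prob_space)
  qed
  have S0: "(\<integral>om. \<phi> (S.X n om) \<partial>N) = V n x0" using ES[of n] by (simp add: S.X_def S.prob_space)
  \<comment> \<open>The geometric series costs a factor \<open>1 / (lam * h)\<close>, which turns
    the local order \<open>h^3\<close> into the global order \<open>h^2\<close>, uniformly in
    \<open>n\<close>.\<close>
  have "(lam * h) * (\<Sum>k<n. r ^ k) = 1 - r ^ n" using one_diff_power_eq[of r n] lam(4) by simp
  also have "\<dots> \<le> 1" using lam by simp
  finally have geo: "(\<Sum>k<n. r ^ k) \<le> 1 / (lam * h)" using lam by (simp add: field_simps)
  have c0: "0 \<le> c" using cT0 A h01 by (simp add: c_def)
  have "\<bar>(\<integral>om. \<phi> (Y (real n * h) om) \<partial>M) - V n x0\<bar> \<le> c * (\<Sum>k<n. r ^ k)"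
    using tel[of n] Y0 by (simp add: sum_distrib_left)
  also have "\<dots> \<le> c * (1 / (lam * h))" using geo c0 by (rule mult_left_mono)
  also have "\<dots> = cT / lam * A * (w x0 ^ 4 + 2) * h^2" using h01 lam by (simp add: c_def power2_eq_square power3_eq_cube)
  finally show "\<bar>(\<integral>om. \<phi> (run h x0 n (\<lambda>i. \<gamma> i om)) \<partial>N) - (\<integral>om. \<phi> (Y (real n * h) om) \<partial>M)\<bar> \<le> cT / lam * A * (w x0 ^ 4 + 2) * h^2"
    unfolding X S0 by (simp add: abs_minus_commute)
  show "integrable N (\<lambda>om. \<phi> (run h x0 n (\<lambda>i. \<gamma> i om)))"
    unfolding X by (rule S.X_integrable[OF jetD(1)[OF j] jet_growth4[OF j A]])
  show "integrable M (\<lambda>om. \<phi> (Y (real n * h) om))"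
    by (rule step.jet_integrable[OF step[of n] j A]) (use h01 in auto)
qed

end

lemma sg_scheme_run:
  assumes "coeffs (grad F) g1 g2 \<sigma> \<sigma>1 \<sigma>2 xs K \<mu>"
  shows "sg_scheme F \<sigma> \<gamma> h x n om = coeffs.run (grad F) \<sigma> h x n (\<lambda>i. \<gamma> i om)"
proof -
  interpret coeffs "grad F" g1 g2 \<sigma> \<sigma>1 \<sigma>2 xs K \<mu> by (rule assms)
  show ?thesis by (induction n) (simp_all add: \<Phi>_def Let_def)
qed

lemma std_gaussian_sequence_law:
  assumes "std_gaussian_sequence M \<gamma>" "1 \<le> n"
  shows "distr M borel (\<gamma> n) = gauss 1"
proof -
  have "distributed M lborel (\<gamma> n) (gauss_density 1)" using assms by (simp add: std_gaussian_sequence_def)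
  then have "distr M lborel (\<gamma> n) = gauss 1" by (simp add: distributed_def gauss_def)
  then show ?thesis by (simp cong: distr_cong)
qed

theorem proposition6p2:
  fixes F :: "real^'n \<Rightarrow> real"
    and \<sigma> :: "real \<Rightarrow> real^'n \<Rightarrow> real^'n^'n"
    and h_max h\<^sub>0 \<mu> :: real
  assumes "0 < h_max"
    and "F_strong h_max h\<^sub>0 \<mu> F"
    and "sigma_strong F \<sigma>"
  shows "\<exists>H C. 0 < H \<and> H < h\<^sub>0 \<and> 0 < C \<and>
    (\<forall>(\<phi> :: real^'n \<Rightarrow> real) (x\<^sub>0 :: real^'n) h
      (M :: 'v measure) (\<gamma> :: nat \<Rightarrow> 'v \<Rightarrow> real^'n)
      (M' :: 'w measure) (\<F> :: real \<Rightarrow> 'w measure) (B :: real \<Rightarrow> 'w \<Rightarrow> real^'n)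
      (Y :: real \<Rightarrow> 'w \<Rightarrow> real^'n).
      class_C 3 \<phi> \<and> bounded_deriv 2 \<phi> \<and> bounded_deriv 3 \<phi> \<and>
      0 < h \<and> h < H \<and>
      std_gaussian_sequence M \<gamma> \<and>
      wiener_process M' \<F> B \<and> modified_sde_solution M' \<F> B F \<sigma> h x\<^sub>0 Y \<longrightarrow>
      (\<forall>N\<ge>1. integrable M (\<lambda>\<omega>. \<phi> (sg_scheme F \<sigma> \<gamma> h x\<^sub>0 N \<omega>)) \<and>
             integrable M' (\<lambda>\<omega>. \<phi> (Y (real N * h) \<omega>))) \<and>
      (SUP N\<in>{1..}. ereal
          \<bar>(\<integral>\<omega>. \<phi> (sg_scheme F \<sigma> \<gamma> h x\<^sub>0 N \<omega>) \<partial>M) - (\<integral>\<omega>. \<phi> (Y (real N * h) \<omega>) \<partial>M')\<bar>)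
        \<le> ereal (C * (norm (grad \<phi> (minimizer F)) + deriv_norm 2 \<phi> + deriv_norm 3 \<phi>)
                   * (1 + norm (x\<^sub>0 - minimizer F) ^ 5) * h\<^sup>2))"
proof -
  obtain K g1 g2 \<sigma>1 \<sigma>2 where co: "coeffs (grad F) g1 g2 \<sigma> \<sigma>1 \<sigma>2 (minimizer F) K \<mu>"
    and mo: "\<And>x h. grad (modified_objective F h) x = grad F x + (h / 2) *\<^sub>R g1 x (grad F x)"
    by (rule coeffs_exist[OF assms(2,3)], rule that; assumption)
  interpret coeffs "grad F" g1 g2 \<sigma> \<sigma>1 \<sigma>2 "minimizer F" K \<mu> by (rule co)
  obtain b where b: "0 < b" "\<And>h. 0 < h \<Longrightarrow> h < b \<Longrightarrow> small2 h"
    using eventually_small2 unfolding eventually_at_right_field by blast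
  \<comment> \<open>Halving \<open>h\<^sub>0\<close> gives the strict inequality
    \<open>H < h\<^sub>0\<close>.\<close>
  define H where "H = min b (h\<^sub>0 / 2)"
  have "0 < h\<^sub>0" using assms(2) by (simp add: F_strong_def)
  then have H: "0 < H" "H < h\<^sub>0" "H \<le> b" using b by (auto simp: H_def)
  have lam0: "0 < lam" using mu by (simp add: lam_def)
  \<comment> \<open>The six comes from \<open>w_pow4_le\<close>; adding one makes \<open>C\<close>
    positive, since \<open>cT\<close> is shown only to be nonnegative.\<close>
  define C where "C = cT / lam * 6 + 1"
  have C: "0 < C" "cT / lam * 6 \<le> C" using cT0 lam0 by (auto simp: C_def add_nonneg_pos)
  show ?thesis
  proof (rule exI[of _ H], rule exI[of _ C], intro conjI H(1,2) C(1) allI impI)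
    fix \<phi> :: "real^'n \<Rightarrow> real" and x\<^sub>0 :: "real^'n" and h and M :: "'v measure" and \<gamma> :: "nat \<Rightarrow> 'v \<Rightarrow> real^'n"
      and M' :: "'w measure" and \<F> :: "real \<Rightarrow> 'w measure" and B :: "real \<Rightarrow> 'w \<Rightarrow> real^'n" and Y :: "real \<Rightarrow> 'w \<Rightarrow> real^'n"
    assume "class_C 3 \<phi> \<and> bounded_deriv 2 \<phi> \<and> bounded_deriv 3 \<phi> \<and> 0 < h \<and> h < H \<and> std_gaussian_sequence M \<gamma> \<and>
      wiener_process M' \<F> B \<and> modified_sde_solution M' \<F> B F \<sigma> h x\<^sub>0 Y"
    then have \<phi>: "class_C 3 \<phi>" "bounded_deriv 2 \<phi>" "bounded_deriv 3 \<phi>" and h: "0 < h" "h < H"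
      and \<gamma>: "std_gaussian_sequence M \<gamma>" and W: "wiener_process M' \<F> B" and Y: "modified_sde_solution M' \<F> B F \<sigma> h x\<^sub>0 Y"
      by blast+
    have sm: "small2 h" using b(2) h H by simp
    have "(\<lambda>x. - grad (modified_objective F h) x) = bb h" by (simp add: mo bb_def fun_eq_iff)
    then have sol: "sde_solution M' \<F> B (bb h) (\<lambda>t x. sqrt h *\<^sub>R \<sigma> t x) x\<^sub>0 Y"
      using Y by (simp add: modified_sde_solution_def)
    interpret sde "grad F" g1 g2 \<sigma> \<sigma>1 \<sigma>2 "minimizer F" K \<mu> M' \<F> B h x\<^sub>0 Y
      by (intro sde.intro co wiener.intro W sde_axioms.intro sm sol)
    have sch: "scheme (grad F) g1 g2 \<sigma> \<sigma>1 \<sigma>2 (minimizer F) K \<mu> M \<gamma> h"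
    proof (intro scheme.intro co scheme_axioms.intro)
      show "prob_space M" "prob_space.indep_vars M (\<lambda>_. borel) \<gamma> {1..}" using \<gamma> by (auto simp: std_gaussian_sequence_def)
      show "small h" using sm by (simp add: small2_def)
      show "distr M borel (\<gamma> n) = gauss 1" if "1 \<le> n" for n by (rule std_gaussian_sequence_law[OF \<gamma> that])
    qed
    define A where "A = norm (grad \<phi> (minimizer F)) + deriv_norm 2 \<phi> + deriv_norm 3 \<phi>"
    have A: "0 \<le> A" using \<phi> by (auto simp: A_def intro!: add_nonneg_nonneg deriv_norm_nonneg)
    note E = weak_error[OF sch jet_smooth[OF \<phi>, folded A_def] A, folded sg_scheme_run[OF co]]
    show "integrable M (\<lambda>om. \<phi> (sg_scheme F \<sigma> \<gamma> h x\<^sub>0 N om))" "integrable M' (\<lambda>om. \<phi> (Y (real N * h) om))" for N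
      by (rule E)+
    show "(SUP N\<in>{1..}. ereal
          \<bar>(\<integral>om. \<phi> (sg_scheme F \<sigma> \<gamma> h x\<^sub>0 N om) \<partial>M) - (\<integral>om. \<phi> (Y (real N * h) om) \<partial>M')\<bar>)
        \<le> ereal (C * (norm (grad \<phi> (minimizer F)) + deriv_norm 2 \<phi> + deriv_norm 3 \<phi>)
                   * (1 + norm (x\<^sub>0 - minimizer F) ^ 5) * h^2)"
      unfolding A_def[symmetric]
    proof (rule SUP_least)
      \<comment> \<open>In \<open>ereal\<close> a bound for each \<open>N\<close> suffices for the
        supremum, and that of \<open>weak_error\<close> does not depend on \<open>N\<close>.\<close>
      fix N :: nat
      let ?n = "1 + norm (x\<^sub>0 - minimizer F) ^ 5"
      have "cT / lam * A * (w x\<^sub>0 ^ 4 + 2) * h^2 \<le> cT / lam * A * (6 * ?n) * h^2"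
        using w_pow4_le[of x\<^sub>0] cT0 lam0 A by (intro mult_right_mono mult_left_mono) auto
      also have "\<dots> = cT / lam * 6 * (A * ?n * h^2)" by (simp add: ac_simps)
      also have "\<dots> \<le> C * (A * ?n * h^2)" using C A by (intro mult_right_mono) auto
      finally show "ereal \<bar>(\<integral>om. \<phi> (sg_scheme F \<sigma> \<gamma> h x\<^sub>0 N om) \<partial>M) - (\<integral>om. \<phi> (Y (real N * h) om) \<partial>M')\<bar> \<le> ereal (C * A * ?n * h^2)"
        using E(3)[of N] by (simp add: mult.assoc)
    qed
  qed
qed

end
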